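(* Let $\alpha>0$ and $0<\beta\le 2$. If $f\in \mathrm{Dom}(D^{\alpha,\beta})\subset L^2(\mathbb{A})$ is any complex-valued function in this domain, then the Cauchy problem $$\frac{\partial u(x,t)}{\partial t}+D^{\alpha,\beta}u(x,t)=0,\quad x\in\mathbb{A},\ t>0,\qquad u(x,0)=f(x),$$ has a classical solution $u(x,t)$ determined by the convolution of $f$ with the heat kernel $Z_{\mathbb{A}}(x,t)$, that is, $u(x,t)=\int_{\mathbb{A}}Z_{\mathbb{A}}(x-y,t)f(y)\,dy$ for $t>0$. Moreover, $Z_{\mathbb{A}}(x,t)$ is the transition density (via $p(t,x,y)=Z_{\mathbb{A}}(x-y,t)$) of a time and space homogeneous Markov process on $\mathbb{A}$ which is bounded, right-continuous and has no discontinuities other than jumps.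
   Context: Fix a strictly increasing sequence of natural numbers $\{e^{\psi(n)}\}_{n\ge 0}$ with $e^{\psi(0)}=1$, totally ordered by divisibility (so $e^{\psi(n)}\mid e^{\psi(n+1)}$) and cofinal in $\mathbb{N}$ for divisibility (every natural number divides some $e^{\psi(n)}$). Here $\psi(n)=\log(e^{\psi(n)})$, extended to $n\in\mathbb{Z}$ by $\psi(-n)=-\psi(n)$. Put $e^{\Lambda(n)}=e^{\psi(n)}/e^{\psi(n-1)}$, $n\in\mathbb{Z}$. For $x\in\mathbb{Q}$ let $\mathrm{ord}(x)=\max\{n\in\mathbb{Z}:x\in e^{\psi(n)}\mathbb{Z}\}$ if $x\ne0$, and $\mathrm{ord}(0)=\infty$. The ring of finite adeles $\mathbb{A}_f$ is the completion of $\mathbb{Q}$ for the ultrametric $d(x,y)=e^{-\psi(\mathrm{ord}(x-y))}$; $\mathrm{ord}$ extends to $\mathbb{A}_f$, and $\|x\|=e^{-\psi(\mathrm{ord}(x))}$, $\|0\|=0$. Every nonzero $x\in\mathbb{A}_f$ is uniquely a convergent series $x=\sum_{l\ge\gamma}x_le^{\psi(l)}$ with $x_l\in\{0,\dots,e^{\Lambda(l+1)}-1\}$, $x_\gamma\neq0$, $\gamma=\mathrm{ord}(x)$; its fractional part is $\{x\}=\sum_{l=\gamma}^{-1}x_le^{\psi(l)}\in\mathbb{Q}$ if $\gamma<0$ and $\{x\}=0$ otherwise. The canonical character of $\mathbb{A}_f$ is $\chi_f(x)=\exp(2\pi i\{x\})$. The Haar measure on $\mathbb{A}_f$ is normalized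 so that the unit ball $\widehat{\mathbb{Z}}=\{\|x\|\le1\}$ has measure $1$. The adele ring is $\mathbb{A}=\mathbb{R}\times\mathbb{A}_f$ with the product topology and the product $dx$ of Lebesgue measure on $\mathbb{R}$ and the Haar measure on $\mathbb{A}_f$ normalized so that $\widehat{\mathbb{Z}}$ has measure $1$; elements are $x=(x_\infty,x_f)$. The canonical character is $\chi(x)=\chi_\infty(x_\infty)\chi_f(x_f)$ with $\chi_\infty(x_\infty)=e^{-2\pi i x_\infty}$. The Fourier transform is $\mathcal{F}[\varphi](\xi)=\widehat\varphi(\xi)=\int_{\mathbb{A}}\varphi(x)\chi(\xi x)\,dx$, extended to a unitary operator on $L^2(\mathbb{A})$. The operator $D^{\alpha,\beta}$ is the positive selfadjoint operator on $L^2(\mathbb{A})$ given by $D^{\alpha,\beta}\phi=\mathcal{F}^{-1}\big[(\|\xi_f\|^\alpha+|\xi_\infty|^\beta)\,\mathcal{F}[\phi](\xi)\big]$ with domain $\mathrm{Dom}(D^{\alpha,\beta})=\{\phi\in L^2(\mathbb{A}):(\|\xi_f\|^\alpha+|\xi_\infty|^\beta)\widehat\phi(\xi)\in L^2(\mathbb{A})\}$. The adelic heat kernel is $Z_{\mathbb{A}}(x,t)=\int_{\mathbb{A}}\chi(-\xi x)e^{-t(\|\xi_f\|^\alpha+|\xi_\infty|^\beta)}\,d\xi$, $t>0$, $x\in\mathbb{A}$. A (classical) solution of the Cauchy problem is a function $u:\mathbb{A}\times[0,\infty)\to\mathbb{C}$ such that $t\mapsto u(\cdot,t)$ is a continuously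 differentiable function $[0,\infty)\to L^2(\mathbb{A})$, $u(\cdot,t)\in\mathrm{Dom}(D^{\alpha,\beta})$ for all $t\ge0$, and $u$ satisfies the initial value problem (the equation being understood in $L^2(\mathbb{A})$). Terminology for Markov processes (as in Dynkin): "bounded" means that each trajectory stays in a relatively compact set on every finite time interval; "no discontinuities other than jumps" means that trajectories have left limits in the state space at every $t>0$. "Time and space homogeneous" means that the transition function is $P(t,x,B)=\int_B Z_{\mathbb{A}}(x-y,t)\,dy$ for $t>0$ and $P(0,x,B)=1_B(x)$, for Borel sets $B\subset\mathbb{A}$. *)

theory Defs
  imports "HOL-Analysis.Analysis" "HOL-Probability.Probability"
begin

section \<open>The ring of finite adeles\<close>

definition zmul :: "rat \<Rightarrow> rat set"
  where "zmul r = {of_int z * r |z. True}"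

lemma zmul_0 [simp]: "0 \<in> zmul r"
  unfolding zmul_def by (auto intro: exI[of _ 0])

lemma zmul_self [simp]: "r \<in> zmul r"
  unfolding zmul_def by (auto intro: exI[of _ 1])

lemma zmul_add: "a \<in> zmul r \<Longrightarrow> b \<in> zmul r \<Longrightarrow> a + b \<in> zmul r"
  unfolding zmul_def by (auto simp: distrib_right[symmetric] simp flip: of_int_add)

lemma zmul_minus: "a \<in> zmul r \<Longrightarrow> - a \<in> zmul r"
  unfolding zmul_def by clarsimp (metis mult_minus_left of_int_minus)

lemma zmul_diff: "a \<in> zmul r \<Longrightarrow> b \<in> zmul r \<Longrightarrow> a - b \<in> zmul r"
  using zmul_add[of a r "- b"] zmul_minus[of b r] by simp

lemma zmul_mult: "a \<in> zmul r \<Longrightarrow> b \<in> zmul s \<Longrightarrow> a * b \<in> zmul (r * s)"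
  unfolding zmul_def by clarsimp (metis (no_types) mult.assoc mult.left_commute of_int_mult)

lemma zmul_trans: "a \<in> zmul r \<Longrightarrow> r \<in> zmul s \<Longrightarrow> a \<in> zmul s"
  unfolding zmul_def by clarsimp (metis mult.assoc of_int_mult)

text \<open>The subgroups \<open>r\<int>\<close>, \<open>r > 0\<close> rational, form a neighbourhood basis of \<open>0\<close> for the ultrametric
  of every divisibility sequence (see \<open>cauchyQ_iff\<close> and \<open>nullQ_iff\<close> below), so a single type serves
  for all of them. That it is the completion of \<open>\<rat>\<close> for each of the ultrametrics is
  \<open>fadele_completion\<close>.\<close>

definition cauchyQ :: "(nat \<Rightarrow> rat) \<Rightarrow> bool"
  where "cauchyQ X \<longleftrightarrow> (\<forall>r>0. \<exists>k. \<forall>m\<ge>k. \<forall>n\<ge>k. X m - X n \<in> zmul r)"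

definition nullQ :: "(nat \<Rightarrow> rat) \<Rightarrow> bool"
  where "nullQ X \<longleftrightarrow> (\<forall>r>0. \<forall>\<^sub>F n in sequentially. X n \<in> zmul r)"

lemma nullQ_0 [simp]: "nullQ (\<lambda>n. 0)"
  by (simp add: nullQ_def)

lemma nullQ_add: "nullQ X \<Longrightarrow> nullQ Y \<Longrightarrow> nullQ (\<lambda>n. X n + Y n)"
  unfolding nullQ_def by (blast intro: eventually_elim2 zmul_add)

lemma nullQ_minus: "nullQ X \<Longrightarrow> nullQ (\<lambda>n. - X n)"
  unfolding nullQ_def by (blast intro: eventually_mono zmul_minus)

lemma nullQ_const: "nullQ (\<lambda>n. c) \<longleftrightarrow> c = 0"
proof
  assume "nullQ (\<lambda>n. c)"
  then have *: "c \<in> zmul r" if "r > 0" for r using that by (simp add: nullQ_def)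
  show "c = 0"
  proof (rule ccontr)
    assume "c \<noteq> 0"
    then obtain z :: int where z: "c = of_int z * (2 * \<bar>c\<bar>)"
      using *[of "2 * \<bar>c\<bar>"] by (auto simp: zmul_def)
    have "\<bar>c\<bar> = \<bar>of_int z\<bar> * (2 * \<bar>c\<bar>)"
      using arg_cong[OF z, of abs] by (simp add: abs_mult)
    then have "\<bar>c\<bar> * (\<bar>of_int z\<bar> * 2) = \<bar>c\<bar> * 1" by (simp only: mult.commute mult.left_commute mult_1)
    then have "\<bar>of_int z :: rat\<bar> * 2 = 1" using \<open>c \<noteq> 0\<close> by (simp only: mult_left_cancel abs_eq_0 not_False_eq_True)
    then have "(of_int (\<bar>z\<bar> * 2) :: rat) = of_int 1" by (simp only: of_int_mult of_int_abs of_int_numeral of_int_1)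
    then have "\<bar>z\<bar> * 2 = 1" by (simp only: of_int_eq_iff)
    then show False by presburger
  qed
qed simp

lemma cauchyQ_const [simp]: "cauchyQ (\<lambda>n. c)"
  by (simp add: cauchyQ_def)

lemma cauchyQ_add: "cauchyQ X \<Longrightarrow> cauchyQ Y \<Longrightarrow> cauchyQ (\<lambda>n. X n + Y n)"
  unfolding cauchyQ_def
proof safe
  fix r :: rat assume r: "r > 0"
    and "\<forall>r>0. \<exists>k. \<forall>m\<ge>k. \<forall>n\<ge>k. X m - X n \<in> zmul r" "\<forall>r>0. \<exists>k. \<forall>m\<ge>k. \<forall>n\<ge>k. Y m - Y n \<in> zmul r"
  then obtain k l where "\<forall>m\<ge>k. \<forall>n\<ge>k. X m - X n \<in> zmul r" "\<forall>m\<ge>l. \<forall>n\<ge>l. Y m - Y n \<in> zmul r"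
    by meson
  then show "\<exists>k. \<forall>m\<ge>k. \<forall>n\<ge>k. (X m + Y m) - (X n + Y n) \<in> zmul r"
    by (intro exI[of _ "max k l"]) (auto simp: add_diff_add intro!: zmul_add)
qed

lemma cauchyQ_minus: "cauchyQ X \<Longrightarrow> cauchyQ (\<lambda>n. - X n)"
  unfolding cauchyQ_def by (metis minus_diff_minus zmul_minus)

lemma zmul_ex_pos: "\<exists>s>0. q \<in> zmul s"
proof (cases "q = 0")
  case True
  then show ?thesis by (auto intro: exI[of _ 1])
next
  case False
  then show ?thesis
    by (intro exI[of _ "\<bar>q\<bar>"]) (auto simp: abs_if intro: zmul_minus[of "- q" "- q", simplified])
qed

lemma zmul_ex_common: 
  assumes "r > 0" "s > 0" shows "\<exists>t>0. r \<in> zmul t \<and> s \<in> zmul t"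
proof -
  obtain a b where r: "r = of_int a / of_int b" "b > 0" by (metis Fract_of_int_quotient Rat_cases)
  obtain c d where s: "s = of_int c / of_int d" "d > 0" by (metis Fract_of_int_quotient Rat_cases)
  let ?t = "1 / (of_int b * of_int d) :: rat"
  have "r = of_int (a * d) * ?t" "s = of_int (c * b) * ?t" using r s by (auto simp: field_simps)
  moreover have "?t > 0" using r s by simp
  ultimately show ?thesis unfolding zmul_def by blast
qed

lemma cauchyQ_bounded: 
  assumes "cauchyQ X" shows "\<exists>s>0. \<exists>k. \<forall>n\<ge>k. X n \<in> zmul s"
proof -
  from assms obtain k where k: "\<forall>m\<ge>k. \<forall>n\<ge>k. X m - X n \<in> zmul 1"
    unfolding cauchyQ_def by (meson zero_less_one)
  obtain s where s: "s > 0" "X k \<in> zmul s" using zmul_ex_pos by blast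
  obtain t where t: "t > 0" "s \<in> zmul t" "1 \<in> zmul t" using zmul_ex_common[OF s(1), of 1] by auto
  have "X n \<in> zmul t" if "n \<ge> k" for n
  proof -
    have "X n - X k \<in> zmul t" using k that t(3) by (blast intro: zmul_trans)
    from zmul_add[OF this zmul_trans[OF s(2) t(2)]] show ?thesis by simp
  qed
  with t(1) show ?thesis by blast
qed

lemma nullQ_mult:
  assumes X: "cauchyQ X" and Y: "nullQ Y" shows "nullQ (\<lambda>n. X n * Y n)"
  unfolding nullQ_def
proof safe
  fix r :: rat assume r: "r > 0"
  obtain s k where s: "s > 0" "\<forall>n\<ge>k. X n \<in> zmul s" using cauchyQ_bounded[OF X] by blast
  have "\<forall>\<^sub>F n in sequentially. X n \<in> zmul s" using s(2) by (auto simp: eventually_sequentially)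
  moreover have "\<forall>\<^sub>F n in sequentially. Y n \<in> zmul (r / s)" using Y r s by (simp add: nullQ_def)
  ultimately show "\<forall>\<^sub>F n in sequentially. X n * Y n \<in> zmul r"
    by eventually_elim (use zmul_mult s in force)
qed

lemma cauchyQ_mult: 
  assumes X: "cauchyQ X" and Y: "cauchyQ Y" shows "cauchyQ (\<lambda>n. X n * Y n)"
  unfolding cauchyQ_def
proof safe
  fix r :: rat assume r: "r > 0"
  obtain s k where s: "s > 0" "\<forall>n\<ge>k. X n \<in> zmul s" using cauchyQ_bounded[OF X] by blast
  obtain t l where t: "t > 0" "\<forall>n\<ge>l. Y n \<in> zmul t" using cauchyQ_bounded[OF Y] by blast
  obtain i where i: "\<forall>m\<ge>i. \<forall>n\<ge>i. X m - X n \<in> zmul (r / t)"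
    using X r t(1) unfolding cauchyQ_def by (meson divide_pos_pos)
  obtain j where j: "\<forall>m\<ge>j. \<forall>n\<ge>j. Y m - Y n \<in> zmul (r / s)"
    using Y r s(1) unfolding cauchyQ_def by (meson divide_pos_pos)
  have "X m * Y m - X n * Y n \<in> zmul r" 
    if "m \<ge> max (max k l) (max i j)" "n \<ge> max (max k l) (max i j)" for m n
  proof -
    have "X m * (Y m - Y n) \<in> zmul (s * (r / s))" 
      using s j that by (intro zmul_mult) auto
    moreover have "(X m - X n) * Y n \<in> zmul ((r / t) * t)" 
      using t i that by (intro zmul_mult) auto
    ultimately have "X m * (Y m - Y n) + (X m - X n) * Y n \<in> zmul r"
      using s(1) t(1) by (intro zmul_add) simp_all
    then show ?thesis by (simp add: algebra_simps)
  qed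
  then show "\<exists>k. \<forall>m\<ge>k. \<forall>n\<ge>k. X m * Y m - X n * Y n \<in> zmul r" by blast
qed

definition fadele_rel :: "(nat \<Rightarrow> rat) \<Rightarrow> (nat \<Rightarrow> rat) \<Rightarrow> bool"
  where "fadele_rel X Y \<longleftrightarrow> cauchyQ X \<and> cauchyQ Y \<and> nullQ (\<lambda>n. X n - Y n)"

lemma fadele_rel_refl: "cauchyQ X \<Longrightarrow> fadele_rel X X"
  by (simp add: fadele_rel_def)

lemma fadele_rel_part_equivp: "part_equivp fadele_rel"
proof (rule part_equivpI)
  show "\<exists>X. fadele_rel X X" using fadele_rel_refl[OF cauchyQ_const] by blast
  show "symp fadele_rel"
    unfolding fadele_rel_def by (rule sympI) (auto dest: nullQ_minus)
  show "transp fadele_rel"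
    unfolding fadele_rel_def by (rule transpI) (auto dest: nullQ_add)
qed

quotient_type fadele = "nat \<Rightarrow> rat" / partial: fadele_rel
  morphisms rep_fadele abs_fadele
  by (rule fadele_rel_part_equivp)

lemma cr_fadele_eq: "pcr_fadele = (\<lambda>x y. cauchyQ x \<and> abs_fadele x = y)"
  unfolding fadele.pcr_cr_eq cr_fadele_def fadele_rel_def by auto

lemma Domainp_pcr_fadele [transfer_domain_rule]: "Domainp pcr_fadele = cauchyQ"
  by (simp add: fadele.domain_eq fadele_rel_def)

lemma fadele_induct [induct type: fadele]: "(\<And>X. cauchyQ X \<Longrightarrow> P (abs_fadele X)) \<Longrightarrow> P x"
  by (induct x) (simp add: fadele_rel_def)

lemma eq_abs_fadele: 
  "cauchyQ X \<Longrightarrow> cauchyQ Y \<Longrightarrow> abs_fadele X = abs_fadele Y \<longleftrightarrow> nullQ (\<lambda>n. X n - Y n)"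
  using fadele.rel_eq_transfer
  unfolding fadele.pcr_cr_eq cr_fadele_def rel_fun_def fadele_rel_def by simp

instantiation fadele :: comm_ring_1
begin

lift_definition zero_fadele :: fadele is "\<lambda>n. 0"
  by (simp add: fadele_rel_refl)

lift_definition one_fadele :: fadele is "\<lambda>n. 1"
  by (simp add: fadele_rel_refl)

lift_definition plus_fadele :: "fadele \<Rightarrow> fadele \<Rightarrow> fadele" is "\<lambda>X Y n. X n + Y n"
  unfolding fadele_rel_def add_diff_add by (simp only: cauchyQ_add nullQ_add simp_thms)

lift_definition uminus_fadele :: "fadele \<Rightarrow> fadele" is "\<lambda>X n. - X n"
  unfolding fadele_rel_def minus_diff_minus by (simp only: cauchyQ_minus nullQ_minus simp_thms)

lift_definition times_fadele :: "fadele \<Rightarrow> fadele \<Rightarrow> fadele" is "\<lambda>X Y n. X n * Y n"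
proof -
  fix f1 f2 f3 f4
  have "\<lbrakk>cauchyQ f1; cauchyQ f4; nullQ (\<lambda>n. f1 n - f2 n); nullQ (\<lambda>n. f3 n - f4 n)\<rbrakk>
       \<Longrightarrow> nullQ (\<lambda>n. f1 n * (f3 n - f4 n) + f4 n * (f1 n - f2 n))"
    by (simp add: nullQ_add nullQ_mult)
  then show "\<lbrakk>fadele_rel f1 f2; fadele_rel f3 f4\<rbrakk> \<Longrightarrow> fadele_rel (\<lambda>n. f1 n * f3 n) (\<lambda>n. f2 n * f4 n)"
    by (simp add: mult.commute fadele_rel_def mult_diff_mult cauchyQ_mult)
qed

definition "x - y = x + - y" for x y :: fadele

instance
proof
  fix a b c :: fadele
  show "a + b = b + a" by transfer (simp add: ac_simps fadele_rel_def cauchyQ_add)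
  show "(a + b) + c = a + (b + c)" by transfer (simp add: ac_simps fadele_rel_def cauchyQ_add)
  show "0 + a = a" by transfer (simp add: fadele_rel_def)
  show "- a + a = 0" by transfer (simp add: fadele_rel_def cauchyQ_minus)
  show "a - b = a + - b" by (rule minus_fadele_def)
  show "(a * b) * c = a * (b * c)" by transfer (simp add: ac_simps fadele_rel_def cauchyQ_mult)
  show "a * b = b * a" by transfer (simp add: ac_simps fadele_rel_def cauchyQ_mult)
  show "1 * a = a" by transfer (simp add: fadele_rel_def)
  show "(a + b) * c = a * c + b * c"
    by transfer (simp add: distrib_right fadele_rel_refl cauchyQ_add cauchyQ_mult)
  show "(0::fadele) \<noteq> 1"
    by transfer (use nullQ_minus[of "\<lambda>n. -1"] nullQ_const[of 1] in \<open>auto simp: fadele_rel_def\<close>)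
qed

end

lift_definition fadele_of_rat :: "rat \<Rightarrow> fadele" is "\<lambda>q n. q"
  by (simp add: fadele_rel_refl)

lift_definition in_ideal :: "rat \<Rightarrow> fadele \<Rightarrow> bool" 
  is "\<lambda>r X. r > 0 \<and> (\<forall>\<^sub>F n in sequentially. X n \<in> zmul r)"
proof -
  fix r :: rat and X Y assume *: "fadele_rel X Y"
  have "(\<forall>\<^sub>F n in sequentially. X n \<in> zmul r) \<longleftrightarrow> (\<forall>\<^sub>F n in sequentially. Y n \<in> zmul r)" if "r > 0"
  proof -
    have "\<forall>\<^sub>F n in sequentially. X n - Y n \<in> zmul r" using * that by (simp add: fadele_rel_def nullQ_def)
    then have "\<forall>\<^sub>F n in sequentially. X n \<in> zmul r \<longleftrightarrow> Y n \<in> zmul r"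
    proof eventually_elim
      case (elim n)
      then show ?case using zmul_add[of "X n - Y n" r "Y n"] zmul_diff[of "X n" r "X n - Y n"] by auto
    qed
    then show ?thesis by (auto elim: eventually_elim2)
  qed
  then show "(r > 0 \<and> (\<forall>\<^sub>F n in sequentially. X n \<in> zmul r)) = (r > 0 \<and> (\<forall>\<^sub>F n in sequentially. Y n \<in> zmul r))"
    by blast
qed

lemma in_ideal_abs: 
  "cauchyQ X \<Longrightarrow> in_ideal r (abs_fadele X) \<longleftrightarrow> r > 0 \<and> (\<forall>\<^sub>F n in sequentially. X n \<in> zmul r)"
  by (simp add: in_ideal.abs_eq fadele_rel_refl)

lemma in_ideal_0: "r > 0 \<Longrightarrow> in_ideal r 0"
  by transfer simp

lemma in_ideal_add: "in_ideal r x \<Longrightarrow> in_ideal r y \<Longrightarrow> in_ideal r (x + y)"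
  by transfer (auto intro: eventually_elim2 zmul_add)

lemma in_ideal_minus: "in_ideal r x \<Longrightarrow> in_ideal r (- x)"
  by transfer (auto elim!: eventually_mono intro: zmul_minus)

lemma in_ideal_diff: "in_ideal r x \<Longrightarrow> in_ideal r y \<Longrightarrow> in_ideal r (x - y)"
  by (metis in_ideal_add in_ideal_minus minus_fadele_def)

lemma in_ideal_trans: "in_ideal r x \<Longrightarrow> r \<in> zmul s \<Longrightarrow> s > 0 \<Longrightarrow> in_ideal s x"
  by transfer (auto elim!: eventually_mono intro: zmul_trans)

lemma in_ideal_of_rat: "in_ideal r (fadele_of_rat q) \<longleftrightarrow> r > 0 \<and> q \<in> zmul r"
  by transfer simp

lemma fadele_of_rat_diff: "fadele_of_rat p - fadele_of_rat q = fadele_of_rat (p - q)"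
  unfolding minus_fadele_def by transfer (simp add: fadele_rel_refl)

lemma fadele_of_rat_add: "fadele_of_rat (p + q) = fadele_of_rat p + fadele_of_rat q"
  by transfer (simp add: fadele_rel_refl)

lemma fadele_of_rat_mult: "fadele_of_rat (p * q) = fadele_of_rat p * fadele_of_rat q"
  by transfer (simp add: fadele_rel_refl)

lemma fadele_of_rat_0 [simp]: "fadele_of_rat 0 = 0"
  by transfer (simp add: fadele_rel_refl)

lemma fadele_of_rat_1 [simp]: "fadele_of_rat 1 = 1"
  by transfer (simp add: fadele_rel_refl)

lemma fadele_eq_0_iff: "x = 0 \<longleftrightarrow> (\<forall>r>0. in_ideal r x)"
  by transfer (auto simp: fadele_rel_def nullQ_def)

lemma fadele_approx: 
  assumes "r > 0" shows "\<exists>q. in_ideal r (x - fadele_of_rat q)"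
proof (induct x)
  case (1 X)
  from 1 assms obtain k where k: "\<forall>m\<ge>k. \<forall>n\<ge>k. X m - X n \<in> zmul r" unfolding cauchyQ_def by meson
  have c: "cauchyQ (\<lambda>n. X n + - X k)" using 1 by (intro cauchyQ_add) auto
  have "abs_fadele X - fadele_of_rat (X k) = abs_fadele (\<lambda>n. X n + - X k)"
    unfolding minus_fadele_def using 1
    by (simp add: fadele_of_rat.abs_eq uminus_fadele.abs_eq plus_fadele.abs_eq fadele_rel_refl)
  then show ?case using c k assms 
    by (intro exI[of _ "X k"]) (auto simp: in_ideal_abs eventually_sequentially intro!: exI[of _ k])
qed


section \<open>Divisibility sequences and the associated ultrametrics\<close>

definition adelic_sequence :: "(nat \<Rightarrow> nat) \<Rightarrow> bool"
  where "adelic_sequence E \<longleftrightarrow> strict_mono E \<and> E 0 = 1 \<and> (\<forall>n. E n dvd E (Suc n)) 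
    \<and> (\<forall>N>0. \<exists>n. N dvd E n)"

text \<open>\<open>exp_psi E n\<close> is \<open>e\<^sup>\<psi>\<^sup>(\<^sup>n\<^sup>)\<close>; since \<open>\<psi>(-n) = -\<psi>(n)\<close>, it is inverted for negative \<open>n\<close>.\<close>

definition exp_psi :: "(nat \<Rightarrow> nat) \<Rightarrow> int \<Rightarrow> rat"
  where "exp_psi E n = (if 0 \<le> n then of_nat (E (nat n)) else 1 / of_nat (E (nat (- n))))"

definition exp_Lambda :: "(nat \<Rightarrow> nat) \<Rightarrow> int \<Rightarrow> rat"
  where "exp_Lambda E n = exp_psi E n / exp_psi E (n - 1)"

text \<open>Only meaningful for \<open>q \<noteq> 0\<close>; the value \<open>ord(0) = \<infinity>\<close> is accounted for in the norms.\<close>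

definition ordQ :: "(nat \<Rightarrow> nat) \<Rightarrow> rat \<Rightarrow> int"
  where "ordQ E q = (GREATEST n. q \<in> zmul (exp_psi E n))"

definition normQ :: "(nat \<Rightarrow> nat) \<Rightarrow> rat \<Rightarrow> real"
  where "normQ E q = (if q = 0 then 0 else 1 / of_rat (exp_psi E (ordQ E q)))"

text \<open>On \<open>\<rat> - {0}\<close> the function \<open>ord\<close> is locally constant, so its extension by continuity to a
  nonzero finite adele is its eventual value along representing Cauchy sequences.\<close>

definition ordf :: "(nat \<Rightarrow> nat) \<Rightarrow> fadele \<Rightarrow> int"
  where "ordf E x = (THE k. \<exists>X. cauchyQ X \<and> abs_fadele X = x \<and> (\<forall>\<^sub>F n in sequentially. ordQ E (X n) = k))"

definition normf :: "(nat \<Rightarrow> nat) \<Rightarrow> fadele \<Rightarrow> real"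
  where "normf E x = (if x = 0 then 0 else 1 / of_rat (exp_psi E (ordf E x)))"

context
  fixes E :: "nat \<Rightarrow> nat"
  assumes E: "adelic_sequence E"
begin

lemma E_mono: "strict_mono E" and E_0: "E 0 = 1" and E_cofinal: "N > 0 \<Longrightarrow> \<exists>n. N dvd E n"
  using E by (auto simp: adelic_sequence_def)

lemma E_pos: "E n > 0"
  using E_mono E_0 by (metis bot_nat_0.extremum gr0I not_one_le_zero strict_mono_less_eq)

lemma E_dvd: "m \<le> n \<Longrightarrow> E m dvd E n"
proof (induction rule: dec_induct)
  case (step k)
  then show ?case using E dvd_trans unfolding adelic_sequence_def by blast
qed simp

lemma exp_psi_pos: "exp_psi E n > 0"
  using E_pos by (simp add: exp_psi_def)

lemma exp_psi_zmul: assumes "m \<le> n" shows "exp_psi E n \<in> zmul (exp_psi E m)"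
proof -
  consider "0 \<le> m" "0 \<le> n" | "m < 0" "0 \<le> n" | "m < 0" "n < 0" using assms by linarith
  then show ?thesis
  proof cases
    case 1
    then obtain c where "E (nat n) = E (nat m) * c" using E_dvd[of "nat m" "nat n"] assms by (meson dvdE nat_mono)
    then show ?thesis using 1 unfolding zmul_def
      by (auto intro!: exI[of _ "int c"] simp: exp_psi_def)
  next
    case 2
    then show ?thesis unfolding zmul_def
      by (auto intro!: exI[of _ "int (E (nat n) * E (nat (- m)))"] simp: exp_psi_def E_pos less_imp_neq[OF E_pos, symmetric])
  next
    case 3
    then obtain c where "E (nat (- m)) = E (nat (- n)) * c" using E_dvd[of "nat (-n)" "nat (-m)"] assms by (meson dvdE nat_mono neg_le_iff_le)
    then show ?thesis using 3 unfolding zmul_def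
      by (auto intro!: exI[of _ "int c"] simp: exp_psi_def less_imp_neq[OF E_pos, symmetric])
         (metis E_pos mult_is_0 nonzero_divide_mult_cancel_right not_gr_zero of_nat_eq_0_iff mult.commute)
  qed
qed

lemma exp_psi_strict_mono: assumes "m < n" shows "exp_psi E m < exp_psi E n"
proof -
  have 1: "E i < E j" if "i < j" for i j using E_mono that by (simp add: strict_mono_def)
  have 2: "(of_nat (E i) :: rat) \<ge> 1" for i using E_pos[of i] by (simp add: Suc_leI)
  have 3: "(of_nat (E i) :: rat) > 1" if "i > 0" for i using 1[OF that] E_0 by simp
  consider "0 \<le> m" "0 \<le> n" | "m < 0" "0 \<le> n" | "m < 0" "n < 0" using assms by linarith
  then show ?thesis
  proof cases
    case 1
    then show ?thesis using assms \<open>\<And>i j. i < j \<Longrightarrow> E i < E j\<close> by (simp add: exp_psi_def)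
  next
    case 2
    have "1 / of_nat (E (nat (- m))) < (1::rat)" using 3[of "nat (- m)"] 2 by simp
    also have "1 \<le> (of_nat (E (nat n)) :: rat)" by (rule \<open>\<And>i. 1 \<le> of_nat (E i)\<close>)
    finally show ?thesis using 2 by (simp add: exp_psi_def)
  next
    case 3
    then show ?thesis using assms \<open>\<And>i j. i < j \<Longrightarrow> E i < E j\<close> E_pos
      by (simp add: exp_psi_def divide_strict_left_mono)
  qed
qed

lemma exp_psi_mono: "m \<le> n \<Longrightarrow> exp_psi E m \<le> exp_psi E n"
  using exp_psi_strict_mono by (cases "m = n") (auto simp: less_le)

lemma exp_psi_less_iff: "exp_psi E m < exp_psi E n \<longleftrightarrow> m < n"
  using exp_psi_strict_mono exp_psi_mono by (meson linorder_not_less)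

lemma exp_psi_small: assumes "r > 0" shows "\<exists>n\<ge>0. exp_psi E n \<in> zmul r"
proof -
  obtain a b where r: "r = of_int a / of_int b" "b > 0" by (metis Fract_of_int_quotient Rat_cases)
  with assms have a: "a > 0" by (simp add: zero_less_divide_iff)
  then obtain n where "nat a dvd E n" using E_cofinal[of "nat a"] by auto
  then obtain c where "E n = nat a * c" ..
  then have "of_nat (E n) = of_int (int c * b) * r" using r a by simp
  then show ?thesis unfolding zmul_def 
    by (intro exI[of _ "int n"]) (auto simp: exp_psi_def simp del: of_int_mult)
qed

lemma exp_psi_large: "\<exists>n. q \<in> zmul (exp_psi E n)"
proof -
  obtain a b where q: "q = of_int a / of_int b" "b > 0" by (metis Fract_of_int_quotient Rat_cases)
  then obtain n where "nat b dvd E n" using E_cofinal[of "nat b"] by auto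
  then obtain c where c: "E n = nat b * c" ..
  then have "c > 0" using E_pos[of n] by (cases c) auto
  have "q = of_int (a * int c) * (1 / of_nat (E n))" using q c \<open>c > 0\<close> by simp
  moreover have "1 / of_nat (E n) = exp_psi E (- int n)"
    by (auto simp: exp_psi_def E_0)
  ultimately have "q = of_int (a * int c) * exp_psi E (- int n)" by simp
  then show ?thesis unfolding zmul_def by blast
qed

lemma exp_psi_unbounded: "\<exists>n. exp_psi E n > q"
proof -
  obtain m :: nat where m: "q < of_nat m" using reals_Archimedean2[of q] by blast
  have "m \<le> E m" using E_mono by (rule strict_mono_imp_increasing)
  then show ?thesis using m by (intro exI[of _ "int m"]) (simp add: exp_psi_def less_le_trans)
qed

lemma zmul_abs_ge: "q \<in> zmul r \<Longrightarrow> q \<noteq> 0 \<Longrightarrow> r > 0 \<Longrightarrow> r \<le> \<bar>q\<bar>"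
proof -
  assume "q \<in> zmul r" "q \<noteq> 0" "r > 0"
  then obtain z :: int where z: "q = of_int z * r" "z \<noteq> 0" by (auto simp: zmul_def)
  then have "1 \<le> \<bar>z\<bar>" by linarith
  then have "(1::rat) \<le> of_int \<bar>z\<bar>" by linarith
  then show "r \<le> \<bar>q\<bar>" using z \<open>r > 0\<close> by (simp add: abs_mult)
qed

lemma int_greatest:
  fixes P :: "int \<Rightarrow> bool"
  assumes "P a" "\<And>m n. m \<le> n \<Longrightarrow> P n \<Longrightarrow> P m" "\<not> P b"
  shows "\<exists>k. \<forall>n. P n \<longleftrightarrow> n \<le> k"
proof -
  have ab: "n < b" if "P n" for n using assms(2)[of b n] assms(3) that by force
  let ?S = "{n. a \<le> n \<and> P n}"
  have fin: "finite ?S" by (rule finite_subset[of _ "{a..b}"]) (use ab in force)+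
  have ne: "?S \<noteq> {}" using assms(1) by auto
  have "P (Max ?S)" using Max_in[OF fin ne] by auto
  moreover have "n \<le> Max ?S" if "P n" for n
    using that Max_ge[OF fin, of n] Max_ge[OF fin, of a] assms(1) by (cases "a \<le> n") auto
  ultimately show ?thesis using assms(2) by blast
qed

lemma ordQ_iff: assumes "q \<noteq> 0" shows "q \<in> zmul (exp_psi E n) \<longleftrightarrow> n \<le> ordQ E q"
proof -
  obtain a where a: "q \<in> zmul (exp_psi E a)" using exp_psi_large by blast
  obtain b where "exp_psi E b > \<bar>q\<bar>" using exp_psi_unbounded by blast
  then have b: "q \<notin> zmul (exp_psi E b)" using zmul_abs_ge[of q] assms exp_psi_pos by force
  obtain k where k: "\<And>n. q \<in> zmul (exp_psi E n) \<longleftrightarrow> n \<le> k"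
    using int_greatest[of "\<lambda>n. q \<in> zmul (exp_psi E n)", OF a _ b] exp_psi_zmul zmul_trans by blast
  have "ordQ E q = k" unfolding ordQ_def by (rule Greatest_equality) (auto simp: k)
  then show ?thesis using k by simp
qed

lemma ordf_iff: assumes "x \<noteq> 0" shows "in_ideal (exp_psi E n) x \<longleftrightarrow> n \<le> ordf E x"
proof -
  have ex: "\<exists>k. (\<forall>n. in_ideal (exp_psi E n) (abs_fadele X) \<longleftrightarrow> n \<le> k) \<and> (\<forall>\<^sub>F n in sequentially. ordQ E (X n) = k)"
    if X: "cauchyQ X" "abs_fadele X \<noteq> 0" for X
  proof -
    obtain r where r: "r > 0" "\<not> in_ideal r (abs_fadele X)" using X fadele_eq_0_iff by blast
    obtain b where "exp_psi E b \<in> zmul r" using exp_psi_small[OF r(1)] by blast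
    then have b: "\<not> in_ideal (exp_psi E b) (abs_fadele X)" using r in_ideal_trans by blast
    then have *: "\<exists>\<^sub>F n in sequentially. X n \<notin> zmul (exp_psi E b)"
      using X by (simp add: in_ideal_abs exp_psi_pos frequently_def)
    obtain i where i: "\<forall>m\<ge>i. \<forall>n\<ge>i. X m - X n \<in> zmul (exp_psi E b)"
      using X exp_psi_pos[of b] unfolding cauchyQ_def by meson
    obtain j where j: "j \<ge> i" "X j \<notin> zmul (exp_psi E b)"
      using * unfolding frequently_def eventually_sequentially by blast
    have eq: "X m \<in> zmul (exp_psi E n) \<longleftrightarrow> X j \<in> zmul (exp_psi E n)" if "m \<ge> i" "n \<le> b" for m n
    proof -
      have "X m - X j \<in> zmul (exp_psi E n)" using i j that exp_psi_zmul zmul_trans by blast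
      then show ?thesis using zmul_add[of "X m - X j" _ "X j"] zmul_diff[of "X m" _ "X m - X j"] by auto
    qed
    have nz: "X m \<noteq> 0" if "m \<ge> i" for m using eq[OF that order_refl] j by auto
    have lt: "ordQ E (X m) < b" if "m \<ge> i" for m
      using eq[OF that order_refl] j ordQ_iff[OF nz[OF that], of b] by auto
    have const: "ordQ E (X m) = ordQ E (X j)" if "m \<ge> i" for m
    proof -
      have "n \<le> ordQ E (X m) \<longleftrightarrow> n \<le> ordQ E (X j)" if "n \<le> b" for n
        using eq[OF \<open>m \<ge> i\<close> that] ordQ_iff nz \<open>m \<ge> i\<close> j by simp
      from this[of "ordQ E (X m)"] this[of "ordQ E (X j)"] show ?thesis
        using lt[OF that] lt[OF j(1)] by linarith
    qed
    have "in_ideal (exp_psi E n) (abs_fadele X) \<longleftrightarrow> n \<le> ordQ E (X j)" for n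
    proof -
      have "\<forall>\<^sub>F m in sequentially. X m \<in> zmul (exp_psi E n) \<longleftrightarrow> n \<le> ordQ E (X j)"
        unfolding eventually_sequentially using ordQ_iff nz const by (intro exI[of _ i]) auto
      then have "(\<forall>\<^sub>F m in sequentially. X m \<in> zmul (exp_psi E n)) \<longleftrightarrow> (\<forall>\<^sub>F m in sequentially. n \<le> ordQ E (X j))"
        by (rule eventually_subst)
      then show ?thesis using X by (simp add: in_ideal_abs exp_psi_pos)
    qed
    moreover have "\<forall>\<^sub>F m in sequentially. ordQ E (X m) = ordQ E (X j)"
      unfolding eventually_sequentially using const by blast
    ultimately show ?thesis by blast
  qed
  obtain X where X: "cauchyQ X" "abs_fadele X = x" by (induct x) blast
  then obtain k where k: "\<And>n. in_ideal (exp_psi E n) x \<longleftrightarrow> n \<le> k" 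
    "\<forall>\<^sub>F n in sequentially. ordQ E (X n) = k" using ex assms by blast
  have "ordf E x = k" unfolding ordf_def
  proof (rule the_equality)
    show "\<exists>X. cauchyQ X \<and> abs_fadele X = x \<and> (\<forall>\<^sub>F n in sequentially. ordQ E (X n) = k)"
      using X k by blast
  next
    fix l assume "\<exists>X. cauchyQ X \<and> abs_fadele X = x \<and> (\<forall>\<^sub>F n in sequentially. ordQ E (X n) = l)"
    then obtain Y where Y: "cauchyQ Y" "abs_fadele Y = x" "\<forall>\<^sub>F n in sequentially. ordQ E (Y n) = l" by blast
    then obtain k' where k': "\<And>n. in_ideal (exp_psi E n) x \<longleftrightarrow> n \<le> k'" 
      "\<forall>\<^sub>F n in sequentially. ordQ E (Y n) = k'" using ex assms by blast
    have "k' = k" using k(1) k'(1) by (metis order_antisym order_refl)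
    moreover have "l = k'"
      using eventually_happens'[OF sequentially_bot eventually_conj[OF Y(3) k'(2)]] by auto
    ultimately show "l = k" by simp
  qed
  then show ?thesis using k by simp
qed

lemma normf_nonneg: "normf E x \<ge> 0"
  using exp_psi_pos by (simp add: normf_def less_imp_le)

lemma normf_0 [simp]: "normf E 0 = 0"
  by (simp add: normf_def)

lemma normf_eq_0: "normf E x = 0 \<longleftrightarrow> x = 0"
  using exp_psi_pos[of "ordf E x"] by (auto simp: normf_def)

lemma normf_less_iff: "normf E x < 1 / of_rat (exp_psi E n) \<longleftrightarrow> in_ideal (exp_psi E (n + 1)) x"
proof (cases "x = 0")
  case True
  then show ?thesis using exp_psi_pos in_ideal_0 by simp
next
  case False
  have "normf E x < 1 / of_rat (exp_psi E n) \<longleftrightarrow> exp_psi E n < exp_psi E (ordf E x)"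
    using False exp_psi_pos by (simp add: normf_def frac_less_eq of_rat_less divide_less_eq field_simps)
  also have "\<dots> \<longleftrightarrow> n + 1 \<le> ordf E x" by (auto simp: exp_psi_less_iff)
  finally show ?thesis using ordf_iff[OF False] by simp
qed

lemma normf_le_iff: "normf E x \<le> 1 / of_rat (exp_psi E n) \<longleftrightarrow> in_ideal (exp_psi E n) x"
proof (cases "x = 0")
  case True
  then show ?thesis using exp_psi_pos[of n] in_ideal_0 by simp
next
  case False
  have "normf E x \<le> 1 / of_rat (exp_psi E n) \<longleftrightarrow> exp_psi E n \<le> exp_psi E (ordf E x)"
    using False exp_psi_pos by (simp add: normf_def of_rat_less_eq field_simps)
  also have "\<dots> \<longleftrightarrow> n \<le> ordf E x" using exp_psi_less_iff[of "ordf E x" n] by auto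
  finally show ?thesis using ordf_iff[OF False] by simp
qed

lemma normf_minus: "normf E (- x) = normf E x"
proof -
  have "in_ideal r (- x) \<longleftrightarrow> in_ideal r x" for r using in_ideal_minus by fastforce
  then have "ordf E (- x) = ordf E x" if "x \<noteq> 0"
    using ordf_iff[of x] ordf_iff[of "- x"] that by (metis neg_equal_0_iff_equal order_antisym order_refl)
  then show ?thesis by (simp add: normf_def)
qed

lemma normf_ultrametric: "normf E (x + y) \<le> max (normf E x) (normf E y)"
proof (cases "x = 0 \<or> y = 0")
  case True
  then show ?thesis by (auto simp: normf_nonneg)
next
  case False
  then obtain n where n: "max (normf E x) (normf E y) = 1 / of_rat (exp_psi E n)"
    by (cases "normf E x \<le> normf E y") (auto simp: normf_def max_def)
  then have "in_ideal (exp_psi E n) x" "in_ideal (exp_psi E n) y"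
    by (auto simp flip: normf_le_iff)
  then show ?thesis using n normf_le_iff in_ideal_add by simp
qed

lemma normf_of_rat: "normf E (fadele_of_rat q) = normQ E q"
proof (cases "q = 0")
  case False
  then have nz: "fadele_of_rat q \<noteq> 0"
    by transfer (simp add: fadele_rel_def nullQ_const)
  have "n \<le> ordf E (fadele_of_rat q) \<longleftrightarrow> n \<le> ordQ E q" for n
    using ordf_iff[OF nz] ordQ_iff[OF False] by (simp add: in_ideal_of_rat exp_psi_pos)
  then have "ordf E (fadele_of_rat q) = ordQ E q" by (metis order_antisym order_refl)
  then show ?thesis using False nz by (simp add: normf_def normQ_def)
qed (simp add: normQ_def)

lemma normf_small_ideal: assumes "r > 0" shows "\<exists>e>0. \<forall>x. normf E x < e \<longrightarrow> in_ideal r x"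
proof -
  obtain n where "exp_psi E n \<in> zmul r" using exp_psi_small[OF assms] by blast
  then have "in_ideal r x" if "normf E x < 1 / of_rat (exp_psi E n)" for x
    using that in_ideal_trans assms by (metis less_imp_le normf_le_iff)
  then show ?thesis using exp_psi_pos[of n]
    by (intro exI[of _ "1 / of_rat (exp_psi E n)"]) auto
qed

lemma ideal_small_normf: assumes "e > 0" shows "\<exists>r>0. \<forall>x. in_ideal r x \<longrightarrow> normf E x < e"
proof -
  obtain m :: nat where m: "1 / e < of_nat m" using reals_Archimedean2 by blast
  obtain n where n: "exp_psi E n > of_nat m" using exp_psi_unbounded by blast
  have "(of_nat m :: real) < of_rat (exp_psi E n)" using n by (metis of_rat_less of_rat_of_nat_eq)
  then have "1 / of_rat (exp_psi E n) < e" using m assms exp_psi_pos[of n]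
    by (simp add: field_simps) (smt (verit) mult_left_mono)
  then show ?thesis using exp_psi_pos[of n]
    by (intro exI[of _ "exp_psi E n"]) (auto simp flip: normf_le_iff)
qed

lemma normQ_small_iff: "(\<forall>e>0. P (\<lambda>q. normQ E q < e)) \<longleftrightarrow> (\<forall>r>0. P (\<lambda>q. q \<in> zmul r))"
  if mono: "\<And>A B. (\<And>q. A q \<Longrightarrow> B q) \<Longrightarrow> P A \<Longrightarrow> P B" for P
proof safe
  fix r :: rat assume *: "\<forall>e>0. P (\<lambda>q. normQ E q < e)" "r > 0"
  obtain e where "e > 0" "\<forall>x. normf E x < e \<longrightarrow> in_ideal r x" using normf_small_ideal[OF *(2)] by blast
  then have "P (\<lambda>q. normQ E q < e)" "\<And>q. normQ E q < e \<Longrightarrow> q \<in> zmul r"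
    using * by (simp, metis in_ideal_of_rat normf_of_rat)
  then show "P (\<lambda>q. q \<in> zmul r)" by (rule mono[rotated])
next
  fix e :: real assume *: "\<forall>r>0. P (\<lambda>q. q \<in> zmul r)" "e > 0"
  obtain r where "r > 0" "\<forall>x. in_ideal r x \<longrightarrow> normf E x < e" using ideal_small_normf[OF *(2)] by blast
  then have "P (\<lambda>q. q \<in> zmul r)" "\<And>q. q \<in> zmul r \<Longrightarrow> normQ E q < e"
    using * by (simp, metis in_ideal_of_rat normf_of_rat)
  then show "P (\<lambda>q. normQ E q < e)" by (rule mono[rotated])
qed

lemma cauchyQ_iff: "cauchyQ X \<longleftrightarrow> (\<forall>e>0. \<exists>k. \<forall>m\<ge>k. \<forall>n\<ge>k. normQ E (X m - X n) < e)"
  unfolding cauchyQ_def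
  by (rule normQ_small_iff[symmetric, of "\<lambda>A. \<exists>k. \<forall>m\<ge>k. \<forall>n\<ge>k. A (X m - X n)"]) blast

lemma nullQ_iff: "nullQ X \<longleftrightarrow> (\<lambda>n. normQ E (X n)) \<longlonglongrightarrow> 0"
proof -
  have "nullQ X \<longleftrightarrow> (\<forall>e>0. \<forall>\<^sub>F n in sequentially. normQ E (X n) < e)"
    unfolding nullQ_def
    by (rule normQ_small_iff[symmetric, of "\<lambda>A. \<forall>\<^sub>F n in sequentially. A (X n)"]) 
       (auto elim: eventually_mono)
  also have "\<dots> \<longleftrightarrow> (\<lambda>n. normQ E (X n)) \<longlonglongrightarrow> 0"
    using normf_nonneg by (simp add: tendsto_iff flip: normf_of_rat)
  finally show ?thesis .
qed

lemma normf_metric: "Metric_space UNIV (\<lambda>x y. normf E (x - y))"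
proof
  fix x y z :: fadele
  show "normf E (x - y) = normf E (y - x)" using normf_minus[of "x - y"] by simp
  show "normf E (x - z) \<le> normf E (x - y) + normf E (y - z)"
    using normf_ultrametric[of "x - y" "y - z"] normf_nonneg[of "x - y"] normf_nonneg[of "y - z"] by simp
qed (auto simp: normf_nonneg normf_eq_0)

lemma normf_complete: 
  assumes s: "\<And>e. e > 0 \<Longrightarrow> \<exists>k. \<forall>m\<ge>k. \<forall>n\<ge>k. normf E (s m - s n) < e"
  shows "\<exists>x. (\<lambda>n. normf E (s n - x)) \<longlonglongrightarrow> 0"
proof -
  have "\<forall>n. \<exists>q. in_ideal (exp_psi E (int n)) (s n - fadele_of_rat q)" using fadele_approx exp_psi_pos by blast
  then obtain q where q: "\<And>n. in_ideal (exp_psi E (int n)) (s n - fadele_of_rat (q n))" by metis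
  have ev: "\<exists>k. \<forall>n\<ge>k. in_ideal r (s n - fadele_of_rat (q n))" if r: "r > 0" for r
  proof -
    obtain k where k: "k \<ge> 0" "exp_psi E k \<in> zmul r" using exp_psi_small[OF r] by blast
    have "in_ideal r (s n - fadele_of_rat (q n))" if "n \<ge> nat k" for n
      using q[of n] exp_psi_zmul[of k "int n"] that k r in_ideal_trans zmul_trans by (metis nat_le_iff)
    then show ?thesis by blast
  qed
  have cq: "cauchyQ q" unfolding cauchyQ_def
  proof safe
    fix r :: rat assume r: "r > 0"
    obtain e where e: "e > 0" "\<forall>x. normf E x < e \<longrightarrow> in_ideal r x" using normf_small_ideal[OF r] by blast
    obtain k where k: "\<forall>m\<ge>k. \<forall>n\<ge>k. normf E (s m - s n) < e" using s[OF e(1)] by blast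
    obtain l where l: "\<forall>n\<ge>l. in_ideal r (s n - fadele_of_rat (q n))" using ev[OF r] by blast
    have "q m - q n \<in> zmul r" if "m \<ge> max k l" "n \<ge> max k l" for m n
    proof -
      have "in_ideal r ((s m - s n) - ((s m - fadele_of_rat (q m)) - (s n - fadele_of_rat (q n))))"
        using that k l e by (intro in_ideal_diff[of r "s m - s n"] in_ideal_diff[of r "s m - fadele_of_rat (q m)"]) auto
      then have "in_ideal r (fadele_of_rat (q m) - fadele_of_rat (q n))" by (simp add: algebra_simps)
      then show ?thesis by (simp add: fadele_of_rat_diff in_ideal_of_rat)
    qed
    then show "\<exists>k. \<forall>m\<ge>k. \<forall>n\<ge>k. q m - q n \<in> zmul r" by blast
  qed
  have lim: "\<exists>k. \<forall>n\<ge>k. in_ideal r (s n - abs_fadele q)" if r: "r > 0" for r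
  proof -
    obtain k where k: "\<forall>m\<ge>k. \<forall>n\<ge>k. q m - q n \<in> zmul r" using cq r unfolding cauchyQ_def by meson
    obtain l where l: "\<forall>n\<ge>l. in_ideal r (s n - fadele_of_rat (q n))" using ev[OF r] by blast
    have "in_ideal r (s n - abs_fadele q)" if "n \<ge> max k l" for n
    proof -
      have c: "cauchyQ (\<lambda>i. q n + - q i)" using cq by (intro cauchyQ_add cauchyQ_minus) auto
      have "fadele_of_rat (q n) - abs_fadele q = abs_fadele (\<lambda>i. q n + - q i)"
        unfolding minus_fadele_def using cq cauchyQ_minus[OF cq]
        by (simp add: fadele_of_rat.abs_eq uminus_fadele.abs_eq plus_fadele.abs_eq fadele_rel_refl)
      then have "in_ideal r (fadele_of_rat (q n) - abs_fadele q)"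
        using c k r that by (auto simp: in_ideal_abs eventually_sequentially intro!: exI[of _ k])
      moreover have "in_ideal r (s n - fadele_of_rat (q n))" using l that by simp
      ultimately have "in_ideal r ((s n - fadele_of_rat (q n)) + (fadele_of_rat (q n) - abs_fadele q))"
        by (intro in_ideal_add)
      then show ?thesis by simp
    qed
    then show ?thesis by blast
  qed
  have "(\<lambda>n. normf E (s n - abs_fadele q)) \<longlonglongrightarrow> 0"
  proof (rule LIMSEQ_I)
    fix e :: real assume "e > 0"
    then obtain r where "r > 0" "\<forall>x. in_ideal r x \<longrightarrow> normf E x < e" using ideal_small_normf by blast
    then show "\<exists>k. \<forall>n\<ge>k. norm (normf E (s n - abs_fadele q) - 0) < e"
      using lim normf_nonneg by fastforce
  qed
  then show ?thesis by blast
qed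

end

lemma adelic_sequence_fact: "adelic_sequence (\<lambda>n. fact (Suc n))"
  unfolding adelic_sequence_def
proof (intro conjI allI impI)
  show "strict_mono (\<lambda>n. fact (Suc n) :: nat)" by (intro strict_monoI fact_less_mono) auto
  fix N :: nat assume "N > 0"
  then show "\<exists>n. N dvd fact (Suc n)" by (intro exI[of _ N] dvd_fact) auto
qed (auto simp del: mult_Suc)

text \<open>As a type class instance \<open>dist\<close> must be one fixed metric. All the ultrametrics induce the same
  topology (\<open>fadele_completion\<close>), and only the topology is used below.\<close>

instantiation fadele :: metric_space
begin

definition dist_fadele :: "fadele \<Rightarrow> fadele \<Rightarrow> real"
  where "dist_fadele x y = normf (\<lambda>n. fact (Suc n)) (x - y)"

definition uniformity_fadele :: "(fadele \<times> fadele) filter"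
  where "uniformity_fadele = (INF e\<in>{0 <..}. principal {(x, y). dist x y < e})"

definition open_fadele :: "fadele set \<Rightarrow> bool"
  where "open_fadele U \<longleftrightarrow> (\<forall>x\<in>U. eventually (\<lambda>(x', y). x' = x \<longrightarrow> y \<in> U) uniformity)"

instance
proof
  interpret Metric_space UNIV "dist :: fadele \<Rightarrow> fadele \<Rightarrow> real"
    unfolding dist_fadele_def by (rule normf_metric[OF adelic_sequence_fact])
  fix x y z :: fadele
  show "dist x y = 0 \<longleftrightarrow> x = y" by simp
  show "dist x y \<le> dist x z + dist y z" using triangle[of x z y] commute[of y z] by simp
qed (auto simp: uniformity_fadele_def open_fadele_def)

end

lemma open_fadele_iff: "open U \<longleftrightarrow> (\<forall>x\<in>U. \<exists>r>0. \<forall>y. in_ideal r (y - x) \<longrightarrow> y \<in> U)"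
proof -
  have 1: "\<exists>r>0. \<forall>x. in_ideal r x \<longrightarrow> normf (\<lambda>n. fact (Suc n)) x < e" if "e > 0" for e
    using that by (rule ideal_small_normf[OF adelic_sequence_fact])
  have 2: "\<exists>e>0. \<forall>x. normf (\<lambda>n. fact (Suc n)) x < e \<longrightarrow> in_ideal r x" if "r > 0" for r
    using that by (rule normf_small_ideal[OF adelic_sequence_fact])
  show ?thesis unfolding open_dist dist_fadele_def using 1 2 by meson
qed

instance fadele :: complete_space
proof
  fix s :: "nat \<Rightarrow> fadele" assume "Cauchy s"
  then have "\<exists>k. \<forall>m\<ge>k. \<forall>n\<ge>k. normf (\<lambda>n. fact (Suc n)) (s m - s n) < e" if "e > 0" for e
    using that unfolding Cauchy_def dist_fadele_def by meson
  from normf_complete[OF adelic_sequence_fact this]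
  obtain x where "(\<lambda>n. normf (\<lambda>n. fact (Suc n)) (s n - x)) \<longlonglongrightarrow> 0" by blast
  then have "s \<longlonglongrightarrow> x" by (subst tendsto_dist_iff) (simp add: dist_fadele_def)
  then show "convergent s" by (rule convergentI)
qed

instance fadele :: second_countable_topology
proof
  define V where "V = (\<lambda>(q, r). {y. in_ideal r (y - fadele_of_rat q)})"
  define B where "B = V ` (UNIV \<times> {0<..})"
  have "countable B" unfolding B_def by (intro countable_image) (auto intro: countable_subset[of _ UNIV])
  moreover have "topological_basis B"
  proof (rule topological_basisI)
    fix U assume "U \<in> B"
    then obtain q r where U: "U = {y. in_ideal r (y - fadele_of_rat q)}" "r > 0"
      by (auto simp: B_def V_def)
    have "in_ideal r (y - fadele_of_rat q)" 
      if "in_ideal r (x - fadele_of_rat q)" "in_ideal r (y - x)" for x y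
      using in_ideal_add[OF that] by simp
    then show "open U" unfolding open_fadele_iff using U by blast
  next
    fix U and x :: fadele assume "open U" "x \<in> U"
    then obtain r where r: "r > 0" "\<And>y. in_ideal r (y - x) \<Longrightarrow> y \<in> U" unfolding open_fadele_iff by blast
    obtain q where q: "in_ideal r (x - fadele_of_rat q)" using fadele_approx[OF r(1)] by blast
    have "in_ideal r (y - x)" if "in_ideal r (y - fadele_of_rat q)" for y
      using in_ideal_diff[OF that q] by simp
    then have "x \<in> V (q, r)" "V (q, r) \<subseteq> U" using q r by (auto simp: V_def)
    then show "\<exists>B'\<in>B. x \<in> B' \<and> B' \<subseteq> U" using r(1) by (auto simp: B_def)
  qed
  ultimately show "\<exists>B::fadele set set. countable B \<and> open = generate_topology B"
    using topological_basis_imp_subbasis by blast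
qed

instance fadele :: polish_space ..

theorem fadele_completion:
  assumes "adelic_sequence E"
  shows "Metric_space UNIV (\<lambda>x y. normf E (x - y))"
    and "Metric_space.mcomplete UNIV (\<lambda>x y. normf E (x - y))"
    and "Metric_space.mtopology UNIV (\<lambda>x y. normf E (x - y)) = euclidean"
    and "normf E (fadele_of_rat p - fadele_of_rat q) = normQ E (p - q)"
    and "closure (range fadele_of_rat) = UNIV"
proof -
  show ms: "Metric_space UNIV (\<lambda>x y. normf E (x - y))" by (rule normf_metric[OF assms])
  then interpret Metric_space UNIV "\<lambda>x y. normf E (x - y)" .
  show "mcomplete" unfolding mcomplete_def MCauchy_def
  proof clarsimp
    fix s :: "nat \<Rightarrow> fadele" assume "\<forall>e>0. \<exists>N. \<forall>n\<ge>N. \<forall>n'\<ge>N. normf E (s n - s n') < e"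
    with normf_complete[OF assms] obtain x where "(\<lambda>n. normf E (s n - x)) \<longlonglongrightarrow> 0" by blast
    then show "\<exists>x. limitin mtopology s x sequentially" 
      by (auto simp: limit_metric_sequentially LIMSEQ_iff normf_nonneg[OF assms] abs_of_nonneg)
  qed
  have 1: "\<exists>r>0. \<forall>x. in_ideal r x \<longrightarrow> normf E x < e" if "e > 0" for e
    using that by (rule ideal_small_normf[OF assms])
  have 2: "\<exists>e>0. \<forall>x. normf E x < e \<longrightarrow> in_ideal r x" if "r > 0" for r
    using that by (rule normf_small_ideal[OF assms])
  have "openin mtopology U \<longleftrightarrow> open U" for U
  proof -
    have "openin mtopology U \<longleftrightarrow> (\<forall>x\<in>U. \<exists>e>0. \<forall>y. normf E (y - x) < e \<longrightarrow> y \<in> U)"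
      unfolding openin_mtopology by (auto simp: subset_iff commute)
    also have "\<dots> \<longleftrightarrow> open U" unfolding open_fadele_iff using 1 2 by meson
    finally show ?thesis .
  qed
  then show "mtopology = euclidean" by (simp add: topology_eq)
  show "normf E (fadele_of_rat p - fadele_of_rat q) = normQ E (p - q)"
    by (simp add: fadele_of_rat_diff normf_of_rat[OF assms])
  show "closure (range fadele_of_rat) = UNIV"
  proof -
    have "U \<inter> range fadele_of_rat \<noteq> {}" if U: "open U" "x \<in> U" for U x
    proof -
      obtain r where r: "r > 0" "\<And>y. in_ideal r (y - x) \<Longrightarrow> y \<in> U" using U unfolding open_fadele_iff by blast
      obtain q where "in_ideal r (x - fadele_of_rat q)" using fadele_approx[OF r(1)] by blast
      then have "in_ideal r (fadele_of_rat q - x)" using in_ideal_minus by fastforce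
      then show ?thesis using r by auto
    qed
    then have "x \<in> closure (range fadele_of_rat)" for x
      unfolding closure_iff_nhds_not_empty by blast
    then show ?thesis by blast
  qed
qed

text \<open>The ring operations are continuous, hence the unique continuous extensions of those of \<open>\<rat>\<close>.\<close>

lemma in_ideal_mult: "in_ideal r x \<Longrightarrow> in_ideal s y \<Longrightarrow> in_ideal (r * s) (x * y)"
proof transfer
  fix r s :: rat and X Y :: "nat \<Rightarrow> rat"
  assume X: "r > 0 \<and> (\<forall>\<^sub>F n in sequentially. X n \<in> zmul r)"
    and Y: "s > 0 \<and> (\<forall>\<^sub>F n in sequentially. Y n \<in> zmul s)"
  from X[THEN conjunct2] Y[THEN conjunct2] have "\<forall>\<^sub>F n in sequentially. X n * Y n \<in> zmul (r * s)"
    by eventually_elim (rule zmul_mult)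
  with X Y show "r * s > 0 \<and> (\<forall>\<^sub>F n in sequentially. X n * Y n \<in> zmul (r * s))" by simp
qed

lemma in_ideal_ex: "\<exists>r>0. in_ideal r x"
proof -
  obtain q where q: "in_ideal 1 (x - fadele_of_rat q)" using fadele_approx[of 1 x] by auto
  obtain s where s: "s > 0" "q \<in> zmul s" using zmul_ex_pos by blast
  obtain t where t: "t > 0" "s \<in> zmul t" "1 \<in> zmul t" using zmul_ex_common[OF s(1), of 1] by auto
  have "in_ideal t (x - fadele_of_rat q)" using in_ideal_trans[OF q t(3,1)] .
  moreover have "in_ideal t (fadele_of_rat q)" using zmul_trans[OF s(2) t(2)] t(1) by (simp add: in_ideal_of_rat)
  ultimately have "in_ideal t ((x - fadele_of_rat q) + fadele_of_rat q)" by (rule in_ideal_add)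
  then show ?thesis using t(1) by auto
qed

lemma open_in_ideal: "open {y. in_ideal r (y - x)}"
proof (cases "r > 0")
  case True
  have "in_ideal r (z - x)" if "in_ideal r (y - x)" "in_ideal r (z - y)" for y z
    using in_ideal_add[OF that] by simp
  then show ?thesis using True unfolding open_fadele_iff by blast
next
  case False
  then have "\<not> in_ideal r y" for y by transfer simp
  then show ?thesis by simp
qed

lemma eventually_nhds_fadele: "eventually P (nhds x) \<longleftrightarrow> (\<exists>r>0. \<forall>y. in_ideal r (y - x) \<longrightarrow> P y)"
proof
  assume "eventually P (nhds x)"
  then show "\<exists>r>0. \<forall>y. in_ideal r (y - x) \<longrightarrow> P y"
    unfolding eventually_nhds open_fadele_iff by meson
next
  assume "\<exists>r>0. \<forall>y. in_ideal r (y - x) \<longrightarrow> P y"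
  then obtain r where "r > 0" "\<forall>y. in_ideal r (y - x) \<longrightarrow> P y" by blast
  then show "eventually P (nhds x)" unfolding eventually_nhds
    by (intro exI[of _ "{y. in_ideal r (y - x)}"]) (auto simp: open_in_ideal in_ideal_0)
qed

lemma tendsto_fadele_iff: 
  "(f \<longlongrightarrow> x) F \<longleftrightarrow> (\<forall>r>0. \<forall>\<^sub>F i in F. in_ideal r (f i - x))"
proof
  assume f: "(f \<longlongrightarrow> x) F"
  have "\<forall>\<^sub>F y in nhds x. in_ideal r (y - x)" if "r > 0" for r
    using that by (auto simp: eventually_nhds_fadele)
  with f show "\<forall>r>0. \<forall>\<^sub>F i in F. in_ideal r (f i - x)" unfolding filterlim_iff by blast
next
  assume *: "\<forall>r>0. \<forall>\<^sub>F i in F. in_ideal r (f i - x)"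
  show "(f \<longlongrightarrow> x) F" unfolding filterlim_iff
  proof safe
    fix P assume "eventually P (nhds x)"
    then obtain r where r: "r > 0" "\<And>y. in_ideal r (y - x) \<Longrightarrow> P y" by (auto simp: eventually_nhds_fadele)
    from *[rule_format, OF r(1)] show "\<forall>\<^sub>F i in F. P (f i)" by (rule eventually_mono) (rule r(2))
  qed
qed

instance fadele :: topological_monoid_add
proof
  fix a b :: fadele
  show "((\<lambda>x. fst x + snd x) \<longlongrightarrow> a + b) (nhds a \<times>\<^sub>F nhds b)"
    unfolding tendsto_fadele_iff
  proof safe
    fix r :: rat assume r: "r > 0"
    have "\<forall>\<^sub>F x in nhds a. in_ideal r (x - a)" "\<forall>\<^sub>F x in nhds b. in_ideal r (x - b)"
      using r by (auto simp: eventually_nhds_fadele)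
    from eventually_prodI[OF this]
    show "\<forall>\<^sub>F x in nhds a \<times>\<^sub>F nhds b. in_ideal r (fst x + snd x - (a + b))"
      by eventually_elim (auto simp: add_diff_add intro: in_ideal_add)
  qed
qed

instance fadele :: topological_group_add
proof
  fix a :: fadele
  show "(uminus \<longlongrightarrow> - a) (nhds a)"
    unfolding tendsto_fadele_iff eventually_nhds_fadele
    using in_ideal_minus by fastforce
qed

instance fadele :: topological_semigroup_mult
proof
  fix a b :: fadele
  show "((\<lambda>x. fst x * snd x) \<longlongrightarrow> a * b) (nhds a \<times>\<^sub>F nhds b)"
    unfolding tendsto_fadele_iff
  proof safe
    fix r :: rat assume r: "r > 0"
    obtain s t where st: "s > 0" "in_ideal s a" "t > 0" "in_ideal t b" using in_ideal_ex by meson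
    have ev: "\<forall>\<^sub>F x in nhds c. in_ideal e (x - c)" if "e > 0" for e c
      using that by (auto simp: eventually_nhds_fadele)
    have "\<forall>\<^sub>F x in nhds a. in_ideal (r / t) (x - a) \<and> in_ideal 1 (x - a)" 
      "\<forall>\<^sub>F x in nhds b. in_ideal (r / s) (x - b) \<and> in_ideal r (x - b)"
      using r st by (intro eventually_conj ev; simp)+
    from eventually_prodI[OF this]
    show "\<forall>\<^sub>F x in nhds a \<times>\<^sub>F nhds b. in_ideal r (fst x * snd x - a * b)"
    proof eventually_elim
      case (elim x)
      have "in_ideal r (a * (snd x - b))" "in_ideal r ((fst x - a) * b)" "in_ideal r ((fst x - a) * (snd x - b))"
        using elim st in_ideal_mult[of s a "r / s" "snd x - b"] in_ideal_mult[of "r / t" "fst x - a" t b] 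
          in_ideal_mult[of 1 "fst x - a" r "snd x - b"] by auto
      then have "in_ideal r (a * (snd x - b) + (fst x - a) * b + (fst x - a) * (snd x - b))"
        by (intro in_ideal_add)
      then show ?case by (simp add: algebra_simps)
    qed
  qed
qed


section \<open>Hensel expansions and the canonical characters\<close>

definition hensel_expansion :: "(nat \<Rightarrow> nat) \<Rightarrow> fadele \<Rightarrow> (int \<Rightarrow> nat) \<Rightarrow> bool"
  where "hensel_expansion E x a \<longleftrightarrow>
    (\<forall>l. of_nat (a l) < exp_Lambda E (l + 1)) \<and>
    (\<forall>l < ordf E x. a l = 0) \<and> a (ordf E x) \<noteq> 0 \<and>
    (\<lambda>n. \<Sum>l = ordf E x..int n. fadele_of_rat (of_nat (a l) * exp_psi E l)) \<longlonglongrightarrow> x"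

lemma fadele_of_rat_sum: "fadele_of_rat (sum f A) = (\<Sum>i\<in>A. fadele_of_rat (f i))"
  by (induction A rule: infinite_finite_induct) (simp_all add: fadele_of_rat_add)

lemma zmul_sum: "(\<And>i. i \<in> A \<Longrightarrow> f i \<in> zmul r) \<Longrightarrow> sum f A \<in> zmul r"
  by (induction A rule: infinite_finite_induct) (simp_all add: zmul_add)

lemma zmul_of_nat: "of_nat n * r \<in> zmul r"
  unfolding zmul_def by (rule CollectI, rule exI[of _ "int n"], simp)

context
  fixes E :: "nat \<Rightarrow> nat"
  assumes E: "adelic_sequence E"
begin

lemma exp_Lambda_nat: "\<exists>c>0. exp_Lambda E n = of_nat c"
proof -
  note pos = exp_psi_pos[OF E]
  obtain z :: int where z: "exp_psi E n = of_int z * exp_psi E (n - 1)"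
    using exp_psi_zmul[OF E, of "n - 1" n] by (auto simp: zmul_def)
  then have *: "exp_Lambda E n = of_int z" using pos[of "n - 1"] by (simp add: exp_Lambda_def)
  have "exp_Lambda E n > 0" unfolding exp_Lambda_def using pos by simp
  then have "z > 0" using * by simp
  then show ?thesis using * by (intro exI[of _ "nat z"]) auto
qed

lemma hensel_partial_sum:
  assumes a: "hensel_expansion E x a" and n: "ordf E x \<le> n + 1"
  shows "in_ideal (exp_psi E (n + 1)) (x - fadele_of_rat (\<Sum>l = ordf E x..n. of_nat (a l) * exp_psi E l))"
proof -
  let ?S = "\<lambda>n. fadele_of_rat (\<Sum>l = ordf E x..n. of_nat (a l) * exp_psi E l)"
  have "(\<lambda>n. ?S (int n)) \<longlonglongrightarrow> x"
    using a by (simp add: hensel_expansion_def fadele_of_rat_sum)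
  then have "\<forall>\<^sub>F m in sequentially. in_ideal (exp_psi E (n + 1)) (?S (int m) - x)"
    using exp_psi_pos[OF E] by (simp add: tendsto_fadele_iff)
  then obtain m0 where m0: "\<And>m. m \<ge> m0 \<Longrightarrow> in_ideal (exp_psi E (n + 1)) (?S (int m) - x)"
    by (auto simp: eventually_sequentially)
  define m where "m = max m0 (nat n)"
  have "{ordf E x..int m} = {ordf E x..n} \<union> {n+1..int m}" using n by (auto simp: m_def)
  then have "(\<Sum>l = ordf E x..int m. of_nat (a l) * exp_psi E l) = 
     (\<Sum>l = ordf E x..n. of_nat (a l) * exp_psi E l) + (\<Sum>l = n+1..int m. of_nat (a l) * exp_psi E l)"
    by (simp add: sum.union_disjoint)
  then have eq: "?S (int m) = ?S n + fadele_of_rat (\<Sum>l = n+1..int m. of_nat (a l) * exp_psi E l)"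
    by (simp add: fadele_of_rat_add)
  have "(\<Sum>l = n+1..int m. of_nat (a l) * exp_psi E l) \<in> zmul (exp_psi E (n + 1))"
    by (intro zmul_sum zmul_trans[OF zmul_of_nat exp_psi_zmul[OF E]]) auto
  then have "in_ideal (exp_psi E (n + 1)) (?S (int m) - ?S n)"
    using eq exp_psi_pos[OF E] by (simp add: in_ideal_of_rat)
  from in_ideal_diff[OF this m0[of m]] show ?thesis by (simp add: m_def)
qed

lemma hensel_expansion_unique:
  assumes a: "hensel_expansion E x a" and b: "hensel_expansion E x b"
  shows "a = b"
proof -
  let ?g = "ordf E x"
  have "a l = b l" for l
  proof (cases "l < ?g")
    case True
    then show ?thesis using a b by (simp add: hensel_expansion_def)
  next
    case False
    then have "?g \<le> l" by simp
    then show ?thesis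
    proof (induction "nat (l - ?g)" arbitrary: l rule: less_induct)
      case less
      have eq: "(\<Sum>i = ?g..l - 1. of_nat (a i) * exp_psi E i) = (\<Sum>i = ?g..l - 1. of_nat (b i) * exp_psi E i)"
        using less by (intro sum.cong) auto
      have set: "{?g..l} = insert l {?g..l - 1}" using less.prems by auto
      have "in_ideal (exp_psi E (l + 1)) 
         ((x - fadele_of_rat (\<Sum>i = ?g..l. of_nat (b i) * exp_psi E i)) - (x - fadele_of_rat (\<Sum>i = ?g..l. of_nat (a i) * exp_psi E i)))"
        using less.prems by (intro in_ideal_diff hensel_partial_sum a b) auto
      then have "in_ideal (exp_psi E (l + 1)) (fadele_of_rat ((\<Sum>i = ?g..l. of_nat (a i) * exp_psi E i) - (\<Sum>i = ?g..l. of_nat (b i) * exp_psi E i)))"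
        by (simp flip: fadele_of_rat_diff)
      moreover have "(\<Sum>i = ?g..l. of_nat (a i) * exp_psi E i) - (\<Sum>i = ?g..l. of_nat (b i) * exp_psi E i) = (of_nat (a l) - of_nat (b l)) * exp_psi E l"
        unfolding set using eq by (simp add: left_diff_distrib)
      ultimately obtain z :: int where z: "(of_nat (a l) - of_nat (b l)) * exp_psi E l = of_int z * exp_psi E (l + 1)"
        by (auto simp: in_ideal_of_rat zmul_def)
      have pos: "exp_psi E l > 0" by (rule exp_psi_pos[OF E])
      obtain c where c: "c > 0" "exp_Lambda E (l + 1) = of_nat c" using exp_Lambda_nat by blast
      then have "exp_psi E (l + 1) = of_nat c * exp_psi E l" using pos by (simp add: exp_Lambda_def field_simps)
      then have "(of_nat (a l) - of_nat (b l)) * exp_psi E l = (of_int z * of_nat c) * exp_psi E l" using z by simp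
      then have "(of_nat (a l) - of_nat (b l) :: rat) = of_int z * of_nat c" using pos by simp
      then have "of_int (int (a l) - int (b l)) = (of_int (z * int c) :: rat)" by simp
      then have d: "int (a l) - int (b l) = z * int c" by (simp only: of_int_eq_iff)
      have "a l < c" "b l < c" using a b c by (auto simp: hensel_expansion_def dest!: spec[of _ l])
      then have "\<bar>z * int c\<bar> < int c" using d by linarith
      then have "\<bar>z\<bar> * int c < 1 * int c" by (simp add: abs_mult)
      then have "z = 0" using c(1) by (simp only: mult_less_cancel_right) auto
      then show ?case using d by simp
    qed
  qed
  then show ?thesis by blast
qed

lemma hensel_expansion_exists:
  assumes "x \<noteq> 0" shows "\<exists>a. hensel_expansion E x a"
proof -
  let ?g = "ordf E x"
  note pos = exp_psi_pos[OF E]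
  define good where "good s l c \<longleftrightarrow> of_nat c < exp_Lambda E (l + 1) \<and> 
    in_ideal (exp_psi E (l + 1)) (x - fadele_of_rat (s + of_nat c * exp_psi E l))" for s l and c :: nat
  have good: "\<exists>c. good s l c" if s: "in_ideal (exp_psi E l) (x - fadele_of_rat s)" for s l
  proof -
    obtain q where q: "in_ideal (exp_psi E (l + 1)) ((x - fadele_of_rat s) - fadele_of_rat q)"
      using fadele_approx[OF pos] by blast
    have "in_ideal (exp_psi E l) ((x - fadele_of_rat s) - ((x - fadele_of_rat s) - fadele_of_rat q))"
      using in_ideal_diff[OF s in_ideal_trans[OF q exp_psi_zmul[OF E] pos]] by simp
    then obtain z :: int where z: "q = of_int z * exp_psi E l" by (auto simp: in_ideal_of_rat zmul_def)
    obtain c where c: "c > 0" "exp_Lambda E (l + 1) = of_nat c" using exp_Lambda_nat by blast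
    then have e: "exp_psi E (l + 1) = of_nat c * exp_psi E l" using pos[of l] by (simp add: exp_Lambda_def field_simps)
    define d where "d = nat (z mod int c)"
    have d: "int d = z mod int c" using c by (simp add: d_def)
    then have "d < c" using c by (metis of_nat_0_less_iff of_nat_less_iff pos_mod_bound)
    have "of_int z = (of_int (z div int c * int c + int d) :: rat)" unfolding d by simp
    then have "q - of_nat d * exp_psi E l = of_int (z div int c) * exp_psi E (l + 1)"
      unfolding z e by (simp add: algebra_simps)
    then have "in_ideal (exp_psi E (l + 1)) (fadele_of_rat (q - of_nat d * exp_psi E l))"
      using pos by (auto simp: in_ideal_of_rat zmul_def)
    from in_ideal_add[OF q this] have "good s l d"
      using \<open>d < c\<close> c unfolding good_def by (simp add: fadele_of_rat_add algebra_simps flip: fadele_of_rat_diff)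
    then show ?thesis by blast
  qed
  define dig where "dig s l = (SOME c. good s l c)" for s l
  define S where "S = rec_nat 0 (\<lambda>n s. s + of_nat (dig s (?g + int n)) * exp_psi E (?g + int n))"
  have S0: "S 0 = 0" and SS: "\<And>n. S (Suc n) = S n + of_nat (dig (S n) (?g + int n)) * exp_psi E (?g + int n)"
    by (simp_all add: S_def)
  have inv: "in_ideal (exp_psi E (?g + int n)) (x - fadele_of_rat (S n))" for n
  proof (induction n)
    case 0
    then show ?case using ordf_iff[OF E assms] by (simp add: S0)
  next
    case (Suc n)
    have "good (S n) (?g + int n) (dig (S n) (?g + int n))" 
      unfolding dig_def by (rule someI_ex[OF good[OF Suc]])
    then show ?case unfolding good_def SS by (simp add: add.assoc add.commute add.left_commute)
  qed
  have gd: "good (S n) (?g + int n) (dig (S n) (?g + int n))" for n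
    unfolding dig_def by (rule someI_ex[OF good[OF inv]])
  define a where "a l = (if l < ?g then 0 else dig (S (nat (l - ?g))) l)" for l
  have sum: "(\<Sum>l = ?g..?g + int n - 1. of_nat (a l) * exp_psi E l) = S n" for n
  proof (induction n)
    case (Suc n)
    have "{?g..?g + int (Suc n) - 1} = insert (?g + int n) {?g..?g + int n - 1}" by auto
    then show ?case using Suc by (simp add: SS a_def)
  qed (simp add: S0)
  have "hensel_expansion E x a" unfolding hensel_expansion_def
  proof (intro conjI allI impI)
    fix l
    show "of_nat (a l) < exp_Lambda E (l + 1)"
    proof (cases "l < ?g")
      case True
      then show ?thesis using exp_Lambda_nat[of "l + 1"] by (auto simp: a_def)
    next
      case False
      then show ?thesis using gd[of "nat (l - ?g)"] by (simp add: a_def good_def)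
    qed
  next
    fix l assume "l < ?g" then show "a l = 0" by (simp add: a_def)
  next
    show "a ?g \<noteq> 0"
    proof
      assume "a ?g = 0"
      then have "in_ideal (exp_psi E (?g + 1)) x" using gd[of 0] by (simp add: a_def good_def S0)
      then show False using ordf_iff[OF E assms] by simp
    qed
  next
    show "(\<lambda>n. \<Sum>l = ?g..int n. fadele_of_rat (of_nat (a l) * exp_psi E l)) \<longlonglongrightarrow> x"
      unfolding tendsto_fadele_iff
    proof safe
      fix r :: rat assume r: "r > 0"
      obtain k where k: "exp_psi E k \<in> zmul r" using exp_psi_small[OF E r] by blast
      have "in_ideal r ((\<Sum>l = ?g..int n. fadele_of_rat (of_nat (a l) * exp_psi E l)) - x)" if "n \<ge> nat k + nat ?g" for n
      proof -
        define m where "m = nat (int n - ?g + 1)"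
        have m: "int n = ?g + int m - 1" using that by (simp add: m_def)
        have "in_ideal (exp_psi E (?g + int m)) (- (x - fadele_of_rat (S m)))" by (intro in_ideal_minus inv)
        then have "in_ideal (exp_psi E k) (fadele_of_rat (S m) - x)"
          using in_ideal_trans[OF _ exp_psi_zmul[OF E] pos] m that by simp
        then have "in_ideal r (fadele_of_rat (S m) - x)" using in_ideal_trans k r by blast
        then show ?thesis unfolding m sum[of m, symmetric] by (simp only: fadele_of_rat_sum)
      qed
      then show "\<forall>\<^sub>F n in sequentially. in_ideal r ((\<Sum>l = ?g..int n. fadele_of_rat (of_nat (a l) * exp_psi E l)) - x)"
        unfolding eventually_sequentially by blast
    qed
  qed
  then show ?thesis by blast
qed

end

lemma hensel_expansion_ex1: "adelic_sequence E \<Longrightarrow> x \<noteq> 0 \<Longrightarrow> \<exists>!a. hensel_expansion E x a"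
  using hensel_expansion_exists hensel_expansion_unique by blast

definition hensel_digits :: "(nat \<Rightarrow> nat) \<Rightarrow> fadele \<Rightarrow> int \<Rightarrow> nat"
  where "hensel_digits E x = (THE a. hensel_expansion E x a)"

definition frac_part :: "(nat \<Rightarrow> nat) \<Rightarrow> fadele \<Rightarrow> rat"
  where "frac_part E x = (if x \<noteq> 0 \<and> ordf E x < 0
     then \<Sum>l = ordf E x..-1. of_nat (hensel_digits E x l) * exp_psi E l else 0)"

definition chi_f :: "(nat \<Rightarrow> nat) \<Rightarrow> fadele \<Rightarrow> complex"
  where "chi_f E x = exp (2 * of_real pi * \<i> * of_rat (frac_part E x))"

definition chi_inf :: "real \<Rightarrow> complex"
  where "chi_inf x = exp (- 2 * of_real pi * \<i> * of_real x)"


section \<open>The adele ring and its Haar measure\<close>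

type_synonym adele = "real \<times> fadele"

definition adele_mult :: "adele \<Rightarrow> adele \<Rightarrow> adele"
  where "adele_mult x y = (fst x * fst y, snd x * snd y)"

definition chi :: "(nat \<Rightarrow> nat) \<Rightarrow> adele \<Rightarrow> complex"
  where "chi E x = chi_inf (fst x) * chi_f E (snd x)"

text \<open>Regularity is automatic on the second countable locally compact groups considered here.\<close>

definition haar_measure :: "'a::{ab_group_add, topological_space} measure \<Rightarrow> bool"
  where "haar_measure M \<longleftrightarrow> sets M = sets borel \<and>
    (\<forall>a. distr M borel (\<lambda>x. a + x) = M) \<and>
    (\<forall>K. compact K \<longrightarrow> emeasure M K < \<infinity>) \<and>
    (\<forall>U. open U \<longrightarrow> U \<noteq> {} \<longrightarrow> emeasure M U > 0)"

definition Zhat :: "(nat \<Rightarrow> nat) \<Rightarrow> fadele set"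
  where "Zhat E = {x. normf E x \<le> 1}"

definition adele_measure :: "fadele measure \<Rightarrow> adele measure"
  where "adele_measure \<mu> = lborel \<Otimes>\<^sub>M \<mu>"


section \<open>Square integrable functions and the Fourier transform\<close>

text \<open>Elements of \<open>L\<^sup>2\<close> are given by representatives; equality in \<open>L\<^sup>2\<close> is equality almost everywhere.\<close>

definition L2 :: "'a measure \<Rightarrow> ('a \<Rightarrow> complex) set"
  where "L2 M = {f \<in> borel_measurable M. integrable M (\<lambda>x. (cmod (f x))\<^sup>2)}"

definition L2_norm :: "'a measure \<Rightarrow> ('a \<Rightarrow> complex) \<Rightarrow> real"
  where "L2_norm M f = sqrt (\<integral>x. (cmod (f x))\<^sup>2 \<partial>M)"

definition fourier_L1 :: "(nat \<Rightarrow> nat) \<Rightarrow> fadele measure \<Rightarrow> (adele \<Rightarrow> complex) \<Rightarrow> adele \<Rightarrow> complex"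
  where "fourier_L1 E \<mu> \<phi> \<xi> = (\<integral>x. \<phi> x * chi E (adele_mult \<xi> x) \<partial>adele_measure \<mu>)"

text \<open>The graph of the extension of \<open>fourier_L1\<close> by continuity from \<open>L\<^sup>1 \<inter> L\<^sup>2\<close> to \<open>L\<^sup>2\<close>.\<close>

definition is_fourier :: "(nat \<Rightarrow> nat) \<Rightarrow> fadele measure \<Rightarrow> (adele \<Rightarrow> complex) \<Rightarrow> (adele \<Rightarrow> complex) \<Rightarrow> bool"
  where "is_fourier E \<mu> \<phi> \<psi> \<longleftrightarrow> (let M = adele_measure \<mu> in
    \<phi> \<in> L2 M \<and> \<psi> \<in> L2 M \<and>
    (\<exists>s :: nat \<Rightarrow> adele \<Rightarrow> complex.
      (\<forall>n. integrable M (s n) \<and> s n \<in> L2 M \<and> fourier_L1 E \<mu> (s n) \<in> L2 M) \<and>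
      (\<lambda>n. L2_norm M (\<lambda>x. s n x - \<phi> x)) \<longlonglongrightarrow> 0 \<and>
      (\<lambda>n. L2_norm M (\<lambda>\<xi>. fourier_L1 E \<mu> (s n) \<xi> - \<psi> \<xi>)) \<longlonglongrightarrow> 0))"

definition fourier :: "(nat \<Rightarrow> nat) \<Rightarrow> fadele measure \<Rightarrow> (adele \<Rightarrow> complex) \<Rightarrow> adele \<Rightarrow> complex"
  where "fourier E \<mu> \<phi> = (SOME \<psi>. is_fourier E \<mu> \<phi> \<psi>)"

definition inv_fourier :: "(nat \<Rightarrow> nat) \<Rightarrow> fadele measure \<Rightarrow> (adele \<Rightarrow> complex) \<Rightarrow> adele \<Rightarrow> complex"
  where "inv_fourier E \<mu> \<psi> = (SOME \<phi>. \<phi> \<in> L2 (adele_measure \<mu>) \<and>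
    (AE \<xi> in adele_measure \<mu>. fourier E \<mu> \<phi> \<xi> = \<psi> \<xi>))"


section \<open>The operator, the heat kernel and the Cauchy problem\<close>

definition symbolD :: "(nat \<Rightarrow> nat) \<Rightarrow> real \<Rightarrow> real \<Rightarrow> adele \<Rightarrow> real"
  where "symbolD E \<alpha> \<beta> \<xi> = normf E (snd \<xi>) powr \<alpha> + \<bar>fst \<xi>\<bar> powr \<beta>"

definition DomD :: "(nat \<Rightarrow> nat) \<Rightarrow> fadele measure \<Rightarrow> real \<Rightarrow> real \<Rightarrow> (adele \<Rightarrow> complex) set"
  where "DomD E \<mu> \<alpha> \<beta> = {\<phi> \<in> L2 (adele_measure \<mu>).
    (\<lambda>\<xi>. of_real (symbolD E \<alpha> \<beta> \<xi>) * fourier E \<mu> \<phi> \<xi>) \<in> L2 (adele_measure \<mu>)}"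

definition opD :: "(nat \<Rightarrow> nat) \<Rightarrow> fadele measure \<Rightarrow> real \<Rightarrow> real \<Rightarrow> (adele \<Rightarrow> complex) \<Rightarrow> adele \<Rightarrow> complex"
  where "opD E \<mu> \<alpha> \<beta> \<phi> = 
    inv_fourier E \<mu> (\<lambda>\<xi>. of_real (symbolD E \<alpha> \<beta> \<xi>) * fourier E \<mu> \<phi> \<xi>)"

definition heat_kernel :: "(nat \<Rightarrow> nat) \<Rightarrow> fadele measure \<Rightarrow> real \<Rightarrow> real \<Rightarrow> adele \<Rightarrow> real \<Rightarrow> complex"
  where "heat_kernel E \<mu> \<alpha> \<beta> x t = 
    (\<integral>\<xi>. chi E (- adele_mult \<xi> x) * of_real (exp (- t * symbolD E \<alpha> \<beta> \<xi>)) \<partial>adele_measure \<mu>)"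

text \<open>\<open>v\<close> is the continuous derivative of \<open>t \<mapsto> u(\<cdot>,t)\<close> on \<open>[0,\<infinity>)\<close>, one-sided at \<open>0\<close>.\<close>

definition L2_C1_derivative :: "'a measure \<Rightarrow> ('a \<Rightarrow> real \<Rightarrow> complex) \<Rightarrow> ('a \<Rightarrow> real \<Rightarrow> complex) \<Rightarrow> bool"
  where "L2_C1_derivative M u v \<longleftrightarrow> (\<forall>t\<ge>0.
    (\<lambda>x. u x t) \<in> L2 M \<and> (\<lambda>x. v x t) \<in> L2 M \<and>
    ((\<lambda>s. L2_norm M (\<lambda>x. (u x s - u x t) / of_real (s - t) - v x t)) \<longlongrightarrow> 0) (at t within {0..}) \<and>
    ((\<lambda>s. L2_norm M (\<lambda>x. v x s - v x t)) \<longlongrightarrow> 0) (at t within {0..}))"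

definition classical_solution :: 
  "(nat \<Rightarrow> nat) \<Rightarrow> fadele measure \<Rightarrow> real \<Rightarrow> real \<Rightarrow> (adele \<Rightarrow> complex) \<Rightarrow> (adele \<Rightarrow> real \<Rightarrow> complex) \<Rightarrow> bool"
  where "classical_solution E \<mu> \<alpha> \<beta> f u \<longleftrightarrow> (\<exists>v.
    L2_C1_derivative (adele_measure \<mu>) u v \<and>
    (\<forall>t\<ge>0. (\<lambda>x. u x t) \<in> DomD E \<mu> \<alpha> \<beta>) \<and>
    (\<forall>t>0. AE x in adele_measure \<mu>. v x t + opD E \<mu> \<alpha> \<beta> (\<lambda>y. u y t) x = 0) \<and>
    (AE x in adele_measure \<mu>. u x 0 = f x))"


section \<open>Markov processes\<close>

text \<open>A time-homogeneous Markov process in the sense of Dynkin, with infinite life time: \<open>\<Omega>\<close> is the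
  space of elementary events, \<open>F t\<close> (\<open>t \<ge> 0\<close>) the filtration, \<open>X t \<omega>\<close> the position at time \<open>t\<close>,
  \<open>P x\<close> the law of the process started at \<open>x\<close>, and \<open>p t x B\<close> the transition function. The last
  condition provides the time-shifted trajectories.\<close>

definition markov_process :: 
  "(real \<Rightarrow> 'a::topological_space \<Rightarrow> 'a set \<Rightarrow> real) \<Rightarrow> 'w set \<Rightarrow> (real \<Rightarrow> 'w measure) \<Rightarrow>
   (real \<Rightarrow> 'w \<Rightarrow> 'a) \<Rightarrow> ('a \<Rightarrow> 'w measure) \<Rightarrow> bool"
  where "markov_process p \<Omega> F X P \<longleftrightarrow>
    (\<forall>x. prob_space (P x) \<and> space (P x) = \<Omega>) \<and>
    (\<forall>x y. sets (P x) = sets (P y)) \<and>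
    (\<forall>t\<ge>0. \<forall>x. subalgebra (P x) (F t)) \<and>
    (\<forall>s t. 0 \<le> s \<longrightarrow> s \<le> t \<longrightarrow> subalgebra (F t) (F s)) \<and>
    (\<forall>t\<ge>0. X t \<in> F t \<rightarrow>\<^sub>M borel) \<and>
    (\<forall>t\<ge>0. \<forall>B\<in>sets borel. (\<lambda>x. p t x B) \<in> borel_measurable borel) \<and>
    (\<forall>t\<ge>0. \<forall>x. \<forall>B\<in>sets borel. measure (P x) {\<omega>\<in>\<Omega>. X t \<omega> \<in> B} = p t x B) \<and>
    (\<forall>x. measure (P x) {\<omega>\<in>\<Omega>. X 0 \<omega> = x} = 1) \<and>
    (\<forall>s\<ge>0. \<forall>t\<ge>0. \<forall>x. \<forall>B\<in>sets borel. AE \<omega> in P x.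
       real_cond_exp (P x) (F s) (\<lambda>\<omega>. indicat_real B (X (s + t) \<omega>)) \<omega> = p t (X s \<omega>) B) \<and>
    (\<forall>t\<ge>0. \<forall>\<omega>\<in>\<Omega>. \<exists>\<omega>'\<in>\<Omega>. \<forall>h\<ge>0. X h \<omega>' = X (t + h) \<omega>)"

definition bounded_trajectory :: "(real \<Rightarrow> 'a::topological_space) \<Rightarrow> bool"
  where "bounded_trajectory w \<longleftrightarrow> (\<forall>T\<ge>0. compact (closure (w ` {0..T})))"

definition right_continuous_trajectory :: "(real \<Rightarrow> 'a::topological_space) \<Rightarrow> bool"
  where "right_continuous_trajectory w \<longleftrightarrow> (\<forall>t\<ge>0. continuous (at_right t) w)"

definition only_jumps_trajectory :: "(real \<Rightarrow> 'a::topological_space) \<Rightarrow> bool"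
  where "only_jumps_trajectory w \<longleftrightarrow> (\<forall>t>0. \<exists>l. (w \<longlongrightarrow> l) (at_left t))"

text \<open>Taking real parts loses nothing, as the heat kernel is shown to have values in \<open>[0,\<infinity>)\<close>.\<close>

definition heat_transition :: "(nat \<Rightarrow> nat) \<Rightarrow> fadele measure \<Rightarrow> real \<Rightarrow> real \<Rightarrow> real \<Rightarrow> adele \<Rightarrow> adele set \<Rightarrow> real"
  where "heat_transition E \<mu> \<alpha> \<beta> t x B = (if t = 0 then indicat_real B x 
     else LINT y:B|adele_measure \<mu>. Re (heat_kernel E \<mu> \<alpha> \<beta> (x - y) t))"

end

theory Submission
  imports Defs "HOL-Real_Asymp.Real_Asymp"
begin

text \<open>
  The Fourier transform turns everything into statements about the multiplier
  \<open>exp (- t (\<parallel>\<xi>\<^sub>f\<parallel>\<^sup>\<alpha> + |\<xi>\<^sub>\<infinity>|\<^sup>\<beta>))\<close>, of which the heat kernel \<open>Z\<^sub>t\<close> is the inverse transform.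

  \<^bold>\<open>Fourier theory.\<close> The functions \<open>theta\<close>, a Gaussian in the real component times the indicator of an
  ideal in the finite one, have an explicit transform (\<open>FT_theta\<close>), and a sequence of them increases to
  \<open>1\<close> while the transforms form an approximate identity. Integrating the square of a transform
  against them gives Plancherel's theorem, and with it a unitary transform on \<open>L\<^sup>2\<close>. The multiplication
  formula \<open>\<integral> (F f) g = \<integral> f (F g)\<close> then identifies the inverse (\<open>isF_inverse\<close>).

  \<^bold>\<open>The kernel.\<close> It is nonnegative as the product of two nonnegative kernels. On the finite adeles a
  radially decreasing function is a mixture of indicators of subgroups (\<open>FT_exp_normf_nonneg\<close>). On the
  reals \<open>exp (- t |s|\<^sup>\<beta>)\<close>, for \<open>\<beta> \<le> 2\<close>, is a limit of mixtures of Gaussians (\<open>nonneg_FT_stable\<close>). Being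
  nonnegative, the kernel can be tested against the \<open>theta\<close>s: its mass is \<open>1\<close>, and the mass outside a
  neighbourhood of \<open>0\<close> is at most linear in \<open>t\<close> (\<open>heat_tail\<close>).

  \<^bold>\<open>The Cauchy problem.\<close> The convolution of \<open>f\<close> with \<open>Z\<^sub>t\<close> has the transform \<open>exp (- t symb) F\<close>, where \<open>F\<close>
  is the transform of \<open>f\<close>. By Plancherel's theorem, differentiability in \<open>t\<close> and the equation follow from
  dominated convergence, since \<open>symb F\<close> is square integrable exactly for \<open>f\<close> in the domain.

  \<^bold>\<open>The process.\<close> The measures \<open>Z\<^sub>t dx\<close> form a convolution semigroup. Kolmogorov's extension theorem gives
  a process \<open>w\<close> with independent increments distributed by it, indexed by the dyadic times only. If
  \<open>\<rho>\<close> is a subadditive gauge on the adeles with \<open>P (\<rho> \<ge> l) \<le> C t l\<^sup>-\<^sup>\<kappa>\<close> for increments over a time \<open>t\<close>, then two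
  consecutive increments over times \<open>2\<^sup>-\<^sup>j\<close> are both at least \<open>l\<close> with probability at most
  \<open>(C 2\<^sup>-\<^sup>j l\<^sup>-\<^sup>\<kappa>)\<^sup>2\<close>. With \<open>l\<close> decreasing geometrically in \<open>j\<close>, slowly enough, this beats the number of
  pairs, and by the Borel-Cantelli lemma almost surely one increment of each pair is small for all large
  \<open>j\<close>. A chaining argument turns this into the statement that of three nearby dyadic times two
  neighbours have nearby values, which yields left and right limits at all real times
  (\<open>AE_regulated\<close>). The right limits define a right continuous process with left limits, started at \<open>x\<close>
  by translation. Its increments are limits of dyadic ones, so that independence of the past is
  inherited (\<open>increment_independent\<close>) and gives the Markov property. A path that is right continuous with
  left limits is bounded on compact time intervals.\<close>


section \<open>The canonical character\<close>

lemma in_ideal_1_of_rat: "in_ideal 1 (fadele_of_rat q) \<longleftrightarrow> q \<in> \<int>"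
  by (auto simp: in_ideal_of_rat zmul_def Ints_def)

lemma exp_psi_0: "adelic_sequence E \<Longrightarrow> exp_psi E 0 = 1"
  by (simp add: exp_psi_def adelic_sequence_def)

lemma exp_psi_minus: "adelic_sequence E \<Longrightarrow> exp_psi E (- n) = 1 / exp_psi E n"
  by (auto simp: exp_psi_def adelic_sequence_def)

lemma frac_part_in_ideal:
  assumes E: "adelic_sequence E"
  shows "in_ideal 1 (x - fadele_of_rat (frac_part E x))"
proof (cases "x = 0")
  case True
  then show ?thesis by (simp add: frac_part_def in_ideal_0)
next
  case False
  show ?thesis
  proof (cases "ordf E x < 0")
    case True
    have "hensel_expansion E x (hensel_digits E x)"
      unfolding hensel_digits_def by (rule theI'[OF hensel_expansion_ex1[OF E False]])
    from hensel_partial_sum[OF E this, of "-1"] show ?thesis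
      using True False by (simp add: frac_part_def exp_psi_0[OF E])
  next
    case ge: False
    then have "in_ideal (exp_psi E 0) x" using ordf_iff[OF E \<open>x \<noteq> 0\<close>] by simp
    then show ?thesis using ge by (simp add: frac_part_def exp_psi_0[OF E])
  qed
qed

lemma complex_of_real_of_rat: "complex_of_real (of_rat q) = of_rat q"
  by (cases q) (simp add: of_rat_rat)

lemma exp_2pi_rat_eq_1_iff: "exp (2 * of_real pi * \<i> * of_rat q) = (1::complex) \<longleftrightarrow> q \<in> \<int>"
proof
  assume "exp (2 * of_real pi * \<i> * of_rat q) = (1::complex)"
  then obtain n :: int where "2 * complex_of_real pi * of_rat q = of_int (2 * n) * pi"
    by (auto simp: exp_eq_1 mult_ac simp flip: complex_of_real_of_rat)
  then have "(of_rat q :: complex) = of_rat (of_int n)" by simp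
  then show "q \<in> \<int>" by (simp only: of_rat_eq_iff) auto
next
  assume "q \<in> \<int>"
  then obtain n :: int where "q = of_int n" by (auto elim: Ints_cases)
  then have "exp (2 * of_real pi * \<i> * of_rat q) = (exp (of_int (2 * n) * (of_real pi * \<i>)) :: complex)"
    by (simp add: mult_ac)
  also have "\<dots> = 1" by (simp add: exp_eq_1)
  finally show "exp (2 * of_real pi * \<i> * of_rat q) = (1::complex)" .
qed

text \<open>The fractional part enters the character only modulo \<open>1\<close>, so that it may be replaced by any rational
  number that differs from \<open>x\<close> by an integral adele. This makes the character visibly additive.\<close>

lemma chi_f_eq:
  assumes E: "adelic_sequence E" and q: "in_ideal 1 (x - fadele_of_rat q)"
  shows "chi_f E x = exp (2 * of_real pi * \<i> * of_rat q)"
proof -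
  have "in_ideal 1 (fadele_of_rat (frac_part E x - q))"
    using in_ideal_diff[OF q frac_part_in_ideal[OF E, of x]] by (simp add: fadele_of_rat_diff)
  then have "exp (2 * of_real pi * \<i> * of_rat (frac_part E x - q)) = (1::complex)"
    by (simp only: exp_2pi_rat_eq_1_iff in_ideal_1_of_rat)
  then show ?thesis
    by (simp add: chi_f_def of_rat_diff right_diff_distrib exp_diff)
qed

lemma chi_f_add:
  assumes E: "adelic_sequence E" shows "chi_f E (x + y) = chi_f E x * chi_f E y"
proof -
  let ?p = "frac_part E x" and ?q = "frac_part E y"
  have "in_ideal 1 ((x + y) - fadele_of_rat (?p + ?q))"
    using in_ideal_add[OF frac_part_in_ideal[OF E, of x] frac_part_in_ideal[OF E, of y]]
    by (simp add: fadele_of_rat_add algebra_simps)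
  from chi_f_eq[OF E this] show ?thesis
    by (simp add: chi_f_def of_rat_add distrib_left exp_add)
qed

lemma chi_f_eq_1_iff:
  assumes E: "adelic_sequence E" shows "chi_f E x = 1 \<longleftrightarrow> in_ideal 1 x"
proof -
  have "chi_f E x = 1 \<longleftrightarrow> in_ideal 1 (fadele_of_rat (frac_part E x))"
    unfolding chi_f_def exp_2pi_rat_eq_1_iff in_ideal_1_of_rat ..
  also have "\<dots> \<longleftrightarrow> in_ideal 1 x"
    using in_ideal_add[OF frac_part_in_ideal[OF E, of x], of "fadele_of_rat (frac_part E x)"]
      in_ideal_diff[of 1 x, OF _ frac_part_in_ideal[OF E, of x]] by auto
  finally show ?thesis .
qed

lemma norm_chi_f: "cmod (chi_f E x) = 1"
proof -
  have "2 * of_real pi * \<i> * of_rat (frac_part E x) = \<i> * complex_of_real (2 * pi * of_rat (frac_part E x))"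
    by (simp add: complex_of_real_of_rat mult_ac)
  then show ?thesis unfolding chi_f_def by (simp only: norm_exp_i_times)
qed

lemma chi_f_minus:
  assumes E: "adelic_sequence E" shows "chi_f E (- x) = cnj (chi_f E x)"
proof -
  have "chi_f E x * chi_f E (- x) = 1"
    using chi_f_add[OF E, of x "- x"] chi_f_eq_1_iff[OF E, of 0] by (simp add: in_ideal_0)
  moreover have "chi_f E x * cnj (chi_f E x) = 1" by (simp add: complex_norm_square[symmetric] norm_chi_f)
  ultimately show ?thesis
    by (metis mult_cancel_left mult_zero_left zero_neq_one)
qed

text \<open>The character is locally constant: it is trivial on the open subgroup of integral elements.\<close>

lemma continuous_on_chi_f:
  assumes E: "adelic_sequence E" shows "continuous_on S (chi_f E)"
proof -
  have "(chi_f E \<longlongrightarrow> chi_f E x) (nhds x)" for x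
  proof (rule tendsto_eventually)
    have "chi_f E y = chi_f E x" if "in_ideal 1 (y - x)" for y
      using chi_f_add[OF E, of "y - x" x] that chi_f_eq_1_iff[OF E] by simp
    then show "\<forall>\<^sub>F y in nhds x. chi_f E y = chi_f E x"
      unfolding eventually_nhds_fadele by (intro exI[of _ 1]) auto
  qed
  then have "continuous (at x) (chi_f E)" for x
    by (simp add: continuous_at_imp_continuous_at_within isCont_def tendsto_at_iff_tendsto_nhds)
  then show ?thesis by (simp add: continuous_at_imp_continuous_on)
qed

lemma chi_inf_add: "chi_inf (x + y) = chi_inf x * chi_inf y"
  unfolding chi_inf_def by (simp add: distrib_left flip: exp_add)

lemma norm_chi_inf: "cmod (chi_inf x) = 1"
proof -
  have "- 2 * of_real pi * \<i> * of_real x = \<i> * complex_of_real (- 2 * pi * x)"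
    by (simp add: mult_ac)
  then show ?thesis unfolding chi_inf_def by (simp only: norm_exp_i_times)
qed

lemma chi_inf_minus: "chi_inf (- x) = cnj (chi_inf x)"
  by (simp add: chi_inf_def exp_cnj)

lemma norm_chi: "cmod (chi E x) = 1"
  by (simp add: chi_def norm_mult norm_chi_f norm_chi_inf)

lemma chi_add: "adelic_sequence E \<Longrightarrow> chi E (x + y) = chi E x * chi E y"
  by (simp add: chi_def chi_inf_add chi_f_add)

lemma chi_minus: "adelic_sequence E \<Longrightarrow> chi E (- x) = cnj (chi E x)"
  by (simp add: chi_def chi_inf_minus chi_f_minus)

lemma continuous_on_chi: "adelic_sequence E \<Longrightarrow> continuous_on S (chi E)"
  unfolding chi_def chi_inf_def
  by (intro continuous_intros continuous_on_compose2[OF continuous_on_chi_f]) auto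

lemma adele_mult_commute: "adele_mult x y = adele_mult y x"
  by (simp add: adele_mult_def mult.commute)

lemma adele_mult_distrib: "adele_mult x (y + z) = adele_mult x y + adele_mult x z"
  by (simp add: adele_mult_def distrib_left)

lemma adele_mult_minus: "adele_mult x (- y) = - adele_mult x y"
proof -
  have "adele_mult x y + adele_mult x (- y) = adele_mult x 0" by (simp flip: adele_mult_distrib)
  also have "\<dots> = 0" by (simp add: adele_mult_def zero_prod_def)
  finally show ?thesis by (simp add: eq_neg_iff_add_eq_0 add.commute)
qed

lemma adele_mult_0 [simp]: "adele_mult x 0 = 0" "adele_mult 0 x = 0"
  by (simp_all add: adele_mult_def zero_prod_def)

lemma chi_0 [simp]: "adelic_sequence E \<Longrightarrow> chi E 0 = 1"
  using chi_f_eq_1_iff[of E 0] by (simp add: chi_def chi_inf_def in_ideal_0)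

lemma continuous_on_adele_mult:
  "continuous_on S f \<Longrightarrow> continuous_on S g \<Longrightarrow> continuous_on S (\<lambda>x. adele_mult (f x) (g x))"
  unfolding adele_mult_def by (intro continuous_intros)


section \<open>The Haar measure of the finite adeles\<close>

definition ideal :: "rat \<Rightarrow> fadele set"
  where "ideal r = {x. in_ideal r x}"

lemma open_ideal: "open (ideal r)"
  using open_in_ideal[of r 0] by (simp add: ideal_def)

lemma ideal_borel [measurable]: "ideal r \<in> sets borel"
  using open_ideal by (rule borel_open)

lemma ideal_mono: "r \<in> zmul s \<Longrightarrow> s > 0 \<Longrightarrow> ideal r \<subseteq> ideal s"
  by (auto simp: ideal_def intro: in_ideal_trans)

lemma in_ideal_mult_unit_iff:
  assumes "q > 0" shows "in_ideal r (fadele_of_rat q * x) \<longleftrightarrow> in_ideal (r / q) x"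
proof
  assume "in_ideal r (fadele_of_rat q * x)"
  moreover have "in_ideal (1/q) (fadele_of_rat (1/q))" using assms by (simp add: in_ideal_of_rat)
  ultimately have "in_ideal (1/q * r) (fadele_of_rat (1/q) * (fadele_of_rat q * x))"
    by (intro in_ideal_mult)
  moreover have "fadele_of_rat (1/q) * (fadele_of_rat q * x) = x"
    using assms by (simp flip: mult.assoc fadele_of_rat_mult)
  ultimately show "in_ideal (r / q) x" by simp
next
  assume "in_ideal (r / q) x"
  from in_ideal_mult[OF _ this, of q "fadele_of_rat q"] assms
  show "in_ideal r (fadele_of_rat q * x)" by (simp add: in_ideal_of_rat)
qed

text \<open>Cosets of one subgroup have the same Haar measure. This decomposition therefore compares the measures
  of the ideals of \<open>r\<close> and \<open>N r\<close>.\<close>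

lemma ideal_cosets:
  assumes r: "r > 0" and N: "N > 0"
  shows "ideal r = (\<Union>k<N. {x. in_ideal (of_nat N * r) (x - fadele_of_rat (of_nat k * r))})"
    and "disjoint_family_on (\<lambda>k. {x. in_ideal (of_nat N * r) (x - fadele_of_rat (of_nat k * r))}) {..<N}"
proof -
  have pos: "of_nat N * r > 0" using r N by simp
  show "ideal r = (\<Union>k<N. {x. in_ideal (of_nat N * r) (x - fadele_of_rat (of_nat k * r))})"
  proof (intro equalityI subsetI)
    fix x assume "x \<in> ideal r"
    then have x: "in_ideal r x" by (simp add: ideal_def)
    obtain q where q: "in_ideal (of_nat N * r) (x - fadele_of_rat q)" using fadele_approx[OF pos] by blast
    have "in_ideal r (x - (x - fadele_of_rat q))"
      using x in_ideal_trans[OF q zmul_of_nat r] by (rule in_ideal_diff)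
    then obtain z where z: "q = of_int z * r" by (auto simp: in_ideal_of_rat zmul_def)
    define k where "k = nat (z mod int N)"
    have k: "k < N" "int k = z mod int N" using N by (auto simp: k_def nat_less_iff)
    have "of_int z = (of_int (z div int N * int N + int k) :: rat)" unfolding k by simp
    then have "q - of_nat k * r = of_int (z div int N) * (of_nat N * r)"
      unfolding z by (simp add: algebra_simps)
    then have "in_ideal (of_nat N * r) (fadele_of_rat (q - of_nat k * r))"
      using pos by (auto simp: in_ideal_of_rat zmul_def)
    from in_ideal_add[OF q this] have "in_ideal (of_nat N * r) (x - fadele_of_rat (of_nat k * r))"
      by (simp flip: fadele_of_rat_diff)
    then show "x \<in> (\<Union>k<N. {x. in_ideal (of_nat N * r) (x - fadele_of_rat (of_nat k * r))})"
      using k by blast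
  next
    fix x assume "x \<in> (\<Union>k<N. {x. in_ideal (of_nat N * r) (x - fadele_of_rat (of_nat k * r))})"
    then obtain k where k: "in_ideal (of_nat N * r) (x - fadele_of_rat (of_nat k * r))" by auto
    have "in_ideal r (x - fadele_of_rat (of_nat k * r) + fadele_of_rat (of_nat k * r))"
      by (intro in_ideal_add in_ideal_trans[OF k zmul_of_nat r]) (simp add: in_ideal_of_rat r zmul_of_nat)
    then show "x \<in> ideal r" by (simp add: ideal_def)
  qed
  show "disjoint_family_on (\<lambda>k. {x. in_ideal (of_nat N * r) (x - fadele_of_rat (of_nat k * r))}) {..<N}"
    unfolding disjoint_family_on_def
  proof (intro ballI impI, rule ccontr)
    fix j k assume jk: "j \<in> {..<N}" "k \<in> {..<N}" "j \<noteq> k"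
      and "{x. in_ideal (of_nat N * r) (x - fadele_of_rat (of_nat j * r))} \<inter>
           {x. in_ideal (of_nat N * r) (x - fadele_of_rat (of_nat k * r))} \<noteq> {}"
    then obtain x where "in_ideal (of_nat N * r) (x - fadele_of_rat (of_nat j * r))"
      "in_ideal (of_nat N * r) (x - fadele_of_rat (of_nat k * r))" by blast
    from in_ideal_diff[OF this] have "in_ideal (of_nat N * r) (fadele_of_rat (of_nat k * r - of_nat j * r))"
      by (simp flip: fadele_of_rat_diff)
    then obtain z where "of_nat k * r - of_nat j * r = of_int z * (of_nat N * r)"
      by (auto simp: in_ideal_of_rat zmul_def)
    then have "(of_nat k - of_nat j) * r = (of_int z * of_nat N) * r" by (simp add: algebra_simps)
    then have "(of_nat k - of_nat j :: rat) = of_int z * of_nat N" using r by simp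
    then have "of_int (int k - int j) = (of_int (z * int N) :: rat)" by simp
    then have eq: "int k - int j = z * int N" by (simp only: of_int_eq_iff)
    moreover have "\<bar>int k - int j\<bar> < int N" using jk by auto
    ultimately have "\<bar>z\<bar> * int N < 1 * int N" by (simp add: abs_mult)
    then have "z = 0" using N by (simp only: mult_less_cancel_right) auto
    then show False using eq jk by simp
  qed
qed

locale adelic_haar =
  fixes E :: "nat \<Rightarrow> nat" and \<mu> :: "fadele measure"
  assumes E: "adelic_sequence E" and haar: "haar_measure \<mu>"
    and normalized: "emeasure \<mu> (Zhat E) = 1"
begin

lemma sets_\<mu> [measurable_cong, simp]: "sets \<mu> = sets borel"
  using haar by (simp add: haar_measure_def)

lemma space_\<mu> [simp]: "space \<mu> = UNIV"
  using sets_eq_imp_space_eq[OF sets_\<mu>] by simp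

lemma distr_translate: "distr \<mu> borel (\<lambda>x. a + x) = \<mu>"
  using haar by (simp add: haar_measure_def)

lemma emeasure_translate:
  assumes A: "A \<in> sets borel" shows "emeasure \<mu> {x. x - a \<in> A} = emeasure \<mu> A"
proof -
  have "(\<lambda>x. - a + x) -` A = {x. x - a \<in> A}" by (auto simp: algebra_simps)
  moreover have "(\<lambda>x. - a + x) \<in> \<mu> \<rightarrow>\<^sub>M borel" by measurable
  ultimately show ?thesis
    using A emeasure_distr[of "\<lambda>x. - a + x" \<mu> borel A] distr_translate[of "- a"] by simp
qed

lemma emeasure_ideal_mult:
  assumes "r > 0" "N > 0"
  shows "emeasure \<mu> (ideal r) = of_nat N * emeasure \<mu> (ideal (of_nat N * r))"
proof -
  let ?C = "\<lambda>k. {x. in_ideal (of_nat N * r) (x - fadele_of_rat (of_nat k * r))}"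
  have C: "?C k = {x. x - fadele_of_rat (of_nat k * r) \<in> ideal (of_nat N * r)}" for k
    by (simp add: ideal_def)
  have "emeasure \<mu> (ideal r) = (\<Sum>k<N. emeasure \<mu> (?C k))"
    unfolding ideal_cosets(1)[OF assms]
    by (intro sum_emeasure[symmetric] ideal_cosets(2)[OF assms])
       (auto intro!: borel_open open_in_ideal)
  also have "\<dots> = (\<Sum>k<N. emeasure \<mu> (ideal (of_nat N * r)))"
    unfolding C by (intro sum.cong emeasure_translate) auto
  finally show ?thesis by simp
qed

text \<open>For \<open>r = p / q\<close> the ideal of \<open>1 / q\<close> is the union of \<open>q\<close> cosets of the ideal of \<open>1\<close>, which has
  measure \<open>1\<close>, and of \<open>p\<close> cosets of the ideal of \<open>r\<close>.\<close>

lemma emeasure_ideal: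
  assumes r: "r > 0" shows "emeasure \<mu> (ideal r) = ennreal (1 / of_rat r)"
proof -
  obtain p q where pq: "r = of_int p / of_int q" "q > 0" by (metis Fract_of_int_quotient Rat_cases)
  have p: "p > 0" using pq r by (simp add: zero_less_divide_iff)
  have "ideal 1 = Zhat E"
    using normf_le_iff[OF E, of _ 0] exp_psi_0[OF E] by (simp add: ideal_def Zhat_def)
  then have 1: "emeasure \<mu> (ideal 1) = 1" using normalized by simp
  have 2: "emeasure \<mu> (ideal (1 / of_int q)) = of_nat (nat q)"
    using emeasure_ideal_mult[of "1 / of_int q" "nat q"] pq 1 by simp
  have "emeasure \<mu> (ideal (1 / of_int q)) = of_nat (nat p) * emeasure \<mu> (ideal r)"
    using emeasure_ideal_mult[of "1 / of_int q" "nat p"] pq p by simp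
  then have 3: "of_nat (nat p) * emeasure \<mu> (ideal r) = of_nat (nat q)" using 2 by simp
  then have "emeasure \<mu> (ideal r) \<noteq> \<infinity>" using p by (auto simp: ennreal_mult_top)
  then obtain x where x: "emeasure \<mu> (ideal r) = ennreal x" "x \<ge> 0"
    by (cases "emeasure \<mu> (ideal r)") auto
  from 3 have "ennreal (real (nat p) * x) = ennreal (real (nat q))"
    using x by (simp add: ennreal_mult ennreal_of_nat_eq_real_of_nat)
  then have "of_int p * x = of_int q" using x p pq by (subst (asm) ennreal_inj) auto
  moreover have "of_rat r = (of_int p / of_int q :: real)" using pq by (simp add: of_rat_divide)
  moreover have "x = of_int q / of_int p" using p \<open>of_int p * x = of_int q\<close> by (simp add: field_simps)
  ultimately have "x = 1 / of_rat r" by simp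
  with x show ?thesis by simp
qed

lemma measure_ideal: "r > 0 \<Longrightarrow> measure \<mu> (ideal r) = 1 / of_rat r"
  by (simp add: measure_def emeasure_ideal)

lemma ideal_exhausts: "(\<Union>n. ideal (exp_psi E (- int n))) = UNIV"
proof -
  have "\<exists>n. in_ideal (exp_psi E (- int n)) x" for x
  proof (cases "x = 0")
    case False
    then show ?thesis using ordf_iff[OF E, of x]
      by (intro exI[of _ "nat (- ordf E x)"]) auto
  qed (simp add: in_ideal_0 exp_psi_pos[OF E])
  then show ?thesis by (auto simp: ideal_def)
qed

lemma sigma_finite_\<mu>: "sigma_finite_measure \<mu>"
proof (rule sigma_finite_measure.intro, rule exI, intro conjI ballI)
  let ?A = "range (\<lambda>n. ideal (exp_psi E (- int n)))"
  show "countable ?A" "?A \<subseteq> sets \<mu>" "\<Union>?A = space \<mu>" using ideal_exhausts by auto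
  fix a assume "a \<in> ?A"
  then show "emeasure \<mu> a \<noteq> \<infinity>" using emeasure_ideal[OF exp_psi_pos[OF E]] by auto
qed

end

section \<open>Square integrable functions\<close>

lemma L2_measurable [measurable_dest]: "f \<in> L2 M \<Longrightarrow> f \<in> borel_measurable M"
  by (simp add: L2_def)

lemma L2_integrable_square: "f \<in> L2 M \<Longrightarrow> integrable M (\<lambda>x. (cmod (f x))\<^sup>2)"
  by (simp add: L2_def)

lemma L2_I: "f \<in> borel_measurable M \<Longrightarrow> integrable M (\<lambda>x. (cmod (f x))\<^sup>2) \<Longrightarrow> f \<in> L2 M"
  by (simp add: L2_def)

lemma L2_bound:
  assumes g: "integrable M g" and [measurable]: "f \<in> borel_measurable M"
    and "AE x in M. (cmod (f x))\<^sup>2 \<le> g x"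
  shows "f \<in> L2 M"
  by (intro L2_I Bochner_Integration.integrable_bound[OF g]) (use assms(3) in auto)

lemma L2_cmult: "f \<in> L2 M \<Longrightarrow> (\<lambda>x. c * f x) \<in> L2 M"
  unfolding L2_def by (auto simp: norm_mult power_mult_distrib)

lemma borel_measurable_cnj [measurable (raw)]:
  "f \<in> borel_measurable M \<Longrightarrow> (\<lambda>x. cnj (f x)) \<in> borel_measurable M"
  by (rule borel_measurable_continuous_on[OF continuous_on_cnj[OF continuous_on_id]])

lemma L2_cnj: "f \<in> L2 M \<Longrightarrow> (\<lambda>x. cnj (f x)) \<in> L2 M"
  unfolding L2_def by (auto intro: borel_measurable_cnj)

lemma square_norm_add_le: "(cmod (a + b))\<^sup>2 \<le> 2 * (cmod a)\<^sup>2 + 2 * (cmod b)\<^sup>2"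
proof -
  have "(cmod (a + b))\<^sup>2 \<le> (cmod a + cmod b)\<^sup>2" by (intro power_mono norm_triangle_ineq) auto
  also have "\<dots> \<le> (cmod a + cmod b)\<^sup>2 + (cmod a - cmod b)\<^sup>2" by simp
  also have "\<dots> = 2 * (cmod a)\<^sup>2 + 2 * (cmod b)\<^sup>2" by (simp add: power2_eq_square algebra_simps)
  finally show ?thesis .
qed

lemma L2_add:
  assumes [measurable]: "f \<in> L2 M" "g \<in> L2 M" shows "(\<lambda>x. f x + g x) \<in> L2 M"
  by (rule L2_bound[of _ "\<lambda>x. 2 * (cmod (f x))\<^sup>2 + 2 * (cmod (g x))\<^sup>2"])
     (auto intro!: square_norm_add_le L2_integrable_square assms)

lemma L2_diff: "f \<in> L2 M \<Longrightarrow> g \<in> L2 M \<Longrightarrow> (\<lambda>x. f x - g x) \<in> L2 M"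
  using L2_add[of f M "\<lambda>x. - 1 * g x"] L2_cmult[of g M "- 1"] by simp

lemma L2_integrable_mult:
  assumes [measurable]: "f \<in> L2 M" "g \<in> L2 M" shows "integrable M (\<lambda>x. f x * g x)"
proof (rule Bochner_Integration.integrable_bound)
  show "integrable M (\<lambda>x. (cmod (f x))\<^sup>2 + (cmod (g x))\<^sup>2)" by (intro Bochner_Integration.integrable_add L2_integrable_square assms)
  have "cmod a * cmod b \<le> (cmod a)\<^sup>2 + (cmod b)\<^sup>2" for a b
    using sum_squares_bound[of "cmod a" "cmod b"] mult_nonneg_nonneg[OF norm_ge_zero norm_ge_zero, of a b] by linarith
  then show "AE x in M. norm (f x * g x) \<le> norm ((cmod (f x))\<^sup>2 + (cmod (g x))\<^sup>2)"
    by (auto simp: norm_mult)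
qed measurable

lemma L2_norm_nonneg [simp]: "L2_norm M f \<ge> 0"
  by (simp add: L2_norm_def)

lemma L2_norm_square: "(L2_norm M f)\<^sup>2 = (\<integral>x. (cmod (f x))\<^sup>2 \<partial>M)"
  by (simp add: L2_norm_def)

lemma nn_integral_L2: "f \<in> L2 M \<Longrightarrow> (\<integral>\<^sup>+x. ennreal ((cmod (f x))\<^sup>2) \<partial>M) = ennreal ((L2_norm M f)\<^sup>2)"
  unfolding L2_norm_square by (intro nn_integral_eq_integral L2_integrable_square) auto

lemma L2_Cauchy_Schwarz:
  assumes [measurable]: "f \<in> L2 M" "g \<in> L2 M"
  shows "(\<integral>x. cmod (f x) * cmod (g x) \<partial>M) \<le> L2_norm M f * L2_norm M g"
    and "cmod (\<integral>x. f x * g x \<partial>M) \<le> L2_norm M f * L2_norm M g"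
proof -
  have int: "integrable M (\<lambda>x. cmod (f x) * cmod (g x))"
    using integrable_norm[OF L2_integrable_mult[OF assms]] by (simp add: norm_mult)
  let ?c = "\<integral>x. cmod (f x) * cmod (g x) \<partial>M"
  have c: "?c \<ge> 0" by simp
  have "(\<integral>\<^sup>+x. ennreal (cmod (f x)) * ennreal (cmod (g x)) \<partial>M)\<^sup>2 \<le>
      (\<integral>\<^sup>+x. (ennreal (cmod (f x)))\<^sup>2 \<partial>M) * (\<integral>\<^sup>+x. (ennreal (cmod (g x)))\<^sup>2 \<partial>M)"
    by (intro Cauchy_Schwarz_nn_integral) auto
  also have "\<dots> = ennreal ((L2_norm M f)\<^sup>2 * (L2_norm M g)\<^sup>2)"
    by (simp add: ennreal_power nn_integral_L2 assms ennreal_mult)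
  also have "(\<integral>\<^sup>+x. ennreal (cmod (f x)) * ennreal (cmod (g x)) \<partial>M) = ennreal ?c"
    using nn_integral_eq_integral[OF int] by (simp add: ennreal_mult)
  finally have "?c\<^sup>2 \<le> (L2_norm M f * L2_norm M g)\<^sup>2"
    using c by (simp add: ennreal_power power_mult_distrib)
  then show 1: "?c \<le> L2_norm M f * L2_norm M g" by (rule power2_le_imp_le) simp
  have "cmod (\<integral>x. f x * g x \<partial>M) \<le> (\<integral>x. cmod (f x * g x) \<partial>M)" by (rule integral_norm_bound)
  with 1 show "cmod (\<integral>x. f x * g x \<partial>M) \<le> L2_norm M f * L2_norm M g" by (simp add: norm_mult)
qed

lemma L2_norm_triangle:
  assumes [measurable]: "f \<in> L2 M" "g \<in> L2 M"
  shows "L2_norm M (\<lambda>x. f x + g x) \<le> L2_norm M f + L2_norm M g"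
proof (rule power2_le_imp_le)
  have int: "integrable M (\<lambda>x. cmod (f x) * cmod (g x))"
    using integrable_norm[OF L2_integrable_mult[OF assms]] by (simp add: norm_mult)
  note sq = L2_integrable_square[OF assms(1)] L2_integrable_square[OF assms(2)]
  have "(L2_norm M (\<lambda>x. f x + g x))\<^sup>2 \<le>
      (\<integral>x. (cmod (f x))\<^sup>2 + (2 * (cmod (f x) * cmod (g x)) + (cmod (g x))\<^sup>2) \<partial>M)"
    unfolding L2_norm_square
  proof (intro integral_mono L2_integrable_square L2_add assms Bochner_Integration.integrable_add sq
      Bochner_Integration.integrable_mult_right int)
    fix x
    have "(cmod (f x + g x))\<^sup>2 \<le> (cmod (f x) + cmod (g x))\<^sup>2" by (intro power_mono norm_triangle_ineq) auto
    then show "(cmod (f x + g x))\<^sup>2 \<le> (cmod (f x))\<^sup>2 + (2 * (cmod (f x) * cmod (g x)) + (cmod (g x))\<^sup>2)"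
      by (simp add: power2_eq_square algebra_simps)
  qed
  also have "\<dots> = (L2_norm M f)\<^sup>2 + 2 * (\<integral>x. cmod (f x) * cmod (g x) \<partial>M) + (L2_norm M g)\<^sup>2"
    unfolding L2_norm_square using sq int by simp
  also have "\<dots> \<le> (L2_norm M f + L2_norm M g)\<^sup>2"
    using L2_Cauchy_Schwarz(1)[OF assms] by (simp add: power2_eq_square algebra_simps)
  finally show "(L2_norm M (\<lambda>x. f x + g x))\<^sup>2 \<le> (L2_norm M f + L2_norm M g)\<^sup>2" .
qed simp

lemma L2_norm_cmult: "L2_norm M (\<lambda>x. c * f x) = cmod c * L2_norm M f"
  by (simp add: L2_norm_def norm_mult power_mult_distrib real_sqrt_mult)

lemma L2_norm_cnj [simp]: "L2_norm M (\<lambda>x. cnj (f x)) = L2_norm M f"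
  by (simp add: L2_norm_def)

lemma L2_norm_commute: "L2_norm M (\<lambda>x. f x - g x) = L2_norm M (\<lambda>x. g x - f x)"
  by (simp add: L2_norm_def norm_minus_commute)

lemma L2_norm_triangle_diff:
  assumes "f \<in> L2 M" "g \<in> L2 M" "h \<in> L2 M"
  shows "L2_norm M (\<lambda>x. f x - h x) \<le> L2_norm M (\<lambda>x. f x - g x) + L2_norm M (\<lambda>x. g x - h x)"
  using L2_norm_triangle[OF L2_diff[OF assms(1,2)] L2_diff[OF assms(2,3)]] by simp

lemma L2_norm_diff_le:
  assumes "f \<in> L2 M" "g \<in> L2 M"
  shows "\<bar>L2_norm M f - L2_norm M g\<bar> \<le> L2_norm M (\<lambda>x. f x - g x)"
  using L2_norm_triangle[OF L2_diff[OF assms] assms(2)]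
    L2_norm_triangle[OF L2_diff[OF assms(2,1)] assms(1)] L2_norm_commute[of M f g] by simp

lemma L2_norm_cong_AE: "(AE x in M. f x = g x) \<Longrightarrow> f \<in> borel_measurable M \<Longrightarrow> g \<in> borel_measurable M \<Longrightarrow> L2_norm M f = L2_norm M g"
  unfolding L2_norm_def by (intro arg_cong[of _ _ sqrt] integral_cong_AE) auto

lemma L2_norm_eq_0_iff:
  assumes "f \<in> L2 M" shows "L2_norm M f = 0 \<longleftrightarrow> (AE x in M. f x = 0)"
  using integral_nonneg_eq_0_iff_AE[OF L2_integrable_square[OF assms]] by (simp add: L2_norm_def)

lemma L2_cong_AE:
  assumes "f \<in> L2 M" "g \<in> borel_measurable M" "AE x in M. f x = g x" shows "g \<in> L2 M"
  by (rule L2_bound[OF L2_integrable_square[OF assms(1)] assms(2)]) (use assms(3) in auto)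

lemma tendsto_L2_norm:
  assumes "\<And>n. s n \<in> L2 M" "f \<in> L2 M" "((\<lambda>n. L2_norm M (\<lambda>x. s n x - f x)) \<longlongrightarrow> 0) F"
  shows "((\<lambda>n. L2_norm M (s n)) \<longlongrightarrow> L2_norm M f) F"
proof (rule Lim_transform2[OF tendsto_const])
  show "((\<lambda>n. L2_norm M f - L2_norm M (s n)) \<longlongrightarrow> 0) F"
    by (rule Lim_null_comparison[OF _ assms(3)])
       (use L2_norm_diff_le[OF assms(2,1)] in \<open>auto simp: L2_norm_commute[of M f]\<close>)
qed

lemma tendsto_L2_inner:
  assumes s: "\<And>n. s n \<in> L2 M" "f \<in> L2 M" "((\<lambda>n. L2_norm M (\<lambda>x. s n x - f x)) \<longlongrightarrow> 0) F"
    and t: "\<And>n. t n \<in> L2 M" "g \<in> L2 M" "((\<lambda>n. L2_norm M (\<lambda>x. t n x - g x)) \<longlongrightarrow> 0) F"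
  shows "((\<lambda>n. \<integral>x. s n x * t n x \<partial>M) \<longlongrightarrow> (\<integral>x. f x * g x \<partial>M)) F"
proof (rule Lim_transform2[OF tendsto_const])
  have lim: "((\<lambda>n. L2_norm M (\<lambda>x. s n x - f x) * L2_norm M (t n) + L2_norm M f * L2_norm M (\<lambda>x. t n x - g x)) \<longlongrightarrow>
      0 * L2_norm M g + L2_norm M f * 0) F"
    by (intro tendsto_intros s t tendsto_L2_norm)
  show "((\<lambda>n. (\<integral>x. f x * g x \<partial>M) - (\<integral>x. s n x * t n x \<partial>M)) \<longlongrightarrow> 0) F"
  proof (rule Lim_null_comparison[OF always_eventually])
    show "\<forall>n. norm ((\<integral>x. f x * g x \<partial>M) - (\<integral>x. s n x * t n x \<partial>M)) \<le>
        L2_norm M (\<lambda>x. s n x - f x) * L2_norm M (t n) + L2_norm M f * L2_norm M (\<lambda>x. t n x - g x)"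
    proof
      fix n
      have "(\<integral>x. s n x * t n x \<partial>M) - (\<integral>x. f x * g x \<partial>M) =
          (\<integral>x. (s n x - f x) * t n x + f x * (t n x - g x) \<partial>M)"
        by (subst Bochner_Integration.integral_diff[symmetric])
           (auto intro!: L2_integrable_mult s t simp: algebra_simps)
      also have "\<dots> = (\<integral>x. (s n x - f x) * t n x \<partial>M) + (\<integral>x. f x * (t n x - g x) \<partial>M)"
        by (intro Bochner_Integration.integral_add L2_integrable_mult L2_diff s t)
      also have "cmod \<dots> \<le> L2_norm M (\<lambda>x. s n x - f x) * L2_norm M (t n) + L2_norm M f * L2_norm M (\<lambda>x. t n x - g x)"
        by (intro norm_triangle_le add_mono L2_Cauchy_Schwarz L2_diff s t)
      finally show "norm ((\<integral>x. f x * g x \<partial>M) - (\<integral>x. s n x * t n x \<partial>M)) \<le>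
        L2_norm M (\<lambda>x. s n x - f x) * L2_norm M (t n) + L2_norm M f * L2_norm M (\<lambda>x. t n x - g x)"
        by (simp only: norm_minus_commute)
    qed
  qed (use lim in simp)
qed

lemma ennreal_suminf_bounded:
  assumes "(\<Sum>k. ennreal (a k)) \<noteq> \<infinity>" shows "\<exists>C. \<forall>k. a k \<le> C"
proof -
  obtain C where C: "(\<Sum>k. ennreal (a k)) = ennreal C" "C \<ge> 0"
    using assms by (cases "\<Sum>k. ennreal (a k)") auto
  have "ennreal (a k) \<le> ennreal C" for k
    using sum_le_suminf[OF summableI, of "{k}" "\<lambda>k. ennreal (a k)"] C by simp
  then show ?thesis using C(2) by (auto simp: ennreal_le_iff)
qed

text \<open>Along a subsequence with \<open>\<parallel>s (r (k+1)) - s (r k)\<parallel> < 2\<^sup>-\<^sup>k\<close> the sum of \<open>2\<^sup>k |s (r (k+1)) - s (r k)|\<^sup>2\<close>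
  is integrable, hence finite almost everywhere, and the subsequence converges almost everywhere. By
  Fatou's lemma its limit is the limit in the mean.\<close>

lemma L2_complete:
  assumes s: "\<And>n. s n \<in> L2 M"
    and cauchy: "\<And>e. e > 0 \<Longrightarrow> \<exists>N. \<forall>m\<ge>N. \<forall>n\<ge>N. L2_norm M (\<lambda>x. s m x - s n x) < e"
  shows "\<exists>f\<in>L2 M. (\<lambda>n. L2_norm M (\<lambda>x. s n x - f x)) \<longlonglongrightarrow> 0"
proof -
  have [measurable]: "s n \<in> borel_measurable M" for n using s by (rule L2_measurable)
  have "\<forall>k. \<exists>N. \<forall>m\<ge>N. \<forall>n\<ge>N. L2_norm M (\<lambda>x. s m x - s n x) < (1/2)^k"
    using cauchy by simp
  then obtain N where N: "\<And>k m n. m \<ge> N k \<Longrightarrow> n \<ge> N k \<Longrightarrow> L2_norm M (\<lambda>x. s m x - s n x) < (1/2)^k"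
    by metis
  define r where "r k = Max (N ` {..k})" for k
  have r: "N k \<le> r k" "r k \<le> r (Suc k)" for k
    unfolding r_def by (auto intro!: Max_mono)
  have d: "L2_norm M (\<lambda>x. s (r (Suc k)) x - s (r k) x) \<le> (1/2)^k" for k
    using N[of k "r (Suc k)" "r k"] r[of k] by simp
  define f where "f x = lim (\<lambda>k. s (r k) x)" for x
  have [measurable]: "f \<in> borel_measurable M" unfolding f_def by measurable
  let ?d = "\<lambda>k x. (cmod (s (r (Suc k)) x - s (r k) x))\<^sup>2"
  have "(\<integral>\<^sup>+x. (\<Sum>k. ennreal (2^k * ?d k x)) \<partial>M) = (\<Sum>k. \<integral>\<^sup>+x. ennreal (2^k * ?d k x) \<partial>M)"
    by (intro nn_integral_suminf) auto
  also have "\<dots> \<le> (\<Sum>k. ennreal ((1/2)^k))"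
  proof (intro suminf_le summableI)
    fix k
    have "(\<integral>\<^sup>+x. ennreal (2^k * ?d k x) \<partial>M) = ennreal (2^k) * (\<integral>\<^sup>+x. ennreal (?d k x) \<partial>M)"
      by (subst nn_integral_cmult[symmetric]) (auto simp: ennreal_mult)
    also have "\<dots> = ennreal (2^k * (L2_norm M (\<lambda>x. s (r (Suc k)) x - s (r k) x))\<^sup>2)"
      by (simp add: nn_integral_L2 L2_diff s ennreal_mult)
    also have "\<dots> \<le> ennreal (2^k * ((1/2)^k)\<^sup>2)"
      by (intro ennreal_leI mult_left_mono power_mono d) auto
    also have "(2^k * ((1/2)^k)\<^sup>2 :: real) = (1/2)^k"
      by (simp add: power2_eq_square power_divide)
    finally show "(\<integral>\<^sup>+x. ennreal (2^k * ?d k x) \<partial>M) \<le> ennreal ((1/2)^k)" .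
  qed
  also have "\<dots> = ennreal (\<Sum>k. (1/2)^k)" by (intro suminf_ennreal2) auto
  finally have "(\<integral>\<^sup>+x. (\<Sum>k. ennreal (2^k * ?d k x)) \<partial>M) \<noteq> \<infinity>" by (auto simp: top_unique)
  then have AE: "AE x in M. (\<Sum>k. ennreal (2^k * ?d k x)) \<noteq> \<infinity>"
    by (intro nn_integral_noteq_infinite) auto
  have conv: "AE x in M. (\<lambda>k. s (r k) x) \<longlonglongrightarrow> f x"
    using AE
  proof eventually_elim
    case (elim x)
    obtain C where C: "\<And>k. 2^k * ?d k x \<le> C" using ennreal_suminf_bounded[OF elim] by blast
    have le: "cmod (s (r (Suc k)) x - s (r k) x) \<le> sqrt C * (sqrt (1/2))^k" for k
    proof -
      have "?d k x \<le> C * (1/2)^k" using C[of k] by (simp add: field_simps)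
      then have "sqrt (?d k x) \<le> sqrt (C * (1/2)^k)" by (rule real_sqrt_le_mono)
      then show ?thesis by (simp add: real_sqrt_mult real_sqrt_power)
    qed
    have "summable (\<lambda>k. s (r (Suc k)) x - s (r k) x)"
      by (rule summable_comparison_test'[of "\<lambda>k. sqrt C * (sqrt (1/2))^k" 0])
         (auto intro!: summable_mult summable_geometric le)
    then have "convergent (\<lambda>n. \<Sum>k<n. s (r (Suc k)) x - s (r k) x)" by (simp add: summable_iff_convergent)
    then have "convergent (\<lambda>n. s (r 0) x + (s (r n) x - s (r 0) x))"
      by (intro convergent_add convergent_const) (simp only: sum_lessThan_telescope[of "\<lambda>k. s (r k) x"])
    then show ?case by (simp add: f_def convergent_LIMSEQ_iff)
  qed
  have bound: "(\<integral>\<^sup>+x. ennreal ((cmod (s m x - f x))\<^sup>2) \<partial>M) \<le> ennreal (((1/2)^j)\<^sup>2)" if m: "m \<ge> N j" for m j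
  proof -
    have "(\<integral>\<^sup>+x. ennreal ((cmod (s m x - f x))\<^sup>2) \<partial>M) =
        (\<integral>\<^sup>+x. liminf (\<lambda>k. ennreal ((cmod (s m x - s (r k) x))\<^sup>2)) \<partial>M)"
    proof (rule nn_integral_cong_AE, use conv in eventually_elim)
      case (elim x)
      then have "(\<lambda>k. ennreal ((cmod (s m x - s (r k) x))\<^sup>2)) \<longlonglongrightarrow> ennreal ((cmod (s m x - f x))\<^sup>2)"
        by (intro tendsto_intros)
      then show ?case by (rule lim_imp_Liminf[OF sequentially_bot, symmetric])
    qed
    also have "\<dots> \<le> liminf (\<lambda>k. \<integral>\<^sup>+x. ennreal ((cmod (s m x - s (r k) x))\<^sup>2) \<partial>M)"
      by (intro nn_integral_liminf) auto
    also have "\<dots> \<le> liminf (\<lambda>k::nat. ennreal (((1/2)^j)\<^sup>2))"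
    proof (intro Liminf_mono eventually_sequentiallyI)
      fix k assume "j \<le> k"
      then have "r k \<ge> r j" using r(2) by (rule lift_Suc_mono_le[rotated])
      then have "r k \<ge> N j" using r(1)[of j] by simp
      then have "L2_norm M (\<lambda>x. s m x - s (r k) x) \<le> (1/2)^j" using N[OF m, of "r k"] by simp
      then show "(\<integral>\<^sup>+x. ennreal ((cmod (s m x - s (r k) x))\<^sup>2) \<partial>M) \<le> ennreal (((1/2)^j)\<^sup>2)"
        by (simp add: nn_integral_L2 L2_diff s power_mono)
    qed
    finally show ?thesis by (simp add: Liminf_const)
  qed
  have L2d: "(\<lambda>x. s (N 0) x - f x) \<in> L2 M"
    using bound[of 0 "N 0"]
    by (intro L2_I integrableI_bounded) (auto simp: less_top[symmetric] top_unique)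
  have f: "f \<in> L2 M" using L2_diff[OF s[of "N 0"] L2d] by simp
  have norm: "L2_norm M (\<lambda>x. s m x - f x) \<le> (1/2)^j" if "m \<ge> N j" for m j
  proof (rule power2_le_imp_le)
    show "(L2_norm M (\<lambda>x. s m x - f x))\<^sup>2 \<le> ((1/2)^j)\<^sup>2"
      using bound[OF that] nn_integral_L2[OF L2_diff[OF s[of m] f]] by (simp add: ennreal_le_iff)
  qed simp
  have "(\<lambda>n. L2_norm M (\<lambda>x. s n x - f x)) \<longlonglongrightarrow> 0"
  proof (rule LIMSEQ_I)
    fix e :: real assume "e > 0"
    then obtain j where "(1/2)^j < e" using real_arch_pow_inv[of e "1/2"] by auto
    then show "\<exists>no. \<forall>n\<ge>no. norm (L2_norm M (\<lambda>x. s n x - f x) - 0) < e"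
      using norm[of j] by (intro exI[of _ "N j"]) (auto intro: order.strict_trans1)
  qed
  with f show ?thesis by blast
qed

lemma L2_approx_simple:
  assumes f: "f \<in> L2 M"
  shows "\<exists>s. (\<forall>n. simple_function M (s n) \<and> integrable M (s n) \<and> s n \<in> L2 M) \<and>
    (\<forall>n x. x \<in> space M \<longrightarrow> cmod (s n x) \<le> 2 * cmod (f x)) \<and> (\<lambda>n. L2_norm M (\<lambda>x. s n x - f x)) \<longlonglongrightarrow> 0"
proof -
  have [measurable]: "f \<in> borel_measurable M" using f by simp
  from borel_measurable_implies_sequence_metric[of f M 0]
  obtain s where s: "\<And>i. simple_function M (s i)" "\<And>x. x \<in> space M \<Longrightarrow> (\<lambda>i. s i x) \<longlonglongrightarrow> f x"
    "\<And>i x. x \<in> space M \<Longrightarrow> cmod (s i x) \<le> 2 * cmod (f x)"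
    by (auto simp: dist_norm) metis
  have [measurable]: "s i \<in> borel_measurable M" for i using s(1) by (rule borel_measurable_simple_function)
  have sq: "(cmod (s i x))\<^sup>2 \<le> 4 * (cmod (f x))\<^sup>2" if "x \<in> space M" for i x
    using power_mono[OF s(3)[OF that, of i] norm_ge_zero, of 2] by (simp add: power_mult_distrib)
  have L2: "s i \<in> L2 M" for i
    by (rule L2_bound[of _ "\<lambda>x. 4 * (cmod (f x))\<^sup>2"]) (auto intro!: sq L2_integrable_square f)
  have int: "integrable M (s i)" for i
  proof -
    have fin: "finite (s i ` space M)" using s(1) by (simp add: simple_function_def)
    (* the least nonzero modulus: where s i does not vanish, c * |s i| is at most |s i|^2 *)
    define c where "c = Min (insert 1 (cmod ` (s i ` space M - {0})))"
    have c: "c > 0" using fin unfolding c_def by (subst Min_gr_iff) auto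
    have le: "c * cmod (s i x) \<le> (cmod (s i x))\<^sup>2" if "x \<in> space M" for x
    proof (cases "s i x = 0")
      case False
      have "c \<le> cmod (s i x)" unfolding c_def by (rule Min_le) (use fin that False in auto)
      then show ?thesis by (simp add: power2_eq_square mult_right_mono)
    qed simp
    show ?thesis
    proof (rule Bochner_Integration.integrable_bound)
      show "integrable M (\<lambda>x. (cmod (s i x))\<^sup>2 / c)"
        by (intro integrable_divide_zero L2_integrable_square L2)
      show "AE x in M. norm (s i x) \<le> norm ((cmod (s i x))\<^sup>2 / c)"
        using le c by (intro AE_I2) (simp add: field_simps)
    qed measurable
  qed
  have "(\<lambda>i. \<integral>x. (cmod (s i x - f x))\<^sup>2 \<partial>M) \<longlonglongrightarrow> (\<integral>x. 0 \<partial>M)"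
  proof (rule integral_dominated_convergence[where w="\<lambda>x. 9 * (cmod (f x))\<^sup>2"])
    show "integrable M (\<lambda>x. 9 * (cmod (f x))\<^sup>2)" by (intro integrable_mult_right L2_integrable_square f)
    show "AE x in M. (\<lambda>i. (cmod (s i x - f x))\<^sup>2) \<longlonglongrightarrow> 0"
    proof (rule AE_I2)
      fix x assume "x \<in> space M"
      from s(2)[OF this] have "(\<lambda>i. (cmod (s i x - f x))\<^sup>2) \<longlonglongrightarrow> (cmod (f x - f x))\<^sup>2" by (intro tendsto_intros)
      then show "(\<lambda>i. (cmod (s i x - f x))\<^sup>2) \<longlonglongrightarrow> 0" by simp
    qed
    show "AE x in M. norm ((cmod (s i x - f x))\<^sup>2) \<le> 9 * (cmod (f x))\<^sup>2" for i
    proof (rule AE_I2)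
      fix x assume "x \<in> space M"
      then have "cmod (s i x - f x) \<le> 3 * cmod (f x)"
        using norm_triangle_ineq4[of "s i x" "f x"] s(3)[of x i] by linarith
      from power_mono[OF this norm_ge_zero, of 2]
      show "norm ((cmod (s i x - f x))\<^sup>2) \<le> 9 * (cmod (f x))\<^sup>2" by (simp add: power_mult_distrib)
    qed
  qed auto
  then have "(\<lambda>i. sqrt (\<integral>x. (cmod (s i x - f x))\<^sup>2 \<partial>M)) \<longlonglongrightarrow> sqrt (\<integral>x. 0 \<partial>M)"
    by (rule tendsto_real_sqrt)
  then have "(\<lambda>n. L2_norm M (\<lambda>x. s n x - f x)) \<longlonglongrightarrow> 0" by (simp add: L2_norm_def)
  with s(1,3) int L2 show ?thesis by blast
qed

lemma L2_indicator: "A \<in> sets M \<Longrightarrow> emeasure M A < \<infinity> \<Longrightarrow> (indicator A :: _ \<Rightarrow> complex) \<in> L2 M"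
  by (rule L2_bound[of _ "indicator A"]) (auto simp: indicator_def)

text \<open>Square integrable functions are limits of linear combinations of indicators of sets of finite
  measure.\<close>

lemma L2_induct [consumes 2, case_names indicator add cmult lim]:
  assumes f: "f \<in> L2 M" and space: "space M = UNIV"
    and ind: "\<And>A. A \<in> sets M \<Longrightarrow> emeasure M A < \<infinity> \<Longrightarrow> P (indicator A)"
    and add: "\<And>f g. f \<in> L2 M \<Longrightarrow> g \<in> L2 M \<Longrightarrow> P f \<Longrightarrow> P g \<Longrightarrow> P (\<lambda>x. f x + g x)"
    and cmult: "\<And>f c. f \<in> L2 M \<Longrightarrow> P f \<Longrightarrow> P (\<lambda>x. c * f x)"
    and lim: "\<And>s f. (\<And>n. s n \<in> L2 M) \<Longrightarrow> (\<And>n. P (s n)) \<Longrightarrow> f \<in> L2 M \<Longrightarrow>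
      (\<lambda>n. L2_norm M (\<lambda>x. s n x - f x)) \<longlonglongrightarrow> 0 \<Longrightarrow> P f"
  shows "P (f :: 'a \<Rightarrow> complex)"
proof -
  have simple: "P g" if g: "simple_function M g" "integrable M g" for g :: "'a \<Rightarrow> complex"
  proof -
    have fin: "finite (range g)" using g(1) space by (simp add: simple_function_def)
    have A: "g -` {y} \<in> sets M" for y using g(1) space simple_functionD(2)[of M g "{y}"] by simp
    have fm: "emeasure M (g -` {y}) < \<infinity>" if "y \<noteq> 0" for y
    proof -
      have "ennreal (cmod y) * emeasure M (g -` {y}) \<le> (\<integral>\<^sup>+x. ennreal (cmod (g x)) \<partial>M)"
        using A by (subst nn_integral_cmult_indicator[symmetric])
          (auto intro!: nn_integral_mono split: split_indicator)
      also have "\<dots> < \<infinity>" using g(2) by (simp add: integrable_iff_bounded)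
      finally show ?thesis using that by (auto simp: ennreal_mult_less_top)
    qed
    have z: "(\<lambda>x. 0) \<in> L2 M" "P (\<lambda>x. 0)"
      using L2_indicator[of "{}" M] cmult[OF L2_indicator ind, of "{}" 0] by (auto simp: L2_def)
    have "(\<lambda>x. \<Sum>y\<in>S. y * indicator (g -` {y}) x) \<in> L2 M \<and> P (\<lambda>x. \<Sum>y\<in>S. y * indicator (g -` {y}) x)"
      if "finite S" "0 \<notin> S" for S
      using that
    proof (induction S)
      case (insert y S)
      then have "(\<lambda>x. y * indicator (g -` {y}) x) \<in> L2 M" "P (\<lambda>x. y * indicator (g -` {y}) x)"
        by (auto intro!: cmult ind L2_cmult L2_indicator A fm)
      with insert show ?case unfolding sum.insert[OF insert.hyps] by (intro conjI L2_add add) auto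
    qed (use z in auto)
    from this[of "range g - {0}"] fin have "P (\<lambda>x. \<Sum>y\<in>range g - {0}. y * indicator (g -` {y}) x)" by simp
    also have "(\<lambda>x. \<Sum>y\<in>range g - {0}. y * indicator (g -` {y}) x) = g"
    proof
      fix x
      have "(\<Sum>y\<in>range g - {0}. y * indicator (g -` {y}) x) = (\<Sum>y\<in>range g - {0}. if y = g x then g x else 0)"
        by (intro sum.cong) (auto simp: indicator_def)
      also have "\<dots> = g x" using fin by (subst sum.delta) auto
      finally show "(\<Sum>y\<in>range g - {0}. y * indicator (g -` {y}) x) = g x" .
    qed
    finally show ?thesis .
  qed
  from L2_approx_simple[OF f] obtain s where s:
    "\<And>n. simple_function M (s n)" "\<And>n. integrable M (s n)" "\<And>n. s n \<in> L2 M"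
    "(\<lambda>n. L2_norm M (\<lambda>x. s n x - f x)) \<longlonglongrightarrow> 0" by blast
  show ?thesis by (rule lim[OF s(3) simple[OF s(1,2)] f s(4)])
qed

section \<open>Haar measure on the adele ring\<close>

instance prod :: (topological_monoid_add, topological_monoid_add) topological_monoid_add
proof
  fix a b :: "'a \<times> 'b"
  show "((\<lambda>x. fst x + snd x) \<longlongrightarrow> a + b) (nhds a \<times>\<^sub>F nhds b)"
    unfolding plus_prod_def
    by (intro tendsto_Pair tendsto_add tendsto_fst tendsto_snd filterlim_fst filterlim_snd)
qed

instance prod :: (topological_group_add, topological_group_add) topological_group_add
proof
  fix a :: "'a \<times> 'b"
  show "(uminus \<longlongrightarrow> - a) (nhds a)"
    unfolding uminus_prod_def by (intro tendsto_Pair tendsto_minus tendsto_fst tendsto_snd) (simp_all add: filterlim_ident)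
qed

instance prod :: (polish_space, polish_space) polish_space ..

lemma (in pair_sigma_finite) integrable_product:
  fixes f :: "'a \<Rightarrow> complex" and g :: "'b \<Rightarrow> complex"
  assumes f: "integrable M1 f" and g: "integrable M2 g"
  shows "integrable (M1 \<Otimes>\<^sub>M M2) (\<lambda>p. f (fst p) * g (snd p))"
    and "(\<integral>p. f (fst p) * g (snd p) \<partial>(M1 \<Otimes>\<^sub>M M2)) = (\<integral>x. f x \<partial>M1) * (\<integral>y. g y \<partial>M2)"
proof -
  have [measurable]: "f \<in> borel_measurable M1" "g \<in> borel_measurable M2" using f g by auto
  show int: "integrable (M1 \<Otimes>\<^sub>M M2) (\<lambda>p. f (fst p) * g (snd p))"
    by (rule Fubini_integrable) (use f g in \<open>auto simp: norm_mult\<close>)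
  show "(\<integral>p. f (fst p) * g (snd p) \<partial>(M1 \<Otimes>\<^sub>M M2)) = (\<integral>x. f x \<partial>M1) * (\<integral>y. g y \<partial>M2)"
    using integral_fst'[OF int] by simp
qed

text \<open>The characteristic function of the normal distribution, rescaled to the normalisation
  \<open>exp (- 2 \<pi> i x)\<close> of the character.\<close>

lemma integral_gauss_chi_inf:
  assumes s: "\<sigma> > 0"
  shows "(\<integral>x. of_real (exp (- 2 * pi\<^sup>2 * \<sigma>\<^sup>2 * x\<^sup>2)) * chi_inf (\<xi> * x) \<partial>lborel) = of_real (normal_density 0 \<sigma> \<xi>)"
    and "integrable lborel (\<lambda>x. exp (- 2 * pi\<^sup>2 * \<sigma>\<^sup>2 * x\<^sup>2))"
proof -
  define \<tau> where "\<tau> = 1 / (2 * pi * \<sigma>)"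
  have t: "\<tau> > 0" using s by (simp add: \<tau>_def)
  have eq: "exp (- 2 * pi\<^sup>2 * \<sigma>\<^sup>2 * x\<^sup>2) = sqrt (2 * pi * \<tau>\<^sup>2) * normal_density 0 \<tau> x" for x
    using s t by (simp add: normal_density_def \<tau>_def field_simps power2_eq_square)
  show "integrable lborel (\<lambda>x. exp (- 2 * pi\<^sup>2 * \<sigma>\<^sup>2 * x\<^sup>2))"
    unfolding eq using integrable_normal_density[OF t] by simp
  have char: "(\<integral>x. of_real (std_normal_density x) * iexp (y * x) \<partial>lborel) = of_real (exp (- y\<^sup>2 / 2))" for y
    using fun_cong[OF char_std_normal_distribution, of y]
    unfolding char_def by (subst (asm) integral_density) (auto simp: scaleR_conv_of_real)
  have "(\<integral>x. of_real (normal_density 0 \<tau> x) * chi_inf (\<xi> * x) \<partial>lborel) =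
      \<bar>\<tau>\<bar> *\<^sub>R (\<integral>x. of_real (normal_density 0 \<tau> (0 + \<tau> * x)) * chi_inf (\<xi> * (0 + \<tau> * x)) \<partial>lborel)"
    using t by (intro lborel_integral_real_affine) auto
  also have "\<dots> = (\<integral>x. of_real (std_normal_density x) * iexp (- (\<xi> / \<sigma>) * x) \<partial>lborel)"
    unfolding integral_scaleR_right[symmetric]
  proof (intro Bochner_Integration.integral_cong refl)
    fix x
    have "\<bar>\<tau>\<bar> * normal_density 0 \<tau> (0 + \<tau> * x) = std_normal_density x"
      using t by (simp add: normal_density_def std_normal_density_def real_sqrt_mult power_mult_distrib)
    moreover have "chi_inf (\<xi> * (0 + \<tau> * x)) = iexp (- (\<xi> / \<sigma>) * x)"
      using s by (simp add: chi_inf_def \<tau>_def mult_ac)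
    ultimately show "\<bar>\<tau>\<bar> *\<^sub>R (complex_of_real (normal_density 0 \<tau> (0 + \<tau> * x)) * chi_inf (\<xi> * (0 + \<tau> * x))) =
        complex_of_real (std_normal_density x) * iexp (- (\<xi> / \<sigma>) * x)"
      by (metis (no_types) mult_scaleR_left of_real_mult scaleR_conv_of_real)
  qed
  also have "\<dots> = of_real (exp (- (\<xi> / \<sigma>)\<^sup>2 / 2))" unfolding char by simp
  finally have 1: "(\<integral>x. of_real (normal_density 0 \<tau> x) * chi_inf (\<xi> * x) \<partial>lborel) = of_real (exp (- (\<xi> / \<sigma>)\<^sup>2 / 2))" .
  have "(\<integral>x. of_real (exp (- 2 * pi\<^sup>2 * \<sigma>\<^sup>2 * x\<^sup>2)) * chi_inf (\<xi> * x) \<partial>lborel) =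
     of_real (sqrt (2 * pi * \<tau>\<^sup>2)) * (\<integral>x. of_real (normal_density 0 \<tau> x) * chi_inf (\<xi> * x) \<partial>lborel)"
    unfolding eq by (simp add: mult.assoc)
  also have "\<dots> = of_real (sqrt (2 * pi * \<tau>\<^sup>2) * exp (- (\<xi> / \<sigma>)\<^sup>2 / 2))" unfolding 1 by simp
  also have "sqrt (2 * pi * \<tau>\<^sup>2) = 1 / sqrt (2 * pi * \<sigma>\<^sup>2)"
  proof -
    have "2 * pi * \<tau>\<^sup>2 = 1 / (2 * pi * \<sigma>\<^sup>2)" using s by (simp add: \<tau>_def field_simps power2_eq_square)
    then show ?thesis by (simp add: real_sqrt_divide)
  qed
  finally show "(\<integral>x. of_real (exp (- 2 * pi\<^sup>2 * \<sigma>\<^sup>2 * x\<^sup>2)) * chi_inf (\<xi> * x) \<partial>lborel) = of_real (normal_density 0 \<sigma> \<xi>)"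
    by (simp add: normal_density_def power_divide)
qed

context adelic_haar
begin

abbreviation m :: "adele measure" where "m \<equiv> adele_measure \<mu>"

sublocale \<mu>: sigma_finite_measure \<mu> by (rule sigma_finite_\<mu>)

sublocale lborel_\<mu>: pair_sigma_finite lborel \<mu> ..

sublocale m: sigma_finite_measure m
  unfolding adele_measure_def
  by (rule sigma_finite_pair_measure[OF lborel.sigma_finite_measure_axioms \<mu>.sigma_finite_measure_axioms])

sublocale mm: pair_sigma_finite m m ..

lemma sets_m [measurable_cong, simp]: "sets m = sets borel"
proof -
  have "sets m = sets (borel \<Otimes>\<^sub>M borel)"
    unfolding adele_measure_def by (intro sets_pair_measure_cong) auto
  then show ?thesis by (simp only: borel_prod)
qed

lemma space_m [simp]: "space m = UNIV"
  using sets_eq_imp_space_eq[OF sets_m] by simp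

lemma distr_m_translate: "distr m borel (\<lambda>x. a + x) = m"
proof -
  have "distr lborel borel ((+) (fst a)) \<Otimes>\<^sub>M distr \<mu> borel ((+) (snd a)) =
      distr (lborel \<Otimes>\<^sub>M \<mu>) (borel \<Otimes>\<^sub>M borel) (\<lambda>(x, y). (fst a + x, snd a + y))"
    by (rule pair_measure_distr) (auto simp: distr_translate \<mu>.sigma_finite_measure_axioms)
  moreover have "(\<lambda>(x, y). (fst a + x, snd a + y)) = (\<lambda>x. a + x)" by (auto simp: fun_eq_iff prod_eq_iff)
  ultimately show ?thesis
    by (simp add: lborel_distr_plus distr_translate borel_prod adele_measure_def)
qed

lemma continuous_imp_borel_m: "continuous_on UNIV f \<Longrightarrow> f \<in> borel_measurable m"
  using borel_measurable_continuous_onI[of f] by (simp add: measurable_cong_sets[OF sets_m refl])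

lemma translate_measurable [measurable]: "(\<lambda>x. a + x) \<in> m \<rightarrow>\<^sub>M borel" "(\<lambda>x. x + a) \<in> m \<rightarrow>\<^sub>M borel"
  by measurable

lemma integral_translate:
  fixes f :: "adele \<Rightarrow> 'b::{banach, second_countable_topology}"
  assumes "f \<in> borel_measurable m"
  shows "(\<integral>x. f (x + a) \<partial>m) = (\<integral>x. f x \<partial>m)"
    and "integrable m (\<lambda>x. f (x + a)) \<longleftrightarrow> integrable m f"
proof -
  have f: "f \<in> borel_measurable borel" using assms by (simp cong: measurable_cong_sets)
  have "(\<lambda>x. x + a) = (\<lambda>x. a + x)" by (simp add: fun_eq_iff add.commute)
  then have d: "distr m borel (\<lambda>x. x + a) = m" using distr_m_translate by simp
  show "(\<integral>x. f (x + a) \<partial>m) = (\<integral>x. f x \<partial>m)"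
    using integral_distr[OF translate_measurable(2) f, of a] unfolding d ..
  show "integrable m (\<lambda>x. f (x + a)) \<longleftrightarrow> integrable m f"
    using integrable_distr_eq[OF translate_measurable(2) f, of a] unfolding d ..
qed

lemma measurable_translate: "f \<in> borel_measurable m \<Longrightarrow> (\<lambda>x. f (x + a)) \<in> borel_measurable m"
  using measurable_compose[OF translate_measurable(2), of f borel a] by (simp cong: measurable_cong_sets)

lemmas borel_measurable_norm' = measurable_compose[OF _ borel_measurable_norm]

lemma L2_translate: "f \<in> L2 m \<Longrightarrow> (\<lambda>x. f (x + a)) \<in> L2 m"
  using integral_translate(2)[of "\<lambda>x. (cmod (f x))\<^sup>2" a]
  by (simp add: L2_def measurable_translate borel_measurable_power[OF borel_measurable_norm'])

lemma L2_norm_translate: "f \<in> L2 m \<Longrightarrow> L2_norm m (\<lambda>x. f (x + a)) = L2_norm m f"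
  using integral_translate(1)[of "\<lambda>x. (cmod (f x))\<^sup>2" a]
  by (simp add: L2_norm_def L2_def borel_measurable_power[OF borel_measurable_norm'])

lemma chi_measurable [measurable]:
  "(\<lambda>x. chi E (adele_mult \<xi> x)) \<in> borel_measurable m"
  "(\<lambda>p. chi E (adele_mult (fst p) (snd p))) \<in> borel_measurable (m \<Otimes>\<^sub>M m)"
proof -
  have c: "continuous_on UNIV (\<lambda>p. chi E (adele_mult (fst p) (snd p)))"
    by (intro continuous_on_compose2[OF continuous_on_chi[OF E, of UNIV]] continuous_on_adele_mult
        continuous_intros) auto
  show "(\<lambda>x. chi E (adele_mult \<xi> x)) \<in> borel_measurable m"
    by (intro continuous_imp_borel_m continuous_on_compose2[OF continuous_on_chi[OF E, of UNIV]] continuous_on_adele_mult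
        continuous_intros) auto
  have "sets (m \<Otimes>\<^sub>M m) = sets (borel \<Otimes>\<^sub>M borel :: (adele \<times> adele) measure)"
    by (intro sets_pair_measure_cong) auto
  then have "sets (m \<Otimes>\<^sub>M m) = sets borel" by (simp only: borel_prod)
  then show "(\<lambda>p. chi E (adele_mult (fst p) (snd p))) \<in> borel_measurable (m \<Otimes>\<^sub>M m)"
    using borel_measurable_continuous_onI[OF c] by (simp cong: measurable_cong_sets)
qed


section \<open>The Fourier transform of integrable functions\<close>

abbreviation FT :: "(adele \<Rightarrow> complex) \<Rightarrow> adele \<Rightarrow> complex"
  where "FT \<equiv> fourier_L1 E \<mu>"

lemma FT_def: "FT f \<xi> = (\<integral>x. f x * chi E (adele_mult \<xi> x) \<partial>m)"
  by (simp add: fourier_L1_def)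

lemma integrable_mult_chi:
  assumes "integrable m f" shows "integrable m (\<lambda>x. f x * chi E (adele_mult \<xi> x))"
proof -
  have [measurable]: "f \<in> borel_measurable m" using assms by auto
  show ?thesis
    by (rule Bochner_Integration.integrable_bound[OF integrable_norm[OF assms]]) (auto simp: norm_mult norm_chi)
qed

lemma FT_measurable [measurable]: "f \<in> borel_measurable m \<Longrightarrow> FT f \<in> borel_measurable m"
  unfolding FT_def[abs_def]
  by (intro m.borel_measurable_lebesgue_integral)
     (auto simp: split_beta intro!: borel_measurable_times chi_measurable(2) measurable_compose[OF measurable_snd])

lemma norm_FT_le: assumes "integrable m f" shows "cmod (FT f \<xi>) \<le> (\<integral>x. cmod (f x) \<partial>m)"
proof -
  have "cmod (FT f \<xi>) \<le> (\<integral>x. cmod (f x * chi E (adele_mult \<xi> x)) \<partial>m)" unfolding FT_def by (rule integral_norm_bound)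
  then show ?thesis by (simp add: norm_mult norm_chi)
qed

lemma FT_add: "integrable m f \<Longrightarrow> integrable m g \<Longrightarrow> FT (\<lambda>x. f x + g x) \<xi> = FT f \<xi> + FT g \<xi>"
  unfolding FT_def by (simp add: distrib_right integrable_mult_chi)

lemma FT_cmult: "FT (\<lambda>x. c * f x) \<xi> = c * FT f \<xi>"
  unfolding FT_def by (simp add: mult.assoc)

lemma FT_translate:
  assumes "f \<in> borel_measurable m"
  shows "FT (\<lambda>x. f (x + a)) \<xi> = cnj (chi E (adele_mult \<xi> a)) * FT f \<xi>"
proof -
  have "FT f \<xi> = (\<integral>x. f (x + a) * chi E (adele_mult \<xi> (x + a)) \<partial>m)"
    unfolding FT_def by (intro integral_translate(1)[symmetric] borel_measurable_times assms chi_measurable)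
  also have "\<dots> = chi E (adele_mult \<xi> a) * FT (\<lambda>x. f (x + a)) \<xi>"
    unfolding FT_def by (simp add: adele_mult_distrib chi_add[OF E] mult_ac flip: integral_mult_right_zero)
  finally show ?thesis
    by (simp add: complex_norm_square[symmetric] norm_chi flip: mult.assoc) (simp add: mult.commute complex_norm_square[symmetric] norm_chi)
qed

text \<open>Fubini's theorem, because \<open>chi E (adele_mult x \<xi>)\<close> is symmetric in \<open>x\<close> and \<open>\<xi>\<close>.\<close>

lemma FT_multiplication:
  assumes f: "integrable m f" and g: "integrable m g"
  shows "(\<integral>x. FT f x * g x \<partial>m) = (\<integral>x. f x * FT g x \<partial>m)"
proof -
  have [measurable]: "f \<in> borel_measurable m" "g \<in> borel_measurable m" using f g by auto
  have int: "integrable (m \<Otimes>\<^sub>M m) (\<lambda>(x, y). f x * g y * chi E (adele_mult x y))"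
  proof (rule Bochner_Integration.integrable_bound[OF mm.integrable_product(1)[OF f g]])
    show "(\<lambda>(x, y). f x * g y * chi E (adele_mult x y)) \<in> borel_measurable (m \<Otimes>\<^sub>M m)"
      unfolding split_beta by measurable
  qed (auto simp: norm_mult norm_chi)
  from mm.Fubini_integral[OF this]
  have "(\<integral>y. (\<integral>x. f x * g y * chi E (adele_mult x y) \<partial>m) \<partial>m) = (\<integral>x. (\<integral>y. f x * g y * chi E (adele_mult x y) \<partial>m) \<partial>m)" .
  moreover have "(\<integral>x. f x * g y * chi E (adele_mult x y) \<partial>m) = FT f y * g y" for y
  proof -
    have "(\<lambda>x. f x * g y * chi E (adele_mult x y)) = (\<lambda>x. (f x * chi E (adele_mult y x)) * g y)"
      by (simp add: fun_eq_iff adele_mult_commute[of y])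
    then show ?thesis unfolding FT_def by simp
  qed
  moreover have "(\<integral>y. f x * g y * chi E (adele_mult x y) \<partial>m) = f x * FT g x" for x
    unfolding FT_def by (simp add: mult.assoc)
  ultimately show ?thesis by simp
qed

lemma FT_product:
  assumes g: "integrable lborel g" and h: "integrable \<mu> h"
  shows "FT (\<lambda>x. g (fst x) * h (snd x)) \<xi> =
    (\<integral>x. g x * chi_inf (fst \<xi> * x) \<partial>lborel) * (\<integral>x. h x * chi_f E (snd \<xi> * x) \<partial>\<mu>)"
proof -
  have [measurable]: "g \<in> borel_measurable lborel" "h \<in> borel_measurable \<mu>" using g h by auto
  have [measurable]: "(\<lambda>x. chi_inf (fst \<xi> * x)) \<in> borel_measurable borel"
    unfolding chi_inf_def by measurable
  have [measurable]: "(\<lambda>x. chi_f E (snd \<xi> * x)) \<in> borel_measurable borel"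
    by (intro borel_measurable_continuous_onI continuous_on_compose2[OF continuous_on_chi_f[OF E, of UNIV]] continuous_intros) auto
  have "integrable lborel (\<lambda>x. g x * chi_inf (fst \<xi> * x))"
    by (rule Bochner_Integration.integrable_bound[OF integrable_norm[OF g]]) (auto simp: norm_mult norm_chi_inf)
  moreover have "integrable \<mu> (\<lambda>x. h x * chi_f E (snd \<xi> * x))"
    by (rule Bochner_Integration.integrable_bound[OF integrable_norm[OF h]]) (auto simp: norm_mult norm_chi_f)
  ultimately show ?thesis
    using lborel_\<mu>.integrable_product(2)[of "\<lambda>x. g x * chi_inf (fst \<xi> * x)" "\<lambda>x. h x * chi_f E (snd \<xi> * x)"]
    by (simp add: FT_def chi_def adele_mult_def adele_measure_def mult_ac)
qed

text \<open>A nontrivial character of a subgroup has mean value zero, by translation invariance.\<close>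

lemma integral_chi_f_subgroup:
  assumes [measurable]: "H \<in> sets borel" and add: "\<And>x y. x \<in> H \<Longrightarrow> y \<in> H \<Longrightarrow> x + y \<in> H"
    and minus: "\<And>x. x \<in> H \<Longrightarrow> - x \<in> H"
  shows "(\<integral>x. indicator H x * chi_f E (\<xi> * x) \<partial>\<mu>) =
    (if \<forall>x\<in>H. chi_f E (\<xi> * x) = 1 then of_real (measure \<mu> H) else 0)"
proof (cases "\<forall>x\<in>H. chi_f E (\<xi> * x) = 1")
  case True
  then have "(\<integral>x. indicator H x * chi_f E (\<xi> * x) \<partial>\<mu>) = (\<integral>x. indicator H x \<partial>\<mu>)"
    by (intro Bochner_Integration.integral_cong) (auto simp: indicator_def)
  also have "\<dots> = (\<integral>x. complex_of_real (indicator H x) \<partial>\<mu>)"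
    by (intro Bochner_Integration.integral_cong) (auto simp: indicator_def)
  also have "\<dots> = of_real (measure \<mu> H)" by simp
  finally show ?thesis using True by simp
next
  case False
  then obtain a where a: "a \<in> H" "chi_f E (\<xi> * a) \<noteq> 1" by blast
  have [measurable]: "(\<lambda>x. chi_f E (\<xi> * x)) \<in> borel_measurable borel"
    by (intro borel_measurable_continuous_onI continuous_on_compose2[OF continuous_on_chi_f[OF E, of UNIV]] continuous_intros) auto
  have H: "a + x \<in> H \<longleftrightarrow> x \<in> H" for x
    using add[of a x] add[of "- a" "a + x"] minus[of a] a(1) by auto
  have "(\<integral>x. indicator H x * chi_f E (\<xi> * x) \<partial>\<mu>) = (\<integral>x. indicator H x * chi_f E (\<xi> * x) \<partial>distr \<mu> borel (\<lambda>x. a + x))"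
    by (simp only: distr_translate)
  also have "\<dots> = (\<integral>x. indicator H (a + x) * chi_f E (\<xi> * (a + x)) \<partial>\<mu>)"
    by (rule integral_distr) measurable
  also have "\<dots> = (\<integral>x. chi_f E (\<xi> * a) * (indicator H x * chi_f E (\<xi> * x)) \<partial>\<mu>)"
    by (intro Bochner_Integration.integral_cong)
       (auto simp: distrib_left chi_f_add[OF E] indicator_def H)
  finally have "(\<integral>x. indicator H x * chi_f E (\<xi> * x) \<partial>\<mu>) = chi_f E (\<xi> * a) * (\<integral>x. indicator H x * chi_f E (\<xi> * x) \<partial>\<mu>)"
    by simp
  then have "(\<integral>x. indicator H x * chi_f E (\<xi> * x) \<partial>\<mu>) = 0" using a(2) by simp
  then show ?thesis unfolding if_not_P[OF False] .
qed

text \<open>The ideals of \<open>r\<close> and \<open>1/r\<close> annihilate each other under the character.\<close>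

lemma integral_chi_f_ideal:
  assumes r: "r > 0"
  shows "(\<integral>x. indicator (ideal r) x * chi_f E (\<xi> * x) \<partial>\<mu>) = of_real (indicator (ideal (1/r)) \<xi> / of_rat r)"
proof -
  have "(\<forall>x\<in>ideal r. chi_f E (\<xi> * x) = 1) \<longleftrightarrow> \<xi> \<in> ideal (1/r)"
  proof
    assume "\<forall>x\<in>ideal r. chi_f E (\<xi> * x) = 1"
    moreover have "fadele_of_rat r \<in> ideal r" using r by (simp add: ideal_def in_ideal_of_rat)
    ultimately have "chi_f E (\<xi> * fadele_of_rat r) = 1" by blast
    then have "in_ideal 1 (fadele_of_rat r * \<xi>)" by (simp add: chi_f_eq_1_iff[OF E] mult.commute)
    then show "\<xi> \<in> ideal (1/r)" using in_ideal_mult_unit_iff[OF r, of 1 \<xi>] by (simp add: ideal_def)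
  next
    assume "\<xi> \<in> ideal (1/r)"
    then show "\<forall>x\<in>ideal r. chi_f E (\<xi> * x) = 1"
      using r in_ideal_mult[of "1/r" \<xi> r] by (auto simp: chi_f_eq_1_iff[OF E] ideal_def)
  qed
  moreover have "(\<integral>x. indicator (ideal r) x * chi_f E (\<xi> * x) \<partial>\<mu>) =
      (if \<forall>x\<in>ideal r. chi_f E (\<xi> * x) = 1 then of_real (measure \<mu> (ideal r)) else 0)"
    by (rule integral_chi_f_subgroup[OF ideal_borel]) (auto simp: ideal_def in_ideal_add in_ideal_minus)
  ultimately show ?thesis by (simp add: measure_ideal[OF r])
qed

text \<open>Regularisers with an explicit Fourier transform, the probability density \<open>theta_hat\<close>.\<close>

definition theta :: "real \<Rightarrow> rat \<Rightarrow> adele \<Rightarrow> real"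
  where "theta \<sigma> r x = exp (- 2 * pi\<^sup>2 * \<sigma>\<^sup>2 * (fst x)\<^sup>2) * indicator (ideal r) (snd x)"

definition theta_hat :: "real \<Rightarrow> rat \<Rightarrow> adele \<Rightarrow> real"
  where "theta_hat \<sigma> r \<xi> = normal_density 0 \<sigma> (fst \<xi>) * (indicator (ideal (1/r)) (snd \<xi>) / of_rat r)"

lemma integrable_indicator_ideal: "r > 0 \<Longrightarrow> integrable \<mu> (indicator (ideal r) :: _ \<Rightarrow> real)"
  by (rule integrable_real_indicator) (auto simp: emeasure_ideal)

lemma integrable_theta: assumes "\<sigma> > 0" "r > 0" shows "integrable m (theta \<sigma> r)"
proof -
  have "integrable m (\<lambda>x. complex_of_real (exp (- 2 * pi\<^sup>2 * \<sigma>\<^sup>2 * (fst x)\<^sup>2)) * complex_of_real (indicator (ideal r) (snd x)))"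
    unfolding adele_measure_def
    by (rule lborel_\<mu>.integrable_product(1)[of "\<lambda>x. complex_of_real (exp (- 2 * pi\<^sup>2 * \<sigma>\<^sup>2 * x\<^sup>2))" "\<lambda>x. complex_of_real (indicator (ideal r) x)"])
       (intro integrable_of_real integral_gauss_chi_inf(2) integrable_indicator_ideal assms)+
  then show ?thesis unfolding theta_def[abs_def] of_real_mult[symmetric] complex_of_real_integrable_eq .
qed

lemma theta_measurable [measurable]: "theta \<sigma> r \<in> borel_measurable m"
  unfolding theta_def[abs_def] adele_measure_def by measurable

lemma theta_bounds: "0 \<le> theta \<sigma> r x" "theta \<sigma> r x \<le> 1"
  by (auto simp: theta_def indicator_def)

lemma theta_hat_nonneg: "r > 0 \<Longrightarrow> theta_hat \<sigma> r x \<ge> 0"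
  by (auto simp: theta_hat_def)

lemma FT_theta:
  assumes "\<sigma> > 0" "r > 0"
  shows "FT (\<lambda>x. of_real (theta \<sigma> r x)) \<xi> = of_real (theta_hat \<sigma> r \<xi>)"
proof -
  have ind: "complex_of_real (indicator (ideal r) x) = indicator (ideal r) x" for x by (simp add: indicator_def)
  have "complex_integrable \<mu> (indicator (ideal r))"
    using integrable_of_real[OF integrable_indicator_ideal[OF assms(2)], where 'a = complex] by (simp add: ind)
  then show ?thesis
    using FT_product[of "\<lambda>x. complex_of_real (exp (- 2 * pi\<^sup>2 * \<sigma>\<^sup>2 * x\<^sup>2))" "\<lambda>x. complex_of_real (indicator (ideal r) x)" \<xi>]
      integral_gauss_chi_inf[OF assms(1)] integral_chi_f_ideal[OF assms(2), of "snd \<xi>"] integrable_indicator_ideal[OF assms(2)]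
    by (simp add: theta_def theta_hat_def ind integrable_of_real del: of_real_exp)
qed

lemma theta_hat_moment:
  assumes "\<sigma> > 0" "r > 0" "integrable lborel (\<lambda>x. normal_density 0 \<sigma> x * h x)"
  shows "integrable m (\<lambda>x. theta_hat \<sigma> r x * h (fst x))"
    and "(\<integral>x. theta_hat \<sigma> r x * h (fst x) \<partial>m) = (\<integral>x. normal_density 0 \<sigma> x * h x \<partial>lborel)"
proof -
  have i1: "integrable lborel (\<lambda>x. complex_of_real (normal_density 0 \<sigma> x * h x))"
    using assms(3) by (rule integrable_of_real)
  have i2: "integrable \<mu> (\<lambda>x. complex_of_real (indicator (ideal (1/r)) x / of_rat r))"
    using integrable_indicator_ideal[of "1/r"] assms(2)
    by (intro integrable_of_real integrable_divide_zero) auto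
  have eq: "complex_of_real (normal_density 0 \<sigma> (fst x) * h (fst x)) * complex_of_real (indicator (ideal (1/r)) (snd x) / of_rat r)
      = complex_of_real (theta_hat \<sigma> r x * h (fst x))" for x
    by (simp add: theta_hat_def mult_ac)
  from lborel_\<mu>.integrable_product(1)[OF i1 i2]
  have "integrable m (\<lambda>x. complex_of_real (theta_hat \<sigma> r x * h (fst x)))" unfolding eq adele_measure_def .
  then show "integrable m (\<lambda>x. theta_hat \<sigma> r x * h (fst x))" by (simp only: complex_of_real_integrable_eq)
  have "(\<integral>x. indicator (ideal (1/r)) x / of_rat r \<partial>\<mu>) = measure \<mu> (ideal (1/r)) / of_rat r" by simp
  also have "\<dots> = 1" using assms(2) by (simp add: measure_ideal of_rat_divide)
  finally have 1: "(\<integral>x. complex_of_real (indicator (ideal (1/r)) x / of_rat r) \<partial>\<mu>) = 1"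
    by (simp only: integral_complex_of_real) simp
  from lborel_\<mu>.integrable_product(2)[OF i1 i2]
  have "(\<integral>x. complex_of_real (theta_hat \<sigma> r x * h (fst x)) \<partial>m) = (\<integral>x. complex_of_real (normal_density 0 \<sigma> x * h x) \<partial>lborel)"
    unfolding eq 1 adele_measure_def by simp
  then show "(\<integral>x. theta_hat \<sigma> r x * h (fst x) \<partial>m) = (\<integral>x. normal_density 0 \<sigma> x * h x \<partial>lborel)"
    by (simp only: integral_complex_of_real of_real_eq_iff)
qed

lemma theta_hat_prob:
  assumes "\<sigma> > 0" "r > 0"
  shows "integrable m (theta_hat \<sigma> r)" "(\<integral>x. theta_hat \<sigma> r x \<partial>m) = 1"
    "integrable m (\<lambda>x. theta_hat \<sigma> r x * (fst x)\<^sup>2)" "(\<integral>x. theta_hat \<sigma> r x * (fst x)\<^sup>2 \<partial>m) = \<sigma>\<^sup>2"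
proof -
  show "integrable m (theta_hat \<sigma> r)" "(\<integral>x. theta_hat \<sigma> r x \<partial>m) = 1"
    using theta_hat_moment[OF assms, of "\<lambda>_. 1"] assms(1) by simp_all
  have "has_bochner_integral lborel (\<lambda>x. normal_density 0 \<sigma> x * x\<^sup>2) (\<sigma>\<^sup>2)"
    using normal_moment_even[OF assms(1), of 0 1] by (simp add: fact_numeral)
  then show "integrable m (\<lambda>x. theta_hat \<sigma> r x * (fst x)\<^sup>2)" "(\<integral>x. theta_hat \<sigma> r x * (fst x)\<^sup>2 \<partial>m) = \<sigma>\<^sup>2"
    using theta_hat_moment[OF assms, of "\<lambda>x. x\<^sup>2"] by (auto simp: has_bochner_integral_iff)
qed

lemma theta_hat_measurable [measurable]: "theta_hat \<sigma> r \<in> borel_measurable m"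
  unfolding theta_hat_def[abs_def] adele_measure_def by measurable

definition theta_seq :: "nat \<Rightarrow> adele \<Rightarrow> real"
  where "theta_seq k = theta (1 / Suc k) (exp_psi E (- int k))"

definition theta_hat_seq :: "nat \<Rightarrow> adele \<Rightarrow> real"
  where "theta_hat_seq k = theta_hat (1 / Suc k) (exp_psi E (- int k))"

lemma theta_seq_mono: "theta_seq k x \<le> theta_seq (Suc k) x"
proof -
  have "(fst x)\<^sup>2 * (1 / real (Suc (Suc k)))\<^sup>2 \<le> (fst x)\<^sup>2 * (1 / real (Suc k))\<^sup>2"
    by (intro mult_left_mono power_mono divide_left_mono) auto
  then have "- 2 * pi\<^sup>2 * (1 / real (Suc k))\<^sup>2 * (fst x)\<^sup>2 \<le> - 2 * pi\<^sup>2 * (1 / real (Suc (Suc k)))\<^sup>2 * (fst x)\<^sup>2"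
    using mult_left_mono[of "(fst x)\<^sup>2 * (1 / real (Suc (Suc k)))\<^sup>2" "(fst x)\<^sup>2 * (1 / real (Suc k))\<^sup>2" "2 * pi\<^sup>2"]
    by (simp add: mult_ac)
  moreover have "ideal (exp_psi E (- int k)) \<subseteq> ideal (exp_psi E (- int (Suc k)))"
    by (intro ideal_mono exp_psi_zmul[OF E] exp_psi_pos[OF E]) simp
  ultimately show ?thesis unfolding theta_seq_def theta_def
    by (intro mult_mono) (auto simp: indicator_def)
qed

lemma theta_seq_tendsto: "(\<lambda>k. theta_seq k x) \<longlonglongrightarrow> 1"
proof -
  obtain n where n: "snd x \<in> ideal (exp_psi E (- int n))" using ideal_exhausts by blast
  have "snd x \<in> ideal (exp_psi E (- int k))" if "k \<ge> n" for k
    using n ideal_mono[OF exp_psi_zmul[OF E] exp_psi_pos[OF E], of "- int k" "- int n"] that by auto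
  then have ev: "\<forall>\<^sub>F k in sequentially. exp (- 2 * pi\<^sup>2 * (1 / Suc k)\<^sup>2 * (fst x)\<^sup>2) = theta_seq k x"
    unfolding eventually_sequentially theta_seq_def theta_def by (intro exI[of _ n]) auto
  have "(\<lambda>k. - 2 * pi\<^sup>2 * (1 / Suc k)\<^sup>2 * (fst x)\<^sup>2) \<longlonglongrightarrow> - 2 * pi\<^sup>2 * 0\<^sup>2 * (fst x)\<^sup>2"
    using LIMSEQ_inverse_real_of_nat by (intro tendsto_intros) (simp add: inverse_eq_divide)
  then have "(\<lambda>k. exp (- 2 * pi\<^sup>2 * (1 / Suc k)\<^sup>2 * (fst x)\<^sup>2)) \<longlonglongrightarrow> exp 0" by (intro tendsto_exp) simp
  then show ?thesis using Lim_transform_eventually[OF _ ev] by simp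
qed

text \<open>The probability densities \<open>theta_hat_seq k\<close> are an approximate identity: their finite component
  is supported in shrinking ideals, and the variances of the Gaussian components tend to zero.\<close>

lemma theta_hat_seq_approx_identity:
  fixes g :: "adele \<Rightarrow> complex"
  assumes [measurable]: "g \<in> borel_measurable m" and B: "\<And>x. cmod (g x) \<le> B" and c: "isCont g 0"
  shows "(\<lambda>k. \<integral>\<xi>. of_real (theta_hat_seq k \<xi>) * g \<xi> \<partial>m) \<longlonglongrightarrow> g 0"
proof (rule LIMSEQ_I)
  fix e :: real assume e: "e > 0"
  have "(g \<longlongrightarrow> g 0) (nhds 0)" using c by (simp add: isCont_def tendsto_at_iff_tendsto_nhds)
  then have "\<forall>\<^sub>F x in nhds (0, 0). dist (g x) (g 0) < e / 2"
    using e by (auto simp: tendsto_iff zero_prod_def dest!: spec[of _ "e/2"])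
  then obtain P Q where P: "eventually P (nhds (0::real))" and Q: "eventually Q (nhds (0::fadele))"
    and PQ: "\<And>x y. P x \<Longrightarrow> Q y \<Longrightarrow> dist (g (x, y)) (g 0) < e / 2"
    unfolding nhds_prod eventually_prod_filter by auto
  obtain d where d: "d > 0" "\<And>x. \<bar>x\<bar> < d \<Longrightarrow> P x" using P by (auto simp: eventually_nhds_metric)
  obtain r where r: "r > 0" "\<And>y. in_ideal r y \<Longrightarrow> Q y" using Q by (auto simp: eventually_nhds_fadele)
  obtain n where n: "n \<ge> 0" "exp_psi E n \<in> zmul r" using exp_psi_small[OF E r(1)] by blast
  have B0: "B \<ge> 0" using B[of 0] norm_ge_zero[of "g 0"] by linarith
  have "(\<lambda>k. e / 2 + 2 * B / d\<^sup>2 * (1 / Suc k)\<^sup>2) \<longlonglongrightarrow> e / 2 + 2 * B / d\<^sup>2 * 0\<^sup>2"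
    using LIMSEQ_inverse_real_of_nat by (intro tendsto_intros) (simp add: inverse_eq_divide)
  then have "\<forall>\<^sub>F k in sequentially. e / 2 + 2 * B / d\<^sup>2 * (1 / Suc k)\<^sup>2 < e"
    by (rule order_tendstoD(2)) (use e in simp)
  then obtain k0 where k0: "\<And>k. k \<ge> k0 \<Longrightarrow> e / 2 + 2 * B / d\<^sup>2 * (1 / Suc k)\<^sup>2 < e"
    by (auto simp: eventually_sequentially)
  have "norm ((\<integral>\<xi>. of_real (theta_hat_seq k \<xi>) * g \<xi> \<partial>m) - g 0) < e" if k: "k \<ge> max k0 (nat n)" for k
  proof -
    let ?T = "theta_hat_seq k"
    have s: "1 / real (Suc k) > 0" "exp_psi E (- int k) > 0" using exp_psi_pos[OF E] by auto
    note T = theta_hat_prob[OF s, folded theta_hat_seq_def]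
    have [measurable]: "?T \<in> borel_measurable m" unfolding theta_hat_seq_def by measurable
    have T0: "?T \<xi> \<ge> 0" for \<xi> unfolding theta_hat_seq_def by (rule theta_hat_nonneg[OF s(2)])
    have ig: "integrable m (\<lambda>\<xi>. of_real (?T \<xi>) * g \<xi>)"
    proof (rule Bochner_Integration.integrable_bound)
      show "integrable m (\<lambda>\<xi>. B * ?T \<xi>)" using T by simp
      show "AE \<xi> in m. norm (of_real (?T \<xi>) * g \<xi>) \<le> norm (B * ?T \<xi>)"
        using B B0 T0 by (auto simp: norm_mult mult.commute[of B] intro!: mult_left_mono)
    qed measurable
    (* as in Chebyshev's inequality, the part far from 0 is controlled by the second moment *)
    have le: "norm (of_real (?T \<xi>) * g \<xi> - of_real (?T \<xi>) * g 0) \<le> e/2 * ?T \<xi> + 2 * B / d\<^sup>2 * (?T \<xi> * (fst \<xi>)\<^sup>2)" for \<xi>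
    proof (cases "snd \<xi> \<in> ideal (exp_psi E (int k))")
      case True
      have "n \<le> int k" using k by (simp add: nat_le_iff)
      then have "in_ideal (exp_psi E n) (snd \<xi>)"
        using True in_ideal_trans[OF _ exp_psi_zmul[OF E] exp_psi_pos[OF E], of "int k" "snd \<xi>" n] k n by (simp add: ideal_def)
      then have "Q (snd \<xi>)" using r in_ideal_trans[OF _ n(2)] by blast
      have *: "dist (g \<xi>) (g 0) \<le> e/2 + 2 * B / d\<^sup>2 * (fst \<xi>)\<^sup>2"
      proof (cases "\<bar>fst \<xi>\<bar> < d")
        case True
        then have "dist (g \<xi>) (g 0) < e/2" using PQ[of "fst \<xi>" "snd \<xi>"] d \<open>Q (snd \<xi>)\<close> by simp
        moreover have "2 * B / d\<^sup>2 * (fst \<xi>)\<^sup>2 \<ge> 0" using B0 by simp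
        ultimately show ?thesis by linarith
      next
        case False
        then have "d\<^sup>2 \<le> \<bar>fst \<xi>\<bar>\<^sup>2" using d(1) by (intro power_mono) auto
        then have "2 * B * 1 \<le> 2 * B * ((fst \<xi>)\<^sup>2 / d\<^sup>2)" using B0 d(1) by (intro mult_left_mono) auto
        moreover have "dist (g \<xi>) (g 0) \<le> 2 * B"
          using norm_triangle_ineq4[of "g \<xi>" "g 0"] B[of \<xi>] B[of 0] by (simp add: dist_norm)
        ultimately show ?thesis using e by simp
      qed
      have "norm (of_real (?T \<xi>) * g \<xi> - of_real (?T \<xi>) * g 0) = ?T \<xi> * dist (g \<xi>) (g 0)"
        using T0 by (simp add: dist_norm norm_mult flip: right_diff_distrib)
      also have "\<dots> \<le> ?T \<xi> * (e/2 + 2 * B / d\<^sup>2 * (fst \<xi>)\<^sup>2)" using * T0 by (rule mult_left_mono)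
      finally show ?thesis by (simp add: algebra_simps)
    next
      case False
      then have "?T \<xi> = 0" by (simp add: theta_hat_seq_def theta_hat_def exp_psi_minus[OF E])
      then show ?thesis by simp
    qed
    have "(\<integral>\<xi>. of_real (?T \<xi>) * g \<xi> \<partial>m) - g 0 = (\<integral>\<xi>. of_real (?T \<xi>) * g \<xi> - of_real (?T \<xi>) * g 0 \<partial>m)"
      using ig T by (subst Bochner_Integration.integral_diff) (auto simp: integrable_of_real)
    also have "norm \<dots> \<le> (\<integral>\<xi>. e/2 * ?T \<xi> + 2 * B / d\<^sup>2 * (?T \<xi> * (fst \<xi>)\<^sup>2) \<partial>m)"
      by (rule order_trans[OF integral_norm_bound integral_mono])
         (use ig T le in \<open>auto intro!: Bochner_Integration.integrable_diff integrable_mult_left integrable_of_real\<close>)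
    also have "\<dots> = e/2 + 2 * B / d\<^sup>2 * (1 / Suc k)\<^sup>2" using T by simp
    also have "\<dots> < e" using k0 k by simp
    finally show ?thesis .
  qed
  then show "\<exists>no. \<forall>k\<ge>no. norm ((\<integral>\<xi>. of_real (theta_hat_seq k \<xi>) * g \<xi> \<partial>m) - g 0) < e" by blast
qed

end

lemma square_norm_diff: "(cmod (a - b))\<^sup>2 = (cmod a)\<^sup>2 + (cmod b)\<^sup>2 - 2 * Re (a * cnj b)"
  by (simp add: cmod_power2) (simp add: power2_eq_square algebra_simps)

context adelic_haar
begin

section \<open>Plancherel's theorem\<close>

definition adele_box :: "nat \<Rightarrow> adele set"
  where "adele_box n = {- real n<..<real n} \<times> ideal (exp_psi E (- int n))"

lemma box_borel [measurable]: "adele_box n \<in> sets borel" and open_box: "open (adele_box n)"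
proof -
  show "open (adele_box n)" unfolding adele_box_def by (intro open_Times open_greaterThanLessThan open_ideal)
  then show "adele_box n \<in> sets borel" by (rule borel_open)
qed

lemma emeasure_box: "emeasure m (adele_box n) < \<infinity>"
proof -
  have "emeasure m (adele_box n) = emeasure lborel {- real n<..<real n} * emeasure \<mu> (ideal (exp_psi E (- int n)))"
    unfolding adele_box_def adele_measure_def by (rule \<mu>.emeasure_pair_measure_Times) auto
  also have "\<dots> < \<infinity>" by (simp add: emeasure_ideal exp_psi_pos[OF E] ennreal_mult_less_top)
  finally show ?thesis .
qed

lemma box_mono: "n \<le> k \<Longrightarrow> adele_box n \<subseteq> adele_box k"
  using ideal_mono[OF exp_psi_zmul[OF E] exp_psi_pos[OF E], of "- int k" "- int n"]
  by (auto simp: adele_box_def)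

lemma box_exhausts: "(\<Union>n. adele_box n) = UNIV"
proof -
  have "\<exists>n. x \<in> adele_box n" for x
  proof -
    obtain i where i: "snd x \<in> ideal (exp_psi E (- int i))" using ideal_exhausts by blast
    obtain j where j: "\<bar>fst x\<bar> < real j" using reals_Archimedean2 by blast
    have "snd x \<in> ideal (exp_psi E (- int (max i j)))"
      using i ideal_mono[OF exp_psi_zmul[OF E] exp_psi_pos[OF E], of "- int (max i j)" "- int i"] by auto
    then show ?thesis using j by (intro exI[of _ "max i j"]) (auto simp: adele_box_def mem_Times_iff)
  qed
  then show ?thesis by blast
qed

text \<open>For a closed set \<open>K\<close> of finite measure, \<open>\<parallel>1\<^sub>K(\<cdot> + z) - 1\<^sub>K\<parallel>\<^sup>2\<close> is twice the measure of
  \<open>(K - z) - K\<close>, and no point outside \<open>K\<close> lies in \<open>K - z\<close> for small \<open>z\<close>.\<close>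

lemma translation_continuous_closed:
  assumes K: "closed K" "K \<subseteq> adele_box N" and z: "z \<longlonglongrightarrow> 0"
  shows "(\<lambda>n. L2_norm m (\<lambda>x. indicator K (x + z n) - indicator K x)) \<longlonglongrightarrow> 0"
proof -
  have [measurable]: "K \<in> sets borel" using K(1) by (rule borel_closed)
  have fin: "emeasure m K < \<infinity>"
    by (rule order.strict_trans1[OF emeasure_mono[OF K(2)] emeasure_box]) auto
  have ind: "integrable m (indicator K :: _ \<Rightarrow> real)" by (rule integrable_real_indicator) (use fin in auto)
  have indz: "integrable m (\<lambda>x. indicator K (x + a) :: real)" for a
    using ind integral_translate(2)[of "indicator K :: _ \<Rightarrow> real" a] by simp
  have [measurable]: "(\<lambda>x. indicator K (x + a) :: real) \<in> borel_measurable m" for a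
    using indz by (rule borel_measurable_integrable)
  let ?V = "{-1<..<1::real} \<times> ideal (exp_psi E (- int N))"
  have prod: "integrable m (\<lambda>x. indicator K (x + a) * (1 - indicator K x) :: real)" for a
    by (rule Bochner_Integration.integrable_bound[OF indz[of a]]) (auto simp: indicator_def)
  have norm: "L2_norm m (\<lambda>x. indicator K (x + a) - indicator K x) =
      sqrt (2 * (\<integral>x. indicator K (x + a) * (1 - indicator K x) \<partial>m))" for a
  proof -
    have "(\<integral>x. (cmod (indicator K (x + a) - indicator K x))\<^sup>2 \<partial>m) =
      (\<integral>x. 2 * (indicator K (x + a) * (1 - indicator K x)) + (indicator K x - indicator K (x + a)) \<partial>m)"
      by (intro Bochner_Integration.integral_cong) (auto simp: indicator_def)
    also have "\<dots> = 2 * (\<integral>x. indicator K (x + a) * (1 - indicator K x) \<partial>m) +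
        ((\<integral>x. indicator K x \<partial>m) - (\<integral>x. indicator K (x + a) \<partial>m))"
      using prod[of a] ind indz[of a] by simp
    also have "(\<integral>x. indicator K x \<partial>m) - (\<integral>x. indicator K (x + a) \<partial>m) = (0::real)"
      using integral_translate(1)[of "indicator K :: _ \<Rightarrow> real" a] by simp
    finally show ?thesis by (simp add: L2_norm_def)
  qed
  have V: "open ?V" "0 \<in> ?V"
    by (intro open_Times open_ideal open_greaterThanLessThan)
       (simp add: zero_prod_def ideal_def in_ideal_0 exp_psi_pos[OF E])
  have "\<forall>\<^sub>F n in sequentially. z n \<in> ?V" by (rule topological_tendstoD[OF z V])
  then obtain n0 where n0: "\<And>n. n \<ge> n0 \<Longrightarrow> z n \<in> ?V" by (auto simp: eventually_sequentially)
  let ?w = "indicator (adele_box (Suc N)) :: adele \<Rightarrow> real"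
  have "(\<lambda>n. \<integral>x. indicator K (x + z (n + n0)) * (1 - indicator K x) \<partial>m) \<longlonglongrightarrow> (\<integral>x. (0::real) \<partial>m)"
  proof (rule integral_dominated_convergence[where w = ?w])
    show "integrable m ?w" by (rule integrable_real_indicator) (use emeasure_box in auto)
    show "AE x in m. (\<lambda>n. indicator K (x + z (n + n0)) * (1 - indicator K x) :: real) \<longlonglongrightarrow> 0"
    proof (rule AE_I2)
      fix x
      show "(\<lambda>n. indicator K (x + z (n + n0)) * (1 - indicator K x) :: real) \<longlonglongrightarrow> 0"
      proof (cases "x \<in> K")
        case False
        have "(\<lambda>n. x + z (n + n0)) \<longlonglongrightarrow> x + 0"
          by (intro tendsto_add tendsto_const LIMSEQ_ignore_initial_segment z)
        moreover have "open (- K)" "x + 0 \<in> - K" using K False by auto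
        ultimately have "\<forall>\<^sub>F n in sequentially. x + z (n + n0) \<in> - K" by (rule topological_tendstoD)
        then show ?thesis by (intro tendsto_eventually) (auto elim!: eventually_mono)
      qed simp
    qed
    show "AE x in m. norm (indicator K (x + z (n + n0)) * (1 - indicator K x) :: real) \<le> ?w x" for n
    proof (rule AE_I2)
      fix x
      show "norm (indicator K (x + z (n + n0)) * (1 - indicator K x) :: real) \<le> ?w x"
      proof (cases "x + z (n + n0) \<in> K")
        case True
        then have b: "x + z (n + n0) \<in> adele_box N" using K by blast
        have v: "z (n + n0) \<in> ?V" using n0 by simp
        have "in_ideal (exp_psi E (- int N)) (snd x + snd (z (n + n0)) - snd (z (n + n0)))"
          using b v by (intro in_ideal_diff) (auto simp: adele_box_def ideal_def mem_Times_iff)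
        then have "in_ideal (exp_psi E (- int (Suc N))) (snd x)"
          using in_ideal_trans[OF _ exp_psi_zmul[OF E] exp_psi_pos[OF E], of "- int N" "snd x" "- int (Suc N)"] by simp
        moreover have "\<bar>fst x\<bar> < real (Suc N)"
          using b v by (auto simp: adele_box_def mem_Times_iff)
        ultimately have "x \<in> adele_box (Suc N)" by (auto simp: adele_box_def mem_Times_iff ideal_def)
        then show ?thesis by (auto simp: indicator_def)
      qed simp
    qed
  qed measurable
  then have "(\<lambda>n. sqrt (2 * (\<integral>x. indicator K (x + z (n + n0)) * (1 - indicator K x) \<partial>m))) \<longlonglongrightarrow> sqrt (2 * (\<integral>x. (0::real) \<partial>m))"
    by (intro tendsto_intros)
  then have "(\<lambda>n. L2_norm m (\<lambda>x. indicator K (x + z (n + n0)) - indicator K x)) \<longlonglongrightarrow> 0"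
    unfolding norm by simp
  then show ?thesis by (rule LIMSEQ_offset)
qed

text \<open>Inner regularity of finite measures on Polish spaces, applied to the restriction of the measure to a
  set of finite measure.\<close>

lemma closed_approx:
  assumes [measurable]: "A \<in> sets borel" and e: "e > 0"
  shows "\<exists>K. closed K \<and> K \<subseteq> A \<inter> adele_box n \<and> emeasure m (A \<inter> adele_box n) \<le> emeasure m K + ennreal e"
proof -
  let ?N = "density m (indicator (adele_box n))"
  have N: "emeasure ?N B = emeasure m (B \<inter> adele_box n)" if "B \<in> sets borel" for B
    using that by (subst emeasure_density) (auto simp: nn_integral_indicator Int_commute mult_ac simp flip: indicator_inter_arith)
  have fin: "emeasure ?N (space ?N) \<noteq> \<infinity>" using N[of UNIV] emeasure_box[of n] by simp
  have "emeasure ?N (A \<inter> adele_box n) = (SUP K\<in>{K. K \<subseteq> A \<inter> adele_box n \<and> compact K}. emeasure ?N K)"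
    by (rule inner_regular[OF _ fin]) auto
  also have "\<dots> \<le> (SUP K\<in>{K. K \<subseteq> A \<inter> adele_box n \<and> compact K}. emeasure m K)"
    by (intro SUP_subset_mono) (auto simp: N compact_imp_closed borel_closed intro!: emeasure_mono)
  finally have le: "emeasure m (A \<inter> adele_box n) \<le> (SUP K\<in>{K. K \<subseteq> A \<inter> adele_box n \<and> compact K}. emeasure m K)"
    by (simp add: N Int_assoc)
  have fin2: "(SUP K\<in>{K. K \<subseteq> A \<inter> adele_box n \<and> compact K}. emeasure m K) < \<infinity>"
    by (rule order.strict_trans1[OF SUP_least[of _ _ "emeasure m (adele_box n)"] emeasure_box]) (auto intro!: emeasure_mono)
  have "\<exists>K\<in>{K. K \<subseteq> A \<inter> adele_box n \<and> compact K}. (SUP K\<in>{K. K \<subseteq> A \<inter> adele_box n \<and> compact K}. emeasure m K) < emeasure m K + ennreal e"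
  proof (rule SUP_approx_ennreal[OF e _ refl])
    show "{K. K \<subseteq> A \<inter> adele_box n \<and> compact K} \<noteq> {}" by (auto intro!: exI[of _ "{}"])
  qed (rule less_imp_neq[OF fin2])
  then show ?thesis using le compact_imp_closed by (metis (mono_tags, lifting) dual_order.trans less_imp_le mem_Collect_eq)
qed

lemma L2_norm_indicator_diff:
  assumes "K \<subseteq> A" and [measurable]: "K \<in> sets borel" "A \<in> sets borel" and fin: "emeasure m A < \<infinity>"
  shows "L2_norm m (\<lambda>x. indicator K x - indicator A x) = sqrt (measure m A - measure m K)"
proof -
  have "(\<integral>x. (cmod (indicator K x - indicator A x))\<^sup>2 \<partial>m) = (\<integral>x. indicator (A - K) x \<partial>m)"
    using assms(1) by (intro Bochner_Integration.integral_cong) (auto simp: indicator_def)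
  also have "\<dots> = measure m (A - K)" by simp
  also have "\<dots> = measure m A - measure m K" using assms by (intro measure_Diff) auto
  finally show ?thesis by (simp add: L2_norm_def)
qed

text \<open>By \<open>closed_approx\<close> the continuity passes from closed sets to all measurable sets of finite measure, and
  as translations are isometries, the functions with the property form a closed subspace.\<close>

lemma translation_continuous:
  assumes "f \<in> L2 m" "z \<longlonglongrightarrow> 0"
  shows "(\<lambda>n. L2_norm m (\<lambda>x. f (x + z n) - f x)) \<longlonglongrightarrow> 0"
proof -
  let ?P = "\<lambda>f. \<forall>z. z \<longlonglongrightarrow> 0 \<longrightarrow> (\<lambda>n. L2_norm m (\<lambda>x. f (x + z n) - f x)) \<longlonglongrightarrow> 0"
  have closed: "?P f" if s: "\<And>n. s n \<in> L2 m" "\<And>n. ?P (s n)" and f: "f \<in> L2 m"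
    and l: "(\<lambda>n. L2_norm m (\<lambda>x. s n x - f x)) \<longlonglongrightarrow> 0" for s f
  proof (intro allI impI LIMSEQ_I)
    fix z :: "nat \<Rightarrow> adele" and e :: real assume z: "z \<longlonglongrightarrow> 0" and e: "e > 0"
    obtain k where k: "L2_norm m (\<lambda>x. s k x - f x) < e / 3"
      using LIMSEQ_D[OF l, of "e/3"] e by auto
    obtain n0 where n0: "\<And>n. n \<ge> n0 \<Longrightarrow> L2_norm m (\<lambda>x. s k (x + z n) - s k x) < e / 3"
      using LIMSEQ_D[OF s(2)[rule_format, OF z, of k], of "e/3"] e by auto
    have "L2_norm m (\<lambda>x. f (x + z n) - f x) < e" if n: "n \<ge> n0" for n
    proof -
      have "L2_norm m (\<lambda>x. f (x + z n) - f x) \<le>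
          L2_norm m (\<lambda>x. f (x + z n) - s k (x + z n)) + L2_norm m (\<lambda>x. s k (x + z n) - f x)"
        by (intro L2_norm_triangle_diff L2_translate s f)
      also have "L2_norm m (\<lambda>x. s k (x + z n) - f x) \<le>
          L2_norm m (\<lambda>x. s k (x + z n) - s k x) + L2_norm m (\<lambda>x. s k x - f x)"
        by (intro L2_norm_triangle_diff L2_translate s f)
      also have "L2_norm m (\<lambda>x. f (x + z n) - s k (x + z n)) = L2_norm m (\<lambda>x. s k x - f x)"
        using L2_norm_translate[OF L2_diff[OF f s(1)[of k]], of "z n"] L2_norm_commute[of m f "s k"] by simp
      finally show ?thesis using k n0[OF n] by linarith
    qed
    then show "\<exists>no. \<forall>n\<ge>no. norm (L2_norm m (\<lambda>x. f (x + z n) - f x) - 0) < e" by (intro exI[of _ n0]) simp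
  qed
  have "?P f" using assms(1) space_m
  proof (induction rule: L2_induct)
    case (indicator A)
    then have A [measurable]: "A \<in> sets borel" and fin: "emeasure m A < \<infinity>" by simp_all
    have "\<exists>K. closed K \<and> K \<subseteq> A \<inter> adele_box n \<and> emeasure m (A \<inter> adele_box n) \<le> emeasure m K + ennreal (1 / Suc n)" for n
      by (rule closed_approx[OF A]) simp
    then obtain K where K: "\<And>n. closed (K n)" "\<And>n. K n \<subseteq> A \<inter> adele_box n"
      "\<And>n. emeasure m (A \<inter> adele_box n) \<le> emeasure m (K n) + ennreal (1 / Suc n)" by metis
    have [measurable]: "K n \<in> sets borel" for n using K(1) by (rule borel_closed)
    have fin': "emeasure m B < \<infinity>" if "B \<subseteq> A" for B
      by (rule order.strict_trans1[OF emeasure_mono[OF that] fin]) simp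
    have KA: "K n \<subseteq> A" for n using K(2) by blast
    have K3: "measure m (A \<inter> adele_box n) - 1 / Suc n \<le> measure m (K n)" for n
    proof -
      have "ennreal (measure m (A \<inter> adele_box n)) \<le> ennreal (measure m (K n) + 1 / Suc n)"
        using K(3)[of n] fin'[of "A \<inter> adele_box n"] fin'[OF KA[of n]]
        by (subst ennreal_plus) (auto simp: emeasure_eq_ennreal_measure less_top[symmetric])
      then show ?thesis by (subst (asm) ennreal_le_iff) (auto simp: algebra_simps)
    qed
    have "(\<lambda>n. measure m (A \<inter> adele_box n)) \<longlonglongrightarrow> measure m (\<Union>n. A \<inter> adele_box n)"
      using box_mono fin'[of "\<Union>n. A \<inter> adele_box n"] by (intro Lim_measure_incseq) (auto simp: incseq_def)
    moreover have "(\<Union>n. A \<inter> adele_box n) = A" using box_exhausts by blast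
    ultimately have "(\<lambda>n. measure m (A \<inter> adele_box n) - 1 / Suc n) \<longlonglongrightarrow> measure m A - 0"
      using LIMSEQ_inverse_real_of_nat by (intro tendsto_diff) (auto simp: inverse_eq_divide)
    then have low: "(\<lambda>n. measure m (A \<inter> adele_box n) - 1 / Suc n) \<longlonglongrightarrow> measure m A" by simp
    have "(\<lambda>n. measure m (K n)) \<longlonglongrightarrow> measure m A"
    proof (rule tendsto_sandwich[OF _ _ low tendsto_const])
      show "\<forall>\<^sub>F n in sequentially. measure m (A \<inter> adele_box n) - 1 / Suc n \<le> measure m (K n)" using K3 by simp
      show "\<forall>\<^sub>F n in sequentially. measure m (K n) \<le> measure m A"
        using KA fin by (intro always_eventually allI measure_mono_fmeasurable) (auto simp: fmeasurable_def)
    qed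
    then have "(\<lambda>n. sqrt (measure m A - measure m (K n))) \<longlonglongrightarrow> sqrt (measure m A - measure m A)"
      by (intro tendsto_intros)
    then have l: "(\<lambda>n. L2_norm m (\<lambda>x. indicator (K n) x - indicator A x)) \<longlonglongrightarrow> 0"
      using fin by (subst L2_norm_indicator_diff[OF KA]) auto
    show ?case
    proof (rule closed[OF _ _ _ l])
      show "indicator (K n) \<in> L2 m" for n using fin'[OF KA] by (intro L2_indicator) auto
      show "indicator A \<in> L2 m" using fin by (intro L2_indicator) auto
      show "?P (indicator (K n))" for n using translation_continuous_closed[OF K(1), of n n] K(2)[of n] by blast
    qed
  next
    case (add f g)
    show ?case
    proof (intro allI impI)
      fix z :: "nat \<Rightarrow> adele" assume z: "z \<longlonglongrightarrow> 0"
      have l: "(\<lambda>n. L2_norm m (\<lambda>x. f (x + z n) - f x) + L2_norm m (\<lambda>x. g (x + z n) - g x)) \<longlonglongrightarrow> 0"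
        using add z tendsto_add[of "\<lambda>n. L2_norm m (\<lambda>x. f (x + z n) - f x)" 0] by fastforce
      show "(\<lambda>n. L2_norm m (\<lambda>x. f (x + z n) + g (x + z n) - (f x + g x))) \<longlonglongrightarrow> 0"
      proof (rule Lim_null_comparison[OF always_eventually l], intro allI)
        fix n
        show "norm (L2_norm m (\<lambda>x. f (x + z n) + g (x + z n) - (f x + g x))) \<le>
          L2_norm m (\<lambda>x. f (x + z n) - f x) + L2_norm m (\<lambda>x. g (x + z n) - g x)"
          using L2_norm_triangle[OF L2_diff[OF L2_translate[OF add(1)] add(1)] L2_diff[OF L2_translate[OF add(2)] add(2)], of "z n" "z n"]
          by (simp add: add_diff_add)
      qed
    qed
  next
    case (cmult f c)
    show ?case
    proof (intro allI impI)
      fix z :: "nat \<Rightarrow> adele" assume z: "z \<longlonglongrightarrow> 0"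
      have "(\<lambda>n. cmod c * L2_norm m (\<lambda>x. f (x + z n) - f x)) \<longlonglongrightarrow> cmod c * 0"
        using cmult z by (intro tendsto_intros) auto
      then show "(\<lambda>n. L2_norm m (\<lambda>x. c * f (x + z n) - c * f x)) \<longlonglongrightarrow> 0"
        by (simp add: L2_norm_cmult flip: right_diff_distrib)
    qed
  next
    case (lim s f)
    show ?case by (rule closed[OF lim(1,4,2,3)])
  qed
  then show ?thesis using assms(2) by blast
qed

lemma add_measurable_mm [measurable]: "(\<lambda>p. fst p + snd p) \<in> m \<Otimes>\<^sub>M m \<rightarrow>\<^sub>M borel"
proof -
  have "sets (m \<Otimes>\<^sub>M m) = sets (borel \<Otimes>\<^sub>M borel :: (adele \<times> adele) measure)"
    by (intro sets_pair_measure_cong) auto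
  then have "sets (m \<Otimes>\<^sub>M m) = sets borel" by (simp only: borel_prod)
  moreover have "(\<lambda>p::adele \<times> adele. fst p + snd p) \<in> borel_measurable borel"
    by (intro borel_measurable_continuous_onI continuous_intros)
  ultimately show ?thesis by (simp cong: measurable_cong_sets)
qed

text \<open>Up to a reflection \<open>|FT f|\<^sup>2\<close> is the Fourier transform of this function, so that Plancherel's theorem
  is Fourier inversion at \<open>0\<close>, where its value is \<open>\<parallel>f\<parallel>\<^sup>2\<close>.\<close>

definition autocorrelation :: "(adele \<Rightarrow> complex) \<Rightarrow> adele \<Rightarrow> complex"
  where "autocorrelation f y = (\<integral>x. f x * cnj (f (y + x)) \<partial>m)"

lemma integrable_autocorrelation:
  assumes "f \<in> L2 m" shows "integrable m (\<lambda>x. f x * cnj (f (y + x)))"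
  using L2_integrable_mult[OF assms L2_cnj[OF L2_translate[OF assms, of y]]] by (simp add: add.commute)

lemma integrable_autocorrelation': "f \<in> L2 m \<Longrightarrow> integrable m (\<lambda>x. f x * cnj (f (x + y)))"
  using integrable_autocorrelation[of f y] by (simp add: add.commute)

lemma autocorrelation_measurable2:
  assumes "f \<in> L2 m" shows "(\<lambda>p. f (snd p) * cnj (f (fst p + snd p))) \<in> borel_measurable (m \<Otimes>\<^sub>M m)"
proof -
  have f: "f \<in> borel_measurable m" "f \<in> borel_measurable borel" using assms by (auto simp: L2_def cong: measurable_cong_sets)
  show ?thesis
    by (intro borel_measurable_times borel_measurable_cnj measurable_compose[OF measurable_snd f(1)]
        measurable_compose[OF add_measurable_mm f(2)])
qed

lemma autocorrelation_measurable: "f \<in> L2 m \<Longrightarrow> autocorrelation f \<in> borel_measurable m"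
  unfolding autocorrelation_def[abs_def] using autocorrelation_measurable2
  by (intro m.borel_measurable_lebesgue_integral) (simp add: split_beta)

lemma autocorrelation_bound:
  assumes "f \<in> L2 m"
  shows "(\<integral>x. cmod (f x) * cmod (f (y + x)) \<partial>m) \<le> (L2_norm m f)\<^sup>2"
    and "cmod (autocorrelation f y) \<le> (L2_norm m f)\<^sup>2"
proof -
  have y: "(\<lambda>x. f (x + y)) \<in> L2 m" using L2_translate[OF assms] .
  show 1: "(\<integral>x. cmod (f x) * cmod (f (y + x)) \<partial>m) \<le> (L2_norm m f)\<^sup>2"
    using L2_Cauchy_Schwarz(1)[OF assms y] L2_norm_translate[OF assms, of y]
    by (simp add: power2_eq_square add.commute)
  have "cmod (autocorrelation f y) \<le> (\<integral>x. cmod (f x * cnj (f (y + x))) \<partial>m)"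
    unfolding autocorrelation_def by (rule integral_norm_bound)
  with 1 show "cmod (autocorrelation f y) \<le> (L2_norm m f)\<^sup>2" by (simp add: norm_mult)
qed

lemma autocorrelation_0: "autocorrelation f 0 = of_real ((L2_norm m f)\<^sup>2)"
  unfolding autocorrelation_def L2_norm_square by (simp add: complex_norm_square[symmetric] del: of_real_power)

lemma isCont_autocorrelation:
  assumes f: "f \<in> L2 m" shows "isCont (autocorrelation f) 0"
  unfolding continuous_at_sequentially o_def
proof (intro allI impI)
  fix z :: "nat \<Rightarrow> adele" assume z: "z \<longlonglongrightarrow> 0"
  show "(\<lambda>n. autocorrelation f (z n)) \<longlonglongrightarrow> autocorrelation f 0"
  proof (rule Lim_transform2[OF tendsto_const])
    have "(\<lambda>n. L2_norm m f * L2_norm m (\<lambda>x. f (x + z n) - f x)) \<longlonglongrightarrow> L2_norm m f * 0"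
      by (intro tendsto_intros translation_continuous f z)
    then have l: "(\<lambda>n. L2_norm m f * L2_norm m (\<lambda>x. f (x + z n) - f x)) \<longlonglongrightarrow> 0" by simp
    show "(\<lambda>n. autocorrelation f 0 - autocorrelation f (z n)) \<longlonglongrightarrow> 0"
    proof (rule Lim_null_comparison[OF always_eventually l], intro allI)
      fix n
      have d: "(\<lambda>x. f (x + z n) - f x) \<in> L2 m" by (intro L2_diff L2_translate f)
      have "autocorrelation f (z n) - autocorrelation f 0 = (\<integral>x. f x * cnj (f (x + z n) - f x) \<partial>m)"
        unfolding autocorrelation_def
        by (subst Bochner_Integration.integral_diff[symmetric])
           (auto intro!: integrable_autocorrelation[OF f] integrable_autocorrelation'[OF f] integrable_autocorrelation[OF f, of 0, simplified] simp: algebra_simps)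
      also have "cmod \<dots> \<le> L2_norm m f * L2_norm m (\<lambda>x. cnj (f (x + z n) - f x))"
        by (rule L2_Cauchy_Schwarz(2)[OF f L2_cnj[OF d]])
      finally show "norm (autocorrelation f 0 - autocorrelation f (z n)) \<le> L2_norm m f * L2_norm m (\<lambda>x. f (x + z n) - f x)"
        by (simp only: L2_norm_cnj norm_minus_commute)
    qed
  qed
qed

text \<open>By Fubini's theorem the integral of \<open>|FT f|\<^sup>2 theta\<close> is the integral of the autocorrelation of
  \<open>f\<close> against the Fourier transform of \<open>theta\<close>. As \<open>theta\<close> increases to \<open>1\<close>, this Fourier transform
  concentrates at \<open>0\<close>.\<close>

lemma Plancherel_regularised:
  assumes f: "integrable m f" "f \<in> L2 m" and s: "\<sigma> > 0" and r: "r > 0"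
  shows "integrable m (\<lambda>\<xi>. (cmod (FT f \<xi>))\<^sup>2 * theta \<sigma> r \<xi>)"
    and "of_real (\<integral>\<xi>. (cmod (FT f \<xi>))\<^sup>2 * theta \<sigma> r \<xi> \<partial>m) = (\<integral>y. of_real (theta_hat \<sigma> r y) * autocorrelation f y \<partial>m)"
proof -
  have [measurable]: "f \<in> borel_measurable m" using f by auto
  let ?T = "theta \<sigma> r" and ?U = "theta_hat \<sigma> r"
  let ?h = "\<lambda>\<xi>. of_real (?T \<xi>) * cnj (FT f \<xi>)"
  let ?C = "\<integral>x. cmod (f x) \<partial>m"
  have U0: "?U y \<ge> 0" for y by (rule theta_hat_nonneg[OF r])
  have iT: "integrable m (\<lambda>\<xi>. complex_of_real (?T \<xi>))" using integrable_theta[OF s r] by (rule integrable_of_real)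
  have ih: "integrable m ?h"
  proof (rule Bochner_Integration.integrable_bound)
    show "integrable m (\<lambda>\<xi>. ?C * ?T \<xi>)" using integrable_theta[OF s r] by simp
    show "AE \<xi> in m. norm (?h \<xi>) \<le> norm (?C * ?T \<xi>)"
      using norm_FT_le[OF f(1)] by (intro AE_I2) (auto simp: norm_mult theta_bounds mult.commute[of ?C] intro!: mult_left_mono)
  qed measurable
  have sq: "FT f \<xi> * ?h \<xi> = of_real ((cmod (FT f \<xi>))\<^sup>2 * ?T \<xi>)" for \<xi>
    unfolding of_real_mult complex_norm_square by (simp add: mult_ac)
  have "integrable m (\<lambda>\<xi>. FT f \<xi> * ?h \<xi>)"
  proof (rule Bochner_Integration.integrable_bound)
    show "integrable m (\<lambda>\<xi>. ?C * cmod (?h \<xi>))" using ih by simp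
    show "AE \<xi> in m. norm (FT f \<xi> * ?h \<xi>) \<le> norm (?C * cmod (?h \<xi>))"
      using norm_FT_le[OF f(1)] by (intro AE_I2) (auto simp: norm_mult abs_mult intro!: mult_right_mono)
  qed (use ih in measurable)
  then show "integrable m (\<lambda>\<xi>. (cmod (FT f \<xi>))\<^sup>2 * ?T \<xi>)" unfolding sq complex_of_real_integrable_eq .
  have FTh: "FT ?h x = cnj (\<integral>y. of_real (?U y) * f (y + x) \<partial>m)" for x
  proof -
    have fx: "integrable m (\<lambda>y. f (y + x))" using integral_translate(2)[of f x] f by simp
    have "FT ?h x = (\<integral>\<xi>. cnj (FT (\<lambda>y. f (y + x)) \<xi> * of_real (?T \<xi>)) \<partial>m)"
      unfolding FT_def[of ?h] FT_translate[OF \<open>f \<in> borel_measurable m\<close>]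
      by (intro Bochner_Integration.integral_cong) (auto simp: adele_mult_commute[of x])
    also have "\<dots> = cnj (\<integral>\<xi>. FT (\<lambda>y. f (y + x)) \<xi> * of_real (?T \<xi>) \<partial>m)" by (rule Bochner_Integration.integral_cnj)
    also have "(\<integral>\<xi>. FT (\<lambda>y. f (y + x)) \<xi> * of_real (?T \<xi>) \<partial>m) = (\<integral>y. f (y + x) * of_real (?U y) \<partial>m)"
      unfolding FT_multiplication[OF fx iT] FT_theta[OF s r] ..
    finally show ?thesis by (simp add: mult.commute)
  qed
  let ?G = "\<lambda>(y, x). of_real (?U y) * (f x * cnj (f (y + x)))"
  have Gm [measurable]: "?G \<in> borel_measurable (m \<Otimes>\<^sub>M m)"
    unfolding split_beta
    by (intro borel_measurable_times autocorrelation_measurable2 f measurable_compose[OF measurable_fst]) auto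
  have iG: "integrable (m \<Otimes>\<^sub>M m) ?G"
  proof (rule mm.Fubini_integrable[OF Gm])
    show "AE y in m. integrable m (\<lambda>x. ?G (y, x))"
      using integrable_autocorrelation[OF f(2)] by simp
    show "integrable m (\<lambda>y. \<integral>x. norm (?G (y, x)) \<partial>m)"
    proof (rule Bochner_Integration.integrable_bound)
      show "integrable m (\<lambda>y. ?U y * (L2_norm m f)\<^sup>2)" using theta_hat_prob(1)[OF s r] by simp
      show "(\<lambda>y. \<integral>x. norm (?G (y, x)) \<partial>m) \<in> borel_measurable m"
        by (intro m.borel_measurable_lebesgue_integral) (use measurable_compose[OF Gm borel_measurable_norm] in \<open>simp add: split_beta\<close>)
      show "AE y in m. norm (\<integral>x. norm (?G (y, x)) \<partial>m) \<le> norm (?U y * (L2_norm m f)\<^sup>2)"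
        using autocorrelation_bound(1)[OF f(2)] U0
        by (intro AE_I2) (auto simp: norm_mult intro!: mult_left_mono)
    qed
  qed
  have "of_real (\<integral>\<xi>. (cmod (FT f \<xi>))\<^sup>2 * ?T \<xi> \<partial>m) = (\<integral>\<xi>. FT f \<xi> * ?h \<xi> \<partial>m)"
    unfolding sq integral_complex_of_real ..
  also have "\<dots> = (\<integral>x. f x * FT ?h x \<partial>m)" by (rule FT_multiplication[OF f(1) ih])
  also have "\<dots> = (\<integral>x. (\<integral>y. ?G (y, x) \<partial>m) \<partial>m)"
  proof (intro Bochner_Integration.integral_cong refl)
    fix x
    have "(\<integral>y. ?G (y, x) \<partial>m) = (\<integral>y. f x * cnj (of_real (?U y) * f (y + x)) \<partial>m)"
      by (intro Bochner_Integration.integral_cong) (simp_all add: mult_ac)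
    also have "\<dots> = f x * (\<integral>y. cnj (of_real (?U y) * f (y + x)) \<partial>m)" by (rule integral_mult_right_zero)
    finally show "f x * FT ?h x = (\<integral>y. ?G (y, x) \<partial>m)" unfolding FTh Bochner_Integration.integral_cnj ..
  qed
  also have "\<dots> = (\<integral>y. (\<integral>x. ?G (y, x) \<partial>m) \<partial>m)"
    using mm.Fubini_integral[of "\<lambda>y x. ?G (y, x)"] iG by (simp add: split_beta)
  also have "\<dots> = (\<integral>y. of_real (?U y) * autocorrelation f y \<partial>m)"
    unfolding autocorrelation_def by simp
  finally show "of_real (\<integral>\<xi>. (cmod (FT f \<xi>))\<^sup>2 * ?T \<xi> \<partial>m) = (\<integral>y. of_real (?U y) * autocorrelation f y \<partial>m)" .
qed

text \<open>As the regularisers increase to \<open>1\<close>, monotone convergence applies to the integrals of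
  \<open>|FT f|\<^sup>2\<close>, without knowing beforehand that they are finite, and the approximate identity to those of
  the autocorrelation.\<close>

theorem Plancherel:
  assumes f: "integrable m f" "f \<in> L2 m"
  shows "FT f \<in> L2 m" "L2_norm m (FT f) = L2_norm m f"
proof -
  have [measurable]: "f \<in> borel_measurable m" using f by auto
  have s: "1 / real (Suc k) > 0" "exp_psi E (- int k) > 0" for k using exp_psi_pos[OF E] by auto
  have reg: "integrable m (\<lambda>\<xi>. (cmod (FT f \<xi>))\<^sup>2 * theta_seq k \<xi>)"
    "of_real (\<integral>\<xi>. (cmod (FT f \<xi>))\<^sup>2 * theta_seq k \<xi> \<partial>m) = (\<integral>y. of_real (theta_hat_seq k y) * autocorrelation f y \<partial>m)" for k
    using Plancherel_regularised[OF f s(1)[of k] s(2)[of k]] by (simp_all only: theta_seq_def theta_hat_seq_def)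
  have "(\<lambda>k. \<integral>y. of_real (theta_hat_seq k y) * autocorrelation f y \<partial>m) \<longlonglongrightarrow> autocorrelation f 0"
    by (rule theta_hat_seq_approx_identity[OF autocorrelation_measurable[OF f(2)] autocorrelation_bound(2)[OF f(2)] isCont_autocorrelation[OF f(2)]])
  then have "(\<lambda>k. complex_of_real (\<integral>\<xi>. (cmod (FT f \<xi>))\<^sup>2 * theta_seq k \<xi> \<partial>m)) \<longlonglongrightarrow> complex_of_real ((L2_norm m f)\<^sup>2)"
    unfolding reg(2) autocorrelation_0 .
  then have lim: "(\<lambda>k. \<integral>\<xi>. (cmod (FT f \<xi>))\<^sup>2 * theta_seq k \<xi> \<partial>m) \<longlonglongrightarrow> (L2_norm m f)\<^sup>2"
    by (simp only: tendsto_of_real_iff)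
  have mono: "AE \<xi> in m. mono (\<lambda>k. (cmod (FT f \<xi>))\<^sup>2 * theta_seq k \<xi>)"
    by (intro AE_I2 incseq_SucI mult_left_mono theta_seq_mono) auto
  have tend: "AE \<xi> in m. (\<lambda>k. (cmod (FT f \<xi>))\<^sup>2 * theta_seq k \<xi>) \<longlonglongrightarrow> (cmod (FT f \<xi>))\<^sup>2"
    using tendsto_mult[OF tendsto_const theta_seq_tendsto] by (intro AE_I2) fastforce
  have meas: "(\<lambda>\<xi>. (cmod (FT f \<xi>))\<^sup>2) \<in> borel_measurable m" by measurable
  show "FT f \<in> L2 m"
    by (intro L2_I integrable_monotone_convergence[OF reg(1) mono tend lim meas]) measurable
  have "(L2_norm m (FT f))\<^sup>2 = (L2_norm m f)\<^sup>2"
    unfolding L2_norm_square[of m "FT f"] by (rule integral_monotone_convergence[OF reg(1) mono tend lim meas])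
  then show "L2_norm m (FT f) = L2_norm m f" by simp
qed


section \<open>The Fourier transform on square integrable functions\<close>

abbreviation isF :: "(adele \<Rightarrow> complex) \<Rightarrow> (adele \<Rightarrow> complex) \<Rightarrow> bool"
  where "isF \<equiv> is_fourier E \<mu>"

lemma isF_iff: "isF \<phi> \<psi> \<longleftrightarrow> \<phi> \<in> L2 m \<and> \<psi> \<in> L2 m \<and>
    (\<exists>s. (\<forall>n. integrable m (s n) \<and> s n \<in> L2 m) \<and>
      (\<lambda>n. L2_norm m (\<lambda>x. s n x - \<phi> x)) \<longlonglongrightarrow> 0 \<and>
      (\<lambda>n. L2_norm m (\<lambda>\<xi>. FT (s n) \<xi> - \<psi> \<xi>)) \<longlonglongrightarrow> 0)"
  using Plancherel(1) by (auto simp: is_fourier_def Let_def)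

lemma isF_FT: "integrable m f \<Longrightarrow> f \<in> L2 m \<Longrightarrow> isF f (FT f)"
  unfolding isF_iff by (auto simp: Plancherel L2_norm_def intro!: exI[of _ "\<lambda>_. f"])

lemma isF_L2: "isF \<phi> \<psi> \<Longrightarrow> \<phi> \<in> L2 m" "isF \<phi> \<psi> \<Longrightarrow> \<psi> \<in> L2 m"
  by (auto simp: isF_iff)

lemma isF_norm: assumes "isF \<phi> \<psi>" shows "L2_norm m \<psi> = L2_norm m \<phi>"
proof -
  from assms obtain s where s: "\<And>n. integrable m (s n)" "\<And>n. s n \<in> L2 m"
    "(\<lambda>n. L2_norm m (\<lambda>x. s n x - \<phi> x)) \<longlonglongrightarrow> 0" "(\<lambda>n. L2_norm m (\<lambda>\<xi>. FT (s n) \<xi> - \<psi> \<xi>)) \<longlonglongrightarrow> 0"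
    by (auto simp: isF_iff)
  have "(\<lambda>n. L2_norm m (s n)) \<longlonglongrightarrow> L2_norm m \<phi>" by (rule tendsto_L2_norm[OF s(2) isF_L2(1)[OF assms] s(3)])
  moreover have "(\<lambda>n. L2_norm m (FT (s n))) \<longlonglongrightarrow> L2_norm m \<psi>"
    by (rule tendsto_L2_norm[OF Plancherel(1)[OF s(1,2)] isF_L2(2)[OF assms] s(4)])
  ultimately show ?thesis using LIMSEQ_unique by (simp add: Plancherel(2)[OF s(1,2)])
qed

lemma isF_linear:
  assumes "isF \<phi> \<psi>" "isF \<phi>' \<psi>'" shows "isF (\<lambda>x. \<phi> x + c * \<phi>' x) (\<lambda>x. \<psi> x + c * \<psi>' x)"
proof -
  note L2 = isF_L2[OF assms(1)] isF_L2[OF assms(2)]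
  from assms obtain s s' where s: "\<And>n. integrable m (s n)" "\<And>n. s n \<in> L2 m"
    "(\<lambda>n. L2_norm m (\<lambda>x. s n x - \<phi> x)) \<longlonglongrightarrow> 0" "(\<lambda>n. L2_norm m (\<lambda>\<xi>. FT (s n) \<xi> - \<psi> \<xi>)) \<longlonglongrightarrow> 0"
    and s': "\<And>n. integrable m (s' n)" "\<And>n. s' n \<in> L2 m"
    "(\<lambda>n. L2_norm m (\<lambda>x. s' n x - \<phi>' x)) \<longlonglongrightarrow> 0" "(\<lambda>n. L2_norm m (\<lambda>\<xi>. FT (s' n) \<xi> - \<psi>' \<xi>)) \<longlonglongrightarrow> 0"
    by (auto simp: isF_iff)
  have *: "(\<lambda>n. L2_norm m (\<lambda>x. (a n x + c * b n x) - (f x + c * g x))) \<longlonglongrightarrow> 0"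
    if a: "\<And>n. a n \<in> L2 m" "(\<lambda>n. L2_norm m (\<lambda>x. a n x - f x)) \<longlonglongrightarrow> 0" "f \<in> L2 m"
      and b: "\<And>n. b n \<in> L2 m" "(\<lambda>n. L2_norm m (\<lambda>x. b n x - g x)) \<longlonglongrightarrow> 0" "g \<in> L2 m" for a b f g
  proof (rule Lim_null_comparison[OF always_eventually], intro allI)
    fix n
    have "L2_norm m (\<lambda>x. (a n x - f x) + c * (b n x - g x)) \<le> L2_norm m (\<lambda>x. a n x - f x) + L2_norm m (\<lambda>x. c * (b n x - g x))"
      by (intro L2_norm_triangle L2_diff L2_cmult a b)
    also have "(\<lambda>x. (a n x - f x) + c * (b n x - g x)) = (\<lambda>x. (a n x + c * b n x) - (f x + c * g x))"
      by (simp add: algebra_simps)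
    finally show "norm (L2_norm m (\<lambda>x. (a n x + c * b n x) - (f x + c * g x))) \<le>
        L2_norm m (\<lambda>x. a n x - f x) + cmod c * L2_norm m (\<lambda>x. b n x - g x)"
      by (simp only: L2_norm_cmult real_norm_def abs_of_nonneg L2_norm_nonneg)
  next
    show "(\<lambda>n. L2_norm m (\<lambda>x. a n x - f x) + cmod c * L2_norm m (\<lambda>x. b n x - g x)) \<longlonglongrightarrow> 0"
      using tendsto_add[OF a(2) tendsto_mult[OF tendsto_const b(2), of "cmod c"]] by simp
  qed
  show ?thesis unfolding isF_iff
  proof (intro conjI exI[of _ "\<lambda>n x. s n x + c * s' n x"] allI)
    have "FT (\<lambda>x. s n x + c * s' n x) = (\<lambda>\<xi>. FT (s n) \<xi> + c * FT (s' n) \<xi>)" for n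
      using FT_add[OF s(1)[of n], of "\<lambda>x. c * s' n x"] s'(1)[of n] by (simp add: fun_eq_iff FT_cmult)
    then show "(\<lambda>n. L2_norm m (\<lambda>\<xi>. FT (\<lambda>x. s n x + c * s' n x) \<xi> - (\<psi> \<xi> + c * \<psi>' \<xi>))) \<longlonglongrightarrow> 0"
      using *[OF Plancherel(1)[OF s(1,2)] s(4) L2(2) Plancherel(1)[OF s'(1,2)] s'(4) L2(4)] by simp
  qed (use s s' L2 in \<open>auto intro!: L2_add L2_cmult *\<close>)
qed

text \<open>Transforms of approximating simple functions form a Cauchy sequence by Plancherel's theorem, and \<open>L\<^sup>2\<close> is
  complete.\<close>

lemma isF_exists: assumes f: "f \<in> L2 m" shows "\<exists>\<psi>. isF f \<psi>"
proof -
  from L2_approx_simple[OF f] obtain s where s: "\<And>n. integrable m (s n)" "\<And>n. s n \<in> L2 m"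
    "(\<lambda>n. L2_norm m (\<lambda>x. s n x - f x)) \<longlonglongrightarrow> 0" by blast
  have "\<exists>\<psi>\<in>L2 m. (\<lambda>n. L2_norm m (\<lambda>x. FT (s n) x - \<psi> x)) \<longlonglongrightarrow> 0"
  proof (rule L2_complete[OF Plancherel(1)[OF s(1,2)]])
    fix e :: real assume "e > 0"
    then obtain N where N: "\<And>n. n \<ge> N \<Longrightarrow> L2_norm m (\<lambda>x. s n x - f x) < e / 2"
      using LIMSEQ_D[OF s(3), of "e/2"] by auto
    have "L2_norm m (\<lambda>x. FT (s i) x - FT (s j) x) < e" if "i \<ge> N" "j \<ge> N" for i j
    proof -
      have "FT (\<lambda>x. s i x + (- 1) * s j x) = (\<lambda>x. FT (s i) x - FT (s j) x)"
        using FT_add[OF s(1)[of i], of "\<lambda>x. (-1) * s j x"] FT_cmult[of "-1" "s j"] s(1)[of j] by (simp add: fun_eq_iff)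
      then have "L2_norm m (\<lambda>x. FT (s i) x - FT (s j) x) = L2_norm m (\<lambda>x. s i x - s j x)"
        using Plancherel(2)[of "\<lambda>x. s i x + (- 1) * s j x"] s(1) L2_diff[OF s(2) s(2)] by simp
      also have "\<dots> \<le> L2_norm m (\<lambda>x. s i x - f x) + L2_norm m (\<lambda>x. f x - s j x)"
        by (intro L2_norm_triangle_diff s f)
      also have "\<dots> < e" using N[OF that(1)] N[OF that(2)] L2_norm_commute[of m f "s j"] by simp
      finally show ?thesis .
    qed
    then show "\<exists>N. \<forall>i\<ge>N. \<forall>j\<ge>N. L2_norm m (\<lambda>x. FT (s i) x - FT (s j) x) < e" by blast
  qed
  then show ?thesis using s f unfolding isF_iff by blast
qed

lemma isF_unique: assumes "isF \<phi> \<psi>" "isF \<phi> \<psi>'" shows "AE x in m. \<psi> x = \<psi>' x"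
proof -
  have "isF (\<lambda>x. \<phi> x + (- 1) * \<phi> x) (\<lambda>x. \<psi> x + (- 1) * \<psi>' x)" by (rule isF_linear[OF assms])
  then have F: "isF (\<lambda>x. 0) (\<lambda>x. \<psi> x - \<psi>' x)" by simp
  from isF_norm[OF F] have "L2_norm m (\<lambda>x. \<psi> x - \<psi>' x) = 0" by (simp add: L2_norm_def)
  then show ?thesis using L2_norm_eq_0_iff[OF isF_L2(2)[OF F]] by simp
qed

lemma isF_cong_AE:
  assumes F: "isF \<phi> \<psi>" and meas: "\<phi>' \<in> borel_measurable m" "\<psi>' \<in> borel_measurable m"
    and AE: "AE x in m. \<phi> x = \<phi>' x" "AE x in m. \<psi> x = \<psi>' x"
  shows "isF \<phi>' \<psi>'"
proof -
  note [measurable] = meas L2_measurable[OF isF_L2(1)[OF F]] L2_measurable[OF isF_L2(2)[OF F]]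
  from F obtain s where s: "\<And>n. integrable m (s n)" "\<And>n. s n \<in> L2 m"
    "(\<lambda>n. L2_norm m (\<lambda>x. s n x - \<phi> x)) \<longlonglongrightarrow> 0" "(\<lambda>n. L2_norm m (\<lambda>\<xi>. FT (s n) \<xi> - \<psi> \<xi>)) \<longlonglongrightarrow> 0"
    by (auto simp: isF_iff)
  have [measurable]: "s n \<in> borel_measurable m" for n using s(2) by (rule L2_measurable)
  have "L2_norm m (\<lambda>x. s n x - \<phi> x) = L2_norm m (\<lambda>x. s n x - \<phi>' x)"
    "L2_norm m (\<lambda>x. FT (s n) x - \<psi> x) = L2_norm m (\<lambda>x. FT (s n) x - \<psi>' x)" for n
    using AE by (intro L2_norm_cong_AE; auto)+
  then show ?thesis unfolding isF_iff
    using s L2_cong_AE[OF isF_L2(1)[OF F] meas(1) AE(1)] L2_cong_AE[OF isF_L2(2)[OF F] meas(2) AE(2)]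
    by (intro conjI exI[of _ s]) auto
qed

lemma isF_multiplication:
  assumes "isF \<phi> \<psi>" "isF \<phi>' \<psi>'" shows "(\<integral>x. \<psi> x * \<phi>' x \<partial>m) = (\<integral>x. \<phi> x * \<psi>' x \<partial>m)"
proof -
  note L2 = isF_L2[OF assms(1)] isF_L2[OF assms(2)]
  from assms obtain s s' where s: "\<And>n. integrable m (s n)" "\<And>n. s n \<in> L2 m"
    "(\<lambda>n. L2_norm m (\<lambda>x. s n x - \<phi> x)) \<longlonglongrightarrow> 0" "(\<lambda>n. L2_norm m (\<lambda>\<xi>. FT (s n) \<xi> - \<psi> \<xi>)) \<longlonglongrightarrow> 0"
    and s': "\<And>n. integrable m (s' n)" "\<And>n. s' n \<in> L2 m"
    "(\<lambda>n. L2_norm m (\<lambda>x. s' n x - \<phi>' x)) \<longlonglongrightarrow> 0" "(\<lambda>n. L2_norm m (\<lambda>\<xi>. FT (s' n) \<xi> - \<psi>' \<xi>)) \<longlonglongrightarrow> 0"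
    by (auto simp: isF_iff)
  have "(\<lambda>n. \<integral>x. FT (s n) x * s' n x \<partial>m) \<longlonglongrightarrow> (\<integral>x. \<psi> x * \<phi>' x \<partial>m)"
    by (rule tendsto_L2_inner[OF Plancherel(1)[OF s(1,2)] L2(2) s(4) s'(2) L2(3) s'(3)])
  moreover have "(\<lambda>n. \<integral>x. s n x * FT (s' n) x \<partial>m) \<longlonglongrightarrow> (\<integral>x. \<phi> x * \<psi>' x \<partial>m)"
    by (rule tendsto_L2_inner[OF s(2) L2(1) s(3) Plancherel(1)[OF s'(1,2)] L2(4) s'(4)])
  ultimately show ?thesis using LIMSEQ_unique by (simp add: FT_multiplication[OF s(1) s'(1)])
qed

text \<open>The inverse is \<open>g \<mapsto> cnj (F (cnj g))\<close>: both functions have the same norm, and by the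
  multiplication formula the inner product of \<open>F (cnj h)\<close> and \<open>g\<close> is \<open>\<parallel>g\<parallel>\<^sup>2\<close> as well.\<close>

lemma isF_inverse:
  assumes F: "isF (\<lambda>x. cnj (g x)) h" shows "isF (\<lambda>x. cnj (h x)) g"
proof -
  have L2: "g \<in> L2 m" "h \<in> L2 m" using isF_L2[OF F] L2_cnj[of "\<lambda>x. cnj (g x)" m] by auto
  obtain \<psi> where \<psi>: "isF (\<lambda>x. cnj (h x)) \<psi>" using isF_exists[OF L2_cnj[OF L2(2)]] by blast
  have \<psi>L2: "\<psi> \<in> L2 m" using isF_L2(2)[OF \<psi>] .
  have n: "L2_norm m h = L2_norm m g" "L2_norm m \<psi> = L2_norm m g"
    using isF_norm[OF F] isF_norm[OF \<psi>] by simp_all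
  have "(\<integral>x. \<psi> x * cnj (g x) \<partial>m) = (\<integral>x. cnj (h x) * h x \<partial>m)" by (rule isF_multiplication[OF \<psi> F])
  also have "\<dots> = (\<integral>x. of_real ((cmod (h x))\<^sup>2) \<partial>m)"
    by (intro Bochner_Integration.integral_cong) (simp_all only: complex_norm_square mult.commute)
  also have "\<dots> = of_real ((L2_norm m g)\<^sup>2)" unfolding integral_complex_of_real n(1)[symmetric] L2_norm_square ..
  finally have inner: "Re (\<integral>x. \<psi> x * cnj (g x) \<partial>m) = (L2_norm m g)\<^sup>2" by simp
  have i: "integrable m (\<lambda>x. \<psi> x * cnj (g x))" by (intro L2_integrable_mult \<psi>L2 L2_cnj L2)
  have "(L2_norm m (\<lambda>x. \<psi> x - g x))\<^sup>2 = (\<integral>x. (cmod (\<psi> x))\<^sup>2 + (cmod (g x))\<^sup>2 - 2 * Re (\<psi> x * cnj (g x)) \<partial>m)"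
    unfolding L2_norm_square
    by (simp only: square_norm_diff)
  also have "\<dots> = (L2_norm m \<psi>)\<^sup>2 + (L2_norm m g)\<^sup>2 - 2 * Re (\<integral>x. \<psi> x * cnj (g x) \<partial>m)"
    unfolding L2_norm_square integral_Re[OF i, symmetric]
    using integrable_Re[OF i] L2_integrable_square[OF \<psi>L2] L2_integrable_square[OF L2(1)]
    by (simp only: Bochner_Integration.integral_diff Bochner_Integration.integral_add integral_mult_right_zero
        Bochner_Integration.integrable_add integrable_mult_right)
  also have "\<dots> = 0" unfolding inner n by simp
  finally have "AE x in m. \<psi> x = g x" using L2_norm_eq_0_iff[OF L2_diff[OF \<psi>L2 L2(1)]] by simp
  then show ?thesis
    using L2 by (intro isF_cong_AE[OF \<psi>]) (auto intro!: L2_measurable borel_measurable_cnj)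
qed

lemma isF_surj: assumes "\<psi> \<in> L2 m" shows "\<exists>\<phi>. isF \<phi> \<psi>"
  using isF_exists[OF L2_cnj[OF assms]] isF_inverse by blast

lemma isF_fourier: "\<phi> \<in> L2 m \<Longrightarrow> isF \<phi> (fourier E \<mu> \<phi>)"
  unfolding fourier_def by (rule someI_ex[OF isF_exists])

lemma isF_inv_fourier: assumes \<psi>: "\<psi> \<in> L2 m" shows "isF (inv_fourier E \<mu> \<psi>) \<psi>"
proof -
  obtain \<phi> where \<phi>: "isF \<phi> \<psi>" using isF_surj[OF \<psi>] by blast
  then have "\<phi> \<in> L2 m \<and> (AE \<xi> in m. fourier E \<mu> \<phi> \<xi> = \<psi> \<xi>)"
    using isF_unique[OF isF_fourier \<phi>] isF_L2(1)[OF \<phi>] by blast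
  then have "inv_fourier E \<mu> \<psi> \<in> L2 m \<and> (AE \<xi> in m. fourier E \<mu> (inv_fourier E \<mu> \<psi>) \<xi> = \<psi> \<xi>)"
    unfolding inv_fourier_def by (rule someI[of "\<lambda>\<phi>. \<phi> \<in> L2 m \<and> (AE \<xi> in m. fourier E \<mu> \<phi> \<xi> = \<psi> \<xi>)"])
  then show ?thesis using \<psi> by (intro isF_cong_AE[OF isF_fourier[of "inv_fourier E \<mu> \<psi>"]]) auto
qed

end

section \<open>Positivity of the stable densities\<close>

lemma integral_nonneg_Reals:
  assumes "\<And>x. f x \<in> (\<real>\<^sub>\<ge>\<^sub>0 :: complex set)" shows "(\<integral>x. f x \<partial>M) \<in> \<real>\<^sub>\<ge>\<^sub>0"
proof -
  have "f x = of_real (Re (f x))" and pos: "Re (f x) \<ge> 0" for x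
    using assms[of x] by (auto simp: complex_nonneg_Reals_iff complex_eq_iff)
  then have "(\<integral>x. f x \<partial>M) = (\<integral>x. of_real (Re (f x)) \<partial>M)" by presburger
  then show ?thesis using pos by simp
qed

text \<open>By Bochner's theorem, for integrable continuous functions this is positive definiteness.\<close>

definition nonneg_FT :: "(real \<Rightarrow> real) \<Rightarrow> bool"
  where "nonneg_FT \<phi> \<longleftrightarrow> (\<forall>\<xi>. (\<integral>s. of_real (\<phi> s) * chi_inf (\<xi> * s) \<partial>lborel) \<in> \<real>\<^sub>\<ge>\<^sub>0)"

lemma chi_inf_measurable [measurable]: "(\<lambda>s. chi_inf (\<xi> * s)) \<in> borel_measurable borel"
  unfolding chi_inf_def by measurable

lemma integrable_mult_chi_inf:
  assumes "integrable lborel \<phi>" shows "integrable lborel (\<lambda>s. of_real (\<phi> s) * chi_inf (\<xi> * s))"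
proof -
  have [measurable]: "\<phi> \<in> borel_measurable lborel" using assms by auto
  show ?thesis
    by (rule Bochner_Integration.integrable_bound[OF assms]) (auto simp: norm_mult norm_chi_inf)
qed

lemma nonneg_FT_gauss:
  assumes u: "u > 0"
  shows "nonneg_FT (\<lambda>s. exp (- u * s\<^sup>2))" "integrable lborel (\<lambda>s::real. exp (- u * s\<^sup>2))"
proof -
  define \<sigma> where "\<sigma> = sqrt (u / (2 * pi\<^sup>2))"
  have s: "\<sigma> > 0" "- 2 * pi\<^sup>2 * \<sigma>\<^sup>2 = - u" using u by (simp_all add: \<sigma>_def)
  show "nonneg_FT (\<lambda>s. exp (- u * s\<^sup>2))"
    using integral_gauss_chi_inf(1)[OF s(1), unfolded s(2)] by (simp add: nonneg_FT_def normal_density_nonneg del: of_real_exp)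
  show "integrable lborel (\<lambda>s. exp (- u * s\<^sup>2))"
    using integral_gauss_chi_inf(2)[OF s(1)] by (simp only: s(2))
qed

lemma nonneg_FT_sum:
  assumes "finite A" "\<And>i. i \<in> A \<Longrightarrow> c i \<ge> 0" "\<And>i. i \<in> A \<Longrightarrow> nonneg_FT (\<phi> i)" "\<And>i. i \<in> A \<Longrightarrow> integrable lborel (\<phi> i)"
  shows "nonneg_FT (\<lambda>s. \<Sum>i\<in>A. c i * \<phi> i s)"
  unfolding nonneg_FT_def
proof
  fix \<xi>
  have "(\<integral>s. of_real (\<Sum>i\<in>A. c i * \<phi> i s) * chi_inf (\<xi> * s) \<partial>lborel) =
      (\<integral>s. (\<Sum>i\<in>A. of_real (c i) * (of_real (\<phi> i s) * chi_inf (\<xi> * s))) \<partial>lborel)"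
    by (intro Bochner_Integration.integral_cong) (auto simp: sum_distrib_right mult.assoc)
  also have "\<dots> = (\<Sum>i\<in>A. of_real (c i) * (\<integral>s. of_real (\<phi> i s) * chi_inf (\<xi> * s) \<partial>lborel))"
    by (subst Bochner_Integration.integral_sum) (auto intro!: integrable_mult_right integrable_mult_chi_inf assms)
  also have "\<dots> \<in> \<real>\<^sub>\<ge>\<^sub>0"
    using assms(1-3) by (induction A) (auto simp: nonneg_FT_def intro!: nonneg_Reals_add_I nonneg_Reals_mult_I)
  finally show "(\<integral>s. of_real (\<Sum>i\<in>A. c i * \<phi> i s) * chi_inf (\<xi> * s) \<partial>lborel) \<in> \<real>\<^sub>\<ge>\<^sub>0" .
qed

lemma nonneg_FT_limit:
  assumes "\<And>n. nonneg_FT (\<phi>' n)" "integrable lborel w"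
    and meas: "\<And>n. \<phi>' n \<in> borel_measurable borel" "\<phi> \<in> borel_measurable borel"
    and lim: "AE s in lborel. (\<lambda>n. \<phi>' n s) \<longlonglongrightarrow> \<phi> s" and bound: "\<And>n. AE s in lborel. \<bar>\<phi>' n s\<bar> \<le> w s"
  shows "nonneg_FT \<phi>"
  unfolding nonneg_FT_def
proof
  fix \<xi>
  note [measurable] = meas
  have l: "(\<lambda>n. \<integral>s. of_real (\<phi>' n s) * chi_inf (\<xi> * s) \<partial>lborel) \<longlonglongrightarrow> (\<integral>s. of_real (\<phi> s) * chi_inf (\<xi> * s) \<partial>lborel)"
  proof (rule integral_dominated_convergence[OF _ _ assms(2)])
    show "AE s in lborel. (\<lambda>n. of_real (\<phi>' n s) * chi_inf (\<xi> * s)) \<longlonglongrightarrow> of_real (\<phi> s) * chi_inf (\<xi> * s)"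
      using lim by eventually_elim (rule tendsto_mult[OF tendsto_of_real tendsto_const])
    show "AE s in lborel. norm (of_real (\<phi>' n s) * chi_inf (\<xi> * s)) \<le> w s" for n
      using bound[of n] by (simp add: norm_mult norm_chi_inf)
  qed measurable
  show "(\<integral>s. of_real (\<phi> s) * chi_inf (\<xi> * s) \<partial>lborel) \<in> \<real>\<^sub>\<ge>\<^sub>0"
    by (rule closed_sequentially[OF closed_nonneg_Reals_complex _ l])
       (rule assms(1)[unfolded nonneg_FT_def, rule_format])
qed

definition nonneg_power_series :: "(real \<Rightarrow> real) \<Rightarrow> bool"
  where "nonneg_power_series g \<longleftrightarrow> (\<exists>c. (\<forall>k. c k \<ge> 0) \<and> (\<forall>z. 0 \<le> z \<longrightarrow> z < 1 \<longrightarrow> (\<lambda>k. c k * z ^ k) sums g z))"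

lemma nonneg_power_series_mult:
  assumes "nonneg_power_series f" "nonneg_power_series g" shows "nonneg_power_series (\<lambda>z. f z * g z)"
proof -
  obtain a b where a: "\<And>k. a k \<ge> 0" "\<And>z. 0 \<le> z \<Longrightarrow> z < 1 \<Longrightarrow> (\<lambda>k. a k * z ^ k) sums f z"
    and b: "\<And>k. b k \<ge> 0" "\<And>z. 0 \<le> z \<Longrightarrow> z < 1 \<Longrightarrow> (\<lambda>k. b k * z ^ k) sums g z"
    using assms unfolding nonneg_power_series_def by blast
  have "(\<lambda>k. (\<Sum>i\<le>k. a i * b (k - i)) * z ^ k) sums (f z * g z)" if z: "0 \<le> z" "z < 1" for z
  proof -
    have "(\<lambda>k. \<Sum>i\<le>k. (a i * z ^ i) * (b (k - i) * z ^ (k - i))) sums ((\<Sum>k. a k * z ^ k) * (\<Sum>k. b k * z ^ k))"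
      using a(1) b(1) a(2)[OF z] b(2)[OF z] z by (intro Cauchy_product_sums) (auto simp: sums_iff abs_mult)
    moreover have "(\<Sum>i\<le>k. (a i * z ^ i) * (b (k - i) * z ^ (k - i))) = (\<Sum>i\<le>k. a i * b (k - i)) * z ^ k" for k
      unfolding sum_distrib_right by (intro sum.cong) (auto simp: power_add[symmetric] mult_ac)
    ultimately show ?thesis using a(2)[OF z] b(2)[OF z] by (simp add: sums_iff)
  qed
  then show ?thesis unfolding nonneg_power_series_def
    using a(1) b(1) by (intro exI[of _ "\<lambda>k. \<Sum>i\<le>k. a i * b (k - i)"]) (auto intro!: sum_nonneg mult_nonneg_nonneg)
qed

lemma nonneg_power_series_power:
  assumes "nonneg_power_series f" shows "nonneg_power_series (\<lambda>z. f z ^ n)"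
proof (induction n)
  case 0
  have "(\<lambda>k. (if k = 0 then 1 else 0) * z ^ k) sums 1" for z :: real
    using sums_single[of 0 "\<lambda>k. z ^ k"] by (simp add: if_distrib[of "\<lambda>x. x * _"] cong: if_cong)
  then show ?case unfolding nonneg_power_series_def
    by (intro exI[of _ "\<lambda>k. if k = 0 then 1 else 0"]) simp
qed (use assms in \<open>simp add: nonneg_power_series_mult\<close>)

text \<open>The generating function of the Sibuya distribution. In the binomial series of \<open>(1 - z)\<^sup>\<gamma>\<close> the
  quotient \<open>(k - \<gamma>) / (k + 1)\<close> of consecutive coefficients is negative only for \<open>k = 0\<close>, so that all
  coefficients but the first are nonpositive.\<close>

lemma nonneg_power_series_Sibuya:
  assumes g: "0 < \<gamma>" "\<gamma> \<le> 1" shows "nonneg_power_series (\<lambda>z. 1 - (1 - z) powr \<gamma>)"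
proof -
  define b where "b k = (\<gamma> gchoose k) * (- 1) ^ k" for k
  have b0: "b 0 = 1" by (simp add: b_def)
  have step: "b (Suc k) = b k * (of_nat k - \<gamma>) / of_nat (Suc k)" for k
    by (simp add: b_def gbinomial_prod_rev field_simps)
  have neg: "b (Suc k) \<le> 0" for k
  proof (induction k)
    case 0
    then show ?case using g step[of 0] b0 by simp
  next
    case (Suc k)
    have "b (Suc k) * (of_nat (Suc k) - \<gamma>) \<le> 0" using Suc g by (intro mult_nonpos_nonneg) auto
    then show ?case unfolding step[of "Suc k"] by (intro divide_nonpos_pos) auto
  qed
  define c where "c k = (if k = 0 then 0 else - b k)" for k
  have "(\<lambda>k. c k * z ^ k) sums (1 - (1 - z) powr \<gamma>)" if z: "0 \<le> z" "z < 1" for z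
  proof -
    have "(\<lambda>k. b k * z ^ k) sums (1 - z) powr \<gamma>"
      using gen_binomial_real[of "- z" \<gamma>] z by (simp add: b_def mult.assoc flip: power_mult_distrib)
    from sums_diff[OF sums_single[of 0 "\<lambda>_. 1"] this]
    have "(\<lambda>k. (if k = 0 then 1 else 0) - b k * z ^ k) sums (1 - (1 - z) powr \<gamma>)" .
    moreover have "(if k = 0 then 1 else 0) - b k * z ^ k = c k * z ^ k" for k by (simp add: c_def b0)
    ultimately show ?thesis by simp
  qed
  moreover have "c k \<ge> 0" for k using neg[of "k - 1"] by (cases k) (auto simp: c_def)
  ultimately show ?thesis unfolding nonneg_power_series_def by blast
qed

text \<open>A power series in a Gaussian is a series of Gaussians. The factor \<open>exp (- e s\<^sup>2)\<close> makes the partial sums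
  dominated by an integrable function; without it not even the limit need be integrable, as \<open>g\<close> may have
  a constant term.\<close>

lemma nonneg_FT_power_series:
  assumes g: "nonneg_power_series g" "\<And>z. 0 \<le> z \<Longrightarrow> z < 1 \<Longrightarrow> g z \<le> 1" and b: "b > 0" and e: "e > 0"
    and meas: "(\<lambda>s. g (exp (- b * s\<^sup>2))) \<in> borel_measurable borel"
  shows "nonneg_FT (\<lambda>s. g (exp (- b * s\<^sup>2)) * exp (- e * s\<^sup>2))"
proof -
  obtain c where c: "\<And>k. c k \<ge> 0" "\<And>z. 0 \<le> z \<Longrightarrow> z < 1 \<Longrightarrow> (\<lambda>k. c k * z ^ k) sums g z"
    using g(1) unfolding nonneg_power_series_def by blast
  let ?S = "\<lambda>n s. \<Sum>k<n. c k * exp (- (real k * b + e) * s\<^sup>2)"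
  have eq: "?S n s = (\<Sum>k<n. c k * exp (- b * s\<^sup>2) ^ k) * exp (- e * s\<^sup>2)" for n and s :: real
    unfolding sum_distrib_right
    by (intro sum.cong) (auto simp: algebra_simps exp_add[symmetric] simp flip: exp_of_nat_mult)
  have z: "0 \<le> exp (- b * s\<^sup>2)" "exp (- b * s\<^sup>2) < 1" if "s \<noteq> 0" for s :: real using b that by simp_all
  have AE: "AE s in lborel. s \<noteq> (0::real)" by (rule AE_lborel_singleton)
  show ?thesis
  proof (rule nonneg_FT_limit[of ?S])
    show "nonneg_FT (?S n)" for n
      using c(1) b e by (intro nonneg_FT_sum nonneg_FT_gauss) (auto intro!: add_nonneg_pos)
    show "integrable lborel (\<lambda>s. exp (- e * s\<^sup>2))" by (rule nonneg_FT_gauss(2)[OF e])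
    show "AE s in lborel. (\<lambda>n. ?S n s) \<longlonglongrightarrow> g (exp (- b * s\<^sup>2)) * exp (- e * s\<^sup>2)"
      using AE
    proof eventually_elim
      case (elim s)
      show ?case unfolding eq
        using c(2)[OF z[OF elim]] unfolding sums_def by (intro tendsto_intros)
    qed
    show "AE s in lborel. \<bar>?S n s\<bar> \<le> exp (- e * s\<^sup>2)" for n
      using AE
    proof eventually_elim
      case (elim s)
      have "(\<Sum>k<n. c k * exp (- b * s\<^sup>2) ^ k) \<le> g (exp (- b * s\<^sup>2))"
        using c(1) c(2)[OF z[OF elim]] sum_le_suminf[of "\<lambda>k. c k * exp (- b * s\<^sup>2) ^ k" "{..<n}"] by (simp add: sums_iff)
      also have "\<dots> \<le> 1" by (rule g(2)[OF z[OF elim]])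
      finally have "(\<Sum>k<n. c k * exp (- b * s\<^sup>2) ^ k) * exp (- e * s\<^sup>2) \<le> 1 * exp (- e * s\<^sup>2)"
        by (rule mult_right_mono) simp
      moreover have "0 \<le> (\<Sum>k<n. c k * exp (- b * s\<^sup>2) ^ k)" using c(1) by (intro sum_nonneg) auto
      ultimately show ?case unfolding eq by (simp add: abs_mult)
    qed
  qed (use meas in measurable)
qed

lemma exp_powr_decay:
  fixes t a :: real assumes "t > 0" "a > 0"
  shows "\<exists>C. \<forall>r\<ge>0. exp (- t * r powr a) \<le> C * inverse (1 + r\<^sup>2)"
proof -
  have "((\<lambda>r::real. r\<^sup>2 * exp (- t * r powr a)) \<longlongrightarrow> 0) at_top" using assms by real_asymp
  then have "\<forall>\<^sub>F r in at_top. r\<^sup>2 * exp (- t * r powr a) < 1" by (rule order_tendstoD(2)) simp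
  then obtain R where R: "\<And>r. r \<ge> R \<Longrightarrow> r\<^sup>2 * exp (- t * r powr a) < 1" by (auto simp: eventually_at_top_linorder)
  have "exp (- t * r powr a) * (1 + r\<^sup>2) \<le> 2 + R\<^sup>2" if r: "r \<ge> 0" for r
  proof (cases "r \<ge> R")
    case True
    have "exp (- t * r powr a) \<le> 1" using assms by simp
    moreover have "exp (- t * r powr a) * (1 + r\<^sup>2) = exp (- t * r powr a) + r\<^sup>2 * exp (- t * r powr a)"
      by (simp add: algebra_simps)
    ultimately show ?thesis using R[OF True] zero_le_power2[of R] by linarith
  next
    case False
    have "exp (- t * r powr a) * (1 + r\<^sup>2) \<le> 1 * (1 + r\<^sup>2)" using assms by (intro mult_right_mono) auto
    moreover have "r\<^sup>2 \<le> R\<^sup>2" using False r by (intro power_mono) auto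
    ultimately show ?thesis by simp
  qed
  then have "exp (- t * r powr a) \<le> (2 + R\<^sup>2) * inverse (1 + r\<^sup>2)" if "r \<ge> 0" for r
    using that by (simp add: divide_inverse[symmetric] pos_le_divide_eq add_pos_nonneg)
  then show ?thesis by blast
qed

lemma integrable_exp_powr:
  assumes "t > 0" "a > 0" shows "integrable lborel (\<lambda>s::real. exp (- t * \<bar>s\<bar> powr a))"
proof -
  obtain C where C: "\<And>r. r \<ge> 0 \<Longrightarrow> exp (- t * r powr a) \<le> C * inverse (1 + r\<^sup>2)"
    using exp_powr_decay[OF assms] by blast
  have "integrable lborel (\<lambda>x::real. C * inverse (1 + x\<^sup>2))"
    using integrable_inverse_1_plus_square by (simp add: set_integrable_def)
  then show ?thesis
  proof (rule Bochner_Integration.integrable_bound)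
    show "AE s in lborel. norm (exp (- t * \<bar>s\<bar> powr a)) \<le> norm (C * inverse (1 + s\<^sup>2))"
      using C[of "\<bar>s\<bar>" for s] by (intro AE_I2) (auto intro: order_trans[OF _ abs_ge_self])
  qed measurable
qed

text \<open>With \<open>\<gamma> = \<beta>/2\<close>, the functions \<open>(1 - (1 - z)\<^sup>\<gamma>)\<^sup>n\<close> at \<open>z = exp (- c s\<^sup>2 / n\<^sup>1\<^sup>/\<^sup>\<gamma>)\<close> are
  nonnegative combinations of Gaussians and tend to \<open>exp (- t |s|\<^sup>\<beta>)\<close>, where \<open>c\<^sup>\<gamma> = t\<close>.\<close>

lemma nonneg_FT_stable:
  assumes t: "t > 0" and b: "0 < \<beta>" "\<beta> \<le> 2"
  shows "nonneg_FT (\<lambda>s. exp (- t * \<bar>s\<bar> powr \<beta>))"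
proof -
  define \<gamma> where "\<gamma> = \<beta> / 2"
  have g: "0 < \<gamma>" "\<gamma> \<le> 1" using b by (simp_all add: \<gamma>_def)
  define c where "c = t powr (1 / \<gamma>)"
  have c: "c > 0" using t by (simp add: c_def)
  have ceq: "(c * s\<^sup>2) powr \<gamma> = t * \<bar>s\<bar> powr \<beta>" for s
  proof -
    have "s\<^sup>2 powr \<gamma> = \<bar>s\<bar> powr \<beta>"
    proof (cases "s = 0")
      case False
      then have "s\<^sup>2 = \<bar>s\<bar> powr 2" by simp
      then show ?thesis by (simp only: powr_powr \<gamma>_def) simp
    qed simp
    then show ?thesis using g t by (simp add: powr_mult c_def powr_powr)
  qed
  let ?g = "\<lambda>n z. (1 - (1 - z) powr \<gamma>) ^ n"
  let ?b = "\<lambda>n. c / real (Suc n) powr (1 / \<gamma>)"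
  have bounds: "0 \<le> 1 - (1 - z) powr \<gamma>" "1 - (1 - z) powr \<gamma> \<le> 1" if "0 \<le> z" "z \<le> 1" for z
    using that g powr_mono2[of \<gamma> "1 - z" 1] by auto
  have lim1: "(\<lambda>n. ?g (Suc n) (exp (- ?b n * s\<^sup>2))) \<longlonglongrightarrow> exp (- t * \<bar>s\<bar> powr \<beta>)" if s: "s \<noteq> 0" for s
  proof -
    define x where "x = c * s\<^sup>2"
    have x: "x > 0" using c s by (simp add: x_def)
    have "((\<lambda>n. (1 - (1 - exp (- (x / real n powr (1 / \<gamma>)))) powr \<gamma>) ^ n) \<longlongrightarrow> exp (- (x powr \<gamma>))) at_top"
      using x g by real_asymp
    from LIMSEQ_Suc[OF this] show ?thesis using ceq[of s] by (simp add: x_def)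
  qed
  have AE: "AE s in lborel. s \<noteq> (0::real)" by (rule AE_lborel_singleton)
  (* the Gaussian factor provides the integrable majorant for the limit in n; it is removed by a second limit *)
  have reg: "nonneg_FT (\<lambda>s. exp (- t * \<bar>s\<bar> powr \<beta>) * exp (- e * s\<^sup>2))" if e: "e > 0" for e
  proof (rule nonneg_FT_limit[of "\<lambda>n s. ?g (Suc n) (exp (- ?b n * s\<^sup>2)) * exp (- e * s\<^sup>2)"])
    show "nonneg_FT (\<lambda>s. ?g (Suc n) (exp (- ?b n * s\<^sup>2)) * exp (- e * s\<^sup>2))" for n
    proof (rule nonneg_FT_power_series[OF _ _ _ e])
      show "nonneg_power_series (?g (Suc n))" by (intro nonneg_power_series_power nonneg_power_series_Sibuya g)
      show "?g (Suc n) z \<le> 1" if "0 \<le> z" "z < 1" for z using bounds[of z] that by (intro power_le_one) auto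
    qed (use c in auto)
    show "integrable lborel (\<lambda>s. exp (- e * s\<^sup>2))" by (rule nonneg_FT_gauss(2)[OF e])
    show "AE s in lborel. (\<lambda>n. ?g (Suc n) (exp (- ?b n * s\<^sup>2)) * exp (- e * s\<^sup>2)) \<longlonglongrightarrow> exp (- t * \<bar>s\<bar> powr \<beta>) * exp (- e * s\<^sup>2)"
      using AE by eventually_elim (intro tendsto_mult lim1 tendsto_const)
    show "AE s in lborel. \<bar>?g (Suc n) (exp (- ?b n * s\<^sup>2)) * exp (- e * s\<^sup>2)\<bar> \<le> exp (- e * s\<^sup>2)" for n
    proof (rule AE_I2)
      fix s :: real
      have "- ?b n * s\<^sup>2 \<le> 0" using c by simp
      then have z: "0 \<le> exp (- ?b n * s\<^sup>2)" "exp (- ?b n * s\<^sup>2) \<le> 1" by simp_all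
      have "0 \<le> ?g (Suc n) (exp (- ?b n * s\<^sup>2))" "?g (Suc n) (exp (- ?b n * s\<^sup>2)) \<le> 1"
        by (intro zero_le_power power_le_one bounds z)+
      then show "\<bar>?g (Suc n) (exp (- ?b n * s\<^sup>2)) * exp (- e * s\<^sup>2)\<bar> \<le> exp (- e * s\<^sup>2)"
        by (simp add: abs_mult mult_le_cancel_right1 del: power_Suc)
    qed
  qed auto
  show ?thesis
  proof (rule nonneg_FT_limit[of "\<lambda>n s. exp (- t * \<bar>s\<bar> powr \<beta>) * exp (- (1 / Suc n) * s\<^sup>2)"])
    show "nonneg_FT (\<lambda>s. exp (- t * \<bar>s\<bar> powr \<beta>) * exp (- (1 / Suc n) * s\<^sup>2))" for n by (intro reg) simp
    show "integrable lborel (\<lambda>s. exp (- t * \<bar>s\<bar> powr \<beta>))" by (rule integrable_exp_powr[OF t b(1)])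
    show "AE s in lborel. (\<lambda>n. exp (- t * \<bar>s\<bar> powr \<beta>) * exp (- (1 / Suc n) * s\<^sup>2)) \<longlonglongrightarrow> exp (- t * \<bar>s\<bar> powr \<beta>)"
    proof (rule AE_I2)
      fix s :: real
      have "(\<lambda>n. exp (- t * \<bar>s\<bar> powr \<beta>) * exp (- (1 / real (Suc n)) * s\<^sup>2)) \<longlonglongrightarrow> exp (- t * \<bar>s\<bar> powr \<beta>) * exp (- 0 * s\<^sup>2)"
        using LIMSEQ_inverse_real_of_nat by (intro tendsto_intros) (simp add: inverse_eq_divide)
      then show "(\<lambda>n. exp (- t * \<bar>s\<bar> powr \<beta>) * exp (- (1 / Suc n) * s\<^sup>2)) \<longlonglongrightarrow> exp (- t * \<bar>s\<bar> powr \<beta>)" by simp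
    qed
    show "AE s in lborel. \<bar>exp (- t * \<bar>s\<bar> powr \<beta>) * exp (- (1 / Suc n) * s\<^sup>2)\<bar> \<le> exp (- t * \<bar>s\<bar> powr \<beta>)" for n
      by (intro AE_I2) (auto simp: abs_mult mult_le_cancel_left1)
  qed auto
qed


section \<open>The norm on the finite adeles\<close>

context adelic_haar
begin

lemma normf_add_small: "normf E y < c \<Longrightarrow> normf E x < c \<Longrightarrow> normf E (x + y) < c"
  using normf_ultrametric[OF E, of x y] by simp

lemma open_normf_less: "open {x. normf E x < c}"
proof (cases "c > 0")
  case True
  obtain r where r: "r > 0" "\<And>x. in_ideal r x \<Longrightarrow> normf E x < c" using ideal_small_normf[OF E True] by blast
  have "normf E y < c" if "normf E x < c" "in_ideal r (y - x)" for x y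
    using normf_add_small[of "y - x" c x] that r by simp
  then show ?thesis unfolding open_fadele_iff using r(1) by blast
next
  case False
  then have "{x. normf E x < c} = {}" using normf_nonneg[OF E] by (auto simp: not_less intro: order_trans)
  then show ?thesis by simp
qed

lemma normf_measurable [measurable]: "normf E \<in> borel_measurable borel"
  unfolding borel_measurable_iff_less using open_normf_less by auto

lemma of_rat_exp_psi_pos: "(of_rat (exp_psi E n) :: real) > 0"
  using exp_psi_pos[OF E] by simp

lemma tendsto_normf_0: "(normf E \<longlongrightarrow> 0) (nhds 0)"
proof (rule order_tendstoI)
  fix e :: real assume "0 < e"
  then have "open {x. normf E x < e}" "0 \<in> {x. normf E x < e}" using open_normf_less normf_0[OF E] by auto
  then show "\<forall>\<^sub>F x in nhds 0. normf E x < e" unfolding eventually_nhds by blast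
qed (use normf_nonneg[OF E] in \<open>auto intro!: always_eventually intro: less_le_trans\<close>)

text \<open>On the sphere of radius \<open>e\<^sub>n\<^sub>+\<^sub>1\<close>, of measure \<open>e\<^sub>n\<^sub>+\<^sub>1 - e\<^sub>n\<close>, the integrand is bounded by
  \<open>C / e\<^sub>n\<^sub>+\<^sub>1\<^sup>2\<close>, and \<open>(e\<^sub>n\<^sub>+\<^sub>1 - e\<^sub>n) / e\<^sub>n\<^sub>+\<^sub>1\<^sup>2 \<le> 1/e\<^sub>n - 1/e\<^sub>n\<^sub>+\<^sub>1\<close>, however fast the sequence grows.\<close>

lemma integrable_exp_normf:
  assumes "t > 0" "a > 0" shows "integrable \<mu> (\<lambda>\<xi>. exp (- t * normf E \<xi> powr a))"
proof -
  obtain C where C: "\<And>r. r \<ge> 0 \<Longrightarrow> exp (- t * r powr a) \<le> C * inverse (1 + r\<^sup>2)"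
    using exp_powr_decay[OF assms] by blast
  have C0: "C \<ge> 0" using C[of 0] by simp
  define e :: "nat \<Rightarrow> real" where "e n = of_rat (exp_psi E (int n))" for n
  have e0: "e 0 = 1" by (simp add: e_def exp_psi_0[OF E])
  have epos: "e n > 0" for n unfolding e_def by (rule of_rat_exp_psi_pos)
  have emono: "e n \<le> e (Suc n)" for n unfolding e_def of_rat_less_eq by (rule exp_psi_mono[OF E]) simp
  define B where "B n = ideal (exp_psi E (- int n))" for n
  have B: "\<xi> \<in> B n \<longleftrightarrow> normf E \<xi> \<le> e n" for n \<xi>
    using normf_le_iff[OF E, of \<xi> "- int n"] by (simp add: B_def e_def ideal_def exp_psi_minus[OF E] of_rat_divide)
  have [measurable]: "B n \<in> sets borel" for n unfolding B_def by (rule ideal_borel)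
  have mB: "emeasure \<mu> (B n) = ennreal (e n)" for n
    unfolding B_def using emeasure_ideal[OF exp_psi_pos[OF E], of "- int n"]
    by (simp add: exp_psi_minus[OF E] e_def of_rat_divide)
  define S where "S n = B (Suc n) - B n" for n
  have [measurable]: "S n \<in> sets borel" for n unfolding S_def by measurable
  have mS: "emeasure \<mu> (S n) = ennreal (e (Suc n) - e n)" for n
  proof -
    have "B n \<subseteq> B (Suc n)" using emono[of n] B by (meson order_trans subsetI)
    then have "emeasure \<mu> (S n) = emeasure \<mu> (B (Suc n)) - emeasure \<mu> (B n)"
      unfolding S_def by (intro emeasure_Diff) (auto simp: mB)
    then show ?thesis using epos[of n] by (simp add: mB ennreal_minus)
  qed
  have tele: "(\<Sum>n<N. (e (Suc n) - e n) / (e (Suc n))\<^sup>2) \<le> 1" for N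
  proof -
    have "(\<Sum>n<N. (e (Suc n) - e n) / (e (Suc n))\<^sup>2) \<le> (\<Sum>n<N. 1 / e n - 1 / e (Suc n))"
    proof (rule sum_mono)
      fix n
      have "(e (Suc n) - e n) / (e (Suc n))\<^sup>2 \<le> (e (Suc n) - e n) / (e n * e (Suc n))"
        using epos[of n] epos[of "Suc n"] emono[of n]
        by (intro divide_left_mono) (auto simp: power2_eq_square intro: mult_right_mono)
      also have "\<dots> = 1 / e n - 1 / e (Suc n)" using epos[of n] epos[of "Suc n"] by (simp add: field_simps)
      finally show "(e (Suc n) - e n) / (e (Suc n))\<^sup>2 \<le> 1 / e n - 1 / e (Suc n)" .
    qed
    also have "\<dots> = 1 / e 0 - 1 / e N" by (rule sum_lessThan_telescope')
    also have "\<dots> \<le> 1" using epos[of N] e0 by simp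
    finally show ?thesis .
  qed
  let ?y = "\<lambda>\<xi>. exp (- t * normf E \<xi> powr a)"
  have le: "ennreal (?y \<xi>) \<le> indicator (B 0) \<xi> + (\<Sum>n. ennreal (C / (e (Suc n))\<^sup>2) * indicator (S n) \<xi>)" for \<xi>
  proof (cases "\<xi> \<in> B 0")
    case True
    have "ennreal (?y \<xi>) \<le> 1" using assms(1) by (simp add: ennreal_le_1)
    also have "\<dots> \<le> indicator (B 0) \<xi> + (\<Sum>n. ennreal (C / (e (Suc n))\<^sup>2) * indicator (S n) \<xi>)" using True by simp
    finally show ?thesis .
  next
    case False
    then have nz: "\<xi> \<noteq> 0" and gt: "normf E \<xi> > 1" using B[of \<xi> 0] e0 normf_0[OF E] by auto
    let ?k = "ordf E \<xi>"
    have nrm: "normf E \<xi> = 1 / of_rat (exp_psi E ?k)" using nz by (simp add: normf_def)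
    have "?k < 0"
    proof (rule ccontr)
      assume "\<not> ?k < 0"
      then have "exp_psi E 0 \<le> exp_psi E ?k" by (intro exp_psi_mono[OF E]) simp
      then have "1 \<le> (of_rat (exp_psi E ?k) :: real)" by (simp add: exp_psi_0[OF E])
      then show False using gt nrm by (simp add: divide_le_eq)
    qed
    define n where "n = nat (- ?k - 1)"
    have n: "?k = - int (Suc n)" using \<open>?k < 0\<close> by (simp add: n_def)
    have nrm': "normf E \<xi> = e (Suc n)" unfolding nrm n by (simp add: exp_psi_minus[OF E] e_def of_rat_divide del: of_nat_Suc)
    have "e n < e (Suc n)" unfolding e_def of_rat_less by (rule exp_psi_strict_mono[OF E]) simp
    then have S: "\<xi> \<in> S n" using B nrm' by (simp add: S_def)
    have "?y \<xi> \<le> C * inverse (1 + (e (Suc n))\<^sup>2)" using C[OF normf_nonneg[OF E], of \<xi>] nrm' by simp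
    also have "\<dots> \<le> C * inverse ((e (Suc n))\<^sup>2)" using C0 epos[of "Suc n"] by (intro mult_left_mono le_imp_inverse_le) auto
    finally have "ennreal (?y \<xi>) \<le> ennreal (C / (e (Suc n))\<^sup>2) * indicator (S n) \<xi>"
      using S by (simp add: divide_inverse ennreal_leI)
    also have "\<dots> \<le> (\<Sum>n. ennreal (C / (e (Suc n))\<^sup>2) * indicator (S n) \<xi>)"
    proof -
      define T where "T k = ennreal (C / (e (Suc k))\<^sup>2) * indicator (S k) \<xi>" for k
      have "T n \<le> (\<Sum>k. T k)" using sum_le_suminf[OF summableI, of "{n}" T] by simp
      then show ?thesis unfolding T_def .
    qed
    also have "\<dots> \<le> indicator (B 0) \<xi> + \<dots>" by simp
    finally show ?thesis .
  qed
  have "(\<integral>\<^sup>+\<xi>. ennreal (?y \<xi>) \<partial>\<mu>) \<le> (\<integral>\<^sup>+\<xi>. indicator (B 0) \<xi> + (\<Sum>n. ennreal (C / (e (Suc n))\<^sup>2) * indicator (S n) \<xi>) \<partial>\<mu>)"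
    by (intro nn_integral_mono le)
  also have "\<dots> = emeasure \<mu> (B 0) + (\<Sum>n. ennreal (C / (e (Suc n))\<^sup>2) * emeasure \<mu> (S n))"
    by (subst nn_integral_add) (auto simp: nn_integral_suminf nn_integral_cmult)
  also have "(\<Sum>n. ennreal (C / (e (Suc n))\<^sup>2) * emeasure \<mu> (S n)) \<le> ennreal C"
  proof (rule suminf_le_const[OF summableI])
    fix N
    have "(\<Sum>n<N. ennreal (C / (e (Suc n))\<^sup>2) * emeasure \<mu> (S n)) = (\<Sum>n<N. ennreal (C * ((e (Suc n) - e n) / (e (Suc n))\<^sup>2)))"
      using C0 by (intro sum.cong) (auto simp: mS ennreal_mult''[symmetric] emono)
    also have "\<dots> = ennreal (\<Sum>n<N. C * ((e (Suc n) - e n) / (e (Suc n))\<^sup>2))"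
      using C0 emono by (intro sum_ennreal) auto
    also have "\<dots> \<le> ennreal C"
      using mult_left_mono[OF tele[of N] C0] by (intro ennreal_leI) (simp only: sum_distrib_left mult_1_right)
    finally show "(\<Sum>n<N. ennreal (C / (e (Suc n))\<^sup>2) * emeasure \<mu> (S n)) \<le> ennreal C" .
  qed
  also have "emeasure \<mu> (B 0) + ennreal C < \<infinity>" by (simp add: mB)
  finally have "(\<integral>\<^sup>+\<xi>. ennreal (?y \<xi>) \<partial>\<mu>) < \<infinity>" by (simp add: add_left_mono)
  then show ?thesis by (intro integrableI_bounded) auto
qed

text \<open>By the layer cake formula a radially decreasing function is a mixture of indicator functions of
  subgroups, whose Fourier transforms are nonnegative.\<close>

lemma FT_exp_normf_nonneg:
  assumes "t > 0" "a > 0"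
  shows "(\<integral>\<xi>. of_real (exp (- t * normf E \<xi> powr a)) * chi_f E (x * \<xi>) \<partial>\<mu>) \<in> \<real>\<^sub>\<ge>\<^sub>0"
proof -
  let ?y = "\<lambda>\<xi>. exp (- t * normf E \<xi> powr a)"
  have [measurable]: "(\<lambda>\<xi>. chi_f E (x * \<xi>)) \<in> borel_measurable borel"
    by (intro borel_measurable_continuous_onI continuous_on_compose2[OF continuous_on_chi_f[OF E, of UNIV]] continuous_intros) auto
  let ?K = "\<lambda>(\<xi>, u). complex_of_real (indicator {0..<?y \<xi>} u) * chi_f E (x * \<xi>)"
  have Km: "?K \<in> borel_measurable (\<mu> \<Otimes>\<^sub>M lborel)"
    unfolding split_beta atLeastLessThan_iff indicator_def by measurable
  interpret \<mu>l: pair_sigma_finite \<mu> lborel ..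
  have inner: "(\<integral>u. ?K (\<xi>, u) \<partial>lborel) = of_real (?y \<xi>) * chi_f E (x * \<xi>)" for \<xi>
    by simp
  have int: "integrable (\<mu> \<Otimes>\<^sub>M lborel) ?K"
  proof (rule \<mu>l.Fubini_integrable[OF Km])
    have "(\<integral>u. norm (?K (\<xi>, u)) \<partial>lborel) = ?y \<xi>" for \<xi> by (simp add: norm_mult norm_chi_f)
    then show "integrable \<mu> (\<lambda>\<xi>. \<integral>u. norm (?K (\<xi>, u)) \<partial>lborel)" using integrable_exp_normf[OF assms] by simp
    show "AE \<xi> in \<mu>. integrable lborel (\<lambda>u. ?K (\<xi>, u))"
      by (intro AE_I2) (auto intro!: integrable_mult_left integrable_of_real integrable_real_indicator)
  qed
  have "(\<integral>\<xi>. of_real (?y \<xi>) * chi_f E (x * \<xi>) \<partial>\<mu>) = (\<integral>u. (\<integral>\<xi>. ?K (\<xi>, u) \<partial>\<mu>) \<partial>lborel)"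
    using \<mu>l.Fubini_integral[of "\<lambda>\<xi> u. ?K (\<xi>, u)"] int inner by (simp add: split_beta)
  also have "\<dots> \<in> \<real>\<^sub>\<ge>\<^sub>0"
  proof (rule integral_nonneg_Reals)
    fix u :: real
    show "(\<integral>\<xi>. ?K (\<xi>, u) \<partial>\<mu>) \<in> \<real>\<^sub>\<ge>\<^sub>0"
    proof (cases "u \<ge> 0")
      case True
      let ?H = "{\<xi>. u < ?y \<xi>}"
      have down: "\<xi> \<in> ?H" if "normf E \<xi> \<le> normf E \<eta>" "\<eta> \<in> ?H" for \<xi> \<eta>
      proof -
        have "normf E \<xi> powr a \<le> normf E \<eta> powr a" using assms that normf_nonneg[OF E] by (intro powr_mono2) auto
        then have "?y \<eta> \<le> ?y \<xi>" using assms by simp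
        moreover have "u < ?y \<eta>" using that(2) by (simp only: mem_Collect_eq)
        ultimately show ?thesis unfolding mem_Collect_eq by (rule less_le_trans[rotated])
      qed
      have "\<xi> + \<eta> \<in> ?H" if "\<xi> \<in> ?H" "\<eta> \<in> ?H" for \<xi> \<eta>
        using down[of "\<xi> + \<eta>" \<xi>] down[of "\<xi> + \<eta>" \<eta>] that normf_ultrametric[OF E, of \<xi> \<eta>] by (auto simp: max_def split: if_splits)
      moreover have "- \<xi> \<in> ?H" if "\<xi> \<in> ?H" for \<xi> using that by (simp add: normf_minus[OF E])
      moreover have "?H \<in> sets borel" by measurable
      ultimately have "(\<integral>\<xi>. indicator ?H \<xi> * chi_f E (x * \<xi>) \<partial>\<mu>) =
          (if \<forall>\<xi>\<in>?H. chi_f E (x * \<xi>) = 1 then of_real (measure \<mu> ?H) else 0)"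
        by (intro integral_chi_f_subgroup)
      moreover have "(\<lambda>\<xi>. ?K (\<xi>, u)) = (\<lambda>\<xi>. indicator ?H \<xi> * chi_f E (x * \<xi>))"
        using True by (simp add: indicator_def fun_eq_iff)
      ultimately show ?thesis by (simp only:) simp
    qed (simp add: indicator_def)
  qed
  finally show ?thesis .
qed

end

section \<open>The adelic heat kernel\<close>

locale adelic_heat = adelic_haar +
  fixes \<alpha> \<beta> :: real
  assumes \<alpha>: "\<alpha> > 0" and \<beta>: "0 < \<beta>" "\<beta> \<le> 2"
begin

abbreviation symb :: "adele \<Rightarrow> real" where "symb \<equiv> symbolD E \<alpha> \<beta>"

definition heat_mult :: "real \<Rightarrow> adele \<Rightarrow> real"
  where "heat_mult t \<xi> = exp (- t * symb \<xi>)"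

lemma symb_nonneg: "symb \<xi> \<ge> 0"
  by (simp add: symbolD_def)

lemma symb_measurable [measurable]: "symb \<in> borel_measurable m"
  unfolding symbolD_def[abs_def] adele_measure_def by measurable

lemma heat_mult_measurable [measurable]: "heat_mult t \<in> borel_measurable m"
  unfolding heat_mult_def[abs_def] by measurable

lemma heat_mult_pos: "heat_mult t \<xi> > 0"
  by (simp add: heat_mult_def)

lemma heat_mult_le_1: "t \<ge> 0 \<Longrightarrow> heat_mult t \<xi> \<le> 1"
  using symb_nonneg[of \<xi>] by (simp add: heat_mult_def)

lemma heat_mult_add: "heat_mult s \<xi> * heat_mult t \<xi> = heat_mult (s + t) \<xi>"
  by (simp add: heat_mult_def exp_add[symmetric] algebra_simps)

lemma symb_0: "symb 0 = 0"
  using \<alpha> \<beta> normf_0[OF E] by (simp add: symbolD_def)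

lemma heat_mult_eq: "heat_mult t \<xi> = exp (- t * \<bar>fst \<xi>\<bar> powr \<beta>) * exp (- t * normf E (snd \<xi>) powr \<alpha>)"
  by (simp add: heat_mult_def symbolD_def exp_add[symmetric] algebra_simps)

lemma isCont_heat_mult: "isCont (\<lambda>\<xi>. complex_of_real (heat_mult t \<xi>)) 0"
proof -
  have "((\<lambda>\<xi>::adele. snd \<xi>) \<longlongrightarrow> 0) (nhds 0)" using tendsto_snd[OF filterlim_ident, of "0::adele"] by (simp add: zero_prod_def)
  then have n: "((\<lambda>\<xi>::adele. normf E (snd \<xi>)) \<longlongrightarrow> 0) (nhds 0)" by (rule filterlim_compose[OF tendsto_normf_0])
  have "((\<lambda>\<xi>::adele. fst \<xi>) \<longlongrightarrow> 0) (nhds 0)" using tendsto_fst[OF filterlim_ident, of "0::adele"] by (simp add: zero_prod_def)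
  then have f: "((\<lambda>\<xi>::adele. \<bar>fst \<xi>\<bar>) \<longlongrightarrow> 0) (nhds 0)" by (rule tendsto_rabs_zero)
  have "((\<lambda>\<xi>. symb \<xi>) \<longlongrightarrow> 0 + 0) (nhds 0)" unfolding symbolD_def
    using \<alpha> \<beta> normf_nonneg[OF E]
    by (intro tendsto_add tendsto_zero_powrI[OF n tendsto_const] tendsto_zero_powrI[OF f tendsto_const]) auto
  then have "((\<lambda>\<xi>. complex_of_real (heat_mult t \<xi>)) \<longlongrightarrow> of_real (exp (- t * 0))) (nhds 0)"
    unfolding heat_mult_def by (intro tendsto_intros) simp
  moreover have "at (0::adele) \<le> nhds 0" by (simp add: at_within_def)
  ultimately have "((\<lambda>\<xi>. complex_of_real (heat_mult t \<xi>)) \<longlongrightarrow> of_real (exp (- t * 0))) (at 0)"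
    by (rule tendsto_mono[rotated])
  then show ?thesis by (simp add: isCont_def heat_mult_def symb_0)
qed

lemma integrable_heat_mult: assumes "t > 0" shows "integrable m (\<lambda>\<xi>. complex_of_real (heat_mult t \<xi>))"
  unfolding heat_mult_eq adele_measure_def of_real_mult
  by (rule lborel_\<mu>.integrable_product(1)[OF integrable_of_real[OF integrable_exp_powr[OF assms \<beta>(1)]]
      integrable_of_real[OF integrable_exp_normf[OF assms \<alpha>]]])

lemma heat_mult_L2: assumes "t > 0" shows "(\<lambda>\<xi>. complex_of_real (heat_mult t \<xi>)) \<in> L2 m"
proof (rule L2_bound)
  show "integrable m (heat_mult t)" using integrable_heat_mult[OF assms] by (simp only: complex_of_real_integrable_eq)
  have "(heat_mult t \<xi>)\<^sup>2 \<le> heat_mult t \<xi>" for \<xi>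
    using heat_mult_pos[of t \<xi>] heat_mult_le_1[of t \<xi>] assms by (simp add: power2_eq_square mult_le_cancel_left1)
  then show "AE \<xi> in m. (cmod (complex_of_real (heat_mult t \<xi>)))\<^sup>2 \<le> heat_mult t \<xi>" by simp
qed measurable

abbreviation hk :: "adele \<Rightarrow> real \<Rightarrow> complex" where "hk \<equiv> heat_kernel E \<mu> \<alpha> \<beta>"

definition Z :: "real \<Rightarrow> adele \<Rightarrow> real" where "Z t x = Re (hk x t)"

lemma hk_eq: "hk x t = cnj (FT (\<lambda>\<xi>. of_real (heat_mult t \<xi>)) x)"
proof -
  have "hk x t = (\<integral>\<xi>. cnj (of_real (heat_mult t \<xi>) * chi E (adele_mult x \<xi>)) \<partial>m)"
    unfolding heat_kernel_def heat_mult_def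
    by (intro Bochner_Integration.integral_cong) (auto simp: chi_minus[OF E] adele_mult_commute[of x])
  then show ?thesis unfolding FT_def Bochner_Integration.integral_cnj .
qed

text \<open>The transform of a product function is the product of the transforms in the two components.\<close>

lemma FT_heat_mult_nonneg:
  assumes t: "t > 0" shows "FT (\<lambda>\<xi>. of_real (heat_mult t \<xi>)) x \<in> \<real>\<^sub>\<ge>\<^sub>0"
proof -
  have "FT (\<lambda>\<xi>. complex_of_real (exp (- t * \<bar>fst \<xi>\<bar> powr \<beta>)) * complex_of_real (exp (- t * normf E (snd \<xi>) powr \<alpha>))) x =
      (\<integral>s. of_real (exp (- t * \<bar>s\<bar> powr \<beta>)) * chi_inf (fst x * s) \<partial>lborel) *
      (\<integral>\<xi>. of_real (exp (- t * normf E \<xi> powr \<alpha>)) * chi_f E (snd x * \<xi>) \<partial>\<mu>)"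
    by (rule FT_product[OF integrable_of_real[OF integrable_exp_powr[OF t \<beta>(1)]]
        integrable_of_real[OF integrable_exp_normf[OF t \<alpha>]]])
  also have "\<dots> \<in> \<real>\<^sub>\<ge>\<^sub>0"
    using nonneg_FT_stable[OF t \<beta>] unfolding nonneg_FT_def
    by (intro nonneg_Reals_mult_I FT_exp_normf_nonneg[OF t \<alpha>]) blast
  finally show ?thesis unfolding heat_mult_eq of_real_mult .
qed

lemma FT_heat_mult: assumes "t > 0" shows "FT (\<lambda>\<xi>. of_real (heat_mult t \<xi>)) x = of_real (Z t x)"
  using FT_heat_mult_nonneg[OF assms, of x] by (simp add: Z_def hk_eq complex_nonneg_Reals_iff complex_eq_iff)

lemma hk_Z: assumes "t > 0" shows "hk x t = of_real (Z t x)"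
  by (simp add: hk_eq FT_heat_mult[OF assms])

lemma Z_nonneg: "t > 0 \<Longrightarrow> Z t x \<ge> 0"
  using FT_heat_mult_nonneg[of t x] by (simp add: FT_heat_mult)

lemma Z_minus: assumes "t > 0" shows "Z t (- x) = Z t x"
proof -
  have m: "adele_mult (- x) \<xi> = - adele_mult x \<xi>" for \<xi>
    using adele_mult_minus[of \<xi> x] by (simp add: adele_mult_commute)
  have "FT (\<lambda>\<xi>. of_real (heat_mult t \<xi>)) (- x) = (\<integral>\<xi>. cnj (of_real (heat_mult t \<xi>) * chi E (adele_mult x \<xi>)) \<partial>m)"
    unfolding FT_def m by (intro Bochner_Integration.integral_cong) (auto simp: chi_minus[OF E])
  also have "\<dots> = cnj (FT (\<lambda>\<xi>. of_real (heat_mult t \<xi>)) x)"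
    unfolding FT_def Bochner_Integration.integral_cnj ..
  finally show ?thesis by (simp add: FT_heat_mult[OF assms])
qed

lemma Z_diff_commute: "t > 0 \<Longrightarrow> Z t (x - y) = Z t (y - x)"
  using Z_minus[of t "x - y"] by simp

lemma Z_measurable [measurable]: assumes "t > 0" shows "Z t \<in> borel_measurable m"
proof -
  have "(\<lambda>x. complex_of_real (Z t x)) \<in> borel_measurable m"
    using FT_measurable[of "\<lambda>\<xi>. of_real (heat_mult t \<xi>)"] unfolding FT_heat_mult[OF assms, abs_def]
    by (simp add: FT_heat_mult[OF assms, abs_def] cong: measurable_cong)
  then have "(\<lambda>x. Re (complex_of_real (Z t x))) \<in> borel_measurable m" by measurable
  then show ?thesis by simp
qed

text \<open>The multiplication formula, for the multiplier and a regulariser.\<close>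

lemma Z_theta:
  assumes t: "t > 0" and s: "\<sigma> > 0" and r: "r > 0"
  shows "integrable m (\<lambda>x. Z t x * theta \<sigma> r x)"
    and "(\<integral>x. Z t x * theta \<sigma> r x \<partial>m) = (\<integral>\<xi>. theta_hat \<sigma> r \<xi> * heat_mult t \<xi> \<partial>m)"
proof -
  note [measurable] = Z_measurable[OF t]
  have iT: "integrable m (\<lambda>x. complex_of_real (theta \<sigma> r x))" by (intro integrable_of_real integrable_theta s r)
  let ?C = "\<integral>\<xi>. cmod (complex_of_real (heat_mult t \<xi>)) \<partial>m"
  show "integrable m (\<lambda>x. Z t x * theta \<sigma> r x)"
  proof (rule Bochner_Integration.integrable_bound)
    show "integrable m (\<lambda>x. ?C * theta \<sigma> r x)" by (intro integrable_mult_right integrable_theta s r)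
    show "AE x in m. norm (Z t x * theta \<sigma> r x) \<le> norm (?C * theta \<sigma> r x)"
      using norm_FT_le[OF integrable_heat_mult[OF t]]
      by (intro AE_I2) (auto simp: FT_heat_mult[OF t] abs_mult theta_bounds intro!: mult_right_mono)
  qed measurable
  have "complex_of_real (\<integral>x. Z t x * theta \<sigma> r x \<partial>m) = (\<integral>x. FT (\<lambda>\<xi>. of_real (heat_mult t \<xi>)) x * of_real (theta \<sigma> r x) \<partial>m)"
    by (simp only: FT_heat_mult[OF t] of_real_mult[symmetric] integral_complex_of_real)
  also have "\<dots> = (\<integral>\<xi>. of_real (heat_mult t \<xi>) * of_real (theta_hat \<sigma> r \<xi>) \<partial>m)"
    unfolding FT_multiplication[OF integrable_heat_mult[OF t] iT] FT_theta[OF s r] ..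
  also have "\<dots> = complex_of_real (\<integral>\<xi>. theta_hat \<sigma> r \<xi> * heat_mult t \<xi> \<partial>m)"
    by (simp only: of_real_mult[symmetric] integral_complex_of_real mult.commute)
  finally show "(\<integral>x. Z t x * theta \<sigma> r x \<partial>m) = (\<integral>\<xi>. theta_hat \<sigma> r \<xi> * heat_mult t \<xi> \<partial>m)"
    by (simp only: of_real_eq_iff)
qed

text \<open>As the kernel is nonnegative and the regularisers increase to \<open>1\<close>, monotone convergence gives
  integrability and the mass at the same time; the mass is the value of the multiplier at \<open>0\<close>.\<close>

lemma assumes t: "t > 0" shows integrable_Z: "integrable m (Z t)" and integral_Z: "(\<integral>x. Z t x \<partial>m) = 1"
proof -
  note [measurable] = Z_measurable[OF t]
  have s: "1 / real (Suc k) > 0" "exp_psi E (- int k) > 0" for k using exp_psi_pos[OF E] by auto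
  have Zt: "integrable m (\<lambda>x. Z t x * theta_seq k x)"
    "(\<integral>x. Z t x * theta_seq k x \<partial>m) = (\<integral>\<xi>. theta_hat_seq k \<xi> * heat_mult t \<xi> \<partial>m)" for k
    unfolding theta_seq_def theta_hat_seq_def by (rule Z_theta[OF t s(1) s(2)])+
  have "(\<lambda>k. \<integral>\<xi>. of_real (theta_hat_seq k \<xi>) * complex_of_real (heat_mult t \<xi>) \<partial>m) \<longlonglongrightarrow> complex_of_real (heat_mult t 0)"
    by (rule theta_hat_seq_approx_identity[OF _ _ isCont_heat_mult, of _ 1])
       (use heat_mult_le_1[of t] heat_mult_pos[of t] t in \<open>auto simp: abs_of_pos\<close>)
  then have "(\<lambda>k. \<integral>\<xi>. theta_hat_seq k \<xi> * heat_mult t \<xi> \<partial>m) \<longlonglongrightarrow> heat_mult t 0"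
    by (simp only: of_real_mult[symmetric] integral_complex_of_real tendsto_of_real_iff)
  then have lim: "(\<lambda>k. \<integral>x. Z t x * theta_seq k x \<partial>m) \<longlonglongrightarrow> 1"
    by (simp add: Zt(2) heat_mult_def symb_0)
  have mono: "AE x in m. mono (\<lambda>k. Z t x * theta_seq k x)"
    by (intro AE_I2 incseq_SucI mult_left_mono theta_seq_mono Z_nonneg t)
  have tend: "AE x in m. (\<lambda>k. Z t x * theta_seq k x) \<longlonglongrightarrow> Z t x"
    using tendsto_mult[OF tendsto_const theta_seq_tendsto] by (intro AE_I2) fastforce
  show "integrable m (Z t)" by (rule integrable_monotone_convergence[OF Zt(1) mono tend lim]) measurable
  show "(\<integral>x. Z t x \<partial>m) = 1" by (rule integral_monotone_convergence[OF Zt(1) mono tend lim]) measurable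
qed

text \<open>The heat kernel is real and even, so that it makes no difference whether it is obtained from the
  multiplier by the transform or its inverse.\<close>

lemma isF_Z: assumes t: "t > 0" shows "isF (\<lambda>x. of_real (Z t x)) (\<lambda>\<xi>. of_real (heat_mult t \<xi>))"
proof -
  have "isF (\<lambda>\<xi>. cnj (of_real (heat_mult t \<xi>))) (FT (\<lambda>\<xi>. of_real (heat_mult t \<xi>)))"
    using isF_FT[OF integrable_heat_mult[OF t] heat_mult_L2[OF t]] by simp
  from isF_inverse[OF this] show ?thesis by (simp add: FT_heat_mult[OF t])
qed

text \<open>The function \<open>y \<mapsto> Z t (x - y)\<close> is itself the transform of the multiplier times a character, and the
  multiplication formula applies.\<close>

lemma heat_convolution:
  assumes t: "t > 0" and F: "isF f \<psi>"
  shows "integrable m (\<lambda>y. of_real (Z t (x - y)) * f y)"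
    and "(\<integral>y. of_real (Z t (x - y)) * f y \<partial>m) = (\<integral>\<xi>. of_real (heat_mult t \<xi>) * \<psi> \<xi> * cnj (chi E (adele_mult x \<xi>)) \<partial>m)"
proof -
  let ?g = "\<lambda>\<xi>. of_real (heat_mult t \<xi>) * cnj (chi E (adele_mult x \<xi>))"
  have int: "integrable m ?g"
    by (rule Bochner_Integration.integrable_bound[OF integrable_heat_mult[OF t]]) (auto simp: norm_mult norm_chi)
  have L2: "?g \<in> L2 m"
    by (rule L2_bound[OF L2_integrable_square[OF heat_mult_L2[OF t]]]) (auto simp: norm_mult norm_chi)
  have FTg: "FT ?g y = of_real (Z t (x - y))" for y
  proof -
    have "cnj (chi E (adele_mult x \<xi>)) * chi E (adele_mult y \<xi>) = chi E (adele_mult (y - x) \<xi>)" for \<xi>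
    proof -
      have "adele_mult (y - x) \<xi> = adele_mult y \<xi> + (- adele_mult x \<xi>)"
        by (simp add: adele_mult_def left_diff_distrib)
      then show ?thesis by (simp only: chi_add[OF E] chi_minus[OF E] mult.commute)
    qed
    then have "FT ?g y = FT (\<lambda>\<xi>. of_real (heat_mult t \<xi>)) (y - x)"
      unfolding FT_def by (intro Bochner_Integration.integral_cong) (auto simp: mult.assoc)
    then show ?thesis by (simp add: FT_heat_mult[OF t] Z_diff_commute[OF t, of y])
  qed
  have isg: "isF ?g (\<lambda>y. of_real (Z t (x - y)))" using isF_FT[OF int L2] unfolding FTg[abs_def] .
  show "integrable m (\<lambda>y. of_real (Z t (x - y)) * f y)"
    by (rule L2_integrable_mult[OF isF_L2(2)[OF isg] isF_L2(1)[OF F]])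
  show "(\<integral>y. of_real (Z t (x - y)) * f y \<partial>m) = (\<integral>\<xi>. of_real (heat_mult t \<xi>) * \<psi> \<xi> * cnj (chi E (adele_mult x \<xi>)) \<partial>m)"
    using isF_multiplication[OF isg F] by (simp add: mult_ac)
qed

text \<open>The case \<open>f = Z t\<close> of the preceding formula, since multipliers multiply.\<close>

lemma Z_semigroup:
  assumes s: "s > 0" and t: "t > 0"
  shows "integrable m (\<lambda>y. Z s (x - y) * Z t y)" and "(\<integral>y. Z s (x - y) * Z t y \<partial>m) = Z (s + t) x"
proof -
  note conv = heat_convolution[OF s isF_Z[OF t], of x]
  have "integrable m (\<lambda>y. complex_of_real (Z s (x - y) * Z t y))" using conv(1) by simp
  then show "integrable m (\<lambda>y. Z s (x - y) * Z t y)" by (simp only: complex_of_real_integrable_eq)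
  have "complex_of_real (\<integral>y. Z s (x - y) * Z t y \<partial>m) = (\<integral>y. of_real (Z s (x - y)) * of_real (Z t y) \<partial>m)"
    by (simp only: of_real_mult[symmetric] integral_complex_of_real)
  also have "\<dots> = (\<integral>\<xi>. cnj (of_real (heat_mult (s + t) \<xi>) * chi E (adele_mult x \<xi>)) \<partial>m)"
    unfolding conv(2) by (simp flip: of_real_mult add: heat_mult_add)
  also have "\<dots> = cnj (FT (\<lambda>\<xi>. of_real (heat_mult (s + t) \<xi>)) x)"
    unfolding FT_def Bochner_Integration.integral_cnj ..
  also have "\<dots> = of_real (Z (s + t) x)" using s t by (simp add: FT_heat_mult)
  finally show "(\<integral>y. Z s (x - y) * Z t y \<partial>m) = Z (s + t) x" by (simp only: of_real_eq_iff)
qed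

definition outer :: "real \<Rightarrow> int \<Rightarrow> adele set"
  where "outer l n = {x. \<bar>fst x\<bar> \<ge> l \<or> snd x \<notin> ideal (exp_psi E n)}"

text \<open>On the set in question \<open>1 - theta (1/l) (exp_psi E n)\<close> is at least \<open>1/2\<close>. Its integral against
  the kernel is the integral of \<open>1 - exp (- t symb) \<le> t symb\<close> against the probability density
  \<open>theta_hat (1/l) (exp_psi E n)\<close>, on whose support the finite component has norm at most \<open>e\<^sub>n\<close>.\<close>

lemma heat_tail:
  assumes t: "t > 0" and l: "l > 0"
  shows "(\<integral>x. indicator (outer l n) x * Z t x \<partial>m) \<le> 2 * t * (of_rat (exp_psi E n) powr \<alpha> + 2 * l powr - \<beta>)"
proof -
  note [measurable] = Z_measurable[OF t]
  let ?r = "exp_psi E n" and ?s = "1 / l"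
  have s: "?s > 0" using l by simp
  have r: "?r > 0" by (rule exp_psi_pos[OF E])
  let ?T = "theta ?s ?r" and ?U = "theta_hat ?s ?r"
  note U = theta_hat_prob[OF s r]
  have U0: "?U \<xi> \<ge> 0" for \<xi> by (rule theta_hat_nonneg[OF r])
  have Uh: "0 \<le> ?U \<xi> * heat_mult t \<xi>" "?U \<xi> * heat_mult t \<xi> \<le> ?U \<xi>" for \<xi>
    using mult_left_mono[OF heat_mult_le_1[of t \<xi>] U0[of \<xi>]] U0[of \<xi>] heat_mult_pos[of t \<xi>] t by auto
  have half: "indicator (outer l n) x \<le> 2 * (1 - ?T x)" for x
  proof (cases "x \<in> (outer l n)")
    case True
    have "?T x \<le> 1/2"
    proof (cases "snd x \<in> ideal ?r")
      case True
      then have "\<bar>fst x\<bar> \<ge> l" using \<open>x \<in> (outer l n)\<close> by (simp add: outer_def)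
      then have "l\<^sup>2 \<le> \<bar>fst x\<bar>\<^sup>2" using l by (intro power_mono) auto
      then have "1 \<le> (1 / l)\<^sup>2 * (fst x)\<^sup>2" using l by (simp add: power_divide)
      moreover have "9 \<le> pi\<^sup>2" using power_mono[of 3 pi 2] pi_gt3 by simp
      ultimately have "9 * 1 \<le> pi\<^sup>2 * ((1 / l)\<^sup>2 * (fst x)\<^sup>2)" by (intro mult_mono) auto
      then have "- 2 * pi\<^sup>2 * (1 / l)\<^sup>2 * (fst x)\<^sup>2 \<le> - 1" by (simp add: mult.assoc)
      then have "?T x \<le> exp (- 1)" unfolding theta_def by (auto simp: indicator_def)
      also have "exp (- 1) \<le> (1/2 :: real)" using exp_ge_add_one_self[of 1] by (simp add: exp_minus inverse_eq_divide divide_le_eq)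
      finally show ?thesis .
    qed (simp add: theta_def)
    then show ?thesis using True by simp
  qed (use theta_bounds(2)[of ?s ?r x] in simp)
  have iZT: "integrable m (\<lambda>x. Z t x - Z t x * ?T x)"
    by (intro Bochner_Integration.integrable_diff integrable_Z t Z_theta s r)
  have [measurable]: "outer l n \<in> sets m"
  proof -
    have "outer l n = {x \<in> space m. l \<le> \<bar>fst x\<bar> \<or> snd x \<notin> ideal ?r}" by (simp add: outer_def)
    also have "\<dots> \<in> sets m" unfolding adele_measure_def by measurable
    finally show ?thesis .
  qed
  have "(\<integral>x. indicator (outer l n) x * Z t x \<partial>m) \<le> (\<integral>x. 2 * (Z t x - Z t x * ?T x) \<partial>m)"
  proof (rule integral_mono)
    show "integrable m (\<lambda>x. indicator (outer l n) x * Z t x)"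
      by (rule Bochner_Integration.integrable_bound[OF integrable_Z[OF t]]) (auto simp: indicator_def)
    show "integrable m (\<lambda>x. 2 * (Z t x - Z t x * ?T x))" using iZT by (rule integrable_mult_right)
    show "indicator (outer l n) x * Z t x \<le> 2 * (Z t x - Z t x * ?T x)" for x
      using mult_right_mono[OF half[of x] Z_nonneg[OF t, of x]] by (simp add: algebra_simps)
  qed
  also have "\<dots> = 2 * (1 - (\<integral>\<xi>. ?U \<xi> * heat_mult t \<xi> \<partial>m))"
    using integrable_Z[OF t] integral_Z[OF t] Z_theta[OF t s r] by simp
  also have "1 - (\<integral>\<xi>. ?U \<xi> * heat_mult t \<xi> \<partial>m) = (\<integral>\<xi>. ?U \<xi> - ?U \<xi> * heat_mult t \<xi> \<partial>m)"
  proof -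
    have "integrable m (\<lambda>\<xi>. ?U \<xi> * heat_mult t \<xi>)"
      by (rule Bochner_Integration.integrable_bound[OF U(1)]) (use Uh U0 in auto)
    then show ?thesis using U by simp
  qed
  also have "\<dots> \<le> (\<integral>\<xi>. t * (of_rat ?r powr \<alpha> + l powr - \<beta>) * ?U \<xi> + t * l powr (2 - \<beta>) * (?U \<xi> * (fst \<xi>)\<^sup>2) \<partial>m)"
  proof (rule integral_mono)
    show "integrable m (\<lambda>\<xi>. ?U \<xi> - ?U \<xi> * heat_mult t \<xi>)"
      by (rule Bochner_Integration.integrable_bound[OF U(1)]) (use Uh U0 in auto)
    show "integrable m (\<lambda>\<xi>. t * (of_rat ?r powr \<alpha> + l powr - \<beta>) * ?U \<xi> + t * l powr (2 - \<beta>) * (?U \<xi> * (fst \<xi>)\<^sup>2))"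
      by (intro Bochner_Integration.integrable_add integrable_mult_right U)
    fix \<xi>
    show "?U \<xi> - ?U \<xi> * heat_mult t \<xi> \<le> t * (of_rat ?r powr \<alpha> + l powr - \<beta>) * ?U \<xi> + t * l powr (2 - \<beta>) * (?U \<xi> * (fst \<xi>)\<^sup>2)"
    proof (cases "snd \<xi> \<in> ideal (1 / ?r)")
      case True
      then have "normf E (snd \<xi>) \<le> of_rat ?r"
        using normf_le_iff[OF E, of "snd \<xi>" "- n"] r by (simp add: exp_psi_minus[OF E] ideal_def of_rat_divide)
      then have 1: "normf E (snd \<xi>) powr \<alpha> \<le> of_rat ?r powr \<alpha>"
        using \<alpha> normf_nonneg[OF E] by (intro powr_mono2) auto
      (* beta <= 2 allows a bound by the second moment, which the Gaussian theta_hat has, of size (1/l)^2 *)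
      have 2: "\<bar>fst \<xi>\<bar> powr \<beta> \<le> l powr - \<beta> + l powr (2 - \<beta>) * (fst \<xi>)\<^sup>2"
      proof (cases "\<bar>fst \<xi>\<bar> * l \<le> 1")
        case True
        then have "\<bar>fst \<xi>\<bar> \<le> 1 / l" using l by (simp add: field_simps)
        then have "\<bar>fst \<xi>\<bar> powr \<beta> \<le> (1 / l) powr \<beta>" using \<beta> by (intro powr_mono2) auto
        also have "\<dots> = l powr - \<beta>" using l by (simp add: powr_divide powr_minus inverse_eq_divide)
        finally show ?thesis by (simp add: add_increasing2)
      next
        case False
        then have "(\<bar>fst \<xi>\<bar> * l) powr \<beta> \<le> (\<bar>fst \<xi>\<bar> * l) powr 2" using \<beta> by (intro powr_mono) auto
        then have "\<bar>fst \<xi>\<bar> powr \<beta> * l powr \<beta> \<le> (fst \<xi>)\<^sup>2 * l powr 2"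
          using False l by (simp add: powr_mult power_mult_distrib)
        then have "\<bar>fst \<xi>\<bar> powr \<beta> \<le> (fst \<xi>)\<^sup>2 * l powr 2 / l powr \<beta>" using l by (simp add: pos_le_divide_eq)
        also have "\<dots> = l powr (2 - \<beta>) * (fst \<xi>)\<^sup>2" by (simp add: powr_diff)
        finally show ?thesis by (simp add: add_increasing)
      qed
      have "1 - heat_mult t \<xi> \<le> t * symb \<xi>"
        using exp_ge_add_one_self[of "- t * symb \<xi>"] by (simp add: heat_mult_def)
      also have "\<dots> \<le> t * (of_rat ?r powr \<alpha> + l powr - \<beta> + l powr (2 - \<beta>) * (fst \<xi>)\<^sup>2)"
        using 1 2 t by (intro mult_left_mono) (auto simp: symbolD_def)
      finally have "?U \<xi> * (1 - heat_mult t \<xi>) \<le> ?U \<xi> * (t * (of_rat ?r powr \<alpha> + l powr - \<beta> + l powr (2 - \<beta>) * (fst \<xi>)\<^sup>2))"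
        by (rule mult_left_mono[OF _ U0])
      then show ?thesis by (simp add: algebra_simps)
    qed (simp add: theta_hat_def)
  qed
  also have "\<dots> = t * (of_rat ?r powr \<alpha> + l powr - \<beta>) + t * (l powr (2 - \<beta>) * (1 / l)\<^sup>2)"
    using U by (simp add: mult.assoc)
  also have "l powr (2 - \<beta>) * (1 / l)\<^sup>2 = l powr - \<beta>"
    using l by (simp add: powr_diff powr_minus power_divide field_simps)
  finally show ?thesis using t by (simp add: algebra_simps)
qed


section \<open>The Cauchy problem\<close>

lemma isF_cmult: "isF \<phi> \<psi> \<Longrightarrow> isF (\<lambda>x. c * \<phi> x) (\<lambda>x. c * \<psi> x)"
  using isF_linear[of \<phi> \<psi> \<phi> \<psi> "c - 1"] by (simp add: algebra_simps)

lemma L2_norm_dominated: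
  assumes w: "w \<in> L2 M" and [measurable]: "\<And>n. g n \<in> borel_measurable M"
    and bound: "\<And>n x. cmod (g n x) \<le> cmod (w x)" and lim: "\<And>x. (\<lambda>n. g n x) \<longlonglongrightarrow> 0"
  shows "(\<lambda>n. L2_norm M (g n)) \<longlonglongrightarrow> 0"
proof -
  have "(\<lambda>n. \<integral>x. (cmod (g n x))\<^sup>2 \<partial>M) \<longlonglongrightarrow> (\<integral>x. 0 \<partial>M)"
  proof (rule integral_dominated_convergence[where w="\<lambda>x. (cmod (w x))\<^sup>2"])
    show "integrable M (\<lambda>x. (cmod (w x))\<^sup>2)" by (rule L2_integrable_square[OF w])
    show "AE x in M. (\<lambda>n. (cmod (g n x))\<^sup>2) \<longlonglongrightarrow> 0"
      using tendsto_power[OF tendsto_norm[OF lim], of _ 2] by simp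
    show "AE x in M. norm ((cmod (g n x))\<^sup>2) \<le> (cmod (w x))\<^sup>2" for n
      using bound by (intro AE_I2) (auto intro!: power_mono)
  qed auto
  then have "(\<lambda>n. sqrt (\<integral>x. (cmod (g n x))\<^sup>2 \<partial>M)) \<longlonglongrightarrow> sqrt (\<integral>x. 0 \<partial>M)" by (rule tendsto_real_sqrt)
  then show ?thesis by (simp add: L2_norm_def)
qed

lemma exp_diff_le:
  fixes s t a :: real assumes "s \<ge> 0" "t \<ge> 0" "a \<ge> 0"
  shows "\<bar>exp (- s * a) - exp (- t * a)\<bar> \<le> a * \<bar>s - t\<bar>"
proof -
  have *: "exp (- s * a) - exp (- t * a) \<le> a * \<bar>s - t\<bar>" if "s \<ge> 0" "t \<ge> 0" for s t
  proof -
    have "exp (- s * a) - exp (- t * a) = exp (- s * a) * (1 - exp (- (t - s) * a))"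
      by (simp add: algebra_simps exp_add[symmetric])
    also have "\<dots> \<le> exp (- s * a) * (a * \<bar>s - t\<bar>)"
    proof (rule mult_left_mono)
      have "1 - exp (- (t - s) * a) \<le> (t - s) * a" using exp_ge_add_one_self[of "(s - t) * a"] by (simp add: algebra_simps)
      also have "\<dots> \<le> a * \<bar>s - t\<bar>" using assms(3) by (simp add: mult.commute[of a] mult_right_mono)
      finally show "1 - exp (- (t - s) * a) \<le> a * \<bar>s - t\<bar>" .
    qed simp
    also have "\<dots> \<le> 1 * (a * \<bar>s - t\<bar>)" using that assms(3) by (intro mult_right_mono) auto
    finally show ?thesis by simp
  qed
  show ?thesis using *[OF assms(1,2)] *[OF assms(2,1)] by (simp add: abs_le_iff abs_minus_commute)
qed

text \<open>The Fourier transform of the solution at time \<open>t\<close> is \<open>exp (- t symb)\<close> times that of \<open>f\<close>, and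
  Plancherel's theorem reduces all the limits to dominated convergence, with the square integrable
  majorant \<open>2 symb F\<close>.\<close>

theorem heat_equation_solution:
  assumes f: "f \<in> DomD E \<mu> \<alpha> \<beta>"
  shows "\<exists>u. classical_solution E \<mu> \<alpha> \<beta> f u \<and>
    (\<forall>t>0. \<forall>x. integrable m (\<lambda>y. hk (x - y) t * f y) \<and> u x t = (\<integral>y. hk (x - y) t * f y \<partial>m))"
proof -
  define F where "F = fourier E \<mu> f"
  have f2: "f \<in> L2 m" and aF: "(\<lambda>\<xi>. of_real (symb \<xi>) * F \<xi>) \<in> L2 m"
    using f by (auto simp: DomD_def F_def)
  have isf: "isF f F" unfolding F_def by (rule isF_fourier[OF f2])
  note F2 = isF_L2(2)[OF isf]
  have [measurable]: "F \<in> borel_measurable m" using F2 by (rule L2_measurable)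
  define u where "u x t = (if t \<le> 0 then f x else (\<integral>y. hk (x - y) t * f y \<partial>m))" for x t
  define U where "U t \<xi> = of_real (heat_mult t \<xi>) * F \<xi>" for t \<xi>
  have [measurable]: "U t \<in> borel_measurable m" for t unfolding U_def[abs_def] by measurable
  have U_le: "cmod (U t \<xi>) \<le> cmod (F \<xi>)" if "t \<ge> 0" for t \<xi>
    using mult_right_mono[OF heat_mult_le_1[OF that, of \<xi>] norm_ge_zero[of "F \<xi>"]] heat_mult_pos[of t \<xi>]
    by (simp add: U_def norm_mult abs_of_pos)
  have U2: "U t \<in> L2 m" if "t \<ge> 0" for t
  proof (rule L2_bound[OF L2_integrable_square[OF F2]])
    show "AE \<xi> in m. (cmod (U t \<xi>))\<^sup>2 \<le> (cmod (F \<xi>))\<^sup>2"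
      by (intro AE_I2 power_mono U_le that) simp
  qed measurable
  have aU2: "(\<lambda>\<xi>. of_real (symb \<xi>) * U t \<xi>) \<in> L2 m" if "t \<ge> 0" for t
  proof (rule L2_bound[OF L2_integrable_square[OF aF]])
    show "AE \<xi> in m. (cmod (of_real (symb \<xi>) * U t \<xi>))\<^sup>2 \<le> (cmod (of_real (symb \<xi>) * F \<xi>))\<^sup>2"
      using U_le[OF that] by (intro AE_I2 power_mono) (auto simp: norm_mult intro!: mult_left_mono)
  qed measurable
  have isu: "isF (\<lambda>x. u x t) (U t)" if t: "t \<ge> 0" for t
  proof (cases "t = 0")
    case True
    then show ?thesis using isf by (simp add: u_def U_def[abs_def] heat_mult_def)
  next
    case False
    then have t: "t > 0" using t by simp
    have U1: "integrable m (U t)" unfolding U_def[abs_def] by (rule L2_integrable_mult[OF heat_mult_L2[OF t] F2])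
    have "cnj (FT (\<lambda>\<xi>. cnj (U t \<xi>)) x) = u x t" for x
    proof -
      have "u x t = (\<integral>\<xi>. U t \<xi> * cnj (chi E (adele_mult x \<xi>)) \<partial>m)"
        using t heat_convolution(2)[OF t isf, of x] by (simp add: u_def U_def hk_Z[OF t])
      also have "\<dots> = (\<integral>\<xi>. cnj (cnj (U t \<xi>) * chi E (adele_mult x \<xi>)) \<partial>m)" by simp
      also have "\<dots> = cnj (FT (\<lambda>\<xi>. cnj (U t \<xi>)) x)" unfolding FT_def Bochner_Integration.integral_cnj ..
      finally show ?thesis by simp
    qed
    moreover have "isF (\<lambda>x. cnj (FT (\<lambda>\<xi>. cnj (U t \<xi>)) x)) (U t)"
      by (rule isF_inverse[OF isF_FT[OF integrable_cnj[OF U1] L2_cnj[OF U2]]]) (use t in simp)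
    ultimately show ?thesis by simp
  qed
  have fu: "AE \<xi> in m. of_real (symb \<xi>) * fourier E \<mu> (\<lambda>x. u x t) \<xi> = of_real (symb \<xi>) * U t \<xi>" if "t \<ge> 0" for t
    using isF_unique[OF isF_fourier[OF isF_L2(1)[OF isu[OF that]]] isu[OF that]] by eventually_elim simp
  have fm: "fourier E \<mu> (\<lambda>x. u x t) \<in> borel_measurable m" if "t \<ge> 0" for t
    using isF_L2(2)[OF isF_fourier[OF isF_L2(1)[OF isu[OF that]]]] by (rule L2_measurable)
  have au: "(\<lambda>\<xi>. of_real (symb \<xi>) * fourier E \<mu> (\<lambda>x. u x t) \<xi>) \<in> L2 m" if "t \<ge> 0" for t
  proof (rule L2_cong_AE[OF aU2[OF that]])
    note [measurable] = fm[OF that]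
    show "(\<lambda>\<xi>. of_real (symb \<xi>) * fourier E \<mu> (\<lambda>x. u x t) \<xi>) \<in> borel_measurable m" by measurable
    show "AE \<xi> in m. of_real (symb \<xi>) * U t \<xi> = of_real (symb \<xi>) * fourier E \<mu> (\<lambda>x. u x t) \<xi>"
      using fu[OF that] by eventually_elim (rule sym)
  qed
  have dom: "(\<lambda>x. u x t) \<in> DomD E \<mu> \<alpha> \<beta>" if "t \<ge> 0" for t
    using au[OF that] isF_L2(1)[OF isu[OF that]] by (simp add: DomD_def)
  define v where "v x t = - opD E \<mu> \<alpha> \<beta> (\<lambda>y. u y t) x" for x t
  have isv: "isF (\<lambda>x. v x t) (\<lambda>\<xi>. - of_real (symb \<xi>) * U t \<xi>)" if "t \<ge> 0" for t
  proof -
    have i: "isF (opD E \<mu> \<alpha> \<beta> (\<lambda>y. u y t)) (\<lambda>\<xi>. of_real (symb \<xi>) * fourier E \<mu> (\<lambda>x. u x t) \<xi>)"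
      unfolding opD_def by (rule isF_inv_fourier[OF au[OF that]])
    have "isF (opD E \<mu> \<alpha> \<beta> (\<lambda>y. u y t)) (\<lambda>\<xi>. of_real (symb \<xi>) * U t \<xi>)"
      using fu[OF that] aU2[OF that] by (intro isF_cong_AE[OF i L2_measurable[OF isF_L2(1)[OF i]]]) auto
    from isF_cmult[OF this, of "-1"] show ?thesis by (simp add: v_def)
  qed
  have deriv: "L2_C1_derivative m u v"
    unfolding L2_C1_derivative_def
  proof (intro allI impI conjI)
    fix t :: real assume t: "t \<ge> 0"
    show "(\<lambda>x. u x t) \<in> L2 m" "(\<lambda>x. v x t) \<in> L2 m" using isF_L2(1)[OF isu[OF t]] isF_L2(1)[OF isv[OF t]] by auto
    show "((\<lambda>s. L2_norm m (\<lambda>x. (u x s - u x t) / of_real (s - t) - v x t)) \<longlongrightarrow> 0) (at t within {0..})"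
      unfolding tendsto_at_iff_sequentially o_def
    proof (intro allI impI)
      fix s :: "nat \<Rightarrow> real" assume s: "\<forall>i. s i \<in> {0..} - {t}" "s \<longlonglongrightarrow> t"
      have s0: "s n \<ge> 0" "s n \<noteq> t" for n using s(1) by auto
      let ?g = "\<lambda>n \<xi>. of_real ((heat_mult (s n) \<xi> - heat_mult t \<xi>) / (s n - t) + symb \<xi> * heat_mult t \<xi>) * F \<xi>"
      have eq: "L2_norm m (\<lambda>x. (u x (s n) - u x t) / of_real (s n - t) - v x t) = L2_norm m (?g n)" for n
      proof -
        let ?c = "1 / complex_of_real (s n - t)"
        have "isF (\<lambda>x. ?c * (u x (s n) + (- 1) * u x t) + (- 1) * v x t)
            (\<lambda>\<xi>. ?c * (U (s n) \<xi> + (- 1) * U t \<xi>) + (- 1) * (- of_real (symb \<xi>) * U t \<xi>))"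
          by (intro isF_linear isF_cmult isu isv t s0)
        from isF_norm[OF this] have "L2_norm m (\<lambda>x. ?c * (u x (s n) - u x t) - v x t) =
            L2_norm m (\<lambda>\<xi>. ?c * (U (s n) \<xi> - U t \<xi>) + of_real (symb \<xi>) * U t \<xi>)" by simp
        also have "(\<lambda>\<xi>. ?c * (U (s n) \<xi> - U t \<xi>) + of_real (symb \<xi>) * U t \<xi>) = ?g n"
          using s0(2)[of n] by (simp add: fun_eq_iff U_def field_simps)
        finally show ?thesis by simp
      qed
      show "(\<lambda>n. L2_norm m (\<lambda>x. (u x (s n) - u x t) / of_real (s n - t) - v x t)) \<longlonglongrightarrow> 0"
        unfolding eq
      proof (rule L2_norm_dominated[OF L2_cmult[OF aF, of 2]])
        fix n \<xi>
        have "\<bar>heat_mult (s n) \<xi> - heat_mult t \<xi>\<bar> \<le> symb \<xi> * \<bar>s n - t\<bar>"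
          unfolding heat_mult_def by (rule exp_diff_le[OF s0(1) t symb_nonneg])
        then have "\<bar>(heat_mult (s n) \<xi> - heat_mult t \<xi>) / (s n - t)\<bar> \<le> symb \<xi>"
          using s0(2)[of n] by (simp add: abs_divide divide_le_eq)
        moreover have "\<bar>symb \<xi> * heat_mult t \<xi>\<bar> \<le> symb \<xi>"
          using symb_nonneg[of \<xi>] heat_mult_pos[of t \<xi>] heat_mult_le_1[OF t, of \<xi>] by (simp add: abs_mult mult_left_le)
        ultimately have "\<bar>(heat_mult (s n) \<xi> - heat_mult t \<xi>) / (s n - t) + symb \<xi> * heat_mult t \<xi>\<bar> \<le> 2 * symb \<xi>" by linarith
        then show "cmod (?g n \<xi>) \<le> cmod (2 * (of_real (symb \<xi>) * F \<xi>))"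
          using symb_nonneg[of \<xi>] mult_right_mono[OF _ norm_ge_zero[of "F \<xi>"]] by (simp add: norm_mult mult.assoc[symmetric] del: of_real_add of_real_divide)
      next
        fix \<xi>
        have "((\<lambda>r. exp (- r * symb \<xi>)) has_real_derivative (- symb \<xi> * exp (- t * symb \<xi>))) (at t)"
          by (auto intro!: derivative_eq_intros)
        then have "((\<lambda>r. (exp (- r * symb \<xi>) - exp (- t * symb \<xi>)) / (r - t)) \<longlongrightarrow> - symb \<xi> * exp (- t * symb \<xi>)) (at t)"
          by (simp add: has_field_derivative_iff)
        moreover have "filterlim s (at t) sequentially"
          using s s0(2) by (intro filterlim_atI) auto
        ultimately have "(\<lambda>n. (exp (- s n * symb \<xi>) - exp (- t * symb \<xi>)) / (s n - t)) \<longlonglongrightarrow> - symb \<xi> * exp (- t * symb \<xi>)"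
          by (rule filterlim_compose)
        then have "(\<lambda>n. complex_of_real ((exp (- s n * symb \<xi>) - exp (- t * symb \<xi>)) / (s n - t) + symb \<xi> * exp (- t * symb \<xi>)) * F \<xi>)
            \<longlonglongrightarrow> complex_of_real (- symb \<xi> * exp (- t * symb \<xi>) + symb \<xi> * exp (- t * symb \<xi>)) * F \<xi>"
          by (intro tendsto_mult tendsto_of_real tendsto_add tendsto_const)
        then show "(\<lambda>n. ?g n \<xi>) \<longlonglongrightarrow> 0" by (simp add: heat_mult_def)
      qed measurable
    qed
    show "((\<lambda>s. L2_norm m (\<lambda>x. v x s - v x t)) \<longlongrightarrow> 0) (at t within {0..})"
      unfolding tendsto_at_iff_sequentially o_def
    proof (intro allI impI)
      fix s :: "nat \<Rightarrow> real" assume s: "\<forall>i. s i \<in> {0..} - {t}" "s \<longlonglongrightarrow> t"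
      have s0: "s n \<ge> 0" for n using s(1) by auto
      let ?g = "\<lambda>n \<xi>. of_real (heat_mult t \<xi> - heat_mult (s n) \<xi>) * (of_real (symb \<xi>) * F \<xi>)"
      have eq: "L2_norm m (\<lambda>x. v x (s n) - v x t) = L2_norm m (?g n)" for n
      proof -
        have "isF (\<lambda>x. v x (s n) + (- 1) * v x t) (\<lambda>\<xi>. - of_real (symb \<xi>) * U (s n) \<xi> + (- 1) * (- of_real (symb \<xi>) * U t \<xi>))"
          by (intro isF_linear isv t s0)
        from isF_norm[OF this] show ?thesis by (simp add: U_def algebra_simps)
      qed
      show "(\<lambda>n. L2_norm m (\<lambda>x. v x (s n) - v x t)) \<longlonglongrightarrow> 0"
        unfolding eq
      proof (rule L2_norm_dominated[OF aF])
        fix n \<xi>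
        have "\<bar>heat_mult t \<xi> - heat_mult (s n) \<xi>\<bar> \<le> 1"
          using heat_mult_pos[of t \<xi>] heat_mult_le_1[OF t, of \<xi>] heat_mult_pos[of "s n" \<xi>] heat_mult_le_1[OF s0, of n \<xi>] by linarith
        then show "cmod (?g n \<xi>) \<le> cmod (of_real (symb \<xi>) * F \<xi>)"
          using mult_right_mono[of "\<bar>heat_mult t \<xi> - heat_mult (s n) \<xi>\<bar>" 1 "cmod (of_real (symb \<xi>) * F \<xi>)"]
          by (simp add: norm_mult[of "complex_of_real (_ - _)"] del: of_real_diff)
      next
        fix \<xi>
        have "(\<lambda>n. complex_of_real (exp (- t * symb \<xi>) - exp (- s n * symb \<xi>)) * (of_real (symb \<xi>) * F \<xi>)) \<longlonglongrightarrow>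
            complex_of_real (exp (- t * symb \<xi>) - exp (- t * symb \<xi>)) * (of_real (symb \<xi>) * F \<xi>)"
          by (intro tendsto_intros s(2))
        then show "(\<lambda>n. ?g n \<xi>) \<longlonglongrightarrow> 0" by (simp add: heat_mult_def)
      qed measurable
    qed
  qed
  have "classical_solution E \<mu> \<alpha> \<beta> f u"
    unfolding classical_solution_def using deriv dom by (intro exI[of _ v]) (auto simp: v_def u_def)
  moreover have "integrable m (\<lambda>y. hk (x - y) t * f y)" if "t > 0" for x t
    using heat_convolution(1)[OF that isf, of x] by (simp add: hk_Z[OF that])
  ultimately show ?thesis by (intro exI[of _ u]) (auto simp: u_def)
qed

end

section \<open>Regularity of paths on the dyadic numbers\<close>

definition dyadic :: "nat \<Rightarrow> nat \<Rightarrow> real"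
  where "dyadic n k = real k / 2 ^ n"

definition dyadic_times :: "real set"
  where "dyadic_times = {dyadic n k |n k. True}"

lemma dyadic_refine: "dyadic n k = dyadic (n + j) (k * 2 ^ j)"
  by (simp add: dyadic_def power_add)

lemma dyadic_Suc: "dyadic n k = dyadic (Suc n) (2 * k)"
  by (simp add: dyadic_def)

lemma dyadic_le_iff: "dyadic n a \<le> dyadic n b \<longleftrightarrow> a \<le> b"
  and dyadic_less_iff: "dyadic n a < dyadic n b \<longleftrightarrow> a < b"
  by (simp_all add: dyadic_def divide_le_cancel divide_less_cancel)

lemma dyadic_in_dyadics [simp]: "dyadic n k \<in> dyadic_times"
  by (auto simp: dyadic_times_def)

lemma dyadics_level: "q \<in> dyadic_times \<Longrightarrow> \<exists>n. \<forall>m\<ge>n. \<exists>k. q = dyadic m k"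
proof -
  assume "q \<in> dyadic_times"
  then obtain n k where q: "q = dyadic n k" by (auto simp: dyadic_times_def)
  have "q = dyadic m (k * 2 ^ (m - n))" if "m \<ge> n" for m
    using dyadic_refine[of n k "m - n"] that q by simp
  then show ?thesis by blast
qed

lemma finite_dyadics_level: "finite J \<Longrightarrow> J \<subseteq> dyadic_times \<Longrightarrow> \<exists>n. \<forall>m\<ge>n. J \<subseteq> range (dyadic m)"
proof (induction J rule: finite_induct)
  case (insert q J)
  then obtain n where n: "\<And>m. m \<ge> n \<Longrightarrow> J \<subseteq> range (dyadic m)" by auto
  obtain n' where "\<And>m. m \<ge> n' \<Longrightarrow> q \<in> range (dyadic m)" using dyadics_level[of q] insert by blast
  with n show ?case by (intro exI[of _ "max n n'"]) auto
qed simp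

lemma dyadics_add: assumes "p \<in> dyadic_times" "q \<in> dyadic_times" shows "p + q \<in> dyadic_times"
proof -
  obtain n where "\<forall>m\<ge>n. {p, q} \<subseteq> range (dyadic m)" using finite_dyadics_level[of "{p, q}"] assms by blast
  then have "{p, q} \<subseteq> range (dyadic n)" by blast
  then obtain a b where "p = dyadic n a" "q = dyadic n b" by auto
  then have "p + q = dyadic n (a + b)" by (simp add: dyadic_def add_divide_distrib)
  then show ?thesis by simp
qed

text \<open>The first grid point strictly after \<open>t\<close>. It has to differ from \<open>t\<close> even for dyadic \<open>t\<close>, since the value
  at \<open>t\<close> of a path on the dyadic numbers need not be its right limit.\<close>

definition dyadic_above :: "nat \<Rightarrow> real \<Rightarrow> real"
  where "dyadic_above j t = dyadic j (Suc (nat \<lfloor>t * 2 ^ j\<rfloor>))"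

lemma dyadic_above:
  assumes "t \<ge> 0"
  shows "dyadic_above j t \<in> dyadic_times" "t < dyadic_above j t" "dyadic_above j t \<le> t + 1 / 2 ^ j"
proof -
  have f: "real (nat \<lfloor>t * 2 ^ j\<rfloor>) = of_int \<lfloor>t * 2 ^ j\<rfloor>" using assms by simp
  have "t * 2 ^ j < of_int \<lfloor>t * 2 ^ j\<rfloor> + 1" "of_int \<lfloor>t * 2 ^ j\<rfloor> \<le> t * 2 ^ j" by linarith+
  then show "t < dyadic_above j t" "dyadic_above j t \<le> t + 1 / 2 ^ j"
    using f by (simp_all add: dyadic_above_def dyadic_def field_simps)
qed (simp add: dyadic_above_def)

lemma dyadic_above_tendsto: assumes "t \<ge> 0" shows "(\<lambda>j. dyadic_above j t) \<longlonglongrightarrow> t"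
proof (rule tendsto_sandwich[OF _ _ tendsto_const])
  show "\<forall>\<^sub>F j in sequentially. t \<le> dyadic_above j t" "\<forall>\<^sub>F j in sequentially. dyadic_above j t \<le> t + (1/2) ^ j"
    using dyadic_above[OF assms] by (auto intro!: always_eventually less_imp_le simp: power_divide)
  have "(\<lambda>j. t + (1/2::real) ^ j) \<longlonglongrightarrow> t + 0" by (intro tendsto_intros LIMSEQ_power_zero) auto
  then show "(\<lambda>j. t + (1/2::real) ^ j) \<longlonglongrightarrow> t" by simp
qed

lemma dyadics_dense: assumes "0 \<le> a" "a < b" shows "\<exists>q\<in>dyadic_times. a < q \<and> q < b"
proof -
  have "\<forall>\<^sub>F j in sequentially. dyadic_above j a < b"
    using order_tendstoD(2)[OF dyadic_above_tendsto[OF assms(1)] assms(2)] .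
  then obtain j where "dyadic_above j a < b" by (auto simp: eventually_sequentially)
  then show ?thesis using dyadic_above[OF assms(1), of j] by blast
qed

text \<open>The chaining argument. At each level \<open>n\<close> of two consecutive increments at least one is smaller
  than \<open>l n\<close>. Hence a grid point of level \<open>m + 1\<close> can be moved to a neighbouring point of level \<open>m\<close>
  at the cost \<open>l (m + 1)\<close>, and these moves preserve the order.\<close>

lemma chaining:
  fixes d :: "'a \<Rightarrow> 'a \<Rightarrow> real" and w :: "real \<Rightarrow> 'a"
  assumes refl: "\<And>x. d x x = 0" and sym: "\<And>x y. d x y = d y x"
    and tri: "\<And>x y z. d x z \<le> d x y + d y z" and l0: "\<And>n. l n \<ge> 0"
    and small: "\<And>j k. j \<ge> n \<Longrightarrow> k < M * 2 ^ j \<Longrightarrow>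
      min (d (w (dyadic j k)) (w (dyadic j (k + 1)))) (d (w (dyadic j (k + 1))) (w (dyadic j (k + 2)))) < l j"
    and i: "i + 2 \<le> M * 2 ^ n"
    and abc: "i * 2 ^ m \<le> a" "a \<le> b" "b \<le> c" "c \<le> (i + 2) * 2 ^ m"
  shows "min (d (w (dyadic (n + m) a)) (w (dyadic (n + m) b))) (d (w (dyadic (n + m) b)) (w (dyadic (n + m) c)))
      \<le> l n + 2 * (\<Sum>j\<in>{1..m}. l (n + j))"
  using abc
proof (induction m arbitrary: a b c)
  case 0
  consider "a = b" | "b = c" | "a = i" "b = i + 1" "c = i + 2" using 0 by force
  then show ?case
  proof cases
    case 3
    then show ?thesis using small[of n i] i by simp
  qed (use l0[of n] in \<open>auto simp: refl min_le_iff_disj\<close>)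
next
  case (Suc m)
  let ?g = "\<lambda>k. w (dyadic (n + Suc m) k)" and ?h = "\<lambda>k. w (dyadic (n + m) k)"
  have gh: "?g (2 * k) = ?h k" for k using dyadic_Suc[of "n + m" k] by simp
  (* an odd point, the midpoint of an interval of level n + m, moves to an endpoint to which its increment is small *)
  define pr where "pr k = (if even k then k div 2 else if d (?g (k - 1)) (?g k) < l (n + Suc m) then k div 2 else k div 2 + 1)" for k
  have pr1: "k div 2 \<le> pr k" "pr k \<le> (k + 1) div 2" for k by (auto simp: pr_def elim!: oddE)
  have mono: "pr j \<le> pr k" if "j \<le> k" for j k
  proof (cases "j = k")
    case False
    then have "(j + 1) div 2 \<le> k div 2 \<or> (even j \<and> k = j + 1)" using that by presburger
    then show ?thesis using pr1[of j] pr1[of k] by (auto simp: pr_def)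
  qed simp
  have close: "d (?g k) (?h (pr k)) \<le> l (n + Suc m)" if k: "k \<le> (i + 2) * 2 ^ Suc m" for k
  proof (cases "even k")
    case True
    then show ?thesis using gh[of "k div 2"] l0 by (simp add: pr_def refl)
  next
    case False
    then obtain j where j: "k = 2 * j + 1" by (elim oddE)
    have e: "?g (2 * j) = ?h j" "?g (2 * j + 2) = ?h (j + 1)" using gh[of j] gh[of "j + 1"] by simp_all
    have "(i + 2) * 2 ^ Suc m \<le> M * 2 ^ n * 2 ^ Suc m" by (rule mult_le_mono1[OF i])
    then have "2 * j < M * 2 ^ (n + Suc m)" using k j by (simp add: power_add mult_ac)
    from small[OF _ this] have "min (d (?g (2 * j)) (?g (2 * j + 1))) (d (?g (2 * j + 1)) (?g (2 * j + 2))) < l (n + Suc m)" by simp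
    then show ?thesis using j e sym[of "?g k" "?h j"] by (auto simp: pr_def min_less_iff_disj)
  qed
  have "i * 2 ^ m \<le> a div 2" using Suc.prems(1) by simp
  then have 1: "i * 2 ^ m \<le> pr a" using pr1(1)[of a] by simp
  have "(c + 1) div 2 \<le> (i + 2) * 2 ^ m"
  proof -
    have "c \<le> 2 * ((i + 2) * 2 ^ m)" using Suc.prems(4) by simp
    then show ?thesis by presburger
  qed
  then have 2: "pr c \<le> (i + 2) * 2 ^ m" using pr1(2)[of c] by simp
  have IH: "min (d (?h (pr a)) (?h (pr b))) (d (?h (pr b)) (?h (pr c))) \<le> l n + 2 * (\<Sum>j\<in>{1..m}. l (n + j))"
    using Suc.prems by (intro Suc.IH 1 2 mono)
  have step: "d (?g x) (?g y) \<le> d (?h (pr x)) (?h (pr y)) + 2 * l (n + Suc m)" if "x \<le> c" "y \<le> c" for x y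
    using tri[of "?g x" "?g y" "?h (pr x)"] tri[of "?h (pr x)" "?g y" "?h (pr y)"] close[of x] close[of y] sym[of "?g y" "?h (pr y)"]
      Suc.prems(4) that by simp
  have "{1..Suc m} = insert (Suc m) {1..m}" by auto
  then have "(\<Sum>j\<in>{1..Suc m}. l (n + j)) = l (n + Suc m) + (\<Sum>j\<in>{1..m}. l (n + j))" by simp
  then show ?case using IH step[of a b] step[of b c] Suc.prems by (auto simp: min_le_iff_disj)
qed

text \<open>Three dyadic times within \<open>2\<^sup>-\<^sup>n\<close> of each other lie in two adjacent intervals of level \<open>n\<close>, so that chaining
  bounds the smaller of the two increments by a tail of the series of the \<open>l j\<close>. As only the \<open>j 2\<^sup>j\<close> first
  pairs of level \<open>j\<close> are controlled, the level \<open>n\<close> has to exceed the time horizon as well.\<close>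

lemma chaining_oscillation:
  fixes d :: "'a \<Rightarrow> 'a \<Rightarrow> real" and w :: "real \<Rightarrow> 'a"
  assumes refl: "\<And>x. d x x = 0" and sym: "\<And>x y. d x y = d y x"
    and tri: "\<And>x y z. d x z \<le> d x y + d y z" and l0: "\<And>n. l n \<ge> 0" and summ: "summable l"
    and small: "\<And>j k. j \<ge> N \<Longrightarrow> k < j * 2 ^ j \<Longrightarrow>
      min (d (w (dyadic j k)) (w (dyadic j (k + 1)))) (d (w (dyadic j (k + 1))) (w (dyadic j (k + 2)))) < l j"
    and e: "e > 0"
  shows "\<exists>\<delta>>0. \<forall>r\<in>dyadic_times. \<forall>s\<in>dyadic_times. \<forall>t\<in>dyadic_times. r < s \<and> s < t \<and> t \<le> T \<and> t - r < \<delta> \<longrightarrow>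
    min (d (w r) (w s)) (d (w s) (w t)) < e"
proof -
  obtain M0 :: nat where M0: "T < real M0" using reals_Archimedean2 by blast
  define M where "M = M0 + 1"
  have "\<exists>n0. \<forall>n\<ge>n0. norm (\<Sum>j. l (j + n)) < e / 2" using suminf_exist_split[of "e/2" l] e summ by simp
  then obtain n0 where n0: "\<And>n. n \<ge> n0 \<Longrightarrow> (\<Sum>j. l (j + n)) < e / 2" by fastforce
  define n where "n = max (max N M) n0"
  have n: "n \<ge> N" "n \<ge> M" "n \<ge> n0" by (auto simp: n_def)
  have tail: "l n + 2 * (\<Sum>j\<in>{1..m}. l (n + j)) < e" for m
  proof -
    have s: "summable (\<lambda>j. l (j + n))" using summ by (simp add: summable_iff_shift)
    have "(\<Sum>j\<in>{0..m}. l (j + n)) \<le> (\<Sum>j. l (j + n))" by (rule sum_le_suminf[OF s]) (auto simp: l0)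
    moreover have "{0..m} = insert 0 {1..m}" by auto
    ultimately have "l n + (\<Sum>j\<in>{1..m}. l (n + j)) \<le> (\<Sum>j. l (j + n))" by (simp add: add.commute)
    then show ?thesis using n0[OF n(3)] l0[of n] by linarith
  qed
  have "min (d (w r) (w s)) (d (w s) (w t)) < e"
    if q: "r \<in> dyadic_times" "s \<in> dyadic_times" "t \<in> dyadic_times" and lt: "r < s" "s < t" "t \<le> T" "t - r < 1 / 2 ^ n" for r s t
  proof -
    obtain n' where n': "\<And>k. k \<ge> n' \<Longrightarrow> {r, s, t} \<subseteq> range (dyadic k)" using finite_dyadics_level[of "{r, s, t}"] q by auto
    obtain m where "{r, s, t} \<subseteq> range (dyadic (n + m))" using n'[of "n + n'"] by auto
    then obtain a b c where abc: "r = dyadic (n + m) a" "s = dyadic (n + m) b" "t = dyadic (n + m) c" by auto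
    have le: "a \<le> b" "b \<le> c" using lt unfolding abc by (simp_all add: dyadic_less_iff)
    define i where "i = a div 2 ^ m"
    have i1: "i * 2 ^ m \<le> a" by (simp add: i_def)
    have i2: "a < (i + 1) * 2 ^ m" using dividend_less_div_times[of "2 ^ m" a] by (simp add: i_def algebra_simps)
    have "real c / 2 ^ (n + m) - real a / 2 ^ (n + m) < 1 / 2 ^ n" using lt(4) unfolding abc dyadic_def .
    then have "(real c / 2 ^ (n + m) - real a / 2 ^ (n + m)) * 2 ^ (n + m) < 1 / 2 ^ n * 2 ^ (n + m)"
      by (rule mult_strict_right_mono) simp
    then have "real c - real a < 2 ^ m" by (simp add: left_diff_distrib power_add)
    then have "real c < real (a + 2 ^ m)" by simp
    then have "c < a + 2 ^ m" by (simp only: of_nat_less_iff)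
    then have c: "c \<le> (i + 2) * 2 ^ m" using i2 by (simp add: algebra_simps)
    have "real a / 2 ^ (n + m) < real M0" using lt M0 unfolding abc dyadic_def by linarith
    then have "real a < real (M0 * 2 ^ (n + m))" by (simp add: field_simps)
    then have "a < M0 * 2 ^ n * 2 ^ m" by (simp only: of_nat_less_iff power_add mult.assoc)
    then have "i < M0 * 2 ^ n" unfolding i_def by (simp add: less_mult_imp_div_less)
    moreover have "M * 2 ^ n \<ge> M0 * 2 ^ n + 1" by (simp add: M_def)
    moreover have "M * 2 ^ n = M0 * 2 ^ n + 2 ^ n" by (simp add: M_def)
    moreover have "n \<ge> 1" using n(2) by (simp add: M_def)
    then have "(2::nat) ^ 1 \<le> 2 ^ n" by (intro power_increasing) auto
    ultimately have iM: "i + 2 \<le> M * 2 ^ n" by simp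
    have "min (d (w r) (w s)) (d (w s) (w t)) \<le> l n + 2 * (\<Sum>j\<in>{1..m}. l (n + j))"
      unfolding abc
    proof (rule chaining[OF refl sym tri l0 _ iM i1 le c])
      fix j k assume "j \<ge> n" "k < M * 2 ^ j"
      moreover have "M * 2 ^ j \<le> j * 2 ^ j" using n(2) \<open>j \<ge> n\<close> by (intro mult_le_mono1) simp
      ultimately have "j \<ge> N" "k < j * 2 ^ j" using n(1) by linarith+
      then show "min (d (w (dyadic j k)) (w (dyadic j (k + 1)))) (d (w (dyadic j (k + 1))) (w (dyadic j (k + 2)))) < l j"
        by (rule small)
    qed
    then show ?thesis using tail[of m] by linarith
  qed
  then show ?thesis by (intro exI[of _ "1 / 2 ^ n"]) auto
qed

lemma cauchy_imp_tendsto_within: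
  fixes w :: "real \<Rightarrow> 'a::complete_space"
  assumes nb: "at \<tau> within S \<noteq> bot"
    and cau: "\<And>e. e > 0 \<Longrightarrow> \<exists>\<delta>>0. \<forall>s\<in>S. \<forall>t\<in>S. s \<noteq> \<tau> \<longrightarrow> t \<noteq> \<tau> \<longrightarrow> \<bar>s - \<tau>\<bar> < \<delta> \<longrightarrow> \<bar>t - \<tau>\<bar> < \<delta> \<longrightarrow> dist (w s) (w t) < e"
  shows "\<exists>L. (w \<longlongrightarrow> L) (at \<tau> within S)"
proof -
  have "\<tau> islimpt S" using nb by (simp add: trivial_limit_within)
  then obtain x where x: "\<And>n::nat. x n \<in> S - {\<tau>}" "x \<longlonglongrightarrow> \<tau>" unfolding islimpt_sequential by blast
  have "Cauchy (\<lambda>n. w (x n))"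
  proof (rule metric_CauchyI)
    fix e :: real assume "e > 0"
    then obtain \<delta> where \<delta>: "\<delta> > 0" "\<And>s t. s \<in> S \<Longrightarrow> t \<in> S \<Longrightarrow> s \<noteq> \<tau> \<Longrightarrow> t \<noteq> \<tau> \<Longrightarrow> \<bar>s - \<tau>\<bar> < \<delta> \<Longrightarrow> \<bar>t - \<tau>\<bar> < \<delta> \<Longrightarrow> dist (w s) (w t) < e"
      using cau by metis
    obtain N where "\<And>n. n \<ge> N \<Longrightarrow> \<bar>x n - \<tau>\<bar> < \<delta>" using LIMSEQ_D[OF x(2) \<delta>(1)] by auto
    then show "\<exists>M. \<forall>i\<ge>M. \<forall>j\<ge>M. dist (w (x i)) (w (x j)) < e" using x(1) \<delta>(2) by blast
  qed
  then obtain L where L: "(\<lambda>n. w (x n)) \<longlonglongrightarrow> L" using Cauchy_convergent convergent_def by blast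
  have "(w \<longlongrightarrow> L) (at \<tau> within S)"
  proof (rule tendstoI)
    fix e :: real assume e: "e > 0"
    then obtain \<delta> where \<delta>: "\<delta> > 0" "\<And>s t. s \<in> S \<Longrightarrow> t \<in> S \<Longrightarrow> s \<noteq> \<tau> \<Longrightarrow> t \<noteq> \<tau> \<Longrightarrow> \<bar>s - \<tau>\<bar> < \<delta> \<Longrightarrow> \<bar>t - \<tau>\<bar> < \<delta> \<Longrightarrow> dist (w s) (w t) < e / 2"
      using cau[of "e/2"] by (metis half_gt_zero)
    have "\<forall>\<^sub>F n in sequentially. \<bar>x n - \<tau>\<bar> < \<delta>" using x(2) \<delta>(1) by (auto simp: tendsto_iff dist_real_def)
    moreover have "\<forall>\<^sub>F n in sequentially. dist (w (x n)) L < e / 2" using tendstoD[OF L, of "e/2"] e by simp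
    ultimately have "\<forall>\<^sub>F n in sequentially. \<bar>x n - \<tau>\<bar> < \<delta> \<and> dist (w (x n)) L < e / 2" by (rule eventually_conj)
    then obtain n where n: "\<bar>x n - \<tau>\<bar> < \<delta>" "dist (w (x n)) L < e / 2" by (auto simp: eventually_sequentially)
    have "dist (w s) L < e" if "s \<in> S" "s \<noteq> \<tau>" "\<bar>s - \<tau>\<bar> < \<delta>" for s
      using \<delta>(2)[of s "x n"] that x(1)[of n] n dist_triangle[of "w s" L "w (x n)"] by fastforce
    then show "\<forall>\<^sub>F s in at \<tau> within S. dist (w s) L < e"
      unfolding eventually_at using \<delta>(1) by (intro exI[of _ \<delta>]) (auto simp: dist_real_def)
  qed
  then show ?thesis by blast
qed

text \<open>The analogue of uniform continuity for paths with jumps: of three nearby times, at most one of the two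
  gaps can contain a jump.\<close>

definition regulated :: "(real \<Rightarrow> 'a::metric_space) \<Rightarrow> bool"
  where "regulated w \<longleftrightarrow> (\<forall>T. \<forall>e>0. \<exists>\<delta>>0. \<forall>r\<in>dyadic_times. \<forall>s\<in>dyadic_times. \<forall>t\<in>dyadic_times.
    r < s \<and> s < t \<and> t \<le> T \<and> t - r < \<delta> \<longrightarrow> min (dist (w r) (w s)) (dist (w s) (w t)) < e)"

lemma regulatedD:
  assumes "regulated w" "e > 0"
  shows "\<exists>\<delta>>0. \<forall>r\<in>dyadic_times. \<forall>s\<in>dyadic_times. \<forall>t\<in>dyadic_times.
    r < s \<longrightarrow> s < t \<longrightarrow> t \<le> T \<longrightarrow> t - r < \<delta> \<longrightarrow> dist (w r) (w s) < e \<or> dist (w s) (w t) < e"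
proof -
  obtain \<delta> where \<delta>: "\<delta> > 0" "\<forall>r\<in>dyadic_times. \<forall>s\<in>dyadic_times. \<forall>t\<in>dyadic_times.
    r < s \<and> s < t \<and> t \<le> T \<and> t - r < \<delta> \<longrightarrow> min (dist (w r) (w s)) (dist (w s) (w t)) < e"
    using assms unfolding regulated_def by blast
  then show ?thesis unfolding min_less_iff_disj by blast
qed

lemma at_dyadics_right: assumes "\<tau> \<ge> 0" shows "at \<tau> within (dyadic_times \<inter> {\<tau><..}) \<noteq> bot"
proof -
  have "\<tau> islimpt (dyadic_times \<inter> {\<tau><..})" unfolding islimpt_approachable
  proof (intro allI impI)
    fix e :: real assume "e > 0"
    then obtain q where "q \<in> dyadic_times" "\<tau> < q" "q < \<tau> + e" using dyadics_dense[of \<tau> "\<tau> + e"] assms by auto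
    then show "\<exists>x'\<in>dyadic_times \<inter> {\<tau><..}. x' \<noteq> \<tau> \<and> dist x' \<tau> < e" by (auto simp: dist_real_def intro!: bexI[of _ q])
  qed
  then show ?thesis by (simp add: trivial_limit_within)
qed

lemma at_dyadics_left: assumes "\<tau> > 0" shows "at \<tau> within (dyadic_times \<inter> {..<\<tau>}) \<noteq> bot"
proof -
  have "\<tau> islimpt (dyadic_times \<inter> {..<\<tau>})" unfolding islimpt_approachable
  proof (intro allI impI)
    fix e :: real assume "e > 0"
    then obtain q where "q \<in> dyadic_times" "max 0 (\<tau> - e) < q" "q < \<tau>" using dyadics_dense[of "max 0 (\<tau> - e)" \<tau>] assms by auto
    then show "\<exists>x'\<in>dyadic_times \<inter> {..<\<tau>}. x' \<noteq> \<tau> \<and> dist x' \<tau> < e" by (auto simp: dist_real_def intro!: bexI[of _ q])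
  qed
  then show ?thesis by (simp add: trivial_limit_within)
qed

text \<open>A large increment between two times \<open>s < t\<close> close to \<open>\<tau>\<close> forces the values at all times between \<open>\<tau>\<close> and
  \<open>s\<close> to be near \<open>w s\<close>.\<close>

lemma regulated_right_limit:
  fixes w :: "real \<Rightarrow> 'a::complete_space"
  assumes w: "regulated w" and \<tau>: "\<tau> \<ge> 0"
  shows "\<exists>L. (w \<longlongrightarrow> L) (at \<tau> within (dyadic_times \<inter> {\<tau><..}))"
proof (rule cauchy_imp_tendsto_within[OF at_dyadics_right[OF \<tau>]])
  fix e :: real assume e: "e > 0"
  obtain \<delta> where \<delta>: "\<delta> > 0" "\<And>r s t. r \<in> dyadic_times \<Longrightarrow> s \<in> dyadic_times \<Longrightarrow> t \<in> dyadic_times \<Longrightarrow> r < s \<Longrightarrow> s < t \<Longrightarrow> t \<le> \<tau> + 1 \<Longrightarrow> t - r < \<delta> \<Longrightarrow>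
      dist (w r) (w s) < e / 2 \<or> dist (w s) (w t) < e / 2"
    using regulatedD[OF w half_gt_zero[OF e], of "\<tau> + 1"] by blast
  define \<eta> where "\<eta> = min \<delta> 1"
  have \<eta>: "\<eta> > 0" "\<eta> \<le> \<delta>" "\<eta> \<le> 1" using \<delta>(1) by (auto simp: \<eta>_def)
  show "\<exists>\<delta>>0. \<forall>s\<in>dyadic_times \<inter> {\<tau><..}. \<forall>t\<in>dyadic_times \<inter> {\<tau><..}. s \<noteq> \<tau> \<longrightarrow> t \<noteq> \<tau> \<longrightarrow> \<bar>s - \<tau>\<bar> < \<delta> \<longrightarrow> \<bar>t - \<tau>\<bar> < \<delta> \<longrightarrow> dist (w s) (w t) < e"
  proof (cases "\<exists>s\<in>dyadic_times. \<exists>t\<in>dyadic_times. \<tau> < s \<and> s < t \<and> t < \<tau> + \<eta> \<and> dist (w s) (w t) \<ge> e / 2")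
    case True
    then obtain s t where st: "s \<in> dyadic_times" "t \<in> dyadic_times" "\<tau> < s" "s < t" "t < \<tau> + \<eta>" "dist (w s) (w t) \<ge> e / 2" by blast
    have near: "dist (w r) (w s) < e / 2" if "r \<in> dyadic_times" "\<tau> < r" "r < s" for r
      using \<delta>(2)[of r s t] st that \<eta> by force
    have "dist (w r) (w r') < e" if "r \<in> dyadic_times" "\<tau> < r" "r < s" "r' \<in> dyadic_times" "\<tau> < r'" "r' < s" for r r'
      using near[OF that(1-3)] near[OF that(4-6)] dist_triangle2[of "w r" "w r'" "w s"] by linarith
    then show ?thesis using st(3) by (intro exI[of _ "s - \<tau>"]) auto
  next
    case False
    then have F: "dist (w s) (w t) < e / 2" if "s \<in> dyadic_times" "t \<in> dyadic_times" "\<tau> < s" "s < t" "t < \<tau> + \<eta>" for s t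
      using that by force
    have "dist (w s) (w t) < e" if "s \<in> dyadic_times" "t \<in> dyadic_times" "\<tau> < s" "\<tau> < t" "t < \<tau> + \<eta>" "s < \<tau> + \<eta>" for s t
      using F[of s t] F[of t s] that e by (cases s t rule: linorder_cases) (auto simp: dist_commute)
    then show ?thesis using \<eta>(1) by (intro exI[of _ \<eta>]) auto
  qed
qed

lemma regulated_left_limit:
  fixes w :: "real \<Rightarrow> 'a::complete_space"
  assumes w: "regulated w" and \<tau>: "\<tau> > 0"
  shows "\<exists>L. (w \<longlongrightarrow> L) (at \<tau> within (dyadic_times \<inter> {..<\<tau>}))"
proof (rule cauchy_imp_tendsto_within[OF at_dyadics_left[OF \<tau>]])
  fix e :: real assume e: "e > 0"
  obtain \<delta> where \<delta>: "\<delta> > 0" "\<And>r s t. r \<in> dyadic_times \<Longrightarrow> s \<in> dyadic_times \<Longrightarrow> t \<in> dyadic_times \<Longrightarrow> r < s \<Longrightarrow> s < t \<Longrightarrow> t \<le> \<tau> \<Longrightarrow> t - r < \<delta> \<Longrightarrow>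
      dist (w r) (w s) < e / 2 \<or> dist (w s) (w t) < e / 2"
    using regulatedD[OF w half_gt_zero[OF e], of "\<tau>"] by blast
  show "\<exists>\<delta>>0. \<forall>s\<in>dyadic_times \<inter> {..<\<tau>}. \<forall>t\<in>dyadic_times \<inter> {..<\<tau>}. s \<noteq> \<tau> \<longrightarrow> t \<noteq> \<tau> \<longrightarrow> \<bar>s - \<tau>\<bar> < \<delta> \<longrightarrow> \<bar>t - \<tau>\<bar> < \<delta> \<longrightarrow> dist (w s) (w t) < e"
  proof (cases "\<exists>r\<in>dyadic_times. \<exists>s\<in>dyadic_times. \<tau> - \<delta> < r \<and> r < s \<and> s < \<tau> \<and> dist (w r) (w s) \<ge> e / 2")
    case True
    then obtain r s where rs: "r \<in> dyadic_times" "s \<in> dyadic_times" "\<tau> - \<delta> < r" "r < s" "s < \<tau>" "dist (w r) (w s) \<ge> e / 2" by blast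
    have near: "dist (w t) (w s) < e / 2" if "t \<in> dyadic_times" "s < t" "t < \<tau>" for t
      using \<delta>(2)[of r s t] rs that by (force simp: dist_commute)
    have "dist (w t) (w t') < e" if "t \<in> dyadic_times" "s < t" "t < \<tau>" "t' \<in> dyadic_times" "s < t'" "t' < \<tau>" for t t'
      using near[OF that(1-3)] near[OF that(4-6)] dist_triangle2[of "w t" "w t'" "w s"] by linarith
    then show ?thesis using rs(5) by (intro exI[of _ "\<tau> - s"]) auto
  next
    case False
    then have F: "dist (w s) (w t) < e / 2" if "s \<in> dyadic_times" "t \<in> dyadic_times" "\<tau> - \<delta> < s" "s < t" "t < \<tau>" for s t
      using that by force
    have "dist (w s) (w t) < e" if "s \<in> dyadic_times" "t \<in> dyadic_times" "\<tau> - \<delta> < s" "\<tau> - \<delta> < t" "t < \<tau>" "s < \<tau>" for s t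
      using F[of s t] F[of t s] that e by (cases s t rule: linorder_cases) (auto simp: dist_commute)
    then show ?thesis using \<delta>(1) by (intro exI[of _ \<delta>]) auto
  qed
qed

definition right_limits :: "(real \<Rightarrow> 'a::metric_space) \<Rightarrow> real \<Rightarrow> 'a"
  where "right_limits w t = lim (\<lambda>j. w (dyadic_above j t))"

lemma filterlim_at_dyadics_right:
  assumes "q \<longlonglongrightarrow> \<tau>" "\<And>j. q j \<in> dyadic_times" "\<And>j. \<tau> < q j"
  shows "filterlim q (at \<tau> within (dyadic_times \<inter> {\<tau><..})) sequentially"
  using assms unfolding filterlim_at by (auto simp: less_imp_neq[symmetric])

lemma right_limits:
  fixes w :: "real \<Rightarrow> 'a::complete_space"
  assumes w: "regulated w" and \<tau>: "\<tau> \<ge> 0"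
  shows "(w \<longlongrightarrow> right_limits w \<tau>) (at \<tau> within (dyadic_times \<inter> {\<tau><..}))"
proof -
  obtain L where L: "(w \<longlongrightarrow> L) (at \<tau> within (dyadic_times \<inter> {\<tau><..}))" using regulated_right_limit[OF assms] by blast
  have "filterlim (\<lambda>j. dyadic_above j \<tau>) (at \<tau> within (dyadic_times \<inter> {\<tau><..})) sequentially"
    using dyadic_above[OF \<tau>] by (intro filterlim_at_dyadics_right dyadic_above_tendsto \<tau>) auto
  from filterlim_compose[OF L this] have "right_limits w \<tau> = L"
    unfolding right_limits_def by (rule limI)
  with L show ?thesis by simp
qed

lemma right_limits_sequence:
  fixes w :: "real \<Rightarrow> 'a::complete_space"
  assumes "regulated w" "\<tau> \<ge> 0" "q \<longlonglongrightarrow> \<tau>" "\<And>j. q j \<in> dyadic_times" "\<And>j. \<tau> < q j"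
  shows "(\<lambda>j. w (q j)) \<longlonglongrightarrow> right_limits w \<tau>"
  by (rule filterlim_compose[OF right_limits filterlim_at_dyadics_right]) (use assms in auto)

text \<open>Bounds on the dyadic times of an interval carry over to the right limits in it.\<close>

lemma dist_right_limits_le:
  fixes w :: "real \<Rightarrow> 'a::complete_space"
  assumes w: "regulated w" and u: "0 \<le> a" "a \<le> u" "u < b"
    and near: "\<And>q. q \<in> dyadic_times \<Longrightarrow> a < q \<Longrightarrow> q < b \<Longrightarrow> dist (w q) L \<le> e"
  shows "dist (right_limits w u) L \<le> e"
proof (rule tendsto_upperbound[OF tendsto_dist[OF right_limits[OF w] tendsto_const] _ at_dyadics_right])
  show "0 \<le> u" "0 \<le> u" using u by auto
  show "\<forall>\<^sub>F q in at u within (dyadic_times \<inter> {u<..}). dist (w q) L \<le> e"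
    unfolding eventually_at using u near by (intro exI[of _ "b - u"]) (auto simp: dist_real_def)
qed

lemma right_continuous_right_limits:
  fixes w :: "real \<Rightarrow> 'a::complete_space"
  assumes w: "regulated w" shows "right_continuous_trajectory (right_limits w)"
  unfolding right_continuous_trajectory_def continuous_within
proof (intro allI impI tendstoI)
  fix t e :: real assume t: "0 \<le> t" and e: "e > 0"
  have "\<forall>\<^sub>F q in at t within (dyadic_times \<inter> {t<..}). dist (w q) (right_limits w t) < e / 2"
    by (rule tendstoD[OF right_limits[OF w t]]) (use e in simp)
  then obtain \<delta> where \<delta>: "\<delta> > 0" "\<And>q. q \<in> dyadic_times \<Longrightarrow> t < q \<Longrightarrow> q < t + \<delta> \<Longrightarrow> dist (w q) (right_limits w t) \<le> e / 2"
    unfolding eventually_at by (force simp: dist_real_def)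
  have "dist (right_limits w u) (right_limits w t) < e" if "t < u" "u < t + \<delta>" for u
    using dist_right_limits_le[OF w t less_imp_le[OF that(1)] that(2) \<delta>(2)] e by linarith
  then show "\<forall>\<^sub>F u in at_right t. dist (right_limits w u) (right_limits w t) < e"
    unfolding eventually_at using \<delta>(1) by (intro exI[of _ \<delta>]) (auto simp: dist_real_def)
qed

lemma only_jumps_right_limits:
  fixes w :: "real \<Rightarrow> 'a::complete_space"
  assumes w: "regulated w" shows "only_jumps_trajectory (right_limits w)"
  unfolding only_jumps_trajectory_def
proof (intro allI impI)
  fix t :: real assume t: "0 < t"
  obtain L where L: "(w \<longlongrightarrow> L) (at t within (dyadic_times \<inter> {..<t}))" using regulated_left_limit[OF w t] by blast
  have "(right_limits w \<longlongrightarrow> L) (at_left t)"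
  proof (rule tendstoI)
    fix e :: real assume e: "e > 0"
    have "\<forall>\<^sub>F q in at t within (dyadic_times \<inter> {..<t}). dist (w q) L < e / 2" by (rule tendstoD[OF L]) (use e in simp)
    then obtain \<delta> where \<delta>: "\<delta> > 0" "\<And>q. q \<in> dyadic_times \<Longrightarrow> q < t \<Longrightarrow> t - \<delta> < q \<Longrightarrow> dist (w q) L \<le> e / 2"
      unfolding eventually_at by (force simp: dist_real_def)
    define a where "a = max 0 (t - \<delta>)"
    have "dist (right_limits w u) L < e" if "a < u" "u < t" for u
    proof -
      have "dist (right_limits w u) L \<le> e / 2"
        by (rule dist_right_limits_le[OF w, of a u t]) (use that \<delta>(2) in \<open>auto simp: a_def\<close>)
      then show ?thesis using e by linarith
    qed
    then show "\<forall>\<^sub>F u in at_left t. dist (right_limits w u) L < e"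
      unfolding eventually_at_left_field using \<delta>(1) t by (intro exI[of _ a]) (auto simp: a_def)
  qed
  then show "\<exists>l. (right_limits w \<longlongrightarrow> l) (at_left t)" ..
qed

text \<open>A sequence of times in \<open>[0, T]\<close> has a monotone subsequence, along which a right continuous path
  with left limits converges.\<close>

lemma cadlag_imp_bounded_trajectory:
  fixes w :: "real \<Rightarrow> 'a::metric_space"
  assumes r: "right_continuous_trajectory w" and l: "only_jumps_trajectory w"
  shows "bounded_trajectory w"
  unfolding bounded_trajectory_def
proof (intro allI impI)
  fix T :: real assume T: "0 \<le> T"
  have seq: "\<exists>L s. strict_mono s \<and> (\<lambda>n. w (x (s n))) \<longlonglongrightarrow> L" if x: "\<And>n::nat. x n \<in> {0..T}" for x
  proof -
    obtain s where s: "strict_mono s" "monoseq (\<lambda>n. x (s n))" using seq_monosub[of x] by auto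
    define y where "y n = x (s n)" for n
    have "Bseq y" using x by (intro BseqI'[of _ T]) (auto simp: y_def)
    moreover have "monoseq y" using s(2) by (simp add: y_def[abs_def])
    ultimately have "convergent y" by (rule Bseq_monoseq_convergent)
    then obtain \<tau> where \<tau>: "y \<longlonglongrightarrow> \<tau>" by (auto simp: convergent_def)
    have \<tau>0: "0 \<le> \<tau>" using x by (intro LIMSEQ_le_const[OF \<tau>]) (auto simp: y_def)
    have sub: "\<exists>L s. strict_mono s \<and> (\<lambda>n. w (x (s n))) \<longlonglongrightarrow> L" if "strict_mono k" "(\<lambda>n. w (y (k n))) \<longlonglongrightarrow> L" for k :: "nat \<Rightarrow> nat" and L
      using strict_mono_o[OF s(1) that(1)] that(2) by (intro exI[of _ L] exI[of _ "s \<circ> k"]) (auto simp: y_def o_def)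
    have inf: "\<exists>k :: nat \<Rightarrow> nat. strict_mono k \<and> (\<forall>n. P (y (k n)))" if "\<exists>\<^sub>F n in sequentially. P (y n)" for P
    proof -
      have "infinite {n. P (y n)}" using that by (simp add: frequently_cofinite flip: cofinite_eq_sequentially)
      then show ?thesis using enumerate_in_set[of "{n. P (y n)}"] strict_mono_enumerate[of "{n. P (y n)}"] by blast
    qed
    consider "\<exists>\<^sub>F n in sequentially. y n > \<tau>" | "\<exists>\<^sub>F n in sequentially. y n < \<tau>" | "\<exists>\<^sub>F n in sequentially. y n = \<tau>"
    proof (rule ccontr)
      assume "\<not> thesis"
      then have "\<forall>\<^sub>F n in sequentially. \<not> y n > \<tau>" "\<forall>\<^sub>F n in sequentially. \<not> y n < \<tau>" "\<forall>\<^sub>F n in sequentially. \<not> y n = \<tau>"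
        using that by (auto simp: frequently_def)
      then have "\<forall>\<^sub>F n in sequentially. False" by eventually_elim auto
      then show False by simp
    qed
    then show ?thesis
    proof cases
      case 1
      then obtain k where k: "strict_mono k" "\<And>n::nat. y (k n) > \<tau>" using inf[of "\<lambda>z. z > \<tau>"] by blast
      have "(\<lambda>n. y (k n)) \<longlonglongrightarrow> \<tau>" using LIMSEQ_subseq_LIMSEQ[OF \<tau> k(1)] by (simp add: o_def)
      then have "filterlim (\<lambda>n. y (k n)) (at_right \<tau>) sequentially"
        using k(2) by (intro filterlim_at_withinI) (auto simp: less_imp_neq[symmetric])
      moreover have "(w \<longlongrightarrow> w \<tau>) (at_right \<tau>)" using r \<tau>0 by (auto simp: right_continuous_trajectory_def continuous_within)
      ultimately show ?thesis using k(1) by (intro sub[of k "w \<tau>"]) (auto intro: filterlim_compose)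
    next
      case 2
      then obtain k where k: "strict_mono k" "\<And>n::nat. y (k n) < \<tau>" using inf[of "\<lambda>z. z < \<tau>"] by blast
      have "0 < \<tau>" using k(2)[of 0] x[of "s (k 0)"] by (auto simp: y_def)
      then obtain L where L: "(w \<longlongrightarrow> L) (at_left \<tau>)" using l by (auto simp: only_jumps_trajectory_def)
      have "(\<lambda>n. y (k n)) \<longlonglongrightarrow> \<tau>" using LIMSEQ_subseq_LIMSEQ[OF \<tau> k(1)] by (simp add: o_def)
      then have "filterlim (\<lambda>n. y (k n)) (at_left \<tau>) sequentially"
        using k(2) by (intro filterlim_at_withinI) (auto simp: less_imp_neq)
      then show ?thesis using k(1) L by (intro sub[of k L]) (auto intro: filterlim_compose)
    next
      case 3
      then obtain k where k: "strict_mono k" "\<And>n::nat. y (k n) = \<tau>" using inf[of "\<lambda>z. z = \<tau>"] by blast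
      then show ?thesis by (intro sub[of k "w \<tau>"]) auto
    qed
  qed
  have "seq_compact (closure (w ` {0..T}))"
    unfolding seq_compact_def
  proof (intro allI impI)
    fix f :: "nat \<Rightarrow> 'a" assume f: "\<forall>n. f n \<in> closure (w ` {0..T})"
    have "\<exists>y\<in>{0..T}. dist (w y) (f n) < (1/2) ^ n" for n
      using f[rule_format, of n] unfolding closure_approachable by (metis (no_types) imageE zero_less_power half_gt_zero zero_less_one)
    then obtain x where x: "\<And>n. x n \<in> {0..T}" "\<And>n. dist (w (x n)) (f n) < (1/2) ^ n" by metis
    obtain L s where s: "strict_mono s" "(\<lambda>n. w (x (s n))) \<longlonglongrightarrow> L" using seq[of x, OF x(1)] by blast
    have h: "(\<lambda>n. (1/2::real) ^ s n) \<longlonglongrightarrow> 0"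
      using LIMSEQ_subseq_LIMSEQ[OF LIMSEQ_power_zero[of "1/2::real"] s(1)] by (simp add: o_def)
    have "(\<lambda>n. dist (f (s n)) L) \<longlonglongrightarrow> 0"
    proof (rule Lim_null_comparison[OF always_eventually])
      have "(\<lambda>n. (1/2) ^ s n + dist (w (x (s n))) L) \<longlonglongrightarrow> 0 + dist L L" by (intro tendsto_intros h s(2))
      then show "(\<lambda>n. (1/2) ^ s n + dist (w (x (s n))) L) \<longlonglongrightarrow> 0" by simp
      show "\<forall>n. norm (dist (f (s n)) L) \<le> (1/2) ^ s n + dist (w (x (s n))) L"
      proof
        fix n
        show "norm (dist (f (s n)) L) \<le> (1/2) ^ s n + dist (w (x (s n))) L"
          using x(2)[of "s n"] dist_triangle[of "f (s n)" L "w (x (s n))"] dist_commute[of "f (s n)" "w (x (s n))"] by simp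
      qed
    qed
    then have lim: "(f \<circ> s) \<longlonglongrightarrow> L" by (subst tendsto_dist_iff) (simp add: o_def)
    then have "L \<in> closure (w ` {0..T})" using f by (intro closed_sequentially[OF closed_closure _ lim]) auto
    then show "\<exists>l\<in>closure (w ` {0..T}). \<exists>r. strict_mono r \<and> (f \<circ> r) \<longlonglongrightarrow> l" using s(1) lim by blast
  qed
  then show "compact (closure (w ` {0..T}))" by (simp add: compact_eq_seq_compact_metric)
qed

section \<open>The process at dyadic times\<close>

lemma sets_Collect_measurable: "f \<in> M \<rightarrow>\<^sub>M N \<Longrightarrow> B \<in> sets N \<Longrightarrow> {x \<in> space M. f x \<in> B} \<in> sets M"
  using measurable_sets[of f M N B] by (simp add: vimage_def Int_def conj_commute)

lemma borel_measurable_group_diff: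
  fixes f g :: "'a \<Rightarrow> 'b::{second_countable_topology, topological_group_add}"
  assumes f: "f \<in> borel_measurable M" and g: "g \<in> borel_measurable M"
  shows "(\<lambda>x. f x - g x) \<in> borel_measurable M"
  using f g by (rule borel_measurable_continuous_Pair) (intro continuous_intros)

text \<open>The transition measures of a process with stationary independent increments.\<close>

locale convolution_semigroup =
  fixes p :: "real \<Rightarrow> 'a::{polish_space, topological_ab_group_add} measure"
  assumes prob_p: "prob_space (p t)" and sets_p [measurable_cong, simp]: "sets (p t) = sets borel"
    and p_0: "p 0 = return borel 0"
    and p_conv: "s \<ge> 0 \<Longrightarrow> t \<ge> 0 \<Longrightarrow> distr (p s \<Otimes>\<^sub>M p t) borel (\<lambda>x. fst x + snd x) = p (s + t)"
begin

lemma space_p [simp]: "space (p t) = UNIV"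
  using sets_eq_imp_space_eq[OF sets_p] by simp

text \<open>The laws of the independent increments over the grid of level \<open>n\<close>; \<open>path\<close> sums them up.\<close>

definition Q :: "nat \<Rightarrow> (nat \<Rightarrow> 'a) measure"
  where "Q n = PiM UNIV (\<lambda>_. p (1 / 2 ^ n))"

definition path :: "nat \<Rightarrow> real \<Rightarrow> (nat \<Rightarrow> 'a) \<Rightarrow> 'a"
  where "path n q x = (\<Sum>k<nat \<lfloor>q * 2 ^ n\<rfloor>. x k)"

lemma path_dyadic [simp]: "path n (dyadic n a) x = (\<Sum>k<a. x k)"
  by (simp add: path_def dyadic_def)

lemma sets_Q [measurable_cong, simp]: "sets (Q n) = sets (PiM UNIV (\<lambda>_. borel))"
  unfolding Q_def by (intro sets_PiM_cong) auto

lemma space_Q [simp]: "space (Q n) = UNIV"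
  using sets_eq_imp_space_eq[OF sets_Q] by (simp add: space_PiM)

lemma prob_Q: "prob_space (Q n)"
  unfolding Q_def by (intro prob_space_PiM prob_p)

lemma Q_component: "distr (Q n) borel (\<lambda>x. x i) = p (1 / 2 ^ n)"
proof -
  have "distr (Q n) (p (1 / 2 ^ n)) (\<lambda>x. x i) = p (1 / 2 ^ n)"
    unfolding Q_def by (rule distr_PiM_component) (auto intro: prob_p)
  then show ?thesis by (simp cong: distr_cong)
qed

lemma indep_coordinates: "prob_space.indep_vars (Q n) (\<lambda>_. borel) (\<lambda>i x. x i) UNIV"
proof -
  interpret prob_space "Q n" by (rule prob_Q)
  have "distr (Q n) (PiM UNIV (\<lambda>_. borel)) (\<lambda>x. x) = Q n" by (rule distr_id2) simp
  moreover have "PiM UNIV (\<lambda>i. distr (Q n) borel (\<lambda>x. x i)) = Q n" unfolding Q_component by (simp add: Q_def)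
  ultimately show ?thesis by (subst indep_vars_iff_distr_eq_PiM) (auto simp: restrict_UNIV)
qed

lemma sum_Q_measurable [simp]: "(\<lambda>x. \<Sum>k\<in>I. x k) \<in> Q n \<rightarrow>\<^sub>M borel"
  by measurable

lemma distr_sum_indep:
  assumes M: "prob_space M" and ind: "prob_space.indep_var M borel X borel Y"
    and s: "s \<ge> 0" "t \<ge> 0" and X: "distr M borel X = p s" and Y: "distr M borel Y = p t"
  shows "distr M borel (\<lambda>x. X x + Y x) = p (s + t)"
proof -
  have d: "X \<in> M \<rightarrow>\<^sub>M borel" "Y \<in> M \<rightarrow>\<^sub>M borel" "p s \<Otimes>\<^sub>M p t = distr M (borel \<Otimes>\<^sub>M borel) (\<lambda>x. (X x, Y x))"
    using ind unfolding prob_space.indep_var_distribution_eq[OF M] X Y by auto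
  note [measurable] = d(1,2)
  have "distr M borel (\<lambda>x. X x + Y x) = distr (distr M (borel \<Otimes>\<^sub>M borel) (\<lambda>x. (X x, Y x))) borel (\<lambda>x. fst x + snd x)"
    by (subst distr_distr) (auto simp: o_def)
  then show ?thesis unfolding d(3)[symmetric] p_conv[OF s] .
qed

lemma indep_past_block:
  "prob_space.indep_var (Q n) (PiM {..<a} (\<lambda>_. borel)) (\<lambda>x. restrict x {..<a})
    (PiM {a..<b} (\<lambda>_. borel)) (\<lambda>x. restrict x {a..<b})"
proof -
  interpret prob_space "Q n" by (rule prob_Q)
  show ?thesis by (rule indep_var_restrict[OF indep_coordinates]) auto
qed

lemma block_law: "distr (Q n) borel (\<lambda>x. \<Sum>k\<in>{a..<a + j}. x k) = p (real j / 2 ^ n)"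
proof (induction j)
  case 0
  interpret prob_space "Q n" by (rule prob_Q)
  show ?case by (simp add: p_0 distr_const)
next
  case (Suc j)
  interpret prob_space "Q n" by (rule prob_Q)
  have "indep_var borel ((\<lambda>f. \<Sum>k\<in>{a..<a + j}. f k) \<circ> (\<lambda>x. restrict x {..<a + j}))
      borel ((\<lambda>f. f (a + j)) \<circ> (\<lambda>x. restrict x {a + j..<a + Suc j}))"
    by (rule indep_var_compose[OF indep_past_block]) measurable
  then have "indep_var borel (\<lambda>x. \<Sum>k\<in>{a..<a + j}. x k) borel (\<lambda>x. x (a + j))" by (simp add: o_def)
  from distr_sum_indep[OF prob_Q this _ _ Suc Q_component]
  show ?case by (simp add: add_divide_distrib add.commute)
qed

text \<open>Adding up consecutive pairs of the increments of level \<open>n + 1\<close> gives those of level \<open>n\<close>.\<close>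

lemma Q_Suc: "distr (Q (Suc n)) (PiM UNIV (\<lambda>_. borel)) (\<lambda>x k. x (2 * k) + x (2 * k + 1)) = Q n"
proof -
  interpret prob_space "Q (Suc n)" by (rule prob_Q)
  have "indep_vars (\<lambda>j. PiM {2 * j, 2 * j + 1} (\<lambda>_. borel)) (\<lambda>j x. restrict (\<lambda>i. x i) {2 * j, 2 * j + 1}) (UNIV :: nat set)"
  proof (rule indep_vars_restrict[OF indep_coordinates])
    have div: "x div 2 = i" if "x \<in> {2 * i, 2 * i + 1}" for x i :: nat using that by auto
    show "disjoint_family (\<lambda>j::nat. {2 * j, 2 * j + 1})" unfolding disjoint_family_on_def
    proof (intro ballI impI equals0I)
      fix i j x :: nat assume "i \<noteq> j" "x \<in> {2 * i, 2 * i + 1} \<inter> {2 * j, 2 * j + 1}"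
      then show False using div[of x i] div[of x j] by (simp only: Int_iff)
    qed
  qed auto
  moreover have "(\<lambda>f. f (2 * j) + f (2 * j + 1) :: 'a) \<in> PiM {2 * j, 2 * j + 1} (\<lambda>_. borel) \<rightarrow>\<^sub>M borel" for j :: nat
    by (intro borel_measurable_add measurable_component_singleton) auto
  ultimately have "indep_vars (\<lambda>_. borel) (\<lambda>j x. (\<lambda>f. f (2 * j) + f (2 * j + 1)) (restrict (\<lambda>i. x i) {2 * j, 2 * j + 1})) (UNIV :: nat set)"
    by (rule indep_vars_compose2)
  then have ind: "indep_vars (\<lambda>_. borel) (\<lambda>j x. x (2 * j) + x (2 * j + 1)) (UNIV :: nat set)" by simp
  have "{2 * j..<2 * j + 2} = {2 * j, 2 * j + 1}" for j :: nat by auto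
  then have "distr (Q (Suc n)) borel (\<lambda>x. x (2 * j) + x (2 * j + 1)) = p (1 / 2 ^ n)" for j
    using block_law[of "Suc n" "2 * j" 2] by simp
  moreover have "distr (Q (Suc n)) (PiM UNIV (\<lambda>_. borel)) (\<lambda>x. \<lambda>j\<in>UNIV. x (2 * j) + x (2 * j + 1)) =
      PiM UNIV (\<lambda>j. distr (Q (Suc n)) borel (\<lambda>x. x (2 * j) + x (2 * j + 1)))"
    using ind by (subst (asm) indep_vars_iff_distr_eq_PiM) auto
  ultimately show ?thesis by (simp add: Q_def restrict_UNIV)
qed

lemma path_measurable [measurable]: "(\<lambda>x. path n q x) \<in> PiM UNIV (\<lambda>_. borel) \<rightarrow>\<^sub>M borel"
  unfolding path_def by measurable

lemma path_restrict_measurable: "(\<lambda>x. \<lambda>q\<in>J. path n q x) \<in> PiM UNIV (\<lambda>_. borel) \<rightarrow>\<^sub>M PiM J (\<lambda>_. borel)"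
  by (intro measurable_restrict path_measurable)

definition marginal :: "nat \<Rightarrow> real set \<Rightarrow> (real \<Rightarrow> 'a) measure"
  where "marginal n J = distr (Q n) (PiM J (\<lambda>_. borel)) (\<lambda>x. \<lambda>q\<in>J. path n q x)"

lemma marginal_Suc: assumes "J \<subseteq> range (dyadic n)" shows "marginal (Suc n) J = marginal n J"
proof -
  have sum: "(\<Sum>k<a. x (2 * k) + x (2 * k + 1)) = (\<Sum>k<2 * a. x k)" for a and x :: "nat \<Rightarrow> 'a"
    by (induction a) (auto simp: add.assoc)
  have "path n q (\<lambda>k. x (2 * k) + x (2 * k + 1)) = path (Suc n) q x" if qJ: "q \<in> J" for q x
  proof -
    obtain a where "q = dyadic n a" using subsetD[OF assms qJ] by blast
    then have q: "q = dyadic n a" "q = dyadic (Suc n) (2 * a)" using dyadic_Suc[of n a] by simp_all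
    show ?thesis by (subst q(1), subst q(2)) (simp only: path_dyadic sum)
  qed
  then have "(\<lambda>q\<in>J. path n q (\<lambda>k. x (2 * k) + x (2 * k + 1))) = (\<lambda>q\<in>J. path (Suc n) q x)" for x
    by (intro restrict_ext) auto
  moreover have "(\<lambda>x k. x (2 * k) + x (2 * k + 1)) \<in> Q (Suc n) \<rightarrow>\<^sub>M PiM UNIV (\<lambda>_. borel)"
    by (rule measurable_PiM_single') (auto simp: space_PiM)
  moreover have "(\<lambda>x. \<lambda>q\<in>J. path n q x) \<in> PiM UNIV (\<lambda>_. borel) \<rightarrow>\<^sub>M PiM J (\<lambda>_. borel)" by (rule path_restrict_measurable)
  ultimately show ?thesis
    unfolding marginal_def by (subst (2) Q_Suc[symmetric], subst distr_distr) (auto simp: o_def)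
qed

text \<open>By \<open>marginal_Suc\<close> every level whose grid contains \<open>J\<close> would do.\<close>

definition fdd :: "real set \<Rightarrow> (real \<Rightarrow> 'a) measure"
  where "fdd J = marginal (LEAST n. J \<subseteq> range (dyadic n)) J"

lemma range_dyadic_mono: "n \<le> k \<Longrightarrow> range (dyadic n) \<subseteq> range (dyadic k)"
  using dyadic_refine[of n _ "k - n"] by auto

lemma fdd_eq: assumes J: "J \<subseteq> range (dyadic n)" shows "fdd J = marginal n J"
proof -
  define n0 where "n0 = (LEAST n. J \<subseteq> range (dyadic n))"
  have n0: "J \<subseteq> range (dyadic n0)" "n0 \<le> n"
    unfolding n0_def using LeastI[where P = "\<lambda>n. J \<subseteq> range (dyadic n)", OF J] Least_le[where P = "\<lambda>n. J \<subseteq> range (dyadic n)", OF J] by blast+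
  from n0(2) have "marginal n J = marginal n0 J"
  proof (induction rule: dec_induct)
    case (step k)
    then show ?case using marginal_Suc[of J k] n0(1) range_dyadic_mono[of n0 k] by auto
  qed simp
  then show ?thesis by (simp add: fdd_def n0_def)
qed

lemma projective_fdd: "polish_projective dyadic_times fdd"
  unfolding polish_projective_def projective_family_def
proof (intro conjI allI impI)
  fix J H :: "real set" assume JH: "J \<subseteq> H" "finite H" "H \<subseteq> dyadic_times"
  obtain n where n: "H \<subseteq> range (dyadic n)" using finite_dyadics_level[OF JH(2,3)] by auto
  have "distr (marginal n H) (PiM J (\<lambda>_. borel)) (\<lambda>f. restrict f J) = marginal n J"
    unfolding marginal_def using JH(1)
    by (subst distr_distr) (auto intro!: measurable_restrict_subset path_restrict_measurable distr_cong restrict_ext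
        simp: o_def restrict_restrict Int_absorb1)
  then show "fdd J = distr (fdd H) (PiM J (\<lambda>_. borel)) (\<lambda>f. restrict f J)"
    using fdd_eq[OF n] fdd_eq[of J n] n JH(1) by auto
next
  fix J :: "real set" assume J: "finite J" "J \<subseteq> dyadic_times"
  obtain n where n: "J \<subseteq> range (dyadic n)" using finite_dyadics_level[OF J] by auto
  interpret prob_space "Q n" by (rule prob_Q)
  show "prob_space (fdd J)" unfolding fdd_eq[OF n] marginal_def
    by (rule prob_space_distr) (use path_restrict_measurable in \<open>simp cong: measurable_cong_sets\<close>)
qed

text \<open>The law of the process at dyadic times, given by Kolmogorov's extension theorem.\<close>

definition K :: "(real \<Rightarrow> 'a) measure"
  where "K = projective_family.lim dyadic_times fdd (\<lambda>_. borel)"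

lemma sets_K [measurable_cong, simp]: "sets K = sets (PiM dyadic_times (\<lambda>_. borel))"
proof -
  interpret polish_projective dyadic_times fdd by (rule projective_fdd)
  show ?thesis unfolding K_def by simp
qed

lemma space_K: "space K = space (PiM dyadic_times (\<lambda>_. borel))"
  by (rule sets_eq_imp_space_eq) simp

lemma prob_K: "prob_space K"
proof -
  interpret polish_projective dyadic_times fdd by (rule projective_fdd)
  show ?thesis unfolding K_def by (rule P.prob_space_axioms)
qed

lemma K_coordinate: "q \<in> dyadic_times \<Longrightarrow> (\<lambda>w. w q) \<in> K \<rightarrow>\<^sub>M borel"
  by measurable

lemma K_restrict_measurable: "J \<subseteq> dyadic_times \<Longrightarrow> (\<lambda>w. restrict w J) \<in> K \<rightarrow>\<^sub>M PiM J (\<lambda>_. borel)"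
  using measurable_restrict_subset[of J dyadic_times "\<lambda>_. borel"] by (simp cong: measurable_cong_sets)

lemma K_marginal:
  assumes J: "finite J" "J \<subseteq> range (dyadic n)"
  shows "distr K (PiM J (\<lambda>_. borel)) (\<lambda>w. restrict w J) = marginal n J"
proof -
  interpret polish_projective dyadic_times fdd by (rule projective_fdd)
  have J': "J \<subseteq> dyadic_times" using J(2) by auto
  show ?thesis
  proof (rule measure_eqI)
    fix X assume "X \<in> sets (distr K (PiM J (\<lambda>_. borel)) (\<lambda>w. restrict w J))"
    then have X: "X \<in> sets (PiM J (\<lambda>_. borel))" by simp
    have "emeasure (distr K (PiM J (\<lambda>_. borel)) (\<lambda>w. restrict w J)) X = emeasure K ((\<lambda>w. restrict w J) -` X \<inter> space K)"
      by (rule emeasure_distr[OF K_restrict_measurable[OF J'] X])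
    also have "(\<lambda>w. restrict w J) -` X \<inter> space K = prod_emb dyadic_times (\<lambda>_. borel) J X"
      by (auto simp: prod_emb_def space_K space_PiM)
    also have "emeasure K \<dots> = emeasure (fdd J) X"
      unfolding K_def by (rule emeasure_lim_emb[OF J' J(1) X])
    finally show "emeasure (distr K (PiM J (\<lambda>_. borel)) (\<lambda>w. restrict w J)) X = emeasure (marginal n J) X"
      unfolding fdd_eq[OF J(2)] .
  qed (simp add: marginal_def)
qed

text \<open>Events that involve finitely many times can be computed with the increments of any fine enough grid.\<close>

lemma emeasure_K_marginal:
  assumes J: "finite J" "J \<subseteq> range (dyadic n)"
    and T: "{v \<in> space (PiM J (\<lambda>_. borel)). T v} \<in> sets (PiM J (\<lambda>_. borel))"
  shows "emeasure K {w \<in> space K. T (restrict w J)} = emeasure (Q n) {x. T (\<lambda>q\<in>J. path n q x)}"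
proof -
  have J': "J \<subseteq> dyadic_times" using J(2) by auto
  let ?X = "{v \<in> space (PiM J (\<lambda>_. borel)). T v}"
  have m: "(\<lambda>x. \<lambda>q\<in>J. path n q x) \<in> Q n \<rightarrow>\<^sub>M PiM J (\<lambda>_. borel)" using path_restrict_measurable by (simp cong: measurable_cong_sets)
  have "emeasure K {w \<in> space K. T (restrict w J)} = emeasure K ((\<lambda>w. restrict w J) -` ?X \<inter> space K)"
    by (rule arg_cong[of _ _ "emeasure K"]) (auto simp: space_PiM)
  also have "\<dots> = emeasure (distr K (PiM J (\<lambda>_. borel)) (\<lambda>w. restrict w J)) ?X"
    by (rule emeasure_distr[OF K_restrict_measurable[OF J'] T, symmetric])
  also have "\<dots> = emeasure (Q n) ((\<lambda>x. \<lambda>q\<in>J. path n q x) -` ?X \<inter> space (Q n))"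
    unfolding K_marginal[OF J] marginal_def by (rule emeasure_distr[OF m T])
  also have "(\<lambda>x. \<lambda>q\<in>J. path n q x) -` ?X \<inter> space (Q n) = {x. T (\<lambda>q\<in>J. path n q x)}"
    by (auto simp: space_PiM)
  finally show ?thesis .
qed

lemma K_law: assumes "q \<in> dyadic_times" shows "distr K borel (\<lambda>w. w q) = p q"
proof -
  obtain n a where q: "q = dyadic n a" using assms by (auto simp: dyadic_times_def)
  show ?thesis
  proof (rule measure_eqI)
    fix B assume "B \<in> sets (distr K borel (\<lambda>w. w q))"
    then have [measurable]: "B \<in> sets borel" by simp
    have [measurable]: "(\<lambda>w. w q) \<in> K \<rightarrow>\<^sub>M borel" by (rule K_coordinate[OF assms])
    have "emeasure (distr K borel (\<lambda>w. w q)) B = emeasure K {w \<in> space K. restrict w {q} q \<in> B}"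
      by (subst emeasure_distr) (auto simp: vimage_def Int_def conj_commute)
    also have "\<dots> = emeasure (Q n) {x. (\<lambda>r\<in>{q}. path n r x) q \<in> B}"
      by (rule emeasure_K_marginal) (auto simp: q)
    also have "\<dots> = emeasure (distr (Q n) borel (\<lambda>x. \<Sum>k\<in>{0..<0 + a}. x k)) B"
      by (subst emeasure_distr) (auto simp: q vimage_def lessThan_atLeast0)
    also have "\<dots> = emeasure (p q) B" unfolding block_law by (simp add: q dyadic_def)
    finally show "emeasure (distr K borel (\<lambda>w. w q)) B = emeasure (p q) B" .
  qed simp
qed

text \<open>The two increments are independent and have the same law.\<close>

lemma K_consecutive_increments:
  assumes [measurable]: "B \<in> sets borel"
  shows "measure K {w \<in> space K. w (dyadic n (k + 1)) - w (dyadic n k) \<in> B \<and> w (dyadic n (k + 2)) - w (dyadic n (k + 1)) \<in> B} =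
    (measure (p (1 / 2 ^ n)) B)\<^sup>2"
proof -
  interpret p: prob_space "p (1 / 2 ^ n)" by (rule prob_p)
  let ?J = "{dyadic n k, dyadic n (k + 1), dyadic n (k + 2)}"
  let ?T = "\<lambda>v. v (dyadic n (k + 1)) - v (dyadic n k) \<in> B \<and> v (dyadic n (k + 2)) - v (dyadic n (k + 1)) \<in> B"
  have "emeasure K {w \<in> space K. ?T w} = emeasure K {w \<in> space K. ?T (restrict w ?J)}" by simp
  also have "\<dots> = emeasure (Q n) {x. ?T (\<lambda>q\<in>?J. path n q x)}"
  proof (rule emeasure_K_marginal)
    show "{v \<in> space (PiM ?J (\<lambda>_. borel)). ?T v} \<in> sets (PiM ?J (\<lambda>_. borel))"
      by (intro sets.sets_Collect_conj sets_Collect_measurable[OF borel_measurable_group_diff]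
          measurable_component_singleton assms) auto
  qed auto
  also have "{x. ?T (\<lambda>q\<in>?J. path n q x)} = prod_emb UNIV (\<lambda>_. p (1 / 2 ^ n)) {k, k + 1} (PiE {k, k + 1} (\<lambda>_. B))"
    by (auto simp: prod_emb_def PiE_iff)
  also have "emeasure (Q n) \<dots> = (\<Prod>i\<in>{k, k + 1}. emeasure (p (1 / 2 ^ n)) B)"
    unfolding Q_def by (rule emeasure_PiM_emb) (auto intro: prob_p)
  also have "\<dots> = ennreal ((measure (p (1 / 2 ^ n)) B)\<^sup>2)"
    by (simp add: p.emeasure_eq_measure power2_eq_square ennreal_mult)
  finally show ?thesis by (simp add: measure_def)
qed

text \<open>On a grid that contains all the times involved, the values up to time \<open>q\<close> depend on the increments before
  \<open>q\<close> and \<open>w q' - w q\<close> is a sum of increments after \<open>q\<close>.\<close>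

lemma K_independent_increment_finite:
  assumes q: "q \<in> dyadic_times" "q' \<in> dyadic_times" "q < q'" and J: "finite J" "J \<subseteq> dyadic_times \<inter> {..q}"
    and A [measurable]: "\<And>j. j \<in> J \<Longrightarrow> A j \<in> sets borel" and B: "B \<in> sets borel"
  shows "emeasure K {w \<in> space K. (\<forall>j\<in>J. w j \<in> A j) \<and> w q' - w q \<in> B} =
    emeasure K {w \<in> space K. \<forall>j\<in>J. w j \<in> A j} * emeasure (p (q' - q)) B"
proof -
  let ?H = "insert q (insert q' J)"
  obtain n where n: "?H \<subseteq> range (dyadic n)" using finite_dyadics_level[of ?H] q J by blast
  obtain a b where ab: "q = dyadic n a" "q' = dyadic n b" using n by blast
  have le: "a < b" using q(3) unfolding ab dyadic_less_iff .
  have index: "\<exists>i\<le>a. j = dyadic n i" if "j \<in> J" for j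
  proof -
    have "j \<in> range (dyadic n)" by (rule subsetD[OF n]) (simp add: that)
    then obtain i where i: "j = dyadic n i" by (rule imageE)
    have "j \<le> q" using subsetD[OF J(2) that] by simp
    then have "i \<le> a" unfolding i ab dyadic_le_iff .
    with i show ?thesis by blast
  qed
  have sub: "path n j x = path n j (restrict x {..<a})" if j: "j \<in> J" for j x
  proof -
    obtain i where i: "i \<le> a" "j = dyadic n i" using index[OF j] by blast
    show ?thesis unfolding i(2) path_dyadic using i(1) by (intro sum.cong) simp_all
  qed
  interpret Qn: prob_space "Q n" by (rule prob_Q)
  let ?U = "{v \<in> space (PiM {..<a} (\<lambda>_. borel)). \<forall>j\<in>J. path n j v \<in> A j}"
  have pm: "(\<lambda>v. path n j v) \<in> PiM {..<a} (\<lambda>_. borel) \<rightarrow>\<^sub>M borel" if j: "j \<in> J" for j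
  proof -
    obtain i where i: "i \<le> a" "j = dyadic n i" using index[OF j] by blast
    show ?thesis unfolding i(2) path_dyadic using i(1)
      by (intro borel_measurable_sum measurable_component_singleton) simp
  qed
  have U: "?U \<in> sets (PiM {..<a} (\<lambda>_. borel))"
    using J(1) by (intro sets.sets_Collect_finite_All sets_Collect_measurable[OF pm]) auto
  have past: "{x. \<forall>j\<in>J. path n j x \<in> A j} = (\<lambda>x. restrict x {..<a}) -` ?U \<inter> space (Q n)"
    by (auto simp: space_PiM sub[symmetric])
  let ?W = "{v \<in> space (PiM {a..<b} (\<lambda>_. borel)). (\<Sum>k\<in>{a..<b}. v k) \<in> B}"
  have W: "?W \<in> sets (PiM {a..<b} (\<lambda>_. borel))"
    by (intro sets_Collect_measurable[OF borel_measurable_sum] measurable_component_singleton B) auto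
  have incr: "path n q' x - path n q x = (\<Sum>k\<in>{a..<b}. x k)" for x
    using le sum_diff_nat_ivl[of 0 a b x] by (simp add: ab lessThan_atLeast0)
  have T1: "{v \<in> space (PiM ?H (\<lambda>_. borel)). \<forall>j\<in>J. v j \<in> A j} \<in> sets (PiM ?H (\<lambda>_. borel))"
    using J(1) by (intro sets.sets_Collect_finite_All sets_Collect_measurable[OF measurable_component_singleton]) auto
  have T2: "{v \<in> space (PiM ?H (\<lambda>_. borel)). v q' - v q \<in> B} \<in> sets (PiM ?H (\<lambda>_. borel))"
    by (intro sets_Collect_measurable[OF borel_measurable_group_diff] measurable_component_singleton B) auto
  have "emeasure K {w \<in> space K. (\<forall>j\<in>J. w j \<in> A j) \<and> w q' - w q \<in> B} =
      emeasure K {w \<in> space K. (\<forall>j\<in>J. restrict w ?H j \<in> A j) \<and> restrict w ?H q' - restrict w ?H q \<in> B}" by simp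
  also have "\<dots> = emeasure (Q n) {x. (\<forall>j\<in>J. (\<lambda>q\<in>?H. path n q x) j \<in> A j) \<and> (\<lambda>q\<in>?H. path n q x) q' - (\<lambda>q\<in>?H. path n q x) q \<in> B}"
    using J(1) n sets.sets_Collect_conj[OF T2 T1] by (intro emeasure_K_marginal) auto
  also have "\<dots> = emeasure (Q n) ({x. \<forall>j\<in>J. path n j x \<in> A j} \<inter> {x. (\<Sum>k\<in>{a..<b}. x k) \<in> B})"
    by (intro arg_cong[of _ _ "emeasure (Q n)"]) (auto simp flip: incr)
  also have "{x. \<forall>j\<in>J. path n j x \<in> A j} \<inter> {x. (\<Sum>k\<in>{a..<b}. x k) \<in> B} =
      (\<lambda>x. (restrict x {..<a}, restrict x {a..<b})) -` (?U \<times> ?W) \<inter> space (Q n)"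
    unfolding past by (auto simp: space_PiM)
  also have "emeasure (Q n) \<dots> = emeasure (Q n) {x. \<forall>j\<in>J. path n j x \<in> A j} * emeasure (distr (Q n) borel (\<lambda>x. \<Sum>k\<in>{a..<b}. x k)) B"
  proof -
    have "(\<lambda>x. restrict x {a..<b}) -` ?W \<inter> space (Q n) = (\<lambda>x. \<Sum>k\<in>{a..<b}. x k) -` B \<inter> space (Q n)"
      by (auto simp: space_PiM)
    then show ?thesis using Qn.indep_varD[OF indep_past_block U W] unfolding past
      by (subst emeasure_distr) (auto simp: Qn.emeasure_eq_measure ennreal_mult B)
  qed
  also have "distr (Q n) borel (\<lambda>x. \<Sum>k\<in>{a..<b}. x k) = p (q' - q)"
    using block_law[of n a "b - a"] le by (simp add: ab dyadic_def of_nat_diff diff_divide_distrib)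
  also have "emeasure (Q n) {x. \<forall>j\<in>J. path n j x \<in> A j} = emeasure (Q n) {x. \<forall>j\<in>J. (\<lambda>q\<in>?H. path n q x) j \<in> A j}" by simp
  also have "\<dots> = emeasure K {w \<in> space K. \<forall>j\<in>J. restrict w ?H j \<in> A j}"
    using J(1) n T1 by (intro emeasure_K_marginal[symmetric]) auto
  finally show ?thesis by simp
qed

text \<open>Both sides are finite measures in \<open>C\<close>, so that it suffices to compare them on cylinder sets.\<close>

lemma K_independent_increment:
  assumes q: "q \<in> dyadic_times" "q' \<in> dyadic_times" "q < q'"
    and C: "C \<in> sets (PiM (dyadic_times \<inter> {..q}) (\<lambda>_. borel))" and B [measurable]: "B \<in> sets borel"
  shows "emeasure K {w \<in> space K. restrict w (dyadic_times \<inter> {..q}) \<in> C \<and> w q' - w q \<in> B} =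
    emeasure K {w \<in> space K. restrict w (dyadic_times \<inter> {..q}) \<in> C} * emeasure (p (q' - q)) B"
proof -
  interpret K: prob_space K by (rule prob_K)
  interpret p: prob_space "p (q' - q)" by (rule prob_p)
  let ?I = "dyadic_times \<inter> {..q}"
  let ?r = "\<lambda>w. restrict w ?I"
  have r [measurable]: "?r \<in> K \<rightarrow>\<^sub>M PiM ?I (\<lambda>_. borel)" by (rule K_restrict_measurable) auto
  let ?D = "{w \<in> space K. w q' - w q \<in> B}"
  have D [measurable]: "?D \<in> sets K"
    by (intro sets_Collect_measurable[OF borel_measurable_group_diff] K_coordinate q B)
  have r': "?r \<in> density K (indicator ?D) \<rightarrow>\<^sub>M PiM ?I (\<lambda>_. borel)" by simp
  let ?N1 = "distr (density K (indicator ?D)) (PiM ?I (\<lambda>_. borel)) ?r"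
  let ?N2 = "scale_measure (emeasure (p (q' - q)) B) (distr K (PiM ?I (\<lambda>_. borel)) ?r)"
  have N1: "emeasure ?N1 X = emeasure K {w \<in> space K. ?r w \<in> X \<and> w q' - w q \<in> B}" if X: "X \<in> sets (PiM ?I (\<lambda>_. borel))" for X
  proof -
    have "emeasure ?N1 X = emeasure (density K (indicator ?D)) (?r -` X \<inter> space K)"
      using X by (subst emeasure_distr[OF r']) auto
    also have "\<dots> = emeasure K (?D \<inter> (?r -` X \<inter> space K))"
      by (rule emeasure_restricted[OF D measurable_sets[OF r X]])
    also have "?D \<inter> (?r -` X \<inter> space K) = {w \<in> space K. ?r w \<in> X \<and> w q' - w q \<in> B}" by auto
    finally show ?thesis .
  qed
  have N2: "emeasure ?N2 X = emeasure K {w \<in> space K. ?r w \<in> X} * emeasure (p (q' - q)) B" if X: "X \<in> sets (PiM ?I (\<lambda>_. borel))" for X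
  proof -
    have "?r -` X \<inter> space K = {w \<in> space K. ?r w \<in> X}" by auto
    then show ?thesis using emeasure_distr[OF r X] by (simp add: emeasure_scale_measure mult.commute)
  qed
  have "?N1 = ?N2"
  proof (rule measure_eqI_PiM_infinite[where I = ?I and M = "\<lambda>_. borel"])
    fix A :: "real \<Rightarrow> 'a set" and J assume J: "finite J" "J \<subseteq> ?I" and A: "\<And>j. j \<in> J \<Longrightarrow> A j \<in> sets borel"
    let ?X = "prod_emb ?I (\<lambda>_. borel) J (PiE J A)"
    have X: "?X \<in> sets (PiM ?I (\<lambda>_. borel))" using J A by (intro sets_PiM_I) auto
    have "?r w \<in> ?X \<longleftrightarrow> (\<forall>j\<in>J. w j \<in> A j)" for w
      using J(2) by (auto simp: prod_emb_def PiE_iff space_PiM restrict_def extensional_def)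
    then show "emeasure ?N1 ?X = emeasure ?N2 ?X"
      unfolding N1[OF X] N2[OF X] using K_independent_increment_finite[OF q J A B] by simp
  next
    have "finite_measure (density K (indicator ?D))"
      by (rule finite_measureI) (use emeasure_restricted[OF D sets.top] in \<open>simp add: K.emeasure_eq_measure\<close>)
    then interpret d: finite_measure "density K (indicator ?D)" .
    show "finite_measure ?N1" by (rule d.finite_measure_distr[OF r'])
  qed auto
  then show ?thesis using N1[OF C] N2[OF C] by simp
qed

end

section \<open>Regular trajectories\<close>

text \<open>Closed sets generate the Borel sets, and their indicators are limits of continuous functions between \<open>0\<close>
  and \<open>1\<close>.\<close>

lemma measure_eqI_bounded_continuous:
  fixes M N :: "'a::metric_space measure"
  assumes M: "finite_measure M" and N: "finite_measure N" and sM: "sets M = sets borel" and sN: "sets N = sets borel"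
    and eq: "\<And>f::'a \<Rightarrow> real. continuous_on UNIV f \<Longrightarrow> (\<And>x. 0 \<le> f x) \<Longrightarrow> (\<And>x. f x \<le> 1) \<Longrightarrow> (\<integral>x. f x \<partial>M) = (\<integral>x. f x \<partial>N)"
  shows "M = N"
proof (rule measure_eqI_generator_eq[where E = "Collect closed" and \<Omega> = UNIV and A = "\<lambda>_. UNIV"])
  interpret M: finite_measure M by fact
  interpret N: finite_measure N by fact
  have sp: "space M = UNIV" "space N = UNIV" using sets_eq_imp_space_eq[OF sM] sets_eq_imp_space_eq[OF sN] by auto
  fix C :: "'a set" assume "C \<in> Collect closed"
  then have C: "closed C" by simp
  show "emeasure M C = emeasure N C"
  proof (cases "C = {}")
    case False
    define f where "f n x = max 0 (1 - real n * infdist x C)" for n x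
    have cont: "continuous_on UNIV (f n)" for n unfolding f_def by (intro continuous_intros)
    have bd: "0 \<le> f n x" "f n x \<le> 1" for n x using infdist_nonneg[of x C] by (auto simp: f_def)
    have lim: "(\<lambda>n. f n x) \<longlonglongrightarrow> indicator C x" for x
    proof (cases "x \<in> C")
      case True
      then show ?thesis by (simp add: f_def)
    next
      case out: False
      then have pos: "infdist x C > 0" using in_closed_iff_infdist_zero[OF C False, of x] infdist_nonneg[of x C] by simp
      then obtain k :: nat where k: "1 / infdist x C < real k" using reals_Archimedean2 by blast
      have "f n x = 0" if "n \<ge> k" for n
      proof -
        have "1 / infdist x C < real n" using k that by linarith
        then show ?thesis using pos by (simp add: f_def field_simps)
      qed
      then have "\<forall>\<^sub>F n in sequentially. f n x = indicator C x" using out by (auto simp: eventually_sequentially)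
      then show ?thesis by (rule tendsto_eventually)
    qed
    have limit: "(\<lambda>n. \<integral>x. f n x \<partial>L) \<longlonglongrightarrow> measure L C" if L: "finite_measure L" "sets L = sets borel" for L
    proof -
      interpret L: finite_measure L by fact
      have "(\<lambda>n. \<integral>x. f n x \<partial>L) \<longlonglongrightarrow> (\<integral>x. indicator C x \<partial>L)"
      proof (rule integral_dominated_convergence[where w = "\<lambda>_. 1"])
        show "f n \<in> borel_measurable L" for n
          using borel_measurable_continuous_onI[OF cont[of n]] L(2) by (simp cong: measurable_cong_sets)
        show "indicator C \<in> borel_measurable L" using C L(2) by (simp add: borel_measurable_indicator)
      qed (use lim bd in auto)
      moreover have "C \<inter> space L = C" using sets_eq_imp_space_eq[OF L(2)] by simp
      ultimately show ?thesis by simp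
    qed
    have "measure M C = measure N C"
      using LIMSEQ_unique[OF limit[OF M sM]] limit[OF N sN] eq[OF cont bd] by simp
    then show ?thesis by (simp add: M.emeasure_eq_measure N.emeasure_eq_measure)
  qed simp
qed (auto simp: sM sN borel_eq_closed Int_stable_def simp: finite_measure.emeasure_finite[OF M, simplified])

text \<open>The gauge \<open>\<rho>\<close> measures the size of increments; it need not be a metric for the topology, only to be
  subadditive and to have small balls contained in small balls of the metric.\<close>

locale gauged_semigroup = convolution_semigroup p
  for p :: "real \<Rightarrow> 'a::{polish_space, topological_ab_group_add} measure" +
  fixes \<rho> :: "'a \<Rightarrow> real" and C \<kappa> :: real
  assumes gauge_measurable [measurable]: "\<rho> \<in> borel_measurable borel"
    and gauge_0: "\<rho> 0 = 0" and gauge_minus: "\<rho> (- x) = \<rho> x"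
    and gauge_add: "\<rho> (x + y) \<le> \<rho> x + \<rho> y"
    and gauge_small: "e > 0 \<Longrightarrow> \<exists>\<eta>>0. \<forall>x. \<rho> x < \<eta> \<longrightarrow> dist x 0 < e"
    and dist_translate: "dist (x + z) (y + z) = dist x y"
    and gauge_tail: "t > 0 \<Longrightarrow> 0 < l \<Longrightarrow> l \<le> 1 \<Longrightarrow> measure (p t) {x. \<rho> x \<ge> l} \<le> C * t * l powr - \<kappa>"
    and \<kappa>: "\<kappa> > 0"
begin

lemma dist_diff: "dist x y = dist (x - y) 0" for x y :: 'a
  using dist_translate[of "x - y" y 0] by simp

text \<open>The measure \<open>p (t + h)\<close> is the convolution of \<open>p t\<close> and \<open>p h\<close>, and by the tail bound \<open>p h\<close> concentrates
  at \<open>0\<close> as \<open>h\<close> tends to \<open>0\<close>.\<close>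

lemma weak_right_continuous:
  fixes f :: "'a \<Rightarrow> real"
  assumes f: "continuous_on UNIV f" and f0: "\<And>x. 0 \<le> f x" and f1: "\<And>x. f x \<le> 1"
    and t: "t \<ge> 0" and h: "\<And>n. h n > 0" "h \<longlonglongrightarrow> 0"
  shows "(\<lambda>n. \<integral>x. f x \<partial>p (t + h n)) \<longlonglongrightarrow> (\<integral>x. f x \<partial>p t)"
proof -
  have fm [measurable]: "f \<in> borel_measurable borel" by (rule borel_measurable_continuous_onI[OF f])
  interpret pt: prob_space "p t" by (rule prob_p)
  have point: "(\<lambda>n. \<integral>y. f (x + y) \<partial>p (h n)) \<longlonglongrightarrow> f x" for x
  proof (rule LIMSEQ_I)
    fix e :: real assume e: "e > 0"
    have "isCont f x" using f by (simp add: continuous_on_eq_continuous_at)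
    then obtain d where d: "d > 0" "\<And>y. dist y x < d \<Longrightarrow> dist (f y) (f x) < e / 2"
      using e unfolding continuous_at_eps_delta by (metis half_gt_zero)
    obtain \<eta>' where \<eta>': "\<eta>' > 0" "\<And>y. \<rho> y < \<eta>' \<Longrightarrow> dist y 0 < d" using gauge_small[OF d(1)] by blast
    define \<eta> where "\<eta> = min \<eta>' 1"
    have \<eta>: "\<eta> > 0" "\<eta> \<le> 1" using \<eta>' by (auto simp: \<eta>_def)
    have near: "\<bar>f (x + y) - f x\<bar> \<le> e / 2 + indicator {y. \<rho> y \<ge> \<eta>} y" for y
    proof (cases "\<rho> y \<ge> \<eta>")
      case True
      then show ?thesis using f0[of "x + y"] f1[of "x + y"] f0[of x] f1[of x] e by simp
    next
      case False
      then have "dist y 0 < d" using \<eta>'(2)[of y] by (simp add: \<eta>_def)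
      then have "dist (x + y) x < d" using dist_diff[of "x + y" x] by simp
      then show ?thesis using d(2)[of "x + y"] e False by (simp add: dist_real_def)
    qed
    have "(\<lambda>n. C * h n * \<eta> powr - \<kappa>) \<longlonglongrightarrow> C * 0 * \<eta> powr - \<kappa>" by (intro tendsto_intros h(2))
    then have "\<forall>\<^sub>F n in sequentially. C * h n * \<eta> powr - \<kappa> < e / 2" using e by (intro order_tendstoD(2)) auto
    then obtain N where N: "\<And>n. n \<ge> N \<Longrightarrow> C * h n * \<eta> powr - \<kappa> < e / 2" by (auto simp: eventually_sequentially)
    have "norm ((\<integral>y. f (x + y) \<partial>p (h n)) - f x) < e" if n: "n \<ge> N" for n
    proof -
      interpret q: prob_space "p (h n)" by (rule prob_p)
      have [measurable]: "(\<lambda>y. f (x + y)) \<in> borel_measurable borel" by measurable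
      have i1: "integrable (p (h n)) (\<lambda>y. f (x + y))"
        by (rule q.integrable_const_bound[of _ 1]) (use f0 f1 in auto)
      have "(\<integral>y. f (x + y) \<partial>p (h n)) - f x = (\<integral>y. f (x + y) - f x \<partial>p (h n))"
        using i1 q.prob_space by (simp add: Bochner_Integration.integral_diff)
      also have "\<bar>\<dots>\<bar> \<le> (\<integral>y. \<bar>f (x + y) - f x\<bar> \<partial>p (h n))" by (rule integral_abs_bound)
      also have "\<dots> \<le> (\<integral>y. e / 2 + indicator {y. \<rho> y \<ge> \<eta>} y \<partial>p (h n))"
        using i1 by (intro integral_mono near) (auto simp: q.emeasure_eq_measure)
      also have "\<dots> = e / 2 + measure (p (h n)) {y. \<rho> y \<ge> \<eta>}"
        using q.prob_space by (subst Bochner_Integration.integral_add) (auto simp: q.emeasure_eq_measure)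
      also have "\<dots> < e" using gauge_tail[OF h(1) \<eta>, of n] N[OF n] by simp
      finally show ?thesis by simp
    qed
    then show "\<exists>N. \<forall>n\<ge>N. norm ((\<integral>y. f (x + y) \<partial>p (h n)) - f x) < e" by blast
  qed
  have split: "(\<integral>x. f x \<partial>p (t + h n)) = (\<integral>x. (\<integral>y. f (x + y) \<partial>p (h n)) \<partial>p t)" for n
  proof -
    interpret q: prob_space "p (h n)" by (rule prob_p)
    interpret pair_prob_space "p t" "p (h n)" ..
    have "(\<integral>x. f x \<partial>p (t + h n)) = (\<integral>z. f (fst z + snd z) \<partial>(p t \<Otimes>\<^sub>M p (h n)))"
      using h(1)[of n] t by (subst p_conv[symmetric]) (auto intro: integral_distr simp: less_imp_le)
    also have "\<dots> = (\<integral>x. (\<integral>y. f (fst (x, y) + snd (x, y)) \<partial>p (h n)) \<partial>p t)"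
      by (rule integral_fst'[symmetric], rule P.integrable_const_bound[of _ 1]) (use f0 f1 in auto)
    finally show ?thesis by simp
  qed
  show ?thesis unfolding split
  proof (rule integral_dominated_convergence[where w = "\<lambda>_. 1"])
    fix n
    interpret q: prob_space "p (h n)" by (rule prob_p)
    show "(\<lambda>x. \<integral>y. f (x + y) \<partial>p (h n)) \<in> borel_measurable (p t)" by measurable
    show "AE x in p t. norm (\<integral>y. f (x + y) \<partial>p (h n)) \<le> 1"
    proof (rule AE_I2)
      fix x
      have "\<bar>\<integral>y. f (x + y) \<partial>p (h n)\<bar> \<le> (\<integral>y. \<bar>f (x + y)\<bar> \<partial>p (h n))" by (rule integral_abs_bound)
      also have "\<dots> \<le> 1" using f0 f1 by (intro q.integral_le_const q.integrable_const_bound[of _ 1]) auto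
      finally show "norm (\<integral>y. f (x + y) \<partial>p (h n)) \<le> 1" by simp
    qed
  qed (use point in auto)
qed

text \<open>Two consecutive increments of level \<open>j\<close> are both larger than \<open>2 powr (-j/4\<kappa>)\<close> only with a
  probability that, even after multiplication with the number \<open>j 2\<^sup>j\<close> of pairs, is summable.\<close>

lemma AE_regulated: "AE w in K. regulated w"
proof -
  interpret K: prob_space K by (rule prob_K)
  define r :: real where "r = 2 powr (- 1 / (4 * \<kappa>))"
  define l where "l j = r ^ j" for j
  have r: "0 < r" "r < 1" using \<kappa> powr_less_mono[of "- 1 / (4 * \<kappa>)" 0 2] by (auto simp: r_def)
  have l: "0 < l j" "l j \<le> 1" for j using r by (auto simp: l_def power_le_one)
  let ?B = "\<lambda>j. {x::'a. \<rho> x \<ge> l j}"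
  have B [measurable]: "?B j \<in> sets borel" for j by measurable
  let ?A = "\<lambda>j k. {w \<in> space K. w (dyadic j (k + 1)) - w (dyadic j k) \<in> ?B j \<and> w (dyadic j (k + 2)) - w (dyadic j (k + 1)) \<in> ?B j}"
  have A: "?A j k \<in> sets K" for j k
    by (intro sets.sets_Collect_conj sets_Collect_measurable[OF borel_measurable_group_diff] K_coordinate B) auto
  define U where "U j = (\<Union>k<j * 2 ^ j. ?A j k)" for j
  have U: "U j \<in> sets K" for j unfolding U_def using A by (intro sets.finite_UN) auto
  have U_le: "measure K (U j) \<le> C\<^sup>2 * (real (Suc j) * (2 powr (- 1 / 2)) ^ j)" for j
  proof -
    interpret q: prob_space "p (1 / 2 ^ j)" by (rule prob_p)
    have lp: "l j powr - \<kappa> = (2 powr (1 / 4)) ^ j"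
      unfolding l_def r_def using \<kappa> by (simp add: powr_powr flip: powr_realpow) 
    have tail: "measure (p (1 / 2 ^ j)) (?B j) \<le> C * (1 / 2 ^ j) * (2 powr (1 / 4)) ^ j"
      using gauge_tail[OF _ l, of "1 / 2 ^ j" j] unfolding lp by simp
    have "measure K (U j) \<le> (\<Sum>k<j * 2 ^ j. measure K (?A j k))"
      unfolding U_def using A by (intro K.finite_measure_subadditive_finite) auto
    also have "\<dots> = (\<Sum>k<j * 2 ^ j. (measure (p (1 / 2 ^ j)) (?B j))\<^sup>2)"
      by (intro sum.cong refl K_consecutive_increments B)
    also have "\<dots> \<le> (\<Sum>k<j * 2 ^ j. (C * (1 / 2 ^ j) * (2 powr (1 / 4)) ^ j)\<^sup>2)"
      by (intro sum_mono power_mono tail) auto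
    also have "\<dots> = C\<^sup>2 * (real j * (2 ^ j * ((1 / 2 ^ j) * (2 powr (1 / 4)) ^ j)\<^sup>2))"
      by (simp add: power_mult_distrib power_divide)
    also have "2 ^ j * ((1 / 2 ^ j) * (2 powr (1 / 4)) ^ j)\<^sup>2 = ((2::real) powr (- 1 / 2)) ^ j"
    proof -
      have "(2 powr (1 / 4) :: real) * 2 powr (1 / 4) * 1 = 2 * 2 powr (- 1 / 2)"
        by (simp add: powr_minus powr_half_sqrt field_simps flip: powr_add)
      then have sq: "(2 powr (1 / 4) :: real)\<^sup>2 = 2 * 2 powr (- 1 / 2)" by (simp add: power2_eq_square)
      have "2 ^ j * ((1 / 2 ^ j) * (2 powr (1 / 4)) ^ j)\<^sup>2 = ((2 powr (1 / 4) :: real)\<^sup>2) ^ j / 2 ^ j"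
        by (simp add: power_mult_distrib power2_eq_square field_simps)
      then show ?thesis unfolding sq by (simp add: power_mult_distrib)
    qed
    also have "C\<^sup>2 * (real j * (2 powr (- 1 / 2)) ^ j) \<le> C\<^sup>2 * (real (Suc j) * (2 powr (- 1 / 2)) ^ j)"
      by (intro mult_left_mono mult_right_mono) auto
    finally show ?thesis .
  qed
  have "(2::real) powr (- 1 / 2) < 1" using powr_less_mono[of "- 1 / 2" 0 "2::real"] by simp
  then have "summable (\<lambda>j. of_nat (Suc j) * (2 powr (- 1 / 2) :: real) ^ j)"
    using geometric_deriv_sums[of "2 powr (- 1 / 2) :: real"] by (intro sums_summable) auto
  then have "summable (\<lambda>j. C\<^sup>2 * (real (Suc j) * (2 powr (- 1 / 2)) ^ j))" by (rule summable_mult)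
  then have "summable (\<lambda>j. measure K (U j))"
    by (rule summable_comparison_test') (use U_le in auto)
  then have "AE w in K. \<forall>\<^sub>F j in sequentially. w \<in> space K - U j"
    using U by (intro borel_cantelli_AE1) (auto simp: K.emeasure_eq_measure)
  then show ?thesis
  proof eventually_elim
    case (elim w)
    then obtain N where N: "\<And>j. j \<ge> N \<Longrightarrow> w \<in> space K - U j" by (auto simp: eventually_sequentially)
    let ?d = "\<lambda>x y. \<rho> (x - y)"
    have sym: "?d x y = ?d y x" for x y using gauge_minus[of "x - y"] by simp
    have small: "min (?d (w (dyadic j k)) (w (dyadic j (k + 1)))) (?d (w (dyadic j (k + 1))) (w (dyadic j (k + 2)))) < l j"
      if j: "j \<ge> N" and k: "k < j * 2 ^ j" for j k
    proof -
      have "?A j k \<subseteq> U j" unfolding U_def using k by (intro UN_upper) simp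
      then have "w \<notin> ?A j k" by (rule contra_subsetD) (use N[OF j] in simp)
      then have "\<not> (\<rho> (w (dyadic j (k + 1)) - w (dyadic j k)) \<ge> l j \<and> \<rho> (w (dyadic j (k + 2)) - w (dyadic j (k + 1))) \<ge> l j)"
        using DiffD1[OF N[OF j]] unfolding mem_Collect_eq by (simp only: simp_thms)
      then show ?thesis
        unfolding min_less_iff_disj sym[of "w (dyadic j k)" "w (dyadic j (k + 1))"] sym[of "w (dyadic j (k + 1))" "w (dyadic j (k + 2))"]
        by (simp only: not_le de_Morgan_conj)
    qed
    have summ: "summable l" unfolding l_def using r by (intro summable_geometric) auto
    show "regulated w" unfolding regulated_def
    proof (intro allI impI)
      fix T e :: real assume "e > 0"
      then obtain \<eta> where \<eta>: "\<eta> > 0" "\<And>x. \<rho> x < \<eta> \<Longrightarrow> dist x 0 < e" using gauge_small by blast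
      have near: "dist x y < e" if "\<rho> (x - y) < \<eta>" for x y using \<eta>(2)[OF that] dist_diff[of x y] by simp
      have "\<exists>\<delta>>0. \<forall>r\<in>dyadic_times. \<forall>s\<in>dyadic_times. \<forall>t\<in>dyadic_times. r < s \<and> s < t \<and> t \<le> T \<and> t - r < \<delta> \<longrightarrow>
          min (?d (w r) (w s)) (?d (w s) (w t)) < \<eta>"
      proof (rule chaining_oscillation[where l = l and N = N])
        show "?d x z \<le> ?d x y + ?d y z" for x y z using gauge_add[of "x - y" "y - z"] by simp
      qed (rule small sym summ \<eta>(1) less_imp_le[OF l(1)] | simp add: gauge_0; fail)+
      then show "\<exists>\<delta>>0. \<forall>r\<in>dyadic_times. \<forall>s\<in>dyadic_times. \<forall>t\<in>dyadic_times. r < s \<and> s < t \<and> t \<le> T \<and> t - r < \<delta> \<longrightarrow>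
          min (dist (w r) (w s)) (dist (w s) (w t)) < e"
        unfolding min_less_iff_disj using near by meson
    qed
  qed
qed

definition N :: "(real \<Rightarrow> 'a) set"
  where "N = (SOME N. N \<in> null_sets K \<and> {w \<in> space K. \<not> regulated w} \<subseteq> N)"

lemma N: "N \<in> null_sets K" and regulated_outside_N: "w \<in> space K - N \<Longrightarrow> regulated w"
proof -
  have "\<exists>N. N \<in> null_sets K \<and> {w \<in> space K. \<not> regulated w} \<subseteq> N"
    using AE_regulated unfolding eventually_ae_filter by auto
  from someI_ex[OF this] show "N \<in> null_sets K" "w \<in> space K - N \<Longrightarrow> regulated w" by (auto simp: N_def)
qed

lemma AE_not_N: "AE w in K. w \<in> space K - N"
  using AE_not_in[OF N] AE_space by eventually_elim auto

text \<open>Paths in the null set \<open>N\<close> are replaced by a constant, so that all trajectories are regular.\<close>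

definition \<Phi> :: "(real \<Rightarrow> 'a) \<Rightarrow> real \<Rightarrow> 'a"
  where "\<Phi> w t = (if w \<in> N then 0 else right_limits w t)"

lemma \<Phi>_limit:
  assumes "w \<in> space K - N" "t \<ge> 0" "q \<longlonglongrightarrow> t" "\<And>j. q j \<in> dyadic_times" "\<And>j. t < q j"
  shows "(\<lambda>j. w (q j)) \<longlonglongrightarrow> \<Phi> w t"
  using right_limits_sequence[OF regulated_outside_N] assms by (simp add: \<Phi>_def)

lemma \<Phi>_right_continuous: "w \<in> space K \<Longrightarrow> right_continuous_trajectory (\<lambda>t. x + \<Phi> w t)"
proof (cases "w \<in> N")
  case True
  then show ?thesis by (simp add: \<Phi>_def right_continuous_trajectory_def)
next
  case False
  assume "w \<in> space K"
  then show ?thesis using False right_continuous_right_limits[OF regulated_outside_N[of w]]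
    unfolding right_continuous_trajectory_def \<Phi>_def continuous_within by (auto intro: tendsto_intros)
qed

lemma \<Phi>_only_jumps: "w \<in> space K \<Longrightarrow> only_jumps_trajectory (\<lambda>t. x + \<Phi> w t)"
proof (cases "w \<in> N")
  case True
  then show ?thesis by (auto simp: \<Phi>_def only_jumps_trajectory_def)
next
  case False
  assume "w \<in> space K"
  then have jumps: "only_jumps_trajectory (right_limits w)" using False by (intro only_jumps_right_limits regulated_outside_N) simp
  show ?thesis unfolding only_jumps_trajectory_def
  proof (intro allI impI)
    fix t :: real assume "t > 0"
    then obtain L where "(right_limits w \<longlongrightarrow> L) (at_left t)" using jumps unfolding only_jumps_trajectory_def by blast
    then have "((\<lambda>t. x + \<Phi> w t) \<longlongrightarrow> x + L) (at_left t)" using False by (auto simp: \<Phi>_def intro!: tendsto_intros)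
    then show "\<exists>L. ((\<lambda>t. x + \<Phi> w t) \<longlongrightarrow> L) (at_left t)" ..
  qed
qed

text \<open>The events that, up to the null set \<open>N\<close>, are determined by the dyadic path up to a dyadic time
  shortly after \<open>s\<close>.\<close>

definition past :: "nat \<Rightarrow> real \<Rightarrow> (real \<Rightarrow> 'a) measure"
  where "past j s = vimage_algebra (space K - N) (\<lambda>w. restrict w (dyadic_times \<inter> {..dyadic_above j s}))
    (PiM (dyadic_times \<inter> {..dyadic_above j s}) (\<lambda>_. borel))"

lemma space_past [simp]: "space (past j s) = space K - N"
  by (simp add: past_def)

text \<open>It follows that the limit defining \<open>\<Phi> w r\<close> can be taken along times before \<open>dyadic_above j s\<close>, for every
  \<open>r \<le> s\<close>.\<close>

lemma dyadic_above_refine: assumes "0 \<le> s" shows "dyadic_above (i + j) s \<le> dyadic_above j s"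
proof -
  have "\<lfloor>s * 2 ^ (i + j)\<rfloor> < (\<lfloor>s * 2 ^ j\<rfloor> + 1) * 2 ^ i"
  proof -
    have "s * 2 ^ j < of_int (\<lfloor>s * 2 ^ j\<rfloor> + 1)" by linarith
    then have "s * 2 ^ j * 2 ^ i < of_int (\<lfloor>s * 2 ^ j\<rfloor> + 1) * 2 ^ i" by simp
    then have "s * 2 ^ (i + j) < of_int ((\<lfloor>s * 2 ^ j\<rfloor> + 1) * 2 ^ i)" by (simp add: power_add mult.assoc mult.commute)
    then show ?thesis by linarith
  qed
  then have "Suc (nat \<lfloor>s * 2 ^ (i + j)\<rfloor>) \<le> nat ((\<lfloor>s * 2 ^ j\<rfloor> + 1) * 2 ^ i)"
    using assms by (simp add: Suc_le_eq nat_less_eq_zless)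
  also have "\<dots> = Suc (nat \<lfloor>s * 2 ^ j\<rfloor>) * 2 ^ i" using assms by (simp add: nat_mult_distrib nat_add_distrib nat_power_eq)
  finally show ?thesis unfolding dyadic_above_def
    by (subst (2) dyadic_refine[of _ _ i]) (simp add: add.commute dyadic_le_iff)
qed

lemma dyadic_above_mono: "0 \<le> r \<Longrightarrow> r \<le> s \<Longrightarrow> dyadic_above j r \<le> dyadic_above j s"
  unfolding dyadic_above_def dyadic_le_iff by (intro Suc_le_mono[THEN iffD2] nat_mono floor_mono) simp

lemma \<Phi>_past: assumes "0 \<le> r" "r \<le> s" shows "(\<lambda>w. \<Phi> w r) \<in> past j s \<rightarrow>\<^sub>M borel"
proof (rule borel_measurable_LIMSEQ_metric[where f = "\<lambda>i w. w (dyadic_above (i + j) r)"])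
  fix i
  let ?I = "dyadic_times \<inter> {..dyadic_above j s}"
  have q: "dyadic_above (i + j) r \<in> ?I"
    using dyadic_above(1)[OF assms(1)] dyadic_above_refine[OF assms(1), of i j] dyadic_above_mono[OF assms, of j] by auto
  have "(\<lambda>w. restrict w ?I) \<in> past j s \<rightarrow>\<^sub>M PiM ?I (\<lambda>_. borel)"
    unfolding past_def by (rule measurable_vimage_algebra1) (auto simp: space_PiM)
  from measurable_compose[OF this measurable_component_singleton[OF q]]
  show "(\<lambda>w. w (dyadic_above (i + j) r)) \<in> past j s \<rightarrow>\<^sub>M borel" using q by simp
next
  fix w assume "w \<in> space (past j s)"
  then have "w \<in> space K - N" by simp
  then show "(\<lambda>i. w (dyadic_above (i + j) r)) \<longlonglongrightarrow> \<Phi> w r"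
    using dyadic_above[OF assms(1)] LIMSEQ_ignore_initial_segment[OF dyadic_above_tendsto[OF assms(1)], of j] assms(1)
    by (intro \<Phi>_limit) auto
qed

lemma \<Phi>_measurable [measurable]: "(\<lambda>w. \<Phi> w t) \<in> K \<rightarrow>\<^sub>M borel"
proof -
  have pos: "(\<lambda>w. \<Phi> w t) \<in> K \<rightarrow>\<^sub>M borel" if t: "t \<ge> 0" for t
  proof (rule borel_measurable_LIMSEQ_metric[where f = "\<lambda>i w. if w \<in> N then 0 else w (dyadic_above i t)"])
    show "(\<lambda>w. if w \<in> N then 0 else w (dyadic_above i t)) \<in> K \<rightarrow>\<^sub>M borel" for i
      using N dyadic_above(1)[OF t] by (intro measurable_If_set K_coordinate) auto
    show "(\<lambda>i. if w \<in> N then 0 else w (dyadic_above i t)) \<longlonglongrightarrow> \<Phi> w t" if "w \<in> space K" for w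
      using \<Phi>_limit[of w t "\<lambda>i. dyadic_above i t"] that t dyadic_above[OF t] dyadic_above_tendsto[OF t]
      by (cases "w \<in> N") (auto simp: \<Phi>_def)
  qed
  have "dyadic_above j t = dyadic_above j (max 0 t)" for j
  proof (cases "t \<ge> 0")
    case False
    then have "t * 2 ^ j < 0" by (simp add: mult_neg_pos)
    then have "nat \<lfloor>t * 2 ^ j\<rfloor> = 0" by (simp add: floor_less_iff less_imp_le)
    then show ?thesis using False by (simp add: dyadic_above_def)
  qed simp
  then have "\<Phi> w t = \<Phi> w (max 0 t)" for w by (simp add: \<Phi>_def right_limits_def)
  then show ?thesis using pos[of "max 0 t"] by simp
qed

end

section \<open>The Markov property\<close>

lemma emeasure_distr_restricted:
  assumes D: "D \<in> sets M" and g: "g \<in> M \<rightarrow>\<^sub>M N" and B: "B \<in> sets N"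
  shows "emeasure (distr (density M (indicator D)) N g) B = emeasure M (D \<inter> (g -` B \<inter> space M))"
proof -
  have "g \<in> density M (indicator D) \<rightarrow>\<^sub>M N" using g by simp
  then show ?thesis using emeasure_distr[of g "density M (indicator D)" N B] B emeasure_restricted[OF D measurable_sets[OF g B]] by simp
qed

lemma integral_distr_restricted:
  fixes f :: "'b \<Rightarrow> real"
  assumes D: "D \<in> sets M" and g [measurable]: "g \<in> M \<rightarrow>\<^sub>M N" and f [measurable]: "f \<in> N \<rightarrow>\<^sub>M borel"
  shows "(\<integral>x. f x \<partial>distr (density M (indicator D)) N g) = (\<integral>w. indicator D w * f (g w) \<partial>M)"
proof -
  have ind: "(indicator D :: _ \<Rightarrow> ennreal) = (\<lambda>w. ennreal (indicator D w))" by (auto simp: indicator_def fun_eq_iff)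
  have "g \<in> density M (indicator D) \<rightarrow>\<^sub>M N" using g by simp
  then have "(\<integral>x. f x \<partial>distr (density M (indicator D)) N g) = (\<integral>w. f (g w) \<partial>density M (indicator D))"
    using f by (rule integral_distr)
  also have "\<dots> = (\<integral>w. indicator D w *\<^sub>R f (g w) \<partial>M)"
    unfolding ind using D by (intro integral_density) (auto intro: borel_measurable_indicator)
  finally show ?thesis by simp
qed

lemma finite_measure_restricted: assumes "finite_measure M" "D \<in> sets M" shows "finite_measure (density M (indicator D))"
proof (rule finite_measureI)
  interpret finite_measure M by fact
  show "emeasure (density M (indicator D)) (space (density M (indicator D))) \<noteq> \<infinity>"
    using emeasure_restricted[OF assms(2) sets.top] by (simp add: emeasure_eq_measure)
qed

definition cadlag_paths :: "(real \<Rightarrow> 'a::topological_space) set"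
  where "cadlag_paths = {w. right_continuous_trajectory w \<and> only_jumps_trajectory w}"

definition path_space :: "(real \<Rightarrow> 'a::topological_space) measure"
  where "path_space = restrict_space (PiM UNIV (\<lambda>_. borel)) cadlag_paths"

text \<open>The natural filtration of the coordinate process.\<close>

definition filtration :: "real \<Rightarrow> (real \<Rightarrow> 'a::topological_space) measure"
  where "filtration t = vimage_algebra cadlag_paths (\<lambda>w. restrict w {0..t}) (PiM {0..t} (\<lambda>_. borel))"

lemma space_path_space [simp]: "space path_space = cadlag_paths"
  by (simp add: path_space_def space_restrict_space space_PiM)

lemma space_filtration [simp]: "space (filtration t) = cadlag_paths"
  by (simp add: filtration_def)

lemma restrict_in_space: "(\<lambda>w. restrict w I) \<in> A \<rightarrow> space (PiM I (\<lambda>_. borel))"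
  by (auto simp: space_PiM)

lemma restrict_filtration: "(\<lambda>w. restrict w {0..t}) \<in> filtration t \<rightarrow>\<^sub>M PiM {0..t} (\<lambda>_. borel)"
  unfolding filtration_def by (rule measurable_vimage_algebra1) (rule restrict_in_space)

lemma filtration_mono: assumes "s \<le> t" shows "subalgebra (filtration t) (filtration s)"
proof -
  have "(\<lambda>w. restrict (restrict w {0..t}) {0..s}) \<in> filtration t \<rightarrow>\<^sub>M PiM {0..s} (\<lambda>_. borel :: 'a measure)"
    using assms by (intro measurable_compose[OF restrict_filtration measurable_restrict_subset]) auto
  moreover have "restrict (restrict w {0..t}) {0..s} = restrict w {0..s}" for w :: "real \<Rightarrow> 'a"
    using assms by (simp add: restrict_restrict Int_absorb1)
  ultimately have "(\<lambda>w. restrict w {0..s}) \<in> filtration t \<rightarrow>\<^sub>M PiM {0..s} (\<lambda>_. borel :: 'a measure)" by (simp only:)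
  then show ?thesis unfolding subalgebra_def filtration_def[of s]
    using sets_image_in_sets[of "filtration t" cadlag_paths] by auto
qed

lemma path_space_coordinate: "(\<lambda>w. w t) \<in> path_space \<rightarrow>\<^sub>M borel"
  unfolding path_space_def by (intro measurable_restrict_space1 measurable_component_singleton) simp

lemma filtration_subalgebra: "subalgebra path_space (filtration t)"
proof -
  have "(\<lambda>w. restrict w {0..t}) \<in> path_space \<rightarrow>\<^sub>M PiM {0..t} (\<lambda>_. borel)"
    by (intro measurable_restrict path_space_coordinate)
  then show ?thesis unfolding subalgebra_def filtration_def
    using sets_image_in_sets[of path_space cadlag_paths] by auto
qed

lemma filtration_coordinate: "0 \<le> s \<Longrightarrow> s \<le> t \<Longrightarrow> (\<lambda>w. w s) \<in> filtration t \<rightarrow>\<^sub>M borel"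
  using measurable_compose[OF restrict_filtration measurable_component_singleton[of s "{0..t}"]] by simp

lemma filterlim_add_at_right: "filterlim (\<lambda>h::real. t + h) (at_right (t + a)) (at_right a)"
  unfolding filterlim_at by (auto intro!: tendsto_intros simp: eventually_at_filter)

lemma filterlim_add_at_left: "filterlim (\<lambda>h::real. t + h) (at_left (t + a)) (at_left a)"
  unfolding filterlim_at by (auto intro!: tendsto_intros simp: eventually_at_filter)

lemma shift_cadlag: assumes w: "w \<in> cadlag_paths" and t: "t \<ge> 0" shows "(\<lambda>h. w (t + h)) \<in> cadlag_paths"
proof -
  have "((\<lambda>h. w (t + h)) \<longlongrightarrow> w (t + a)) (at_right a)" if "a \<ge> 0" for a
  proof (rule filterlim_compose[OF _ filterlim_add_at_right])
    show "(w \<longlongrightarrow> w (t + a)) (at_right (t + a))"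
      using w that t by (simp add: cadlag_paths_def right_continuous_trajectory_def continuous_within)
  qed
  moreover have "\<exists>l. ((\<lambda>h. w (t + h)) \<longlongrightarrow> l) (at_left a)" if "a > 0" for a
  proof -
    have "t + a > 0" using that t by simp
    then obtain l where l: "(w \<longlongrightarrow> l) (at_left (t + a))"
      using w unfolding cadlag_paths_def only_jumps_trajectory_def by blast
    show ?thesis using filterlim_compose[OF l filterlim_add_at_left] by blast
  qed
  ultimately show ?thesis by (simp add: cadlag_paths_def right_continuous_trajectory_def only_jumps_trajectory_def continuous_within)
qed

context gauged_semigroup
begin

text \<open>The integrated form of \<open>K_independent_increment\<close>, which is suited to passing to limits.\<close>

lemma K_increment_integral:
  fixes f :: "'a \<Rightarrow> real"
  assumes q: "q \<in> dyadic_times" "q' \<in> dyadic_times" "q < q'"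
    and V: "V \<in> sets (PiM (dyadic_times \<inter> {..q}) (\<lambda>_. borel))" and f [measurable]: "f \<in> borel_measurable borel"
  defines "D \<equiv> {w \<in> space K. restrict w (dyadic_times \<inter> {..q}) \<in> V}"
  shows "(\<integral>w. indicator D w * f (w q' - w q) \<partial>K) = measure K D * (\<integral>x. f x \<partial>p (q' - q))"
proof -
  interpret K: prob_space K by (rule prob_K)
  have D: "D \<in> sets K" unfolding D_def by (rule sets_Collect_measurable[OF K_restrict_measurable V]) auto
  have g: "(\<lambda>w. w q' - w q) \<in> K \<rightarrow>\<^sub>M borel" by (intro borel_measurable_group_diff K_coordinate q)
  have "distr (density K (indicator D)) borel (\<lambda>w. w q' - w q) = density (p (q' - q)) (\<lambda>_. ennreal (measure K D))"
  proof (rule measure_eqI)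
    fix B assume "B \<in> sets (distr (density K (indicator D)) borel (\<lambda>w. w q' - w q))"
    then have B: "B \<in> sets borel" by simp
    have "D \<inter> ((\<lambda>w. w q' - w q) -` B \<inter> space K) = {w \<in> space K. restrict w (dyadic_times \<inter> {..q}) \<in> V \<and> w q' - w q \<in> B}"
      by (auto simp: D_def)
    then have "emeasure (distr (density K (indicator D)) borel (\<lambda>w. w q' - w q)) B = emeasure K D * emeasure (p (q' - q)) B"
      using emeasure_distr_restricted[OF D g B] K_independent_increment[OF q V B] by (simp add: D_def)
    also have "\<dots> = emeasure (density (p (q' - q)) (\<lambda>_. ennreal (measure K D))) B"
      using B by (subst emeasure_density_const) (auto simp: K.emeasure_eq_measure)
    finally show "emeasure (distr (density K (indicator D)) borel (\<lambda>w. w q' - w q)) B =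
      emeasure (density (p (q' - q)) (\<lambda>_. ennreal (measure K D))) B" .
  qed simp
  then have "(\<integral>w. indicator D w * f (w q' - w q) \<partial>K) = (\<integral>x. f x \<partial>density (p (q' - q)) (\<lambda>_. ennreal (measure K D)))"
    using integral_distr_restricted[OF D g f] by simp
  also have "\<dots> = (\<integral>x. measure K D *\<^sub>R f x \<partial>p (q' - q))" by (rule integral_density) auto
  finally show ?thesis by simp
qed

lemma dyadic_above_weak_limit:
  fixes f :: "'a \<Rightarrow> real"
  assumes f: "continuous_on UNIV f" "\<And>x. 0 \<le> f x" "\<And>x. f x \<le> 1" and t: "t \<ge> 0"
  shows "(\<lambda>j. \<integral>x. f x \<partial>p (dyadic_above j t)) \<longlonglongrightarrow> (\<integral>x. f x \<partial>p t)"
proof -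
  have "(\<lambda>j. dyadic_above j t - t) \<longlonglongrightarrow> t - t" by (intro tendsto_diff dyadic_above_tendsto[OF t] tendsto_const)
  then show ?thesis using weak_right_continuous[OF f t, of "\<lambda>j. dyadic_above j t - t"] dyadic_above(2)[OF t] by simp
qed

lemma isCont_on_UNIV: "continuous_on UNIV f \<Longrightarrow> isCont f x"
  by (simp add: continuous_on_eq_continuous_at)

text \<open>The values at dyadic times decreasing to \<open>t\<close> converge almost surely to \<open>\<Phi> w t\<close>, while their laws converge
  weakly to \<open>p t\<close>.\<close>

lemma \<Phi>_law: assumes t: "t \<ge> 0" shows "distr K borel (\<lambda>w. \<Phi> w t) = p t"
proof (rule measure_eqI_bounded_continuous)
  interpret K: prob_space K by (rule prob_K)
  show "finite_measure (distr K borel (\<lambda>w. \<Phi> w t))"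
    using K.prob_space_distr[OF \<Phi>_measurable] by (rule prob_space.finite_measure)
  show "finite_measure (p t)" using prob_p by (rule prob_space.finite_measure)
  fix f :: "'a \<Rightarrow> real" assume f: "continuous_on UNIV f" "\<And>x. 0 \<le> f x" "\<And>x. f x \<le> 1"
  have fm [measurable]: "f \<in> borel_measurable borel" by (rule borel_measurable_continuous_onI[OF f(1)])
  have q: "dyadic_above j t \<in> dyadic_times" for j by (rule dyadic_above[OF t])
  have "(\<lambda>j. \<integral>w. f (w (dyadic_above j t)) \<partial>K) \<longlonglongrightarrow> (\<integral>w. f (\<Phi> w t) \<partial>K)"
  proof (rule integral_dominated_convergence[where w = "\<lambda>_. 1"])
    show "(\<lambda>w. f (w (dyadic_above j t))) \<in> borel_measurable K" for j
      by (rule measurable_compose[OF K_coordinate[OF q] fm])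
    show "AE w in K. (\<lambda>j. f (w (dyadic_above j t))) \<longlonglongrightarrow> f (\<Phi> w t)"
      using AE_not_N
    proof eventually_elim
      case (elim w)
      show ?case
        by (rule isCont_tendsto_compose[OF isCont_on_UNIV[OF f(1)] \<Phi>_limit[OF elim t dyadic_above_tendsto[OF t]]])
          (use dyadic_above[OF t] in auto)
    qed
  qed (use f in auto)
  moreover have "(\<integral>w. f (w (dyadic_above j t)) \<partial>K) = (\<integral>x. f x \<partial>p (dyadic_above j t))" for j
    unfolding K_law[OF q, symmetric] by (rule integral_distr[symmetric]) (use K_coordinate[OF q] in auto)
  ultimately have "(\<integral>w. f (\<Phi> w t) \<partial>K) = (\<integral>x. f x \<partial>p t)"
    using LIMSEQ_unique dyadic_above_weak_limit[OF f t] by simp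
  then show "(\<integral>x. f x \<partial>distr K borel (\<lambda>w. \<Phi> w t)) = (\<integral>x. f x \<partial>p t)"
    by (subst integral_distr) auto
qed auto

text \<open>The increment after time \<open>s\<close> is a limit of increments between dyadic times after \<open>s\<close>, which are
  independent of the events in the past of \<open>s\<close>.\<close>

lemma increment_independent:
  assumes D: "D \<in> sets K" and past: "\<And>j. D - N \<in> sets (past j s)" and s: "s \<ge> 0" and t: "t \<ge> 0" and B: "B \<in> sets borel"
  shows "emeasure K (D \<inter> {w \<in> space K. \<Phi> w (s + t) - \<Phi> w s \<in> B}) = emeasure K D * emeasure (p t) B"
proof -
  interpret K: prob_space K by (rule prob_K)
  interpret pt: prob_space "p t" by (rule prob_p)
  let ?g = "\<lambda>w. \<Phi> w (s + t) - \<Phi> w s"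
  have g [measurable]: "?g \<in> K \<rightarrow>\<^sub>M borel" by (intro borel_measurable_group_diff \<Phi>_measurable)
  let ?M1 = "distr (density K (indicator D)) borel ?g"
  let ?M2 = "density (p t) (\<lambda>_. ennreal (measure K D))"
  have "?M1 = ?M2"
  proof (rule measure_eqI_bounded_continuous)
    interpret d: finite_measure "density K (indicator D)"
      by (rule finite_measure_restricted[OF K.finite_measure_axioms D])
    show "finite_measure ?M1" using g by (intro d.finite_measure_distr) simp
    show "finite_measure ?M2"
      by (rule finite_measureI) (subst emeasure_density_const, auto simp: pt.emeasure_eq_measure ennreal_mult_eq_top_iff)
    fix f :: "'a \<Rightarrow> real" assume f: "continuous_on UNIV f" "\<And>x. 0 \<le> f x" "\<And>x. f x \<le> 1"
    have fm [measurable]: "f \<in> borel_measurable borel" by (rule borel_measurable_continuous_onI[OF f(1)])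
    define a where "a j = dyadic_above j s" for j
    define b where "b j = a j + dyadic_above j t" for j
    have a: "a j \<in> dyadic_times" "s < a j" and b: "b j \<in> dyadic_times" "s + t < b j" "a j < b j" for j
      using dyadic_above[OF s, of j] dyadic_above[OF t, of j] t by (auto simp: a_def b_def intro: dyadics_add)
    have lims: "a \<longlonglongrightarrow> s" "b \<longlonglongrightarrow> s + t"
      unfolding a_def b_def by (intro tendsto_add dyadic_above_tendsto s t)+
    have incr: "(\<lambda>w. f (w (b j) - w (a j))) \<in> borel_measurable K" for j
      by (intro measurable_compose[OF _ fm] borel_measurable_group_diff K_coordinate a b)
    have "(\<lambda>j. \<integral>w. indicator D w * f (w (b j) - w (a j)) \<partial>K) \<longlonglongrightarrow> (\<integral>w. indicator D w * f (?g w) \<partial>K)"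
    proof (rule integral_dominated_convergence[where w = "\<lambda>_. 1"])
      show "(\<lambda>w. indicator D w * f (w (b j) - w (a j))) \<in> borel_measurable K" for j
        using D incr[of j] by (intro borel_measurable_times borel_measurable_indicator)
      show "(\<lambda>w. indicator D w * f (?g w)) \<in> borel_measurable K"
        using D measurable_compose[OF g fm] by (intro borel_measurable_times borel_measurable_indicator)
      show "AE w in K. (\<lambda>j. indicator D w * f (w (b j) - w (a j))) \<longlonglongrightarrow> indicator D w * f (?g w)"
        using AE_not_N
      proof eventually_elim
        case (elim w)
        have "(\<lambda>j. w (b j) - w (a j)) \<longlonglongrightarrow> ?g w"
          by (intro tendsto_diff \<Phi>_limit[OF elim]) (use lims a b s t in auto)
        then show ?case by (intro tendsto_mult tendsto_const isCont_tendsto_compose[OF isCont_on_UNIV[OF f(1)]])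
      qed
      show "AE w in K. norm (indicator D w * f (w (b j) - w (a j))) \<le> 1" for j
        using f by (auto simp: indicator_def)
    qed simp
    moreover have "(\<integral>w. indicator D w * f (w (b j) - w (a j)) \<partial>K) = measure K D * (\<integral>x. f x \<partial>p (dyadic_above j t))" for j
    proof -
      let ?I = "dyadic_times \<inter> {..a j}"
      obtain V where V: "V \<in> sets (PiM ?I (\<lambda>_. borel))" "D - N = (\<lambda>w. restrict w ?I) -` V \<inter> (space K - N)"
        using past[of j] unfolding past_def a_def sets_vimage_algebra2[OF restrict_in_space] by auto
      let ?D = "{w \<in> space K. restrict w ?I \<in> V}"
      have D': "?D \<in> sets K" by (rule sets_Collect_measurable[OF K_restrict_measurable V(1)]) auto
      have same: "AE w in K. w \<in> D \<longleftrightarrow> w \<in> ?D" using AE_not_N by eventually_elim (use V(2) in blast)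
      have "(\<integral>w. indicator D w * f (w (b j) - w (a j)) \<partial>K) = (\<integral>w. indicator ?D w * f (w (b j) - w (a j)) \<partial>K)"
      proof (rule integral_cong_AE)
        show "AE w in K. indicator D w * f (w (b j) - w (a j)) = indicator ?D w * f (w (b j) - w (a j))"
          using same by eventually_elim (simp add: indicator_def)
      qed (use D D' incr[of j] in \<open>auto intro!: borel_measurable_times borel_measurable_indicator\<close>)
      also have "\<dots> = measure K ?D * (\<integral>x. f x \<partial>p (b j - a j))"
        by (rule K_increment_integral[OF a(1) b(1) b(3) V(1) fm])
      also have "measure K ?D = measure K D"
        using same D D' by (intro K.finite_measure_eq_AE) auto
      finally show ?thesis by (simp add: b_def)
    qed
    ultimately have "(\<lambda>j. measure K D * (\<integral>x. f x \<partial>p (dyadic_above j t))) \<longlonglongrightarrow> (\<integral>w. indicator D w * f (?g w) \<partial>K)" by simp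
    moreover have "(\<lambda>j. measure K D * (\<integral>x. f x \<partial>p (dyadic_above j t))) \<longlonglongrightarrow> measure K D * (\<integral>x. f x \<partial>p t)"
      by (intro tendsto_mult tendsto_const dyadic_above_weak_limit f t)
    ultimately have "(\<integral>w. indicator D w * f (?g w) \<partial>K) = measure K D * (\<integral>x. f x \<partial>p t)" by (rule LIMSEQ_unique)
    moreover have "(\<integral>x. f x \<partial>?M2) = (\<integral>x. measure K D *\<^sub>R f x \<partial>p t)" by (rule integral_density) auto
    ultimately show "(\<integral>x. f x \<partial>?M1) = (\<integral>x. f x \<partial>?M2)" using integral_distr_restricted[OF D g fm] by simp
  qed auto
  then have "emeasure K (D \<inter> (?g -` B \<inter> space K)) = emeasure ?M2 B" using emeasure_distr_restricted[OF D g B] by simp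
  also have "\<dots> = emeasure K D * emeasure (p t) B"
    using B by (subst emeasure_density_const) (auto simp: K.emeasure_eq_measure)
  also have "?g -` B \<inter> space K = {w \<in> space K. ?g w \<in> B}" by auto
  finally show ?thesis .
qed

text \<open>Conditionally on an event of the past the pair of the present value and the next increment has a
  product law, because events on the present value belong to the past.\<close>

lemma joint_law:
  fixes x :: 'a
  assumes s: "s \<ge> 0" and t: "t \<ge> 0" and V: "V \<in> sets (PiM {0..s} (\<lambda>_. borel))" and S: "S \<in> sets (borel \<Otimes>\<^sub>M borel)"
  defines "D \<equiv> {w \<in> space K. restrict (\<lambda>r. x + \<Phi> w r) {0..s} \<in> V}"
  shows "emeasure K (D \<inter> {w \<in> space K. (\<Phi> w s, \<Phi> w (s + t) - \<Phi> w s) \<in> S}) =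
    (\<integral>\<^sup>+w. indicator D w * emeasure (p t) (Pair (\<Phi> w s) -` S) \<partial>K)"
proof -
  interpret K: prob_space K by (rule prob_K)
  interpret pt: prob_space "p t" by (rule prob_p)
  let ?g = "\<lambda>w. \<Phi> w (s + t) - \<Phi> w s"
  have g [measurable]: "?g \<in> K \<rightarrow>\<^sub>M borel" by (intro borel_measurable_group_diff \<Phi>_measurable)
  have "(\<lambda>w. restrict (\<lambda>r. x + \<Phi> w r) {0..s}) \<in> K \<rightarrow>\<^sub>M PiM {0..s} (\<lambda>_. borel)"
    by (intro measurable_restrict borel_measurable_add measurable_const \<Phi>_measurable) simp
  then have D: "D \<in> sets K" unfolding D_def using V by (rule sets_Collect_measurable)
  have "(\<lambda>w. restrict (\<lambda>r. x + \<Phi> w r) {0..s}) \<in> past j s \<rightarrow>\<^sub>M PiM {0..s} (\<lambda>_. borel)" for j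
    by (intro measurable_restrict borel_measurable_add measurable_const \<Phi>_past) auto
  from sets_Collect_measurable[OF this V] have "{w \<in> space (past j s). restrict (\<lambda>r. x + \<Phi> w r) {0..s} \<in> V} \<in> sets (past j s)" for j .
  moreover have "{w \<in> space (past j s). restrict (\<lambda>r. x + \<Phi> w r) {0..s} \<in> V} = D - N" for j by (auto simp: D_def)
  ultimately have past: "D - N \<in> sets (past j s)" for j by simp
  let ?M1 = "distr (density K (indicator D)) borel (\<lambda>w. \<Phi> w s)"
  let ?M = "distr (density K (indicator D)) (borel \<Otimes>\<^sub>M borel) (\<lambda>w. (\<Phi> w s, ?g w))"
  have pair: "(\<lambda>w. (\<Phi> w s, ?g w)) \<in> K \<rightarrow>\<^sub>M borel \<Otimes>\<^sub>M borel" by measurable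
  interpret d: finite_measure "density K (indicator D)" by (rule finite_measure_restricted[OF K.finite_measure_axioms D])
  interpret M1: finite_measure ?M1 by (rule d.finite_measure_distr) simp
  have "?M1 \<Otimes>\<^sub>M p t = ?M"
  proof (rule pair_measure_eqI)
    show "sigma_finite_measure ?M1" "sigma_finite_measure (p t)" by unfold_locales
    show "sets (?M1 \<Otimes>\<^sub>M p t) = sets ?M" by (simp cong: sets_pair_measure_cong)
    fix A B assume "A \<in> sets ?M1" "B \<in> sets (p t)"
    then have A: "A \<in> sets borel" and B: "B \<in> sets borel" by simp_all
    let ?D = "D \<inter> ((\<lambda>w. \<Phi> w s) -` A \<inter> space K)"
    have D': "?D \<in> sets K" using D measurable_sets[OF \<Phi>_measurable A] by (rule sets.Int)
    have past': "?D - N \<in> sets (past j s)" for j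
    proof -
      have "(D - N) \<inter> ((\<lambda>w. \<Phi> w s) -` A \<inter> space (past j s)) \<in> sets (past j s)"
        by (rule sets.Int[OF past measurable_sets[OF \<Phi>_past[OF s order_refl] A]])
      moreover have "(D - N) \<inter> ((\<lambda>w. \<Phi> w s) -` A \<inter> space (past j s)) = ?D - N" by auto
      ultimately show ?thesis by simp
    qed
    have "emeasure ?M (A \<times> B) = emeasure K (D \<inter> ((\<lambda>w. (\<Phi> w s, ?g w)) -` (A \<times> B) \<inter> space K))"
      using A B by (intro emeasure_distr_restricted D pair) auto
    also have "D \<inter> ((\<lambda>w. (\<Phi> w s, ?g w)) -` (A \<times> B) \<inter> space K) = ?D \<inter> {w \<in> space K. ?g w \<in> B}" by auto
    also have "emeasure K \<dots> = emeasure K ?D * emeasure (p t) B" by (rule increment_independent[OF D' past' s t B])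
    also have "emeasure K ?D = emeasure ?M1 A" using A by (intro emeasure_distr_restricted[symmetric] D) auto
    finally show "emeasure ?M1 A * emeasure (p t) B = emeasure ?M (A \<times> B)" by simp
  qed
  then have "emeasure ?M S = (\<integral>\<^sup>+u. emeasure (p t) (Pair u -` S) \<partial>?M1)"
    using S by (subst pt.emeasure_pair_measure_alt[symmetric]) (simp_all cong: sets_pair_measure_cong)
  also have "\<dots> = (\<integral>\<^sup>+w. emeasure (p t) (Pair (\<Phi> w s) -` S) \<partial>density K (indicator D))"
  proof (rule nn_integral_distr)
    have "S \<in> sets (borel \<Otimes>\<^sub>M p t)" using S by (simp cong: sets_pair_measure_cong)
    then show "(\<lambda>u. emeasure (p t) (Pair u -` S)) \<in> borel_measurable ?M1"
      using pt.measurable_emeasure_Pair[of S borel] by simp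
  qed simp
  also have "\<dots> = (\<integral>\<^sup>+w. indicator D w * emeasure (p t) (Pair (\<Phi> w s) -` S) \<partial>K)"
  proof (rule nn_integral_density)
    have "S \<in> sets (borel \<Otimes>\<^sub>M p t)" using S by (simp cong: sets_pair_measure_cong)
    then show "(\<lambda>w. emeasure (p t) (Pair (\<Phi> w s) -` S)) \<in> borel_measurable K"
      using measurable_compose[OF \<Phi>_measurable pt.measurable_emeasure_Pair[of S borel]] by simp
  qed (use D in \<open>simp add: borel_measurable_indicator\<close>)
  also have "emeasure ?M S = emeasure K (D \<inter> ((\<lambda>w. (\<Phi> w s, ?g w)) -` S \<inter> space K))"
    by (rule emeasure_distr_restricted[OF D pair S])
  also have "(\<lambda>w. (\<Phi> w s, ?g w)) -` S \<inter> space K = {w \<in> space K. (\<Phi> w s, ?g w) \<in> S}" by auto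
  finally show ?thesis .
qed

definition start :: "'a \<Rightarrow> (real \<Rightarrow> 'a) measure"
  where "start x = distr K path_space (\<lambda>w t. x + \<Phi> w t)"

lemma path_measurable: "(\<lambda>w t. x + \<Phi> w t) \<in> K \<rightarrow>\<^sub>M path_space"
  unfolding path_space_def
proof (rule measurable_restrict_space2)
  show "(\<lambda>w t. x + \<Phi> w t) \<in> space K \<rightarrow> cadlag_paths"
    using \<Phi>_right_continuous \<Phi>_only_jumps by (auto simp: cadlag_paths_def)
  show "(\<lambda>w t. x + \<Phi> w t) \<in> K \<rightarrow>\<^sub>M PiM UNIV (\<lambda>_. borel)"
    by (rule measurable_PiM_single') (auto simp: space_PiM)
qed

lemma sets_start [simp]: "sets (start x) = sets path_space" and space_start [simp]: "space (start x) = cadlag_paths"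
  by (simp_all add: start_def)

lemma prob_start: "prob_space (start x)"
  unfolding start_def using prob_space.prob_space_distr[OF prob_K path_measurable] .

lemma translate_measurable: assumes B: "B \<in> sets borel" shows "{z. fst z + snd z \<in> B} \<in> sets (borel \<Otimes>\<^sub>M (borel :: 'a measure))"
proof -
  have "(\<lambda>z. fst z + snd z) \<in> borel \<Otimes>\<^sub>M (borel :: 'a measure) \<rightarrow>\<^sub>M borel" by measurable
  from measurable_sets[OF this B] show ?thesis by (simp add: vimage_def space_pair_measure)
qed

lemma transition_measurable: assumes B: "B \<in> sets borel" shows "(\<lambda>x. measure (p t) {y. x + y \<in> B}) \<in> borel_measurable borel"
proof -
  interpret pt: prob_space "p t" by (rule prob_p)
  have "{z. fst z + snd z \<in> B} \<in> sets (borel \<Otimes>\<^sub>M p t)"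
    using translate_measurable[OF B] by (simp cong: sets_pair_measure_cong)
  from pt.measurable_emeasure_Pair[OF this] show ?thesis by (simp add: measure_def vimage_def)
qed

lemma start_law:
  assumes t: "t \<ge> 0" and B: "B \<in> sets borel"
  shows "measure (start x) {w \<in> cadlag_paths. w t \<in> B} = measure (p t) {y. x + y \<in> B}"
proof -
  have E: "{w \<in> cadlag_paths. w t \<in> B} \<in> sets path_space"
    using sets_Collect_measurable[OF path_space_coordinate B] by simp
  have B': "{y. x + y \<in> B} \<in> sets borel"
  proof -
    have "(\<lambda>y. x + y) \<in> borel \<rightarrow>\<^sub>M (borel :: 'a measure)" by measurable
    from measurable_sets[OF this B] show ?thesis by (simp add: vimage_def)
  qed
  have "measure (start x) {w \<in> cadlag_paths. w t \<in> B} =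
      measure K ((\<lambda>w t. x + \<Phi> w t) -` {w \<in> cadlag_paths. w t \<in> B} \<inter> space K)"
    unfolding start_def by (rule measure_distr[OF path_measurable E])
  also have "(\<lambda>w t. x + \<Phi> w t) -` {w \<in> cadlag_paths. w t \<in> B} \<inter> space K = (\<lambda>w. \<Phi> w t) -` {y. x + y \<in> B} \<inter> space K"
    using measurable_space[OF path_measurable] by auto
  also have "measure K \<dots> = measure (distr K borel (\<lambda>w. \<Phi> w t)) {y. x + y \<in> B}"
    by (rule measure_distr[OF \<Phi>_measurable B', symmetric])
  finally show ?thesis unfolding \<Phi>_law[OF t] .
qed

text \<open>By \<open>joint_law\<close> the next increment may be integrated out first, with the present value held fixed.\<close>

lemma markov_property:
  assumes s: "s \<ge> 0" and t: "t \<ge> 0" and B: "B \<in> sets borel"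
  shows "AE w in start x. real_cond_exp (start x) (filtration s) (\<lambda>w. indicat_real B (w (s + t))) w = measure (p t) {y. w s + y \<in> B}"
proof -
  interpret P: prob_space "start x" by (rule prob_start)
  interpret K: prob_space K by (rule prob_K)
  interpret pt: prob_space "p t" by (rule prob_p)
  have sub: "subalgebra (start x) (filtration s)"
    using filtration_subalgebra[of s] by (simp add: subalgebra_def)
  interpret finite_measure_subalgebra "start x" "filtration s" by unfold_locales (rule sub)
  let ?f = "\<lambda>w. indicat_real B (w (s + t))" and ?g = "\<lambda>w. measure (p t) {y. w s + y \<in> B}"
  have fm: "?f \<in> borel_measurable path_space"
    by (rule measurable_compose[OF path_space_coordinate borel_measurable_indicator[OF B]])
  have gF: "?g \<in> borel_measurable (filtration s)"
    by (rule measurable_compose[OF filtration_coordinate transition_measurable[OF B]]) (use s in auto)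
  have gm: "?g \<in> borel_measurable path_space"
    by (rule measurable_compose[OF path_space_coordinate transition_measurable[OF B]])
  show ?thesis
  proof (rule real_cond_exp_charact)
    show "integrable (start x) ?f" "integrable (start x) ?g"
      by (rule P.integrable_const_bound[of _ 1]; use fm gm in \<open>auto simp: measurable_cong_sets[OF sets_start refl]\<close>)+
    show "?g \<in> borel_measurable (filtration s)" by (rule gF)
    fix A :: "(real \<Rightarrow> 'a) set" assume A: "A \<in> sets (filtration s)"
    obtain V where V: "V \<in> sets (PiM {0..s} (\<lambda>_. borel))" "A = (\<lambda>w. restrict w {0..s}) -` V \<inter> cadlag_paths"
      using A unfolding filtration_def sets_vimage_algebra2[OF restrict_in_space] by auto
    have A': "A \<in> sets path_space" using A filtration_subalgebra[of s] by (auto simp: subalgebra_def)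
    let ?D = "{w \<in> space K. restrict (\<lambda>r. x + \<Phi> w r) {0..s} \<in> V}"
    have AD: "indicator A (\<lambda>t. x + \<Phi> w t) = (indicator ?D w :: real)" if "w \<in> space K" for w
      using measurable_space[OF path_measurable that, of x] that by (auto simp: V(2) indicator_def)
    have "(\<lambda>w. restrict (\<lambda>r. x + \<Phi> w r) {0..s}) \<in> K \<rightarrow>\<^sub>M PiM {0..s} (\<lambda>_. borel)"
      by (intro measurable_restrict borel_measurable_add measurable_const \<Phi>_measurable) simp
    then have D: "?D \<in> sets K" using V(1) by (rule sets_Collect_measurable)
    let ?S = "{z. fst z + snd z \<in> {y. x + y \<in> B}}"
    have xB: "{y. x + y \<in> B} \<in> sets borel"
    proof -
      have "(\<lambda>y. x + y) \<in> borel \<rightarrow>\<^sub>M (borel :: 'a measure)" by measurable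
      from measurable_sets[OF this B] show ?thesis by (simp add: vimage_def)
    qed
    have move: "(\<integral>w\<in>A. h w \<partial>start x) = (\<integral>w. indicator ?D w * h (\<lambda>t. x + \<Phi> w t) \<partial>K)"
      if h: "h \<in> borel_measurable path_space" for h :: "_ \<Rightarrow> real"
    proof -
      have "(\<integral>w\<in>A. h w \<partial>start x) = (\<integral>w. indicator A (\<lambda>t. x + \<Phi> w t) *\<^sub>R h (\<lambda>t. x + \<Phi> w t) \<partial>K)"
        unfolding set_lebesgue_integral_def start_def
        by (rule integral_distr[OF path_measurable]) (use h A' in \<open>auto intro!: borel_measurable_times borel_measurable_indicator\<close>)
      also have "\<dots> = (\<integral>w. indicator ?D w * h (\<lambda>t. x + \<Phi> w t) \<partial>K)"
        by (rule Bochner_Integration.integral_cong) (auto simp: AD)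
      finally show ?thesis .
    qed
    let ?E = "?D \<inter> {w \<in> space K. (\<Phi> w s, \<Phi> w (s + t) - \<Phi> w s) \<in> ?S}"
    have "(\<integral>w\<in>A. ?f w \<partial>start x) = (\<integral>w. indicator ?E w \<partial>K)"
      unfolding move[OF fm] by (rule Bochner_Integration.integral_cong) (auto simp: indicator_def)
    also have "\<dots> = measure K (?E \<inter> space K)" by simp
    also have "?E \<inter> space K = ?E" by auto
    also have "measure K ?E = enn2real (\<integral>\<^sup>+w. indicator ?D w * emeasure (p t) (Pair (\<Phi> w s) -` ?S) \<partial>K)"
      unfolding measure_def by (rule arg_cong[of _ _ enn2real], rule joint_law[OF s t V(1) translate_measurable[OF xB]])
    also have "(\<integral>\<^sup>+w. indicator ?D w * emeasure (p t) (Pair (\<Phi> w s) -` ?S) \<partial>K) =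
        (\<integral>\<^sup>+w. ennreal (indicator ?D w * measure (p t) {y. (x + \<Phi> w s) + y \<in> B}) \<partial>K)"
      by (rule nn_integral_cong) (simp add: pt.emeasure_eq_measure indicator_def vimage_def add.assoc)
    also have "enn2real \<dots> = (\<integral>w. indicator ?D w * measure (p t) {y. (x + \<Phi> w s) + y \<in> B} \<partial>K)"
    proof (rule integral_eq_nn_integral[symmetric])
      show "(\<lambda>w. indicator ?D w * measure (p t) {y. (x + \<Phi> w s) + y \<in> B}) \<in> borel_measurable K"
        using measurable_compose[OF path_measurable gm] D by (intro borel_measurable_times borel_measurable_indicator) auto
    qed simp
    also have "\<dots> = (\<integral>w\<in>A. ?g w \<partial>start x)" by (rule move[OF gm, symmetric])
    finally show "(\<integral>w\<in>A. ?f w \<partial>start x) = (\<integral>w\<in>A. ?g w \<partial>start x)" .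
  qed
qed

theorem markov_process_cadlag:
  "markov_process (\<lambda>t x B. measure (p t) {y. x + y \<in> B}) cadlag_paths filtration (\<lambda>t w. w t) start"
  unfolding markov_process_def
proof (intro conjI allI impI ballI)
  fix x :: 'a
  show "prob_space (start x)" "space (start x) = cadlag_paths" by (auto intro: prob_start)
  show "sets (start x) = sets (start y)" for y by simp
  show "subalgebra (start x) (filtration t)" for t using filtration_subalgebra[of t] by (simp add: subalgebra_def)
  have "(UNIV \<inter> {y. x + y = x}) = {0}" by auto
  then have "measure (p 0) {y. x + y \<in> {x}} = 1" unfolding p_0 by (simp add: measure_return)
  then show "measure (start x) {w \<in> cadlag_paths. w 0 = x} = 1" using start_law[of 0 "{x}" x] by simp
  fix t :: real assume t: "t \<ge> 0"
  show "measure (start x) {w \<in> cadlag_paths. w t \<in> B} = measure (p t) {y. x + y \<in> B}" if "B \<in> sets borel" for B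
    by (rule start_law[OF t that])
next
  fix s t :: real and x :: 'a and B :: "'a set" assume "0 \<le> s" "0 \<le> t" "B \<in> sets borel"
  then show "AE w in start x. real_cond_exp (start x) (filtration s) (\<lambda>w. indicat_real B (w (s + t))) w = measure (p t) {y. w s + y \<in> B}"
    by (rule markov_property)
next
  fix t :: real and w :: "real \<Rightarrow> 'a" assume "0 \<le> t" "w \<in> cadlag_paths"
  then show "\<exists>w'\<in>cadlag_paths. \<forall>h\<ge>0. w' h = w (t + h)" by (intro bexI[of _ "\<lambda>h. w (t + h)"] shift_cadlag) simp_all
next
  fix s t :: real assume "0 \<le> s" "s \<le> t"
  then show "subalgebra (filtration t :: (real \<Rightarrow> 'a) measure) (filtration s)" by (intro filtration_mono)
next
  fix t :: real assume "0 \<le> t"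
  then show "(\<lambda>w. w t) \<in> filtration t \<rightarrow>\<^sub>M (borel :: 'a measure)" by (intro filtration_coordinate) simp_all
next
  fix t :: real and B :: "'a set" assume "B \<in> sets borel"
  then show "(\<lambda>x. measure (p t) {y. x + y \<in> B}) \<in> borel_measurable borel" by (rule transition_measurable)
qed

end

section \<open>The adelic heat kernel as a transition density\<close>

instance fadele :: topological_ab_group_add ..

instance prod :: (topological_ab_group_add, topological_ab_group_add) topological_ab_group_add ..

lemma markov_process_cong:
  assumes "\<And>t x B. t \<ge> 0 \<Longrightarrow> B \<in> sets borel \<Longrightarrow> p t x B = q t x B"
  shows "markov_process p \<Omega> F X P \<longleftrightarrow> markov_process q \<Omega> F X P"
  unfolding markov_process_def using assms by (simp cong: conj_cong)

context adelic_haar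
begin

text \<open>The norm of an adele takes only the values \<open>1/e\<^sub>n\<close>, and if \<open>\<parallel>x\<parallel> \<ge> l\<close>, all that follows is that \<open>x\<close> lies
  outside the ideal of the least \<open>e\<^sub>n > 1/l\<close>. This \<open>e\<^sub>n\<close> is not bounded by a power of \<open>1/l\<close>, because the
  quotients of the sequence are arbitrary. With the order shifted by one, \<open>x\<close> lies outside the ideal of
  the greatest \<open>e\<^sub>n \<le> 1/l\<close>.\<close>

definition coarse_norm :: "fadele \<Rightarrow> real"
  where "coarse_norm x = (if x = 0 then 0 else 1 / of_rat (exp_psi E (ordf E x + 1)))"

lemma coarse_norm_0 [simp]: "coarse_norm 0 = 0"
  by (simp add: coarse_norm_def)

lemma coarse_norm_nonneg: "coarse_norm x \<ge> 0"
  using of_rat_exp_psi_pos[of "ordf E x + 1"] by (simp add: coarse_norm_def less_imp_le)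

lemma coarse_norm_le_iff: "coarse_norm x \<le> 1 / of_rat (exp_psi E (n + 1)) \<longleftrightarrow> x \<in> ideal (exp_psi E n)"
proof (cases "x = 0")
  case True
  then show ?thesis using of_rat_exp_psi_pos[of "n + 1"] exp_psi_pos[OF E, of n] by (simp add: ideal_def in_ideal_0 less_imp_le)
next
  case False
  have "coarse_norm x \<le> 1 / of_rat (exp_psi E (n + 1)) \<longleftrightarrow> (of_rat (exp_psi E (n + 1)) :: real) \<le> of_rat (exp_psi E (ordf E x + 1))"
    using False of_rat_exp_psi_pos[of "n + 1"] of_rat_exp_psi_pos[of "ordf E x + 1"] by (simp add: coarse_norm_def field_simps)
  also have "\<dots> \<longleftrightarrow> n \<le> ordf E x"
    using exp_psi_less_iff[OF E, of "ordf E x + 1" "n + 1"] by (simp add: of_rat_less not_less[symmetric])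
  finally show ?thesis using ordf_iff[OF E False] by (simp add: ideal_def)
qed

lemma coarse_norm_cases: "coarse_norm x = 0 \<and> x = 0 \<or> (\<exists>n. coarse_norm x = 1 / of_rat (exp_psi E (n + 1)))"
  by (auto simp: coarse_norm_def)

lemma coarse_norm_minus: "coarse_norm (- x) = coarse_norm x"
proof -
  have le: "coarse_norm (- y) \<le> coarse_norm y" for y
  proof (cases "y = 0")
    case False
    then obtain n where n: "coarse_norm y = 1 / of_rat (exp_psi E (n + 1))" using coarse_norm_cases[of y] by blast
    then have "y \<in> ideal (exp_psi E n)" using coarse_norm_le_iff[of y n] by simp
    then have "- y \<in> ideal (exp_psi E n)" by (simp add: ideal_def in_ideal_minus)
    then show ?thesis using coarse_norm_le_iff[of "- y" n] n by simp
  qed simp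
  show ?thesis using le[of x] le[of "- x"] by simp
qed

lemma coarse_norm_add: "coarse_norm (x + y) \<le> max (coarse_norm x) (coarse_norm y)"
proof -
  have le: "coarse_norm (x + y) \<le> coarse_norm x" if xy: "coarse_norm y \<le> coarse_norm x" for x y
  proof (cases "x = 0")
    case True
    then have "coarse_norm y \<le> 0" using xy by simp
    then have "y = 0" using of_rat_exp_psi_pos[of "ordf E y + 1"] by (auto simp: coarse_norm_def split: if_splits)
    then show ?thesis by simp
  next
    case False
    then obtain n where n: "coarse_norm x = 1 / of_rat (exp_psi E (n + 1))" using coarse_norm_cases[of x] by blast
    then have "x \<in> ideal (exp_psi E n)" "y \<in> ideal (exp_psi E n)" using coarse_norm_le_iff[of x n] coarse_norm_le_iff[of y n] xy by simp_all
    then have "x + y \<in> ideal (exp_psi E n)" by (simp add: ideal_def in_ideal_add)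
    then show ?thesis using coarse_norm_le_iff[of "x + y" n] n by simp
  qed
  show ?thesis using le[of y x] le[of x y] by (cases "coarse_norm y \<le> coarse_norm x") (auto simp: add.commute)
qed

lemma coarse_norm_measurable: "coarse_norm \<in> borel_measurable borel"
proof (unfold borel_measurable_iff_less, intro allI)
  fix c :: real
  have "{x. coarse_norm x < c} = (\<Union>n\<in>{n. 1 / of_rat (exp_psi E (n + 1)) < c}. ideal (exp_psi E n))"
  proof (intro equalityI subsetI)
    fix x assume "x \<in> {x. coarse_norm x < c}"
    then have x: "coarse_norm x < c" by simp
    have "\<exists>n. 1 / of_rat (exp_psi E (n + 1)) < c \<and> coarse_norm x \<le> 1 / of_rat (exp_psi E (n + 1))"
    proof (cases "x = 0")
      case True
      then have c: "c > 0" using x by simp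
      obtain q where q: "1 / c < real_of_rat q" using of_rat_dense[of "1 / c" "1 / c + 1"] by auto
      obtain n where "exp_psi E n > q" using exp_psi_unbounded[OF E] by blast
      then have "1 / c < of_rat (exp_psi E ((n - 1) + 1))" using q by (simp add: of_rat_less less_trans[of "1 / c" "of_rat q"])
      then have "1 / of_rat (exp_psi E ((n - 1) + 1)) < c" using c of_rat_exp_psi_pos[of "(n - 1) + 1"] by (simp add: field_simps)
      then show ?thesis using True of_rat_exp_psi_pos[of "(n - 1) + 1"] by (intro exI[of _ "n - 1"]) (simp add: less_imp_le)
    next
      case False
      then show ?thesis using x coarse_norm_cases[of x] by auto
    qed
    then show "x \<in> (\<Union>n\<in>{n. 1 / of_rat (exp_psi E (n + 1)) < c}. ideal (exp_psi E n))" unfolding coarse_norm_le_iff by blast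
  next
    fix x assume "x \<in> (\<Union>n\<in>{n. 1 / of_rat (exp_psi E (n + 1)) < c}. ideal (exp_psi E n))"
    then obtain n where "1 / of_rat (exp_psi E (n + 1)) < c" "x \<in> ideal (exp_psi E n)" by blast
    then show "x \<in> {x. coarse_norm x < c}" using coarse_norm_le_iff[of x n] by simp
  qed
  moreover have "open (\<Union>n\<in>{n. 1 / of_rat (exp_psi E (n + 1)) < c}. ideal (exp_psi E n))" by (intro open_UN ballI open_ideal)
  ultimately show "{w \<in> space borel. coarse_norm w < c} \<in> sets borel" by simp
qed

text \<open>In contrast to the metric of the finite adeles, which does not depend on \<open>E\<close>, this gauge is adapted to
  the heat kernel, whose tails become powers of it.\<close>

definition gauge :: "adele \<Rightarrow> real"
  where "gauge x = max \<bar>fst x\<bar> (coarse_norm (snd x))"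

lemma gauge_measurable: "gauge \<in> borel_measurable borel"
  unfolding gauge_def
  by (intro borel_measurable_max borel_measurable_abs measurable_compose[OF _ coarse_norm_measurable]
      borel_measurable_continuous_onI continuous_on_fst continuous_on_snd continuous_on_id)

lemma gauge_small: assumes e: "e > 0" shows "\<exists>\<eta>>0. \<forall>x. gauge x < \<eta> \<longrightarrow> dist x 0 < e"
proof -
  have "open (ball (0::fadele) (e / 2))" "0 \<in> ball (0::fadele) (e / 2)" using e by auto
  then obtain r where r: "r > 0" "\<And>y. in_ideal r y \<Longrightarrow> dist 0 y < e / 2"
    unfolding open_fadele_iff by (metis diff_zero mem_ball)
  obtain n where n: "exp_psi E n \<in> zmul r" using exp_psi_small[OF E r(1)] by blast
  have "dist x 0 < e" if x: "gauge x < min (e / 2) (1 / of_rat (exp_psi E (n + 1)))" for x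
  proof -
    have 1: "\<bar>fst x\<bar> < e / 2" "coarse_norm (snd x) \<le> 1 / of_rat (exp_psi E (n + 1))" using x by (auto simp: gauge_def)
    have "in_ideal r (snd x)" using 1(2) in_ideal_trans[OF _ n r(1)] unfolding coarse_norm_le_iff by (simp add: ideal_def)
    from r(2)[OF this] have 2: "dist (snd x) 0 < e / 2" by (simp only: dist_commute)
    have "dist x 0 \<le> dist (fst x) 0 + dist (snd x) 0" 
      unfolding dist_prod_def using sqrt_sum_squares_le_sum[of "\<bar>fst x\<bar>" "dist (snd x) 0"] by simp
    then show ?thesis using 1(1) 2 by simp
  qed
  then show ?thesis using e of_rat_exp_psi_pos[of "n + 1"] by (intro exI[of _ "min (e / 2) (1 / of_rat (exp_psi E (n + 1)))"]) simp
qed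

lemma dist_adele_translate: "dist (x + z) (y + z) = dist x (y::adele)"
  by (simp add: dist_prod_def dist_fadele_def dist_real_def)

lemma nn_integral_translate:
  assumes f: "f \<in> borel_measurable borel" shows "(\<integral>\<^sup>+y. f (a + y) \<partial>m) = (\<integral>\<^sup>+y. f y \<partial>m)"
proof -
  have "(\<integral>\<^sup>+y. f y \<partial>distr m borel (\<lambda>x. a + x)) = (\<integral>\<^sup>+y. f (a + y) \<partial>m)"
    using f by (intro nn_integral_distr translate_measurable) (simp cong: measurable_cong_sets)
  then show ?thesis unfolding distr_m_translate by simp
qed

end

context adelic_heat
begin

text \<open>At \<open>t = 0\<close> the kernel degenerates to the unit mass at \<open>0\<close>, which also serves as the value for negative \<open>t\<close>.\<close>

definition law :: "real \<Rightarrow> adele measure"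
  where "law t = (if t \<le> 0 then return borel 0 else density m (\<lambda>x. ennreal (Z t x)))"

lemma sets_law [measurable_cong, simp]: "sets (law t) = sets borel"
  by (simp add: law_def)

lemma space_law [simp]: "space (law t) = UNIV"
  using sets_eq_imp_space_eq[OF sets_law] by simp

lemma Z_borel: "t > 0 \<Longrightarrow> Z t \<in> borel_measurable borel"
  using Z_measurable[of t] by (simp cong: measurable_cong_sets)

lemma emeasure_law: assumes "t > 0" "B \<in> sets borel"
  shows "emeasure (law t) B = (\<integral>\<^sup>+x. ennreal (Z t x) * indicator B x \<partial>m)"
  using assms Z_measurable[of t] unfolding law_def by (simp add: emeasure_density)

lemma measure_law: assumes t: "t > 0" and B: "B \<in> sets borel"
  shows "measure (law t) B = (\<integral>x. indicator B x * Z t x \<partial>m)"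
proof -
  have "(\<integral>x. indicator B x * Z t x \<partial>m) = enn2real (\<integral>\<^sup>+x. ennreal (indicator B x * Z t x) \<partial>m)"
    using t B Z_nonneg[of t] Z_measurable[of t] by (intro integral_eq_nn_integral borel_measurable_times borel_measurable_indicator) auto
  also have "(\<integral>\<^sup>+x. ennreal (indicator B x * Z t x) \<partial>m) = emeasure (law t) B"
    unfolding emeasure_law[OF t B] by (rule nn_integral_cong) (simp add: indicator_def)
  finally show ?thesis by (simp add: measure_def)
qed

lemma prob_law: "prob_space (law t)"
proof (cases "t \<le> 0")
  case True
  then show ?thesis by (simp add: law_def prob_space_return)
next
  case False
  then have t: "t > 0" by simp
  have "emeasure (law t) UNIV = (\<integral>\<^sup>+x. ennreal (Z t x) \<partial>m)" using emeasure_law[OF t, of UNIV] by simp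
  also have "\<dots> = ennreal (\<integral>x. Z t x \<partial>m)"
    using integrable_Z[OF t] Z_nonneg[OF t] by (intro nn_integral_eq_integral) auto
  finally show ?thesis using integral_Z[OF t] by (intro prob_spaceI) simp
qed

lemma law_add_measurable: assumes "B \<in> sets borel" shows "{y. x + y \<in> B} \<in> sets (borel :: adele measure)"
proof -
  have "(\<lambda>y. x + y) \<in> borel \<rightarrow>\<^sub>M (borel :: adele measure)" by measurable
  from measurable_sets[OF this assms] show ?thesis by (simp add: vimage_def)
qed

text \<open>For positive times this is Tonelli's theorem and \<open>Z_semigroup\<close>.\<close>

lemma law_conv:
  assumes s: "s \<ge> 0" and t: "t \<ge> 0"
  shows "distr (law s \<Otimes>\<^sub>M law t) borel (\<lambda>x. fst x + snd x) = law (s + t)"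
proof (rule measure_eqI)
  interpret ls: prob_space "law s" by (rule prob_law)
  interpret lt: prob_space "law t" by (rule prob_law)
  fix B assume "B \<in> sets (distr (law s \<Otimes>\<^sub>M law t) borel (\<lambda>x. fst x + snd x))"
  then have B: "B \<in> sets borel" by simp
  have add: "(\<lambda>x. fst x + snd x) \<in> law s \<Otimes>\<^sub>M law t \<rightarrow>\<^sub>M borel" by measurable
  have "emeasure (distr (law s \<Otimes>\<^sub>M law t) borel (\<lambda>x. fst x + snd x)) B =
      (\<integral>\<^sup>+x. emeasure (law t) (Pair x -` ((\<lambda>x. fst x + snd x) -` B \<inter> space (law s \<Otimes>\<^sub>M law t))) \<partial>law s)"
    unfolding emeasure_distr[OF add B] by (rule lt.emeasure_pair_measure_alt[OF measurable_sets[OF add B]])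
  also have "\<dots> = (\<integral>\<^sup>+x. emeasure (law t) {y. x + y \<in> B} \<partial>law s)"
    by (simp add: vimage_def space_pair_measure)
  also have "\<dots> = emeasure (law (s + t)) B"
  proof -
    have em: "(\<lambda>x. emeasure (law t) {y. x + y \<in> B}) \<in> borel_measurable borel"
    proof -
      have "(\<lambda>z. fst z + snd z) \<in> borel \<Otimes>\<^sub>M law t \<rightarrow>\<^sub>M (borel :: adele measure)" by measurable
      from lt.measurable_emeasure_Pair[OF measurable_sets[OF this B]] show ?thesis by (simp add: vimage_def space_pair_measure)
    qed
    consider "s = 0" | "t = 0" | "s > 0" "t > 0" using s t by fastforce
    then show ?thesis
    proof cases
      case 1
      then show ?thesis using em by (simp add: law_def[of 0] nn_integral_return)
    next
      case 2
      have "emeasure (law 0) {y. x + y \<in> B} = indicator B x" for x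
        using law_add_measurable[OF B, of x] by (simp add: law_def indicator_def)
      then show ?thesis using 2 B by simp
    next
      case 3
      have Zs: "Z s \<in> borel_measurable borel" and Zt: "Z t \<in> borel_measurable borel" using Z_borel 3 by auto
      let ?f = "\<lambda>x y. ennreal (Z t (y - x) * Z s x) * indicator B y"
      have f: "case_prod ?f \<in> borel_measurable (m \<Otimes>\<^sub>M m)"
      proof -
        have "(\<lambda>z. ennreal (Z t (snd z - fst z) * Z s (fst z)) * indicator B (snd z)) \<in> borel_measurable (borel \<Otimes>\<^sub>M borel)"
          by (intro borel_measurable_times_ennreal measurable_compose[OF _ measurable_ennreal] borel_measurable_times
              measurable_compose[OF _ Zs] measurable_compose[OF _ Zt] borel_measurable_group_diff measurable_fst measurable_snd
              measurable_compose[OF measurable_snd borel_measurable_indicator] B)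
        then show ?thesis by (simp add: case_prod_beta' cong: measurable_cong_sets sets_pair_measure_cong)
      qed
      interpret mm: pair_sigma_finite m m ..
      have "(\<integral>\<^sup>+x. emeasure (law t) {y. x + y \<in> B} \<partial>law s) = (\<integral>\<^sup>+x. ennreal (Z s x) * emeasure (law t) {y. x + y \<in> B} \<partial>m)"
        using 3 em Zs unfolding law_def[of s] by (simp add: nn_integral_density cong: measurable_cong_sets)
      also have "\<dots> = (\<integral>\<^sup>+x. (\<integral>\<^sup>+y. ?f x y \<partial>m) \<partial>m)"
      proof (rule nn_integral_cong)
        fix x
        have "emeasure (law t) {y. x + y \<in> B} = (\<integral>\<^sup>+y. ennreal (Z t ((x + y) - x)) * indicator B (x + y) \<partial>m)"
          unfolding emeasure_law[OF 3(2) law_add_measurable[OF B]] by (simp add: indicator_def)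
        also have "\<dots> = (\<integral>\<^sup>+y. ennreal (Z t (y - x)) * indicator B y \<partial>m)"
          by (rule nn_integral_translate[where f = "\<lambda>y. ennreal (Z t (y - x)) * indicator B y"])
            (intro borel_measurable_times_ennreal measurable_compose[OF _ measurable_ennreal] measurable_compose[OF _ Zt]
              borel_measurable_group_diff measurable_ident_sets[OF refl] measurable_const borel_measurable_indicator B; simp)
        finally have e: "emeasure (law t) {y. x + y \<in> B} = (\<integral>\<^sup>+y. ennreal (Z t (y - x)) * indicator B y \<partial>m)" .
        have "(\<lambda>y. ennreal (Z t (y - x)) * indicator B y) \<in> borel_measurable borel"
          by (intro borel_measurable_times_ennreal measurable_compose[OF _ measurable_ennreal] measurable_compose[OF _ Zt]
              borel_measurable_group_diff measurable_ident_sets[OF refl] measurable_const borel_measurable_indicator B; simp)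
        then show "ennreal (Z s x) * emeasure (law t) {y. x + y \<in> B} = (\<integral>\<^sup>+y. ?f x y \<partial>m)"
          unfolding e using Z_nonneg 3 by (simp add: nn_integral_cmult[symmetric] ennreal_mult mult_ac cong: measurable_cong_sets)
      qed
      also have "\<dots> = (\<integral>\<^sup>+y. (\<integral>\<^sup>+x. ?f x y \<partial>m) \<partial>m)" by (rule mm.Fubini'[OF f, symmetric])
      also have "\<dots> = (\<integral>\<^sup>+y. ennreal (Z (s + t) y) * indicator B y \<partial>m)"
      proof (rule nn_integral_cong)
        fix y
        have "(\<lambda>x. Z t (y - x) * Z s x) \<in> borel_measurable m"
          using Z_semigroup(1)[OF 3(2) 3(1), of y] by (rule borel_measurable_integrable)
        then have "(\<integral>\<^sup>+x. ?f x y \<partial>m) = (\<integral>\<^sup>+x. ennreal (Z t (y - x) * Z s x) \<partial>m) * indicator B y"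
          by (intro nn_integral_multc) simp
        also have "(\<integral>\<^sup>+x. ennreal (Z t (y - x) * Z s x) \<partial>m) = ennreal (\<integral>x. Z t (y - x) * Z s x \<partial>m)"
          using Z_semigroup(1)[OF 3(2) 3(1), of y] Z_nonneg 3 by (intro nn_integral_eq_integral) auto
        also have "(\<integral>x. Z t (y - x) * Z s x \<partial>m) = Z (s + t) y"
          using Z_semigroup(2)[OF 3(2) 3(1), of y] by (simp add: add.commute)
        finally show "(\<integral>\<^sup>+x. ?f x y \<partial>m) = ennreal (Z (s + t) y) * indicator B y" .
      qed
      also have "\<dots> = emeasure (law (s + t)) B" using 3 B by (simp add: emeasure_law)
      finally show ?thesis .
    qed
  qed
  finally show "emeasure (distr (law s \<Otimes>\<^sub>M law t) borel (\<lambda>x. fst x + snd x)) B = emeasure (law (s + t)) B" .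
qed simp

text \<open>The estimate \<open>heat_tail\<close> with the greatest \<open>e\<^sub>n \<le> 1/l\<close>.\<close>

lemma law_tail:
  assumes t: "t > 0" and l: "0 < l" "l \<le> 1"
  shows "measure (law t) {x. gauge x \<ge> l} \<le> 6 * t * l powr - (\<alpha> + \<beta>)"
proof -
  obtain q where q: "1 / l < real_of_rat q" using of_rat_dense[of "1 / l" "1 / l + 1"] by auto
  let ?P = "\<lambda>k. of_rat (exp_psi E (int k)) > 1 / l"
  have "\<exists>k. ?P k"
  proof -
    obtain n where n: "exp_psi E n > q" using exp_psi_unbounded[OF E] by blast
    have "exp_psi E n \<le> exp_psi E (int (nat n))" by (rule exp_psi_mono[OF E]) simp
    then have "(of_rat q :: real) < of_rat (exp_psi E (int (nat n)))" using n by (simp only: of_rat_less) 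
    then show ?thesis using q by (intro exI[of _ "nat n"]) simp
  qed
  then obtain k where k: "?P k" "\<And>j. j < k \<Longrightarrow> \<not> ?P j" using exists_least_iff[of ?P] by blast
  have "\<not> ?P 0" using l exp_psi_0[OF E] by simp
  then have "k > 0" using k(1) by (cases k) auto
  define n where "n = int (k - 1)"
  have n: "n + 1 = int k" using \<open>k > 0\<close> by (simp add: n_def)
  have le: "of_rat (exp_psi E n) \<le> 1 / l" using k(2)[of "k - 1"] \<open>k > 0\<close> by (simp add: n_def)
  have gt: "1 / of_rat (exp_psi E (n + 1)) < l"
    using k(1) l of_rat_exp_psi_pos[of "n + 1"] unfolding n by (simp add: field_simps)
  have sub: "x \<in> outer l n" if "gauge x \<ge> l" for x
  proof (rule ccontr)
    assume "x \<notin> outer l n"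
    then have "\<bar>fst x\<bar> < l" "snd x \<in> ideal (exp_psi E n)" by (auto simp: outer_def)
    then have "gauge x < l" using coarse_norm_le_iff[of "snd x" n] gt by (simp add: gauge_def)
    then show False using that by simp
  qed
  have meas: "{x. gauge x \<ge> l} \<in> sets borel" using borel_measurable_le[OF borel_measurable_const gauge_measurable] by simp
  have out: "outer l n \<in> sets borel"
  proof -
    have "outer l n = (\<lambda>x. \<bar>fst x\<bar>) -` {l..} \<union> - (snd -` ideal (exp_psi E n))" by (auto simp: outer_def)
    moreover have "closed ((\<lambda>x::adele. \<bar>fst x\<bar>) -` {l..})"
      by (auto intro!: closed_vimage continuous_intros)
    moreover have "open (snd -` ideal (exp_psi E n) :: adele set)" by (auto intro!: open_vimage open_ideal continuous_intros)
    ultimately show ?thesis by (simp add: borel_closed borel_open borel_comp)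
  qed
  have "measure (law t) {x. gauge x \<ge> l} \<le> measure (law t) (outer l n)"
    using sub out prob_law[of t] by (intro finite_measure.finite_measure_mono prob_space.finite_measure) auto
  also have "\<dots> \<le> 2 * t * (of_rat (exp_psi E n) powr \<alpha> + 2 * l powr - \<beta>)"
    unfolding measure_law[OF t out] by (rule heat_tail[OF t l(1)])
  also have "\<dots> \<le> 2 * t * (l powr - (\<alpha> + \<beta>) + 2 * l powr - (\<alpha> + \<beta>))"
  proof -
    have "of_rat (exp_psi E n) powr \<alpha> \<le> (1 / l) powr \<alpha>"
      using le \<alpha> of_rat_exp_psi_pos[of n] by (intro powr_mono2) auto
    also have "\<dots> = l powr - \<alpha>" using l by (simp add: powr_minus powr_divide inverse_eq_divide)
    also have "\<dots> \<le> l powr - (\<alpha> + \<beta>)" using l \<beta> by (intro powr_mono') auto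
    finally have 1: "of_rat (exp_psi E n) powr \<alpha> \<le> l powr - (\<alpha> + \<beta>)" .
    have 2: "l powr - \<beta> \<le> l powr - (\<alpha> + \<beta>)" using l \<alpha> by (intro powr_mono') auto
    show ?thesis using 1 2 t by (intro mult_left_mono) auto
  qed
  finally show ?thesis by simp
qed

sublocale gauged_semigroup law gauge 6 "\<alpha> + \<beta>"
proof (intro gauged_semigroup.intro convolution_semigroup.intro gauged_semigroup_axioms.intro)
  show "law 0 = return borel 0" by (simp add: law_def)
  show "gauge (x + y) \<le> gauge x + gauge y" for x y
    using coarse_norm_add[of "snd x" "snd y"] coarse_norm_nonneg[of "snd x"] coarse_norm_nonneg[of "snd y"]
    by (auto simp: gauge_def max_def split: if_splits)
  show "gauge 0 = 0" by (simp add: gauge_def)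
  show "gauge (- x) = gauge x" for x by (simp add: gauge_def coarse_norm_minus)
  show "\<alpha> + \<beta> > 0" using \<alpha> \<beta> by simp
qed (rule prob_law sets_law law_conv gauge_measurable gauge_small dist_adele_translate law_tail; assumption)+

text \<open>The kernel is even, so that \<open>Z t (x - y)\<close> is the density at \<open>y\<close> of the translate of the law by \<open>x\<close>.\<close>

lemma heat_transition_eq:
  assumes t: "t \<ge> 0" and B: "B \<in> sets borel"
  shows "measure (law t) {y. x + y \<in> B} = heat_transition E \<mu> \<alpha> \<beta> t x B"
proof (cases "t = 0")
  case True
  then show ?thesis using law_add_measurable[OF B, of x] by (simp add: law_def heat_transition_def measure_return indicator_def)
next
  case False
  then have t: "t > 0" using t by simp
  let ?f = "\<lambda>y. indicator B y * Z t (y - x)"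
  have f: "?f \<in> borel_measurable m"
  proof -
    have "?f \<in> borel_measurable borel"
      by (intro borel_measurable_times borel_measurable_indicator B measurable_compose[OF _ Z_borel[OF t]]
          borel_measurable_group_diff measurable_ident_sets[OF refl] measurable_const; simp)
    then show ?thesis by (simp cong: measurable_cong_sets)
  qed
  have "measure (law t) {y. x + y \<in> B} = (\<integral>y. ?f (y + x) \<partial>m)"
    unfolding measure_law[OF t law_add_measurable[OF B]] by (simp add: indicator_def add.commute)
  also have "\<dots> = (\<integral>y. ?f y \<partial>m)" by (rule integral_translate(1)[OF f])
  finally show ?thesis using False Z_diff_commute[OF t]
    by (simp add: heat_transition_def set_lebesgue_integral_def Z_def)
qed

theorem heat_markov_process:
  "markov_process (heat_transition E \<mu> \<alpha> \<beta>) cadlag_paths filtration (\<lambda>t w. w t) start"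
  by (rule iffD1[OF markov_process_cong markov_process_cadlag]) (rule heat_transition_eq)

end

theorem theorem3p3:
  fixes E :: "nat \<Rightarrow> nat" and \<mu> :: "fadele measure" and \<alpha> \<beta> :: real
  assumes "adelic_sequence E"
    and "haar_measure \<mu>" and "emeasure \<mu> (Zhat E) = 1"
    and "\<alpha> > 0" and "0 < \<beta>" and "\<beta> \<le> 2"
  shows "(\<forall>f \<in> DomD E \<mu> \<alpha> \<beta>. \<exists>u :: adele \<Rightarrow> real \<Rightarrow> complex.
           classical_solution E \<mu> \<alpha> \<beta> f u \<and>
           (\<forall>t>0. \<forall>x. integrable (adele_measure \<mu>) (\<lambda>y. heat_kernel E \<mu> \<alpha> \<beta> (x - y) t * f y) \<and>
              u x t = (\<integral>y. heat_kernel E \<mu> \<alpha> \<beta> (x - y) t * f y \<partial>adele_measure \<mu>))) \<and>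
         (\<forall>t>0. \<forall>x. heat_kernel E \<mu> \<alpha> \<beta> x t \<in> \<real> \<and> 0 \<le> Re (heat_kernel E \<mu> \<alpha> \<beta> x t)) \<and>
         (\<exists>(\<Omega> :: (real \<Rightarrow> adele) set) F X P.
           markov_process (heat_transition E \<mu> \<alpha> \<beta>) \<Omega> F X P \<and>
           (\<forall>\<omega>\<in>\<Omega>. bounded_trajectory (\<lambda>t. X t \<omega>) \<and>
              right_continuous_trajectory (\<lambda>t. X t \<omega>) \<and>
              only_jumps_trajectory (\<lambda>t. X t \<omega>)))"
proof (intro conjI)
  interpret adelic_heat E \<mu> \<alpha> \<beta> using assms by unfold_locales
  show "\<forall>f \<in> DomD E \<mu> \<alpha> \<beta>. \<exists>u :: adele \<Rightarrow> real \<Rightarrow> complex.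
           classical_solution E \<mu> \<alpha> \<beta> f u \<and>
           (\<forall>t>0. \<forall>x. integrable (adele_measure \<mu>) (\<lambda>y. heat_kernel E \<mu> \<alpha> \<beta> (x - y) t * f y) \<and>
              u x t = (\<integral>y. heat_kernel E \<mu> \<alpha> \<beta> (x - y) t * f y \<partial>adele_measure \<mu>))"
    using heat_equation_solution by (rule ballI)
  show "\<forall>t>0. \<forall>x. heat_kernel E \<mu> \<alpha> \<beta> x t \<in> \<real> \<and> 0 \<le> Re (heat_kernel E \<mu> \<alpha> \<beta> x t)"
    using hk_Z Z_nonneg by simp
  have "bounded_trajectory \<omega> \<and> right_continuous_trajectory \<omega> \<and> only_jumps_trajectory \<omega>" if "\<omega> \<in> cadlag_paths" for \<omega> :: "real \<Rightarrow> adele"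
    using that cadlag_imp_bounded_trajectory[of \<omega>] by (simp add: cadlag_paths_def)
  then show "\<exists>(\<Omega> :: (real \<Rightarrow> adele) set) F X P.
           markov_process (heat_transition E \<mu> \<alpha> \<beta>) \<Omega> F X P \<and>
           (\<forall>\<omega>\<in>\<Omega>. bounded_trajectory (\<lambda>t. X t \<omega>) \<and>
              right_continuous_trajectory (\<lambda>t. X t \<omega>) \<and>
              only_jumps_trajectory (\<lambda>t. X t \<omega>))"
    using heat_markov_process by blast
qed

end
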